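(* Fix a class $\mathfrak k$ in $\mathcal I_{\mathfrak m}/i(K_{\mathfrak m,\Gamma})$, suppose $\pi_0$ is a representation of $C^*(\mathfrak a_{\mathfrak k}\rtimes R_{\mathfrak m,\Gamma}^* )$ on $\mathcal H_0$, and let $\vartheta_{\mathfrak k}$ be the associated representation of $C^*_\lambda(R\rtimes R_{\mathfrak m,\Gamma})$ on $\ell^2\big(\bigsqcup_{\mathfrak a\in\mathfrak k,\,\mathfrak a\subseteq R}\mathcal R_{\mathfrak a}\big)\otimes\mathcal H_0$ (defined in the context). Denote the associated von Neumann algebras by $\mathcal M:=\vartheta_{\mathfrak k}(C^*_\lambda(R\rtimes R_{\mathfrak m,\Gamma}))''$ and $\mathcal N:=\pi_0(C^*(\mathfrak a_{\mathfrak k}\rtimes R_{\mathfrak m,\Gamma}^* ))''\subseteq\mathcal B(\mathcal H_0)$. Then $$\mathcal M=\mathcal B\Big(\ell^2\Big(\bigsqcup_{\mathfrak a\in\mathfrak k,\,\mathfrak a\subseteq R}\mathcal R_{\mathfrak a}\Big)\Big)\,\bar\otimes\,\mathcal N$$ under the natural identification $\mathcal B\big(\ell^2(\bigsqcup_{\mathfrak a}\mathcal R_{\mathfrak a})\otimes\mathcal H_0\big)=\mathcal B\big(\ell^2(\bigsqcup_{\mathfrak a}\mathcal R_{\mathfrak a})\big)\bar\otimes\mathcal B(\mathcal H_0)$. Hence, (i) if $\mathcal N$ is a type I (resp. type II$_1$) factor, then $\mathcal M$ is a type I$_\infty$ (resp. type II$_\infty$) factor; (ii) $\vartheta_{\mathfrak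 k}$ is irreducible if and only if $\pi_0$ is irreducible.
   Context: $K$ is a number field with ring of integers $R$, $R^\times=R\setminus\{0\}$, $R^*$ the unit group. A modulus $\mathfrak m=\mathfrak m_\infty\mathfrak m_0$ consists of a $\{0,1\}$-valued function $\mathfrak m_\infty$ on the real embeddings of $K$ and a nonzero ideal $\mathfrak m_0$ of $R$; $w\mid\mathfrak m_\infty$ means $\mathfrak m_\infty(w)=1$. Put $(R/\mathfrak m)^*:=\big(\prod_{w\mid\mathfrak m_\infty}\{\pm1\}\big)\times(R/\mathfrak m_0)^*$ and, for $a\in R$ nonzero and coprime to $\mathfrak m_0$, $[a]_{\mathfrak m}:=((\operatorname{sign}w(a))_{w\mid\mathfrak m_\infty},a+\mathfrak m_0)$, extended multiplicatively to $x\in K^\times$ with $v_{\mathfrak p}(x)=0$ for all $\mathfrak p\mid\mathfrak m_0$. For a subgroup $\Gamma\le(R/\mathfrak m)^*$: $R_{\mathfrak m,\Gamma}:=\{a\in R^\times:v_{\mathfrak p}(a)=0\ \forall\mathfrak p\mid\mathfrak m_0,\ [a]_{\mathfrak m}\in\Gamma\}$, $K_{\mathfrak m,\Gamma}:=\{x\in K^\times:v_{\mathfrak p}(x)=0\ \forall\mathfrak p\mid\mathfrak m_0,\ [x]_{\mathfrak m}\in\Gamma\}$, $R_{\mathfrak m,\Gamma}^*:=R_{\mathfrak m,\Gamma}\cap R^*$. $\mathcal I_{\mathfrak m}$ is the group of fractional ideals of $K$ coprime to $\mathfrak m_0$ and $i(K_{\mathfrak m,\Gamma})$ its subgroup of principal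 fractional ideals with a generator in $K_{\mathfrak m,\Gamma}$. Integral ideal means contained in $R$. For each class $\mathfrak k$ an integral ideal $\mathfrak a_{\mathfrak k}\in\mathfrak k$ is fixed ($\mathfrak a_{[R]}=R$), and for each $\mathfrak a\in\mathfrak k$ an element $t_{\mathfrak a}\in K_{\mathfrak m,\Gamma}$ with $t_{\mathfrak a}\mathfrak a=\mathfrak a_{\mathfrak k}$ is fixed ($t_R=1$). $R\rtimes R_{\mathfrak m,\Gamma}$ has product $(b,a)(d,c)=(b+ad,ac)$; $C^*_\lambda(R\rtimes R_{\mathfrak m,\Gamma})$ is the C*-algebra generated by its left regular isometries $\lambda_{(b,a)}$ on $\ell^2(R\rtimes R_{\mathfrak m,\Gamma})$. $u_{(x,g)}$ denote the canonical unitaries of $C^*(\mathfrak a_{\mathfrak k}\rtimes R_{\mathfrak m,\Gamma}^* )$. For each integral ideal $\mathfrak a$ in $\mathcal I_{\mathfrak m}$, $\mathcal R_{\mathfrak a}$ is a fixed complete set of representatives for $R/\mathfrak a$ with $0\in\mathcal R_{\mathfrak a}$, and $\bar x^{\mathfrak a}$ is the unique element of $\mathcal R_{\mathfrak a}$ with $x-\bar x^{\mathfrak a}\in\mathfrak a$. The standard basis of $\ell^2(\bigsqcup_{\mathfrak a\in\mathfrak k,\mathfrak a\subseteq R}\mathcal R_{\mathfrak a})$ is $\{\delta_{(\mathfrak a,x)}:\mathfrak a\in\mathfrak k,\mathfrak a\subseteq R,x\in\mathcal R_{\mathfrak a}\}$. Representations are nondegenerate. Definition of $\vartheta_{\mathfrak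 k}$: it is the unique representation of $C^*_\lambda(R\rtimes R_{\mathfrak m,\Gamma})$ (it exists) with $\vartheta_{\mathfrak k}(\lambda_{(x,b)})=U^xS_b$ for $(x,b)\in R\rtimes R_{\mathfrak m,\Gamma}$, where for integral $\mathfrak c\in\mathfrak k$, $y\in\mathcal R_{\mathfrak c}$, $\xi\in\mathcal H_0$, $$U^x(\delta_{(\mathfrak c,y)}\otimes\xi)=\delta_{(\mathfrak c,\overline{x+y}^{\mathfrak c})}\otimes\pi_0\big(u_{(t_{\mathfrak c}(x+y-\overline{x+y}^{\mathfrak c}),\,1)}\big)\xi,$$ $$S_b(\delta_{(\mathfrak c,y)}\otimes\xi)=\delta_{(b\mathfrak c,\overline{by}^{b\mathfrak c})}\otimes\pi_0\big(u_{(t_{b\mathfrak c}(by-\overline{by}^{b\mathfrak c}),\,bt_{\mathfrak c}^{-1}t_{b\mathfrak c})}\big)\xi .$$ *)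

theory Defs
  imports
    "HOL-Analysis.Analysis"
    "HOL-Library.Function_Algebras"
    "HOL-Algebra.Ideal_Product"
    "HOL-Algebra.QuotRing"
    "HOL-Algebra.Product_Groups"
begin

section \<open>Hilbert spaces and bounded operators\<close>

text \<open>
  A Hilbert space is a subspace of an ambient additive type, so that the spaces of
  square-summable families over a given index set are again of this form. Inner
  products are linear in the first argument. Operators are functions on the ambient type
  which vanish off the carrier; in particular equality of operators is equality of functions,
  and sums of operators are the pointwise sums of \<^theory>\<open>HOL-Library.Function_Algebras\<close>.
\<close>

record 'v hilbert =
  hcarrier :: "'v set"
  hscale :: "complex \<Rightarrow> 'v \<Rightarrow> 'v"
  hinner :: "'v \<Rightarrow> 'v \<Rightarrow> complex"

definition hnorm :: "'v hilbert \<Rightarrow> 'v \<Rightarrow> real" where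
  "hnorm H x = sqrt (Re (hinner H x x))"

definition hilbert_space :: "'v::ab_group_add hilbert \<Rightarrow> bool" where
  "hilbert_space H \<longleftrightarrow>
     vector_space (hscale H) \<and>
     Modules.module.subspace (hscale H) (hcarrier H) \<and>
     (\<forall>x\<in>hcarrier H. \<forall>y\<in>hcarrier H. \<forall>z\<in>hcarrier H.
        hinner H (x + y) z = hinner H x z + hinner H y z) \<and>
     (\<forall>c. \<forall>x\<in>hcarrier H. \<forall>y\<in>hcarrier H. hinner H (hscale H c x) y = c * hinner H x y) \<and>
     (\<forall>x\<in>hcarrier H. \<forall>y\<in>hcarrier H. hinner H y x = cnj (hinner H x y)) \<and>
     (\<forall>x\<in>hcarrier H. Im (hinner H x x) = 0 \<and> Re (hinner H x x) \<ge> 0) \<and>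
     (\<forall>x\<in>hcarrier H. hinner H x x = 0 \<longrightarrow> x = 0) \<and>
     (\<forall>X. (\<forall>n::nat. X n \<in> hcarrier H) \<and>
          (\<forall>e>0. \<exists>N. \<forall>m\<ge>N. \<forall>n\<ge>N. hnorm H (X m - X n) < e) \<longrightarrow>
          (\<exists>x\<in>hcarrier H. (\<lambda>n. hnorm H (X n - x)) \<longlonglongrightarrow> 0))"

definition bounded_ops :: "'v::ab_group_add hilbert \<Rightarrow> ('v \<Rightarrow> 'v) set" where
  "bounded_ops H = {T.
     (\<forall>x\<in>hcarrier H. T x \<in> hcarrier H) \<and>
     (\<forall>x. x \<notin> hcarrier H \<longrightarrow> T x = 0) \<and>
     (\<forall>x\<in>hcarrier H. \<forall>y\<in>hcarrier H. T (x + y) = T x + T y) \<and>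
     (\<forall>c. \<forall>x\<in>hcarrier H. T (hscale H c x) = hscale H c (T x)) \<and>
     (\<exists>C. \<forall>x\<in>hcarrier H. hnorm H (T x) \<le> C * hnorm H x)}"

definition op_norm :: "'v::ab_group_add hilbert \<Rightarrow> ('v \<Rightarrow> 'v) \<Rightarrow> real" where
  "op_norm H T = (SUP x\<in>{x \<in> hcarrier H. hnorm H x \<le> 1}. hnorm H (T x))"

definition id_op :: "'v::ab_group_add hilbert \<Rightarrow> 'v \<Rightarrow> 'v" where
  "id_op H = (\<lambda>x. if x \<in> hcarrier H then x else 0)"

definition scale_op :: "'v hilbert \<Rightarrow> complex \<Rightarrow> ('v \<Rightarrow> 'v) \<Rightarrow> 'v \<Rightarrow> 'v" where
  "scale_op H c T = (\<lambda>x. hscale H c (T x))"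

definition adjoint_op :: "'v::ab_group_add hilbert \<Rightarrow> ('v \<Rightarrow> 'v) \<Rightarrow> 'v \<Rightarrow> 'v" where
  "adjoint_op H T = (THE T'. T' \<in> bounded_ops H \<and>
     (\<forall>x\<in>hcarrier H. \<forall>y\<in>hcarrier H. hinner H (T x) y = hinner H x (T' y)))"

definition complex_hilbert :: "complex hilbert" where
  "complex_hilbert = \<lparr>hcarrier = UNIV, hscale = (*), hinner = (\<lambda>x y. x * cnj y)\<rparr>"

text \<open>
  \<open>ell2 X H\<close> is the space of square-summable families in \<open>H\<close> indexed by \<open>X\<close>, extended by \<open>0\<close>
  off \<open>X\<close>. It is the Hilbert space tensor product of \<open>\<ell>\<^sup>2(X)\<close>, which is
  \<open>ell2 X complex_hilbert\<close>, and \<open>H\<close>, with elementary tensors \<open>elem_tensor H f \<xi>\<close>.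
\<close>

definition ell2 :: "'i set \<Rightarrow> 'v::ab_group_add hilbert \<Rightarrow> ('i \<Rightarrow> 'v) hilbert" where
  "ell2 X H =
     \<lparr>hcarrier = {f. (\<forall>s\<in>X. f s \<in> hcarrier H) \<and> (\<forall>s. s \<notin> X \<longrightarrow> f s = 0) \<and>
                     (\<lambda>s. (hnorm H (f s))\<^sup>2) summable_on X},
      hscale = (\<lambda>c f s. hscale H c (f s)),
      hinner = (\<lambda>f g. \<Sum>\<^sub>\<infinity>s\<in>X. hinner H (f s) (g s))\<rparr>"

definition elem_tensor :: "'v hilbert \<Rightarrow> ('i \<Rightarrow> complex) \<Rightarrow> 'v \<Rightarrow> 'i \<Rightarrow> 'v" where
  "elem_tensor H f \<xi> = (\<lambda>s. hscale H (f s) \<xi>)"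

definition basis_vec :: "'i \<Rightarrow> 'v::zero \<Rightarrow> 'i \<Rightarrow> 'v" where
  "basis_vec s \<xi> = (\<lambda>r. if r = s then \<xi> else 0)"

text \<open>
  For \<open>\<phi>\<close> injective on \<open>X\<close> with values in \<open>X\<close>, and contractions \<open>W s\<close> on \<open>H\<close>, the following is
  the bounded operator on \<open>ell2 X H\<close> determined by
  \<open>\<delta>\<^sub>s \<otimes> \<xi> \<mapsto> \<delta>\<^bsub>\<phi> s\<^esub> \<otimes> W s \<xi>\<close>: the fibres of \<open>\<phi>\<close> have at most one element, and the value of the
  operator on a family \<open>f\<close> at \<open>r = \<phi> s\<close> is \<open>W s (f s)\<close>. It is used for left regular
  isometries and for the operators defining the representation attached to a class.
\<close>

definition basis_op ::
    "'i set \<Rightarrow> 'v::ab_group_add hilbert \<Rightarrow> ('i \<Rightarrow> 'i) \<Rightarrow> ('i \<Rightarrow> 'v \<Rightarrow> 'v) \<Rightarrow> ('i \<Rightarrow> 'v) \<Rightarrow> ('i \<Rightarrow> 'v)" where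
  "basis_op X H \<phi> W =
     (\<lambda>f. if f \<in> hcarrier (ell2 X H) then (\<lambda>r. \<Sum>s\<in>{s \<in> X. \<phi> s = r}. W s (f s)) else 0)"

lemma basis_op_basis_vec:
  assumes H: "hilbert_space H" and s: "s \<in> X" and inj: "inj_on \<phi> X"
    and W: "\<And>s. s \<in> X \<Longrightarrow> W s 0 = 0" and \<xi>: "\<xi> \<in> hcarrier H"
  shows "basis_op X H \<phi> W (basis_vec s \<xi>) = basis_vec (\<phi> s) (W s \<xi>)"
proof -
  have vs: "vector_space (hscale H)" and sub: "Modules.module.subspace (hscale H) (hcarrier H)"
    using H by (auto simp: hilbert_space_def)
  interpret vector_space "hscale H" by (rule vs)
  have z: "0 \<in> hcarrier H" using sub by (rule subspace_0)
  have h0: "hinner H 0 0 = 0"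
    using H z scale_zero_left[of 0] unfolding hilbert_space_def
    by (metis mult_zero_left)
  have "(\<lambda>r. (hnorm H (basis_vec s \<xi> r))\<^sup>2) summable_on {s}" by simp
  then have "(\<lambda>r. (hnorm H (basis_vec s \<xi> r))\<^sup>2) summable_on X"
    by (rule summable_on_cong_neutral[THEN iffD1, rotated -1])
      (use s in \<open>auto simp: basis_vec_def hnorm_def h0\<close>)
  then have mem: "basis_vec s \<xi> \<in> hcarrier (ell2 X H)"
    using s \<xi> z by (auto simp: ell2_def basis_vec_def)
  have "(\<Sum>s'\<in>{s' \<in> X. \<phi> s' = r}. W s' (basis_vec s \<xi> s')) = basis_vec (\<phi> s) (W s \<xi>) r" for r
  proof (cases "r = \<phi> s")
    case True
    then have "{s' \<in> X. \<phi> s' = r} = {s}" using inj s by (auto simp: inj_on_def)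
    then show ?thesis using True by (simp add: basis_vec_def)
  next
    case False
    then show ?thesis by (auto simp: basis_vec_def W intro!: sum.neutral)
  qed
  then show ?thesis using mem by (auto simp: basis_op_def)
qed


section \<open>Von Neumann algebras\<close>

definition commutant :: "'v::ab_group_add hilbert \<Rightarrow> ('v \<Rightarrow> 'v) set \<Rightarrow> ('v \<Rightarrow> 'v) set" where
  "commutant H A = {T \<in> bounded_ops H. \<forall>S\<in>A. T \<circ> S = S \<circ> T}"

abbreviation bicommutant :: "'v::ab_group_add hilbert \<Rightarrow> ('v \<Rightarrow> 'v) set \<Rightarrow> ('v \<Rightarrow> 'v) set" where
  "bicommutant H A \<equiv> commutant H (commutant H A)"

definition von_neumann_algebra :: "'v::ab_group_add hilbert \<Rightarrow> ('v \<Rightarrow> 'v) set \<Rightarrow> bool" where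
  "von_neumann_algebra H N \<longleftrightarrow>
     N \<subseteq> bounded_ops H \<and> (\<forall>T\<in>N. adjoint_op H T \<in> N) \<and> bicommutant H N = N"

text \<open>
  The von Neumann algebra tensor product of \<open>A\<close>, acting on \<open>\<ell>\<^sup>2(X)\<close>, and \<open>N\<close>, acting on \<open>H\<close>:
  the von Neumann algebra on \<open>ell2 X H\<close> generated by the operators \<open>a \<otimes> b\<close>.
\<close>

definition vn_tensor ::
    "'i set \<Rightarrow> 'v::ab_group_add hilbert \<Rightarrow> (('i \<Rightarrow> complex) \<Rightarrow> ('i \<Rightarrow> complex)) set \<Rightarrow> ('v \<Rightarrow> 'v) set \<Rightarrow>
     (('i \<Rightarrow> 'v) \<Rightarrow> ('i \<Rightarrow> 'v)) set" where
  "vn_tensor X H A N = bicommutant (ell2 X H)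
     {T \<in> bounded_ops (ell2 X H). \<exists>a\<in>A. \<exists>b\<in>N.
        \<forall>f\<in>hcarrier (ell2 X complex_hilbert). \<forall>\<xi>\<in>hcarrier H.
          T (elem_tensor H f \<xi>) = elem_tensor H (a f) (b \<xi>)}"

definition factor :: "'v::ab_group_add hilbert \<Rightarrow> ('v \<Rightarrow> 'v) set \<Rightarrow> bool" where
  "factor H N \<longleftrightarrow> von_neumann_algebra H N \<and> hcarrier H \<noteq> {0} \<and>
     N \<inter> commutant H N = range (\<lambda>c. scale_op H c (id_op H))"

definition projections :: "'v::ab_group_add hilbert \<Rightarrow> ('v \<Rightarrow> 'v) set \<Rightarrow> ('v \<Rightarrow> 'v) set" where
  "projections H N = {p \<in> N. p \<circ> p = p \<and> adjoint_op H p = p}"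

text \<open>Murray--von Neumann equivalence of projections in \<open>N\<close>\<close>

definition mvn_equiv ::
    "'v::ab_group_add hilbert \<Rightarrow> ('v \<Rightarrow> 'v) set \<Rightarrow> ('v \<Rightarrow> 'v) \<Rightarrow> ('v \<Rightarrow> 'v) \<Rightarrow> bool" where
  "mvn_equiv H N p q \<longleftrightarrow> (\<exists>v\<in>N. adjoint_op H v \<circ> v = p \<and> v \<circ> adjoint_op H v = q)"

definition finite_projection ::
    "'v::ab_group_add hilbert \<Rightarrow> ('v \<Rightarrow> 'v) set \<Rightarrow> ('v \<Rightarrow> 'v) \<Rightarrow> bool" where
  "finite_projection H N p \<longleftrightarrow> p \<in> projections H N \<and>
     (\<forall>q\<in>projections H N. p \<circ> q = q \<and> mvn_equiv H N p q \<longrightarrow> q = p)"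

definition abelian_projection ::
    "'v::ab_group_add hilbert \<Rightarrow> ('v \<Rightarrow> 'v) set \<Rightarrow> ('v \<Rightarrow> 'v) \<Rightarrow> bool" where
  "abelian_projection H N p \<longleftrightarrow> p \<in> projections H N \<and>
     (\<forall>x\<in>N. \<forall>y\<in>N. (p \<circ> x \<circ> p) \<circ> (p \<circ> y \<circ> p) = (p \<circ> y \<circ> p) \<circ> (p \<circ> x \<circ> p))"

text \<open>
  For a factor, the unit is the only nonzero central projection, so the type is decided by the
  existence of a nonzero abelian, respectively nonzero finite, projection; the subscript
  \<open>\<infinity>\<close> means that the unit is an infinite projection.
\<close>

definition type_I_factor :: "'v::ab_group_add hilbert \<Rightarrow> ('v \<Rightarrow> 'v) set \<Rightarrow> bool" where
  "type_I_factor H N \<longleftrightarrow> factor H N \<and> (\<exists>p. abelian_projection H N p \<and> p \<noteq> (\<lambda>x. 0))"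

definition type_II_factor :: "'v::ab_group_add hilbert \<Rightarrow> ('v \<Rightarrow> 'v) set \<Rightarrow> bool" where
  "type_II_factor H N \<longleftrightarrow> factor H N \<and>
     \<not> (\<exists>p. abelian_projection H N p \<and> p \<noteq> (\<lambda>x. 0)) \<and>
     (\<exists>p. finite_projection H N p \<and> p \<noteq> (\<lambda>x. 0))"

definition type_I_infinite_factor :: "'v::ab_group_add hilbert \<Rightarrow> ('v \<Rightarrow> 'v) set \<Rightarrow> bool" where
  "type_I_infinite_factor H N \<longleftrightarrow> type_I_factor H N \<and> \<not> finite_projection H N (id_op H)"

definition type_II_1_factor :: "'v::ab_group_add hilbert \<Rightarrow> ('v \<Rightarrow> 'v) set \<Rightarrow> bool" where
  "type_II_1_factor H N \<longleftrightarrow> type_II_factor H N \<and> finite_projection H N (id_op H)"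

definition type_II_infinite_factor :: "'v::ab_group_add hilbert \<Rightarrow> ('v \<Rightarrow> 'v) set \<Rightarrow> bool" where
  "type_II_infinite_factor H N \<longleftrightarrow> type_II_factor H N \<and> \<not> finite_projection H N (id_op H)"


section \<open>C*-algebras and their representations\<close>

text \<open>The underlying *-algebra of a C*-algebra; representations only refer to this structure.\<close>

record 'a star_alg =
  acarrier :: "'a set"
  aadd :: "'a \<Rightarrow> 'a \<Rightarrow> 'a"
  ascale :: "complex \<Rightarrow> 'a \<Rightarrow> 'a"
  amult :: "'a \<Rightarrow> 'a \<Rightarrow> 'a"
  astar :: "'a \<Rightarrow> 'a"

definition representation ::
    "'a star_alg \<Rightarrow> 'v::ab_group_add hilbert \<Rightarrow> ('a \<Rightarrow> 'v \<Rightarrow> 'v) \<Rightarrow> bool" where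
  "representation A H \<pi> \<longleftrightarrow>
     (\<forall>a\<in>acarrier A. \<pi> a \<in> bounded_ops H) \<and>
     (\<forall>a\<in>acarrier A. \<forall>b\<in>acarrier A. \<pi> (aadd A a b) = \<pi> a + \<pi> b) \<and>
     (\<forall>c. \<forall>a\<in>acarrier A. \<pi> (ascale A c a) = scale_op H c (\<pi> a)) \<and>
     (\<forall>a\<in>acarrier A. \<forall>b\<in>acarrier A. \<pi> (amult A a b) = \<pi> a \<circ> \<pi> b) \<and>
     (\<forall>a\<in>acarrier A. \<pi> (astar A a) = adjoint_op H (\<pi> a)) \<and>
     (\<comment> \<open>nondegenerate\<close>
      \<forall>\<xi>\<in>hcarrier H. \<forall>e>0.
        \<exists>\<eta>\<in>Modules.module.span (hscale H) {\<pi> a \<zeta> |a \<zeta>. a \<in> acarrier A \<and> \<zeta> \<in> hcarrier H}.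
          hnorm H (\<xi> - \<eta>) < e)"

definition closed_subspace :: "'v::ab_group_add hilbert \<Rightarrow> 'v set \<Rightarrow> bool" where
  "closed_subspace H W \<longleftrightarrow> W \<subseteq> hcarrier H \<and> Modules.module.subspace (hscale H) W \<and>
     (\<forall>X. \<forall>x\<in>hcarrier H.
        (\<forall>n::nat. X n \<in> W) \<and> (\<lambda>n. hnorm H (X n - x)) \<longlonglongrightarrow> 0 \<longrightarrow> x \<in> W)"

definition irreducible_rep ::
    "'a star_alg \<Rightarrow> 'v::ab_group_add hilbert \<Rightarrow> ('a \<Rightarrow> 'v \<Rightarrow> 'v) \<Rightarrow> bool" where
  "irreducible_rep A H \<pi> \<longleftrightarrow> representation A H \<pi> \<and> hcarrier H \<noteq> {0} \<and>
     (\<forall>W. closed_subspace H W \<and> (\<forall>a\<in>acarrier A. \<forall>\<xi>\<in>W. \<pi> a \<xi> \<in> W) \<longrightarrow>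
        W = {0} \<or> W = hcarrier H)"

subsection \<open>The reduced semigroup C*-algebra\<close>

definition op_cstar_subalgebra :: "'v::ab_group_add hilbert \<Rightarrow> ('v \<Rightarrow> 'v) set \<Rightarrow> bool" where
  "op_cstar_subalgebra H A \<longleftrightarrow> A \<subseteq> bounded_ops H \<and> (\<lambda>x. 0) \<in> A \<and>
     (\<forall>S\<in>A. \<forall>T\<in>A. S + T \<in> A \<and> S \<circ> T \<in> A) \<and>
     (\<forall>c. \<forall>T\<in>A. scale_op H c T \<in> A) \<and>
     (\<forall>T\<in>A. adjoint_op H T \<in> A) \<and>
     (\<forall>X. \<forall>T\<in>bounded_ops H.
        (\<forall>n::nat. X n \<in> A) \<and> (\<lambda>n. op_norm H (X n - T)) \<longlonglongrightarrow> 0 \<longrightarrow> T \<in> A)"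

definition op_cstar_generated ::
    "'v::ab_group_add hilbert \<Rightarrow> ('v \<Rightarrow> 'v) set \<Rightarrow> ('v \<Rightarrow> 'v) star_alg" where
  "op_cstar_generated H G =
     \<lparr>acarrier = \<Inter>{A. op_cstar_subalgebra H A \<and> G \<subseteq> A},
      aadd = (+), ascale = scale_op H, amult = (\<circ>), astar = adjoint_op H\<rparr>"

definition left_regular ::
    "('g, 'x) monoid_scheme \<Rightarrow> 'g \<Rightarrow> ('g \<Rightarrow> complex) \<Rightarrow> ('g \<Rightarrow> complex)" where
  "left_regular P p = basis_op (carrier P) complex_hilbert (\<lambda>q. p \<otimes>\<^bsub>P\<^esub> q) (\<lambda>_. id)"

definition reduced_cstar ::
    "('g, 'x) monoid_scheme \<Rightarrow> (('g \<Rightarrow> complex) \<Rightarrow> ('g \<Rightarrow> complex)) star_alg" where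
  "reduced_cstar P =
     op_cstar_generated (ell2 (carrier P) complex_hilbert) (left_regular P ` carrier P)"

subsection \<open>The full group C*-algebra\<close>

text \<open>
  The completion of the complex group algebra in its largest C*-seminorm (every C*-seminorm is
  at most the \<open>\<ell>\<^sup>1\<close>-norm). Elements of the completion are equivalence classes of Cauchy sequences.
\<close>

definition group_algebra :: "('g, 'x) monoid_scheme \<Rightarrow> ('g \<Rightarrow> complex) set" where
  "group_algebra G = {f. finite {g. f g \<noteq> 0} \<and> {g. f g \<noteq> 0} \<subseteq> carrier G}"

definition conv :: "('g, 'x) monoid_scheme \<Rightarrow> ('g \<Rightarrow> complex) \<Rightarrow> ('g \<Rightarrow> complex) \<Rightarrow> 'g \<Rightarrow> complex" where
  "conv G f h = (\<lambda>x. \<Sum>(a, b)\<in>{(a, b). f a \<noteq> 0 \<and> h b \<noteq> 0 \<and> a \<otimes>\<^bsub>G\<^esub> b = x}. f a * h b)"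

definition conv_star :: "('g, 'x) monoid_scheme \<Rightarrow> ('g \<Rightarrow> complex) \<Rightarrow> 'g \<Rightarrow> complex" where
  "conv_star G f = (\<lambda>x. if x \<in> carrier G then cnj (f (inv\<^bsub>G\<^esub> x)) else 0)"

definition cstar_seminorm :: "('g, 'x) monoid_scheme \<Rightarrow> (('g \<Rightarrow> complex) \<Rightarrow> real) \<Rightarrow> bool" where
  "cstar_seminorm G p \<longleftrightarrow>
     (\<forall>f\<in>group_algebra G. p f \<ge> 0 \<and> p (conv G (conv_star G f) f) = (p f)\<^sup>2) \<and>
     (\<forall>c. \<forall>f\<in>group_algebra G. p (\<lambda>x. c * f x) = cmod c * p f) \<and>
     (\<forall>f\<in>group_algebra G. \<forall>h\<in>group_algebra G.
        p (f + h) \<le> p f + p h \<and> p (conv G f h) \<le> p f * p h)"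

definition full_norm :: "('g, 'x) monoid_scheme \<Rightarrow> ('g \<Rightarrow> complex) \<Rightarrow> real" where
  "full_norm G f = (SUP p\<in>{p. cstar_seminorm G p}. p f)"

definition full_cauchy :: "('g, 'x) monoid_scheme \<Rightarrow> (nat \<Rightarrow> 'g \<Rightarrow> complex) set" where
  "full_cauchy G = {X. (\<forall>n. X n \<in> group_algebra G) \<and>
     (\<forall>e>0. \<exists>N. \<forall>m\<ge>N. \<forall>n\<ge>N. full_norm G (X m - X n) < e)}"

definition full_rel ::
    "('g, 'x) monoid_scheme \<Rightarrow> ((nat \<Rightarrow> 'g \<Rightarrow> complex) \<times> (nat \<Rightarrow> 'g \<Rightarrow> complex)) set" where
  "full_rel G = {(X, Y). X \<in> full_cauchy G \<and> Y \<in> full_cauchy G \<and>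
     (\<lambda>n. full_norm G (X n - Y n)) \<longlonglongrightarrow> 0}"

definition full_cstar :: "('g, 'x) monoid_scheme \<Rightarrow> (nat \<Rightarrow> 'g \<Rightarrow> complex) set star_alg" where
  "full_cstar G =
     \<lparr>acarrier = full_cauchy G // full_rel G,
      aadd = (\<lambda>A B. \<Union>X\<in>A. \<Union>Y\<in>B. full_rel G `` {\<lambda>n. X n + Y n}),
      ascale = (\<lambda>c A. \<Union>X\<in>A. full_rel G `` {\<lambda>n x. c * X n x}),
      amult = (\<lambda>A B. \<Union>X\<in>A. \<Union>Y\<in>B. full_rel G `` {\<lambda>n. conv G (X n) (Y n)}),
      astar = (\<lambda>A. \<Union>X\<in>A. full_rel G `` {\<lambda>n. conv_star G (X n)})\<rparr>"

definition canonical_unitary ::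
    "('g, 'x) monoid_scheme \<Rightarrow> 'g \<Rightarrow> (nat \<Rightarrow> 'g \<Rightarrow> complex) set" where
  "canonical_unitary G g = full_rel G `` {\<lambda>n. basis_vec g 1}"


section \<open>Number fields, moduli and ray classes\<close>

definition number_field :: "'k::field_char_0 itself \<Rightarrow> bool" where
  "number_field _ \<longleftrightarrow>
     (\<exists>B. finite_dimensional_vector_space (\<lambda>(q::rat) (x::'k). of_rat q * x) B)"

definition K_ring :: "'k::field_char_0 ring" where
  "K_ring = \<lparr>carrier = UNIV, monoid.mult = (*), one = 1, zero = 0, add = (+)\<rparr>"

definition int_ring :: "'k::field_char_0 ring" where
  "int_ring = K_ring\<lparr>carrier := {x. algebraic_int x}\<rparr>"

definition smult_set :: "'k::field_char_0 \<Rightarrow> 'k set \<Rightarrow> 'k set" where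
  "smult_set x I = (\<lambda>y. x * y) ` I"

definition fractional_ideal :: "'k::field_char_0 set \<Rightarrow> bool" where
  "fractional_ideal I \<longleftrightarrow> I \<noteq> {0} \<and>
     (\<exists>d\<in>carrier int_ring. d \<noteq> 0 \<and> ideal (smult_set d I) int_ring)"

definition fractional_ideals :: "'k::field_char_0 set monoid" where
  "fractional_ideals =
     \<lparr>carrier = {I. fractional_ideal I}, monoid.mult = ideal_prod K_ring, one = carrier int_ring\<rparr>"

definition nonzero_prime :: "'k::field_char_0 set \<Rightarrow> bool" where
  "nonzero_prime \<pp> \<longleftrightarrow> primeideal \<pp> int_ring \<and> \<pp> \<noteq> {0}"

text \<open>
  Exponent of the prime \<open>\<pp>\<close> in a nonzero integral ideal (in the Dedekind domain of integers,
  \<open>\<pp>\<^sup>n\<close> divides \<open>I\<close> iff it contains \<open>I\<close>), then in a fractional ideal \<open>I = d\<inverse>(dI)\<close>.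
\<close>

definition prime_exponent :: "'k::field_char_0 set \<Rightarrow> 'k set \<Rightarrow> nat" where
  "prime_exponent \<pp> I = (GREATEST n. I \<subseteq> \<pp> [^]\<^bsub>fractional_ideals\<^esub> (n::nat))"

definition ideal_valuation :: "'k::field_char_0 set \<Rightarrow> 'k set \<Rightarrow> int" where
  "ideal_valuation \<pp> I = (THE v. \<exists>d\<in>carrier int_ring. d \<noteq> 0 \<and> smult_set d I \<subseteq> carrier int_ring \<and>
     v = int (prime_exponent \<pp> (smult_set d I)) -
         int (prime_exponent \<pp> (smult_set d (carrier int_ring))))"

definition valuation :: "'k::field_char_0 set \<Rightarrow> 'k \<Rightarrow> int" where
  "valuation \<pp> x = ideal_valuation \<pp> (smult_set x (carrier int_ring))"

definition real_embedding :: "('k::field_char_0 \<Rightarrow> real) \<Rightarrow> bool" where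
  "real_embedding w \<longleftrightarrow> w 1 = 1 \<and> (\<forall>x y. w (x + y) = w x + w y) \<and> (\<forall>x y. w (x * y) = w x * w y)"

record 'k modulus =
  m_inf :: "('k \<Rightarrow> real) \<Rightarrow> nat"
  m_fin :: "'k set"

definition is_modulus :: "'k::field_char_0 modulus \<Rightarrow> bool" where
  "is_modulus \<mm> \<longleftrightarrow> (\<forall>w. real_embedding w \<longrightarrow> m_inf \<mm> w \<in> {0, 1}) \<and>
     ideal (m_fin \<mm>) int_ring \<and> m_fin \<mm> \<noteq> {0}"

definition inf_places :: "'k::field_char_0 modulus \<Rightarrow> ('k \<Rightarrow> real) set" where
  "inf_places \<mm> = {w. real_embedding w \<and> m_inf \<mm> w = 1}"

definition fin_primes :: "'k::field_char_0 modulus \<Rightarrow> 'k set set" where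
  "fin_primes \<mm> = {\<pp>. nonzero_prime \<pp> \<and> m_fin \<mm> \<subseteq> \<pp>}"

definition sign_group :: "real monoid" where
  "sign_group = \<lparr>carrier = {1, -1}, monoid.mult = (*), one = 1\<rparr>"

text \<open>The group \<open>(R/\<mm>)\<^sup>*\<close>\<close>

definition residue_units :: "'k::field_char_0 modulus \<Rightarrow> ((('k \<Rightarrow> real) \<Rightarrow> real) \<times> 'k set) monoid" where
  "residue_units \<mm> =
     product_group (inf_places \<mm>) (\<lambda>_. sign_group) \<times>\<times> units_of (int_ring Quot m_fin \<mm>)"

definition coprime_elems :: "'k::field_char_0 modulus \<Rightarrow> 'k set" where
  "coprime_elems \<mm> = {x. x \<noteq> 0 \<and> (\<forall>\<pp>\<in>fin_primes \<mm>. valuation \<pp> x = 0)}"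

definition int_residue :: "'k::field_char_0 modulus \<Rightarrow> 'k \<Rightarrow> (('k \<Rightarrow> real) \<Rightarrow> real) \<times> 'k set" where
  "int_residue \<mm> a = (\<lambda>w\<in>inf_places \<mm>. sgn (w a), m_fin \<mm> +>\<^bsub>int_ring\<^esub> a)"

text \<open>The multiplicative extension to quotients \<open>a/b\<close> of integers coprime to the modulus\<close>

definition residue :: "'k::field_char_0 modulus \<Rightarrow> 'k \<Rightarrow> (('k \<Rightarrow> real) \<Rightarrow> real) \<times> 'k set" where
  "residue \<mm> x = (THE g. \<exists>a\<in>carrier int_ring \<inter> coprime_elems \<mm>.
     \<exists>b\<in>carrier int_ring \<inter> coprime_elems \<mm>. x = a / b \<and>
       g = int_residue \<mm> a \<otimes>\<^bsub>residue_units \<mm>\<^esub> inv\<^bsub>residue_units \<mm>\<^esub> (int_residue \<mm> b))"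

definition R_ray ::
    "'k::field_char_0 modulus \<Rightarrow> ((('k \<Rightarrow> real) \<Rightarrow> real) \<times> 'k set) set \<Rightarrow> 'k set" where
  "R_ray \<mm> \<Gamma> = {a \<in> carrier int_ring \<inter> coprime_elems \<mm>. int_residue \<mm> a \<in> \<Gamma>}"

definition K_ray ::
    "'k::field_char_0 modulus \<Rightarrow> ((('k \<Rightarrow> real) \<Rightarrow> real) \<times> 'k set) set \<Rightarrow> 'k set" where
  "K_ray \<mm> \<Gamma> = {x \<in> coprime_elems \<mm>. residue \<mm> x \<in> \<Gamma>}"

definition R_ray_units ::
    "'k::field_char_0 modulus \<Rightarrow> ((('k \<Rightarrow> real) \<Rightarrow> real) \<times> 'k set) set \<Rightarrow> 'k set" where
  "R_ray_units \<mm> \<Gamma> = R_ray \<mm> \<Gamma> \<inter> Units int_ring"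

definition coprime_ideals :: "'k::field_char_0 modulus \<Rightarrow> 'k set monoid" where
  "coprime_ideals \<mm> = fractional_ideals
     \<lparr>carrier := {I. fractional_ideal I \<and> (\<forall>\<pp>\<in>fin_primes \<mm>. ideal_valuation \<pp> I = 0)}\<rparr>"

definition principal_ray ::
    "'k::field_char_0 modulus \<Rightarrow> ((('k \<Rightarrow> real) \<Rightarrow> real) \<times> 'k set) set \<Rightarrow> 'k set set" where
  "principal_ray \<mm> \<Gamma> = (\<lambda>x. smult_set x (carrier int_ring)) ` K_ray \<mm> \<Gamma>"

definition ray_classes ::
    "'k::field_char_0 modulus \<Rightarrow> ((('k \<Rightarrow> real) \<Rightarrow> real) \<times> 'k set) set \<Rightarrow> 'k set set set" where
  "ray_classes \<mm> \<Gamma> = carrier (coprime_ideals \<mm> Mod principal_ray \<mm> \<Gamma>)"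

text \<open>The semidirect product \<open>M \<rtimes> A\<close> for an additive set \<open>M\<close> and a multiplicative set \<open>A\<close>\<close>

definition affine_monoid :: "'k::field_char_0 set \<Rightarrow> 'k set \<Rightarrow> ('k \<times> 'k) monoid" where
  "affine_monoid M A =
     \<lparr>carrier = M \<times> A, monoid.mult = (\<lambda>(b, a) (d, c). (b + a * d, a * c)), one = (0, 1)\<rparr>"


section \<open>The representation attached to a class\<close>

text \<open>
  The fixed choices: an integral ideal \<open>\<aa> \<kk>\<close> in each class \<open>\<kk>\<close>, elements \<open>t I\<close> carrying the ideals
  of a class to its chosen representative, and systems of representatives \<open>rep I\<close> of \<open>R/I\<close>.
\<close>

definition ideal_choice ::
    "'k::field_char_0 modulus \<Rightarrow> ((('k \<Rightarrow> real) \<Rightarrow> real) \<times> 'k set) set \<Rightarrow>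
     ('k set set \<Rightarrow> 'k set) \<Rightarrow> ('k set \<Rightarrow> 'k) \<Rightarrow> bool" where
  "ideal_choice \<mm> \<Gamma> \<aa> t \<longleftrightarrow>
     (\<forall>\<kk>\<in>ray_classes \<mm> \<Gamma>.
        \<aa> \<kk> \<in> \<kk> \<and> \<aa> \<kk> \<subseteq> carrier int_ring \<and>
        (carrier int_ring \<in> \<kk> \<longrightarrow> \<aa> \<kk> = carrier int_ring) \<and>
        (\<forall>I\<in>\<kk>. t I \<in> K_ray \<mm> \<Gamma> \<and> smult_set (t I) I = \<aa> \<kk>)) \<and>
     t (carrier int_ring) = 1"

definition representative_choice :: "'k::field_char_0 modulus \<Rightarrow> ('k set \<Rightarrow> 'k set) \<Rightarrow> bool" where
  "representative_choice \<mm> rep \<longleftrightarrow>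
     (\<forall>I\<in>carrier (coprime_ideals \<mm>). I \<subseteq> carrier int_ring \<longrightarrow>
        rep I \<subseteq> carrier int_ring \<and> 0 \<in> rep I \<and>
        (\<forall>x\<in>carrier int_ring. \<exists>!y. y \<in> rep I \<and> x - y \<in> I))"

definition bar :: "('k::field_char_0 set \<Rightarrow> 'k set) \<Rightarrow> 'k set \<Rightarrow> 'k \<Rightarrow> 'k" where
  "bar rep I x = (THE y. y \<in> rep I \<and> x - y \<in> I)"

definition class_index ::
    "('k::field_char_0 set \<Rightarrow> 'k set) \<Rightarrow> 'k set set \<Rightarrow> ('k set \<times> 'k) set" where
  "class_index rep \<kk> = {(I, x). I \<in> \<kk> \<and> I \<subseteq> carrier int_ring \<and> x \<in> rep I}"

text \<open>The group \<open>\<aa>\<^sub>\<kk> \<rtimes> R\<^sup>*\<^bsub>\<mm>,\<Gamma>\<^esub>\<close> and the semigroup \<open>R \<rtimes> R\<^bsub>\<mm>,\<Gamma>\<^esub>\<close>\<close>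

definition class_group ::
    "'k::field_char_0 modulus \<Rightarrow> ((('k \<Rightarrow> real) \<Rightarrow> real) \<times> 'k set) set \<Rightarrow>
     ('k set set \<Rightarrow> 'k set) \<Rightarrow> 'k set set \<Rightarrow> ('k \<times> 'k) monoid" where
  "class_group \<mm> \<Gamma> \<aa> \<kk> = affine_monoid (\<aa> \<kk>) (R_ray_units \<mm> \<Gamma>)"

definition ray_semigroup ::
    "'k::field_char_0 modulus \<Rightarrow> ((('k \<Rightarrow> real) \<Rightarrow> real) \<times> 'k set) set \<Rightarrow> ('k \<times> 'k) monoid" where
  "ray_semigroup \<mm> \<Gamma> = affine_monoid (carrier int_ring) (R_ray \<mm> \<Gamma>)"

text \<open>
  The operators \<open>U\<^sup>x\<close> and \<open>S\<^sub>b\<close>; the argument \<open>\<sigma>\<close> is the unitary representation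
  \<open>g \<mapsto> \<pi>\<^sub>0(u\<^sub>g)\<close> of the group of the class.
\<close>

definition U_op ::
    "('k::field_char_0 set \<Rightarrow> 'k) \<Rightarrow> ('k set \<Rightarrow> 'k set) \<Rightarrow> 'k set set \<Rightarrow> 'h::ab_group_add hilbert \<Rightarrow>
     ('k \<times> 'k \<Rightarrow> 'h \<Rightarrow> 'h) \<Rightarrow> 'k \<Rightarrow> ('k set \<times> 'k \<Rightarrow> 'h) \<Rightarrow> ('k set \<times> 'k \<Rightarrow> 'h)" where
  "U_op t rep \<kk> H \<sigma> x = basis_op (class_index rep \<kk>) H
     (\<lambda>(\<cc>, y). (\<cc>, bar rep \<cc> (x + y)))
     (\<lambda>(\<cc>, y). \<sigma> (t \<cc> * (x + y - bar rep \<cc> (x + y)), 1))"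

definition S_op ::
    "('k::field_char_0 set \<Rightarrow> 'k) \<Rightarrow> ('k set \<Rightarrow> 'k set) \<Rightarrow> 'k set set \<Rightarrow> 'h::ab_group_add hilbert \<Rightarrow>
     ('k \<times> 'k \<Rightarrow> 'h \<Rightarrow> 'h) \<Rightarrow> 'k \<Rightarrow> ('k set \<times> 'k \<Rightarrow> 'h) \<Rightarrow> ('k set \<times> 'k \<Rightarrow> 'h)" where
  "S_op t rep \<kk> H \<sigma> b = basis_op (class_index rep \<kk>) H
     (\<lambda>(\<cc>, y). (smult_set b \<cc>, bar rep (smult_set b \<cc>) (b * y)))
     (\<lambda>(\<cc>, y). \<sigma> (t (smult_set b \<cc>) * (b * y - bar rep (smult_set b \<cc>) (b * y)),
                  b * inverse (t \<cc>) * t (smult_set b \<cc>)))"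

definition class_representation ::
    "'k::field_char_0 modulus \<Rightarrow> ((('k \<Rightarrow> real) \<Rightarrow> real) \<times> 'k set) set \<Rightarrow>
     ('k set set \<Rightarrow> 'k set) \<Rightarrow> ('k set \<Rightarrow> 'k) \<Rightarrow> ('k set \<Rightarrow> 'k set) \<Rightarrow> 'k set set \<Rightarrow>
     'h::ab_group_add hilbert \<Rightarrow> ((nat \<Rightarrow> 'k \<times> 'k \<Rightarrow> complex) set \<Rightarrow> 'h \<Rightarrow> 'h) \<Rightarrow>
     ((('k \<times> 'k \<Rightarrow> complex) \<Rightarrow> ('k \<times> 'k \<Rightarrow> complex)) \<Rightarrow>
        ('k set \<times> 'k \<Rightarrow> 'h) \<Rightarrow> ('k set \<times> 'k \<Rightarrow> 'h)) \<Rightarrow> bool" where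
  "class_representation \<mm> \<Gamma> \<aa> t rep \<kk> H \<pi>\<^sub>0 \<theta> \<longleftrightarrow>
     representation (reduced_cstar (ray_semigroup \<mm> \<Gamma>)) (ell2 (class_index rep \<kk>) H) \<theta> \<and>
     (let \<sigma> = (\<lambda>g. \<pi>\<^sub>0 (canonical_unitary (class_group \<mm> \<Gamma> \<aa> \<kk>) g)) in
      \<forall>x\<in>carrier int_ring. \<forall>b\<in>R_ray \<mm> \<Gamma>.
        \<theta> (left_regular (ray_semigroup \<mm> \<Gamma>) (x, b)) = U_op t rep \<kk> H \<sigma> x \<circ> S_op t rep \<kk> H \<sigma> b)"

end

theory Submission
  imports Defs
begin

text \<open>
  The von Neumann algebra of \<open>\<theta>\<close> is determined through its commutant. Let \<open>X\<close> be the index set of the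
  basis, \<open>\<sigma>(g) = \<pi>\<^sub>0(u\<^sub>g)\<close> and \<open>N' = \<pi>\<^sub>0(C\<^sup>*(\<dots>))'\<close>. The image of the element \<open>(x, b)\<close> of the semigroup
  is an isometry \<open>P x b\<close> which permutes the subspaces \<open>\<delta>\<^sub>s \<otimes> H\<^sub>0\<close> through an injective map
  \<open>\<phi> x b\<close> of \<open>X\<close>, acting by a unitary of the form \<open>\<sigma>(g)\<close> in the second factor. The claim is that
  an operator \<open>T\<close> commutes with all \<open>P x b\<close> and their adjoints if and only if \<open>T = 1 \<otimes> T\<^sub>0\<close> with
  \<open>T\<^sub>0 \<in> N'\<close> (\<open>commuting_iff\<close>).

  \<^item> \<open>T\<close> is diagonal with respect to \<open>X\<close> (\<open>commuting_diagonal\<close>): it preserves the ranges of all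
    \<open>P x d\<close> and their preimages under \<open>P 0 e\<close>, and these sets separate the points of \<open>X\<close>. The
    separation is arithmetic: the basis vector of \<open>(c, y)\<close> lies in the range of \<open>P x d\<close> if and
    only if \<open>c \<subseteq> dR\<close> and \<open>y - x \<in> dR\<close>, and a point \<open>u\<close> outside an ideal \<open>c\<close> is kept apart from \<open>c\<close>
    by a principal fractional ideal \<open>(d/e)R \<supseteq> c\<close> with \<open>d\<close> and \<open>e\<close> in the ray semigroup
    (\<open>ray_separation\<close>). This is the statement that nonzero ideals of a Dedekind domain are
    divisorial, combined with an approximation modulo \<open>\<mm>\<close> and at the real places.
  \<^item> All diagonal entries of \<open>T\<close> agree, up to the unitaries \<open>\<sigma>(g)\<close>, along the maps \<open>\<phi> x b\<close>, and
    every point of \<open>X\<close> is connected with every other one by them (\<open>entry_constant\<close>).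
  \<^item> The elements of the semigroup which fix a point of \<open>X\<close> act there by all the \<open>\<sigma>(g)\<close>, so
    the entries commute with \<open>\<sigma>\<close> (\<open>entry_commutes\<close>).

  To pass from generators to the C*-algebras one needs that their representations are continuous.
  This is automatic: below norm \<open>1\<close> an iteration inside the *-algebra gives a self-adjoint solution \<open>b\<close> of
  \<open>1 - a\<^sup>*a = (1 - b)\<^sup>2\<close>, which forces \<open>\<parallel>\<pi>(a)\<parallel> \<le> 1\<close> (\<open>rep_contractive_if_root\<close>).

  So \<open>M' = 1 \<otimes> N'\<close>. The commutant of the elementary tensors \<open>a \<otimes> b\<close> with \<open>b \<in> N\<close> is \<open>1 \<otimes> N'\<close> as well
  (\<open>commutant_elementary\<close>), and taking commutants gives the tensor product formula. An operator
  lies in \<open>M\<close> precisely when its matrix entries lie in \<open>N\<close>. Hence the centre of \<open>M\<close> is that of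
  \<open>N\<close>; abelian and finite projections of \<open>N\<close> give those of a corner of \<open>M\<close>, and a nonzero
  abelian projection of \<open>M\<close> yields one of \<open>N\<close> (\<open>abelian_descends\<close>). The algebra \<open>M\<close> is
  infinite since it contains the isometry \<open>P 0 b\<close> for a natural number \<open>b > 1\<close> of the
  ray semigroup (\<open>infinite_MM\<close>). Finally, a representation is irreducible if and only if the
  projections in its commutant are trivial, and \<open>M'\<close> and \<open>N'\<close> have the same projections.
\<close>

section \<open>Operators on a Hilbert space\<close>

lemma cmod_square: "(complex_of_real (cmod c))\<^sup>2 = c * cnj c"
  using complex_norm_square[of c] by simp

lemma op_apply:
  fixes S T :: "'v \<Rightarrow> 'v::ab_group_add"
  shows "(S + T) x = S x + T x" "(S - T) x = S x - T x" "(- S) x = - S x" "scale_op H c S x = hscale H c (S x)"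
  by (simp_all add: scale_op_def plus_fun_def fun_diff_def)

locale hilbert =
  fixes H :: "'v::ab_group_add hilbert"
  assumes hilbert_space: "hilbert_space H"
begin

abbreviation "V \<equiv> hcarrier H"
abbreviation "sc \<equiv> hscale H"
abbreviation "ip \<equiv> hinner H"
abbreviation "nrm \<equiv> hnorm H"
abbreviation "Bd \<equiv> bounded_ops H"
abbreviation "adj \<equiv> adjoint_op H"

sublocale vs: vector_space sc
  using hilbert_space by (simp add: hilbert_space_def)

lemma subspace_V: "vs.subspace V"
  using hilbert_space by (simp add: hilbert_space_def)

lemma V_0 [simp]: "0 \<in> V"
  using subspace_V by (rule vs.subspace_0)
lemma V_add [simp]: "x \<in> V \<Longrightarrow> y \<in> V \<Longrightarrow> x + y \<in> V"
  using subspace_V by (rule vs.subspace_add)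
lemma V_sc [simp]: "x \<in> V \<Longrightarrow> sc c x \<in> V"
  using subspace_V by (rule vs.subspace_scale)
lemma V_diff [simp]: "x \<in> V \<Longrightarrow> y \<in> V \<Longrightarrow> x - y \<in> V"
  using subspace_V by (rule vs.subspace_diff)
lemma V_minus [simp]: "x \<in> V \<Longrightarrow> - x \<in> V"
  using subspace_V by (rule vs.subspace_neg)

lemma ip_add_left: "x \<in> V \<Longrightarrow> y \<in> V \<Longrightarrow> z \<in> V \<Longrightarrow> ip (x + y) z = ip x z + ip y z"
  using hilbert_space[unfolded hilbert_space_def, THEN conjunct2, THEN conjunct2, THEN conjunct1] by blast
lemma ip_sc_left: "x \<in> V \<Longrightarrow> y \<in> V \<Longrightarrow> ip (sc c x) y = c * ip x y"
  using hilbert_space[unfolded hilbert_space_def, THEN conjunct2, THEN conjunct2, THEN conjunct2, THEN conjunct1] by blast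
lemma ip_commute: "x \<in> V \<Longrightarrow> y \<in> V \<Longrightarrow> ip y x = cnj (ip x y)"
  using hilbert_space[unfolded hilbert_space_def, THEN conjunct2, THEN conjunct2, THEN conjunct2, THEN conjunct2, THEN conjunct1] by blast
lemma ip_self: "x \<in> V \<Longrightarrow> Im (ip x x) = 0" "x \<in> V \<Longrightarrow> Re (ip x x) \<ge> 0"
  using hilbert_space[unfolded hilbert_space_def, THEN conjunct2, THEN conjunct2, THEN conjunct2, THEN conjunct2, THEN conjunct2, THEN conjunct1] by blast+
lemma ip_eq_0: "x \<in> V \<Longrightarrow> ip x x = 0 \<Longrightarrow> x = 0"
  using hilbert_space[unfolded hilbert_space_def, THEN conjunct2, THEN conjunct2, THEN conjunct2, THEN conjunct2, THEN conjunct2, THEN conjunct2, THEN conjunct1] by blast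
lemma complete:
  assumes "\<And>n::nat. f n \<in> V" "\<And>e. e > 0 \<Longrightarrow> \<exists>N. \<forall>m\<ge>N. \<forall>n\<ge>N. nrm (f m - f n) < e"
  obtains x where "x \<in> V" "(\<lambda>n. nrm (f n - x)) \<longlonglongrightarrow> 0"
  using hilbert_space[unfolded hilbert_space_def, THEN conjunct2, THEN conjunct2, THEN conjunct2, THEN conjunct2, THEN conjunct2, THEN conjunct2, THEN conjunct2, rule_format, of f] assms by blast

lemma ip_add_right: "x \<in> V \<Longrightarrow> y \<in> V \<Longrightarrow> z \<in> V \<Longrightarrow> ip z (x + y) = ip z x + ip z y"
  by (metis V_add complex_cnj_add ip_add_left ip_commute)
lemma ip_sc_right: "x \<in> V \<Longrightarrow> y \<in> V \<Longrightarrow> ip x (sc c y) = cnj c * ip x y"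
  by (metis V_sc complex_cnj_mult ip_commute ip_sc_left)
lemma ip_minus_left: "x \<in> V \<Longrightarrow> y \<in> V \<Longrightarrow> ip (- x) y = - ip x y"
  using ip_sc_left[of x y "-1"] by simp
lemma ip_minus_right: "x \<in> V \<Longrightarrow> y \<in> V \<Longrightarrow> ip x (- y) = - ip x y"
  using ip_sc_right[of x y "-1"] by simp
lemma ip_diff_left: "x \<in> V \<Longrightarrow> y \<in> V \<Longrightarrow> z \<in> V \<Longrightarrow> ip (x - y) z = ip x z - ip y z"
  using ip_add_left[of x "-y" z] by (simp add: ip_minus_left)
lemma ip_diff_right: "x \<in> V \<Longrightarrow> y \<in> V \<Longrightarrow> z \<in> V \<Longrightarrow> ip z (x - y) = ip z x - ip z y"
  using ip_add_right[of x "-y" z] by (simp add: ip_minus_right)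
lemma ip_0_left [simp]: "x \<in> V \<Longrightarrow> ip 0 x = 0"
  using ip_sc_left[of x x 0] by simp
lemma ip_0_right [simp]: "x \<in> V \<Longrightarrow> ip x 0 = 0"
  using ip_sc_right[of x x 0] by simp

lemmas ip_simps = ip_add_left ip_add_right ip_diff_left ip_diff_right ip_sc_left ip_sc_right
  ip_minus_left ip_minus_right

lemma nrm_ge0 [simp]: "x \<in> V \<Longrightarrow> nrm x \<ge> 0"
  by (simp add: hnorm_def ip_self)
lemma nrm_sq: "x \<in> V \<Longrightarrow> (nrm x)\<^sup>2 = Re (ip x x)"
  by (simp add: hnorm_def ip_self)
lemma ip_nrm: "x \<in> V \<Longrightarrow> ip x x = of_real ((nrm x)\<^sup>2)"
  by (simp add: nrm_sq complex_eq_iff ip_self)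
lemma nrm_0 [simp]: "nrm 0 = 0"
  by (simp add: hnorm_def)
lemma nrm_eq_0 [simp]: "x \<in> V \<Longrightarrow> nrm x = 0 \<longleftrightarrow> x = 0"
  using ip_eq_0 ip_nrm by force
lemma nrm_sc: "x \<in> V \<Longrightarrow> nrm (sc c x) = cmod c * nrm x"
proof -
  assume x: "x \<in> V"
  have "ip (sc c x) (sc c x) = of_real ((cmod c * nrm x)\<^sup>2)"
    using x by (simp add: ip_simps ip_nrm[OF x] power_mult_distrib cmod_square mult_ac)
  then have "(nrm (sc c x))\<^sup>2 = (cmod c * nrm x)\<^sup>2"
    using x by (simp add: nrm_sq[of "sc c x"])
  then show ?thesis using x by (simp add: power2_eq_iff_nonneg)
qed
lemma nrm_minus: "x \<in> V \<Longrightarrow> nrm (- x) = nrm x"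
  using nrm_sc[of x "-1"] by simp
lemma nrm_minus_commute: "x \<in> V \<Longrightarrow> y \<in> V \<Longrightarrow> nrm (x - y) = nrm (y - x)"
  using nrm_minus[of "x - y"] by simp

lemma nrm_add_sq: "x \<in> V \<Longrightarrow> y \<in> V \<Longrightarrow> (nrm (x + y))\<^sup>2 = (nrm x)\<^sup>2 + (nrm y)\<^sup>2 + 2 * Re (ip x y)"
  using ip_commute[of x y] by (simp add: nrm_sq ip_simps)
lemma nrm_diff_sq: "x \<in> V \<Longrightarrow> y \<in> V \<Longrightarrow> (nrm (x - y))\<^sup>2 = (nrm x)\<^sup>2 + (nrm y)\<^sup>2 - 2 * Re (ip x y)"
  using nrm_add_sq[of x "-y"] by (simp add: nrm_minus ip_simps)
lemma parallelogram: "x \<in> V \<Longrightarrow> y \<in> V \<Longrightarrow> (nrm (x + y))\<^sup>2 + (nrm (x - y))\<^sup>2 = 2 * (nrm x)\<^sup>2 + 2 * (nrm y)\<^sup>2"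
  by (simp add: nrm_add_sq nrm_diff_sq)

lemma cauchy_schwarz:
  assumes x: "x \<in> V" and y: "y \<in> V"
  shows "cmod (ip x y) \<le> nrm x * nrm y"
proof (cases "y = 0")
  case True then show ?thesis using x by simp
next
  case False
  define c where "c = ip x y"
  define N where "N = (nrm y)\<^sup>2"
  have N: "N > 0" using False y by (simp add: N_def)
  have yx: "ip y x = cnj c" using ip_commute[OF x y] by (simp add: c_def)
  have "ip (sc N x - sc c y) (sc N x - sc c y) = N * (N * of_real ((nrm x)\<^sup>2) - c * cnj c)"
    using x y by (simp add: ip_simps yx c_def[symmetric] ip_nrm[OF x] ip_nrm[OF y] N_def[symmetric] algebra_simps)
  also have "\<dots> = of_real (N * (N * (nrm x)\<^sup>2 - (cmod c)\<^sup>2))"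
    by (simp add: complex_norm_square[symmetric] mult_ac)
  finally have "N * (N * (nrm x)\<^sup>2 - (cmod c)\<^sup>2) \<ge> 0"
    using ip_self(2)[of "sc N x - sc c y"] x y by simp
  then have "(cmod c)\<^sup>2 \<le> (nrm x * nrm y)\<^sup>2" using N by (simp add: zero_le_mult_iff N_def power_mult_distrib mult_ac)
  then show ?thesis using x y unfolding c_def by (meson mult_nonneg_nonneg nrm_ge0 power2_le_imp_le)
qed

lemma nrm_triangle: "x \<in> V \<Longrightarrow> y \<in> V \<Longrightarrow> nrm (x + y) \<le> nrm x + nrm y"
proof -
  assume x: "x \<in> V" and y: "y \<in> V"
  have "(nrm (x + y))\<^sup>2 \<le> (nrm x + nrm y)\<^sup>2"
    using cauchy_schwarz[OF x y] complex_Re_le_cmod[of "ip x y"] x y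
    by (simp add: nrm_add_sq power2_sum)
  then show ?thesis using x y by (meson add_nonneg_nonneg nrm_ge0 power2_le_imp_le)
qed

lemma nrm_triangle_diff: "x \<in> V \<Longrightarrow> y \<in> V \<Longrightarrow> nrm (x - y) \<le> nrm x + nrm y"
  using nrm_triangle[of x "-y"] by (simp add: nrm_minus)

lemma nrm_triangle3: "x \<in> V \<Longrightarrow> y \<in> V \<Longrightarrow> z \<in> V \<Longrightarrow> nrm (x - z) \<le> nrm (x - y) + nrm (y - z)"
  using nrm_triangle[of "x - y" "y - z"] by simp

lemma eq_if_ip_eq: "x \<in> V \<Longrightarrow> y \<in> V \<Longrightarrow> (\<And>z. z \<in> V \<Longrightarrow> ip x z = ip y z) \<Longrightarrow> x = y"
  by (metis V_diff ip_diff_left ip_eq_0 right_minus_eq)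

lemma eq_if_ip_eq': "x \<in> V \<Longrightarrow> y \<in> V \<Longrightarrow> (\<And>z. z \<in> V \<Longrightarrow> ip z x = ip z y) \<Longrightarrow> x = y"
  by (metis eq_if_ip_eq ip_commute)

text \<open>
  The minimising sequence for the distance from \<open>x\<close> to \<open>W\<close> is Cauchy by the parallelogram law.
\<close>

lemma closest_point:
  assumes W: "closed_subspace H W" and x: "x \<in> V"
  obtains w where "w \<in> W" "\<And>v. v \<in> W \<Longrightarrow> nrm (x - w) \<le> nrm (x - v)"
proof -
  have WV: "W \<subseteq> V" and Ws: "vs.subspace W" using W by (auto simp: closed_subspace_def)
  define d where "d = (INF w\<in>W. nrm (x - w))"
  have ne: "W \<noteq> {}" using vs.subspace_0[OF Ws] by auto
  have bdd: "bdd_below ((\<lambda>w. nrm (x - w)) ` W)"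
    using WV x by (auto intro!: bdd_belowI2[of _ 0] nrm_ge0)
  have dle: "d \<le> nrm (x - w)" if "w \<in> W" for w
    unfolding d_def by (rule cINF_lower[OF bdd that])
  have d0: "d \<ge> 0" unfolding d_def using ne WV x by (auto intro!: cINF_greatest nrm_ge0)
  have "\<exists>w\<in>W. nrm (x - w) < d + inverse (Suc n)" for n
    using cINF_less_iff[OF ne bdd, of "d + inverse (Suc n)"] unfolding d_def by auto
  then obtain f where fW: "\<And>n. f n \<in> W" and fd: "\<And>n. nrm (x - f n) < d + inverse (Suc n)"
    by metis
  have fV: "f n \<in> V" for n using fW WV by auto
  have est: "(nrm (f m - f n))\<^sup>2 \<le> 2 * (d + inverse (Suc m))\<^sup>2 + 2 * (d + inverse (Suc n))\<^sup>2 - 4 * d\<^sup>2" for m n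
  proof -
    have mid: "sc (1/2) (f m + f n) \<in> W" using Ws fW by (simp add: vs.subspace_add vs.subspace_scale)
    have eq: "(x - f m) + (x - f n) = sc 2 (x - sc (1/2) (f m + f n))"
      using vs.scale_left_distrib[of 1 1 x] by (simp add: vs.scale_right_diff_distrib algebra_simps)
    have "(nrm ((x - f m) + (x - f n)))\<^sup>2 = 4 * (nrm (x - sc (1/2) (f m + f n)))\<^sup>2"
      unfolding eq using x fV by (subst nrm_sc) (auto simp: power_mult_distrib)
    also have "\<dots> \<ge> 4 * d\<^sup>2" using dle[OF mid] d0 by (simp add: power_mono)
    finally have 1: "(nrm ((x - f m) + (x - f n)))\<^sup>2 \<ge> 4 * d\<^sup>2" .
    have 2: "(nrm (x - f k))\<^sup>2 \<le> (d + inverse (Suc k))\<^sup>2" for k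
      using fd[of k] x fV by (intro power_mono) auto
    have "(nrm ((x - f m) + (x - f n)))\<^sup>2 + (nrm ((x - f m) - (x - f n)))\<^sup>2
        = 2 * (nrm (x - f m))\<^sup>2 + 2 * (nrm (x - f n))\<^sup>2"
      using x fV by (intro parallelogram) auto
    moreover have "nrm ((x - f m) - (x - f n)) = nrm (f m - f n)"
      using nrm_minus[of "f m - f n"] fV by simp
    ultimately show ?thesis using 1 2[of m] 2[of n] by simp
  qed
  have lim: "(\<lambda>n. d + inverse (real (Suc n))) \<longlonglongrightarrow> d"
    using tendsto_add[OF tendsto_const LIMSEQ_inverse_real_of_nat, of d] by simp
  have lim2: "(\<lambda>n. (d + inverse (real (Suc n)))\<^sup>2) \<longlonglongrightarrow> d\<^sup>2"
    by (intro tendsto_power lim)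
  have "\<exists>N. \<forall>m\<ge>N. \<forall>n\<ge>N. nrm (f m - f n) < e" if "e > 0" for e
  proof -
    have "eventually (\<lambda>n. (d + inverse (real (Suc n)))\<^sup>2 < d\<^sup>2 + e\<^sup>2 / 4) sequentially"
      using lim2 that by (intro order_tendstoD) auto
    then obtain N where N: "\<And>n. n \<ge> N \<Longrightarrow> (d + inverse (real (Suc n)))\<^sup>2 < d\<^sup>2 + e\<^sup>2 / 4"
      by (auto simp: eventually_sequentially)
    have "nrm (f m - f n) < e" if "m \<ge> N" "n \<ge> N" for m n
    proof -
      have "(nrm (f m - f n))\<^sup>2 < e\<^sup>2" using est[of m n] N[OF that(1)] N[OF that(2)] by simp
      then show ?thesis using \<open>e > 0\<close> power_less_imp_less_base by fastforce
    qed
    then show ?thesis by blast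
  qed
  then obtain w where w: "w \<in> V" "(\<lambda>n. nrm (f n - w)) \<longlonglongrightarrow> 0"
    using complete[of f] fV by blast
  have wW: "w \<in> W" using W w fW unfolding closed_subspace_def by blast
  have "nrm (x - w) \<le> d + 0 + 0"
  proof (rule tendsto_lowerbound[OF tendsto_add[OF tendsto_add[OF tendsto_const LIMSEQ_inverse_real_of_nat] w(2)]])
    show "\<forall>\<^sub>F n in sequentially. nrm (x - w) \<le> d + inverse (real (Suc n)) + nrm (f n - w)"
    proof (intro always_eventually allI)
      fix n show "nrm (x - w) \<le> d + inverse (real (Suc n)) + nrm (f n - w)"
        using nrm_triangle3[of x "f n" w] fd[of n] x fV[of n] w by simp
    qed
  qed simp
  then show thesis using that wW dle by force
qed

theorem orthogonal_projection:
  assumes W: "closed_subspace H W" and x: "x \<in> V"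
  obtains w where "w \<in> W" "\<And>v. v \<in> W \<Longrightarrow> ip (x - w) v = 0"
proof -
  have WV: "W \<subseteq> V" and Ws: "vs.subspace W" using W by (auto simp: closed_subspace_def)
  obtain w where w: "w \<in> W" and wmin: "\<And>v. v \<in> W \<Longrightarrow> nrm (x - w) \<le> nrm (x - v)"
    using closest_point[OF assms] by blast
  have wV: "w \<in> V" using w WV by auto
  have "ip (x - w) v = 0" if v: "v \<in> W" for v
  proof (cases "v = 0")
    case True then show ?thesis using x wV by simp
  next
    case False
    have vV: "v \<in> V" using v WV by auto
    \<comment> \<open>Move from \<open>w\<close> in the direction of the projection of \<open>x - w\<close> to the line spanned by \<open>v\<close>.\<close>
    define c where "c = ip (x - w) v / of_real ((nrm v)\<^sup>2)"
    have nv: "(nrm v)\<^sup>2 > 0" using False vV by simp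
    have "w + sc c v \<in> W" using w v Ws by (simp add: vs.subspace_add vs.subspace_scale)
    then have "nrm (x - w) \<le> nrm (x - w - sc c v)" using wmin by (simp add: diff_diff_eq)
    then have "(nrm (x - w))\<^sup>2 \<le> (nrm (x - w - sc c v))\<^sup>2" using x wV by (intro power_mono) auto
    also have "\<dots> = (nrm (x - w))\<^sup>2 + (cmod c)\<^sup>2 * (nrm v)\<^sup>2 - 2 * Re (cnj c * ip (x - w) v)"
      using x wV vV by (subst nrm_diff_sq) (auto simp: nrm_sc ip_sc_right power_mult_distrib)
    also have "cnj c * ip (x - w) v = of_real ((cmod c)\<^sup>2 * (nrm v)\<^sup>2)"
    proof -
      have "ip (x - w) v = c * of_real ((nrm v)\<^sup>2)" using nv by (simp add: c_def)
      then have "cnj c * ip (x - w) v = (c * cnj c) * of_real ((nrm v)\<^sup>2)" by simp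
      then show ?thesis by (simp add: cmod_square)
    qed
    finally have "(cmod c)\<^sup>2 * (nrm v)\<^sup>2 \<le> 0" by simp
    then have "c = 0" using nv by (simp add: mult_le_0_iff)
    then show ?thesis using nv by (simp add: c_def)
  qed
  then show thesis using that w by blast
qed

lemma bd_V: "T \<in> Bd \<Longrightarrow> x \<in> V \<Longrightarrow> T x \<in> V"
  and bd_off: "T \<in> Bd \<Longrightarrow> x \<notin> V \<Longrightarrow> T x = 0"
  and bd_add: "T \<in> Bd \<Longrightarrow> x \<in> V \<Longrightarrow> y \<in> V \<Longrightarrow> T (x + y) = T x + T y"
  and bd_sc: "T \<in> Bd \<Longrightarrow> x \<in> V \<Longrightarrow> T (sc c x) = sc c (T x)"
  by (simp_all add: bounded_ops_def)
lemma bd_V' [simp]: "T \<in> Bd \<Longrightarrow> T x \<in> V"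
  by (metis bd_V bd_off V_0)
lemma bd_0: "T \<in> Bd \<Longrightarrow> T 0 = 0"
  using bd_sc[of T 0 0] by simp
lemma bd_minus: "T \<in> Bd \<Longrightarrow> x \<in> V \<Longrightarrow> T (- x) = - T x"
  using bd_sc[of T x "-1"] by simp
lemma bd_diff: "T \<in> Bd \<Longrightarrow> x \<in> V \<Longrightarrow> y \<in> V \<Longrightarrow> T (x - y) = T x - T y"
  using bd_add[of T x "-y"] by (simp add: bd_minus)
lemma bd_bound:
  assumes "T \<in> Bd" obtains c where "c > 0" "\<And>x. x \<in> V \<Longrightarrow> nrm (T x) \<le> c * nrm x"
proof -
  obtain c where c: "\<And>x. x \<in> V \<Longrightarrow> nrm (T x) \<le> c * nrm x" using assms unfolding bounded_ops_def by blast
  have "nrm (T x) \<le> max c 1 * nrm x" if "x \<in> V" for x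
    using c[OF that] mult_right_mono[of c "max c 1" "nrm x"] that by force
  then show thesis using that[of "max c 1"] by auto
qed

lemma bdI:
  assumes "\<And>x. x \<in> V \<Longrightarrow> T x \<in> V" "\<And>x. x \<notin> V \<Longrightarrow> T x = 0"
    "\<And>x y. x \<in> V \<Longrightarrow> y \<in> V \<Longrightarrow> T (x + y) = T x + T y"
    "\<And>c x. x \<in> V \<Longrightarrow> T (sc c x) = sc c (T x)"
    "\<And>x. x \<in> V \<Longrightarrow> nrm (T x) \<le> c * nrm x"
  shows "T \<in> Bd"
  using assms unfolding bounded_ops_def by blast

lemma bd_eqI: "S \<in> Bd \<Longrightarrow> T \<in> Bd \<Longrightarrow> (\<And>x. x \<in> V \<Longrightarrow> S x = T x) \<Longrightarrow> S = T"
  by (rule ext) (metis bd_off)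

lemma bd_zero [simp]: "(\<lambda>x. 0) \<in> Bd"
  by (rule bdI[where c=0]) auto
lemma bd_id [simp]: "id_op H \<in> Bd"
  by (rule bdI[where c=1]) (auto simp: id_op_def)
lemma bd_comp [simp]: assumes S: "S \<in> Bd" and T: "T \<in> Bd" shows "S \<circ> T \<in> Bd"
proof -
  obtain c where c: "c > 0" "\<And>x. x \<in> V \<Longrightarrow> nrm (S x) \<le> c * nrm x" using bd_bound[OF S] by blast
  obtain d where d: "d > 0" "\<And>x. x \<in> V \<Longrightarrow> nrm (T x) \<le> d * nrm x" using bd_bound[OF T] by blast
  have "nrm (S (T x)) \<le> c * d * nrm x" if x: "x \<in> V" for x
  proof -
    have "nrm (S (T x)) \<le> c * nrm (T x)" using c(2) T x by simp
    also have "\<dots> \<le> c * (d * nrm x)" using d(2)[OF x] c(1) by simp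
    finally show ?thesis by (simp add: mult_ac)
  qed
  then show ?thesis using S T
    by (intro bdI[where c="c * d"]) (auto simp: bd_add bd_sc bd_off[of S] bd_off[of T] bd_0)
qed
lemma bd_plus [simp]: assumes S: "S \<in> Bd" and T: "T \<in> Bd" shows "S + T \<in> Bd"
proof -
  obtain c where c: "c > 0" "\<And>x. x \<in> V \<Longrightarrow> nrm (S x) \<le> c * nrm x" using bd_bound[OF S] by blast
  obtain d where d: "d > 0" "\<And>x. x \<in> V \<Longrightarrow> nrm (T x) \<le> d * nrm x" using bd_bound[OF T] by blast
  have "nrm (S x + T x) \<le> (c + d) * nrm x" if x: "x \<in> V" for x
    using c(2)[OF x] d(2)[OF x] nrm_triangle[of "S x" "T x"] S T x by (simp add: algebra_simps)
  then show ?thesis using S T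
    by (intro bdI[where c="c + d"]) (auto simp: bd_add bd_sc bd_off[of S] bd_off[of T] plus_fun_def vs.scale_right_distrib)
qed
lemma bd_scale [simp]: assumes T: "T \<in> Bd" shows "scale_op H c T \<in> Bd"
proof -
  obtain d where d: "d > 0" "\<And>x. x \<in> V \<Longrightarrow> nrm (T x) \<le> d * nrm x" using bd_bound[OF T] by blast
  show ?thesis using T
  proof (intro bdI[where c="cmod c * d"])
    show "nrm (scale_op H c T x) \<le> cmod c * d * nrm x" if x: "x \<in> V" for x
      using d(2)[OF x] T x by (simp add: scale_op_def nrm_sc mult_left_mono mult.assoc)
  qed (auto simp: scale_op_def bd_add bd_sc bd_off[of T] vs.scale_right_distrib mult.commute)
qed
lemma scale_op_minus1: "scale_op H (-1) T = - T"
  by (auto simp: scale_op_def fun_Compl_def)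
lemma bd_uminus [simp]: "T \<in> Bd \<Longrightarrow> - T \<in> Bd"
  using bd_scale[of T "-1"] by (simp add: scale_op_minus1)
lemma bd_minus_op [simp]: "S \<in> Bd \<Longrightarrow> T \<in> Bd \<Longrightarrow> S - T \<in> Bd"
  using bd_plus[of S "-T"] by simp

lemma id_op_comp [simp]: "T \<in> Bd \<Longrightarrow> id_op H \<circ> T = T" "T \<in> Bd \<Longrightarrow> T \<circ> id_op H = T"
  by (auto simp: id_op_def fun_eq_iff bd_off[of T] bd_0)
lemma id_op_apply [simp]: "x \<in> V \<Longrightarrow> id_op H x = x"
  by (simp add: id_op_def)

subsection \<open>Adjoints\<close>

text \<open>
  The kernel of a bounded functional has at most one-dimensional orthogonal complement, and a
  suitable multiple of a vector in it represents the functional.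
\<close>

theorem riesz:
  assumes add: "\<And>x y. x \<in> V \<Longrightarrow> y \<in> V \<Longrightarrow> \<phi> (x + y) = \<phi> x + \<phi> y"
    and scal: "\<And>c x. x \<in> V \<Longrightarrow> \<phi> (sc c x) = c * \<phi> x"
    and bound: "\<And>x. x \<in> V \<Longrightarrow> cmod (\<phi> x) \<le> K * nrm x"
  obtains z where "z \<in> V" "\<And>x. x \<in> V \<Longrightarrow> \<phi> x = ip x z"
proof -
  define W where "W = {x \<in> V. \<phi> x = 0}"
  have \<phi>0: "\<phi> 0 = 0" using scal[of 0 0] by simp
  have diff: "\<phi> (x - y) = \<phi> x - \<phi> y" if "x \<in> V" "y \<in> V" for x y
    using add[of x "-y"] scal[of y "-1"] that by simp
  have "vs.subspace W"
    by (auto simp: vs.subspace_def W_def \<phi>0 add scal)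
  moreover have "x \<in> W" if x: "x \<in> V" and f: "\<forall>n::nat. f n \<in> W" and lim: "(\<lambda>n. nrm (f n - x)) \<longlonglongrightarrow> 0" for f x
  proof -
    have "cmod (\<phi> x) \<le> K * nrm (f n - x)" for n
    proof -
      have "f n \<in> V" "\<phi> (f n) = 0" using f by (auto simp: W_def)
      then show ?thesis using bound[of "f n - x"] x diff by (simp add: norm_minus_commute)
    qed
    moreover have "(\<lambda>n. K * nrm (f n - x)) \<longlonglongrightarrow> K * 0" by (intro tendsto_intros lim)
    ultimately have "cmod (\<phi> x) \<le> K * 0"
      by (intro tendsto_lowerbound) (auto intro!: always_eventually)
    then show ?thesis using x by (simp add: W_def)
  qed
  ultimately have W: "closed_subspace H W" by (auto simp: closed_subspace_def W_def)
  show thesis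
  proof (cases "\<forall>x\<in>V. \<phi> x = 0")
    case True then show thesis using that[of 0] by simp
  next
    case False
    then obtain x0 where x0: "x0 \<in> V" "\<phi> x0 \<noteq> 0" by auto
    obtain w where w: "w \<in> W" "\<And>v. v \<in> W \<Longrightarrow> ip (x0 - w) v = 0"
      using orthogonal_projection[OF W x0(1)] by blast
    define y where "y = x0 - w"
    have wV: "w \<in> V" "\<phi> w = 0" using w by (auto simp: W_def)
    have yV: "y \<in> V" using x0 wV by (simp add: y_def)
    have \<phi>y: "\<phi> y \<noteq> 0" using x0 wV by (simp add: y_def diff)
    have ny: "(nrm y)\<^sup>2 \<noteq> 0" using \<phi>y \<phi>0 yV by auto
    define z where "z = sc (cnj (\<phi> y) / of_real ((nrm y)\<^sup>2)) y"
    have rep: "\<phi> x = ip x z" if x: "x \<in> V" for x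
    proof -
      have "sc (\<phi> y) x - sc (\<phi> x) y \<in> W" using x yV by (simp add: W_def diff scal)
      then have "ip y (sc (\<phi> y) x - sc (\<phi> x) y) = 0" using w(2) by (simp add: y_def)
      then have "ip (sc (\<phi> y) x - sc (\<phi> x) y) y = 0"
        using ip_commute[of y "sc (\<phi> y) x - sc (\<phi> x) y"] x yV by simp
      then have "\<phi> y * ip x y = \<phi> x * of_real ((nrm y)\<^sup>2)" using x yV by (simp add: ip_simps ip_nrm[OF yV])
      then show ?thesis using ny x yV by (simp add: z_def ip_sc_right field_simps)
    qed
    have "z \<in> V" using yV by (simp add: z_def)
    then show thesis using rep by (rule that)
  qed
qed

lemma adjoint_ex1:
  assumes T: "T \<in> Bd"
  shows "\<exists>!T'. T' \<in> Bd \<and> (\<forall>x\<in>V. \<forall>y\<in>V. ip (T x) y = ip x (T' y))"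
proof -
  obtain c where c: "c > 0" "\<And>x. x \<in> V \<Longrightarrow> nrm (T x) \<le> c * nrm x" using bd_bound[OF T] by blast
  have "\<exists>z\<in>V. \<forall>x\<in>V. ip (T x) y = ip x z" if y: "y \<in> V" for y
  proof -
    have "cmod (ip (T x) y) \<le> (c * nrm y) * nrm x" if x: "x \<in> V" for x
      using cauchy_schwarz[of "T x" y] mult_right_mono[OF c(2)[OF x], of "nrm y"] T x y by (simp add: mult_ac)
    then obtain z where "z \<in> V" "\<And>x. x \<in> V \<Longrightarrow> ip (T x) y = ip x z"
      using riesz[of "\<lambda>x. ip (T x) y"] T y by (metis bd_V bd_add bd_sc ip_add_left ip_sc_left)
    then show ?thesis by blast
  qed
  then obtain f where f: "\<And>y. y \<in> V \<Longrightarrow> f y \<in> V" "\<And>x y. y \<in> V \<Longrightarrow> x \<in> V \<Longrightarrow> ip (T x) y = ip x (f y)"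
    by metis
  define T' where "T' = (\<lambda>y. if y \<in> V then f y else 0)"
  have "T' \<in> Bd"
  proof (rule bdI[where c=c])
    show "T' (x + y) = T' x + T' y" if "x \<in> V" "y \<in> V" for x y
    proof (rule eq_if_ip_eq')
      fix z assume z: "z \<in> V"
      show "ip z (T' (x + y)) = ip z (T' x + T' y)"
        using that z f T by (simp add: T'_def ip_add_right f(2)[symmetric])
    qed (use that f in \<open>auto simp: T'_def\<close>)
    show "T' (sc a x) = sc a (T' x)" if "x \<in> V" for x a
    proof (rule eq_if_ip_eq')
      fix z assume z: "z \<in> V"
      show "ip z (T' (sc a x)) = ip z (sc a (T' x))"
        using that z f T by (simp add: T'_def ip_sc_right f(2)[symmetric])
    qed (use that f in \<open>auto simp: T'_def\<close>)
    show "nrm (T' y) \<le> c * nrm y" if y: "y \<in> V" for y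
    proof (cases "T' y = 0")
      case True then show ?thesis using y c(1) by simp
    next
      case False
      have yV: "T' y \<in> V" using y f by (simp add: T'_def)
      have "(nrm (T' y))\<^sup>2 = Re (ip (T' y) (T' y))" using yV by (rule nrm_sq)
      also have "ip (T' y) (T' y) = ip (T (T' y)) y" using f(2)[OF y yV] y by (simp add: T'_def)
      also have "Re \<dots> \<le> nrm (T (T' y)) * nrm y"
        using cauchy_schwarz[of "T (T' y)" y] complex_Re_le_cmod T y order_trans bd_V' by blast
      also have "\<dots> \<le> (c * nrm (T' y)) * nrm y" using c(2)[OF yV] y by (intro mult_right_mono) auto
      finally have "nrm (T' y) * nrm (T' y) \<le> nrm (T' y) * (c * nrm y)" by (simp add: power2_eq_square mult_ac)
      moreover have "nrm (T' y) > 0" using False yV nrm_ge0[OF yV] nrm_eq_0[OF yV] by linarith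
      ultimately show ?thesis by simp
    qed
  qed (use f in \<open>auto simp: T'_def\<close>)
  then have ex: "T' \<in> Bd" "\<And>x y. x \<in> V \<Longrightarrow> y \<in> V \<Longrightarrow> ip (T x) y = ip x (T' y)"
    using f by (auto simp: T'_def)
  show ?thesis
  proof (rule ex1I[of _ T'])
    show "T' \<in> Bd \<and> (\<forall>x\<in>V. \<forall>y\<in>V. ip (T x) y = ip x (T' y))" using ex by blast
    fix S assume S: "S \<in> Bd \<and> (\<forall>x\<in>V. \<forall>y\<in>V. ip (T x) y = ip x (S y))"
    show "S = T'"
    proof (rule bd_eqI)
      fix y assume y: "y \<in> V"
      show "S y = T' y"
      proof (rule eq_if_ip_eq')
        fix z assume "z \<in> V"
        then show "ip z (S y) = ip z (T' y)" using S ex(2) y by metis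
      qed (use S ex in auto)
    qed (use S ex in auto)
  qed
qed

lemma adj_bd [simp]: "T \<in> Bd \<Longrightarrow> adj T \<in> Bd"
  using theI'[OF adjoint_ex1, of T] unfolding adjoint_op_def by blast
lemma adj_ip: "T \<in> Bd \<Longrightarrow> x \<in> V \<Longrightarrow> y \<in> V \<Longrightarrow> ip (T x) y = ip x (adj T y)"
  using theI'[OF adjoint_ex1, of T] unfolding adjoint_op_def by blast
lemma adj_eqI:
  assumes "T \<in> Bd" "S \<in> Bd" "\<And>x y. x \<in> V \<Longrightarrow> y \<in> V \<Longrightarrow> ip (T x) y = ip x (S y)"
  shows "adj T = S"
  by (rule bd_eqI) (use assms in \<open>auto intro!: eq_if_ip_eq' simp flip: adj_ip\<close>)
lemma adj_ip': assumes "T \<in> Bd" "x \<in> V" "y \<in> V" shows "ip (adj T x) y = ip x (T y)"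
  using adj_ip[of T y x] assms ip_commute[of "T y" x] ip_commute[of y "adj T x"] by simp
lemma adj_adj [simp]: "T \<in> Bd \<Longrightarrow> adj (adj T) = T"
  by (rule adj_eqI) (auto simp: adj_ip')
lemma adj_comp: "S \<in> Bd \<Longrightarrow> T \<in> Bd \<Longrightarrow> adj (S \<circ> T) = adj T \<circ> adj S"
  by (rule adj_eqI) (auto simp: adj_ip)
lemma adj_plus: "S \<in> Bd \<Longrightarrow> T \<in> Bd \<Longrightarrow> adj (S + T) = adj S + adj T"
  by (rule adj_eqI) (auto simp: adj_ip ip_simps op_apply)
lemma adj_scale: "T \<in> Bd \<Longrightarrow> adj (scale_op H c T) = scale_op H (cnj c) (adj T)"
  by (rule adj_eqI) (auto simp: adj_ip ip_simps op_apply)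
lemma adj_id [simp]: "adj (id_op H) = id_op H"
  by (rule adj_eqI) auto
lemma adj_zero [simp]: "adj (\<lambda>x. 0) = (\<lambda>x. 0)"
  by (rule adj_eqI) auto

lemma isometry_adj:
  assumes T: "T \<in> Bd" and "\<And>x y. x \<in> V \<Longrightarrow> y \<in> V \<Longrightarrow> ip (T x) (T y) = ip x y"
  shows "adj T \<circ> T = id_op H"
  using assms by (intro bd_eqI eq_if_ip_eq') (auto simp flip: adj_ip)

lemma bd_compose_distrib:
  "S \<in> Bd \<Longrightarrow> T \<in> Bd \<Longrightarrow> U \<in> Bd \<Longrightarrow> S \<circ> (T + U) = (S \<circ> T) + (S \<circ> U)"
  "S \<in> Bd \<Longrightarrow> T \<in> Bd \<Longrightarrow> U \<in> Bd \<Longrightarrow> (T + U) \<circ> S = (T \<circ> S) + (U \<circ> S)"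
  "S \<in> Bd \<Longrightarrow> T \<in> Bd \<Longrightarrow> S \<circ> scale_op H c T = scale_op H c (S \<circ> T)"
  "S \<in> Bd \<Longrightarrow> T \<in> Bd \<Longrightarrow> scale_op H c T \<circ> S = scale_op H c (T \<circ> S)"
  by (simp_all add: fun_eq_iff op_apply bd_add bd_sc)

subsection \<open>Projections onto closed subspaces\<close>

lemma projection_onto:
  assumes W: "closed_subspace H W"
  obtains p where "p \<in> Bd" "p \<circ> p = p" "adj p = p" "\<And>x. p x \<in> W" "\<And>x. x \<in> W \<Longrightarrow> p x = x"
    "\<And>x v. x \<in> V \<Longrightarrow> v \<in> W \<Longrightarrow> ip (x - p x) v = 0"
proof -
  have WV: "W \<subseteq> V" and Ws: "vs.subspace W" using W by (auto simp: closed_subspace_def)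
  have "\<forall>x\<in>V. \<exists>w. w \<in> W \<and> (\<forall>v\<in>W. ip (x - w) v = 0)"
    using orthogonal_projection[OF W] by metis
  then obtain f where f: "\<And>x. x \<in> V \<Longrightarrow> f x \<in> W" "\<And>x v. x \<in> V \<Longrightarrow> v \<in> W \<Longrightarrow> ip (x - f x) v = 0"
    by metis
  have fV: "f x \<in> V" if "x \<in> V" for x using f(1)[OF that] WV by auto
  define p where "p = (\<lambda>x. if x \<in> V then f x else 0)"
  have uniq: "w = f x" if "x \<in> V" "w \<in> W" "\<And>v. v \<in> W \<Longrightarrow> ip (x - w) v = 0" for x w
  proof -
    have d: "f x - w \<in> W" using that f Ws by (simp add: vs.subspace_diff)
    have wV: "w \<in> V" using that WV by auto
    have "ip (f x - w) (f x - w) = ip (x - w) (f x - w) - ip (x - f x) (f x - w)"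
      using that wV fV by (simp add: ip_simps)
    also have "\<dots> = 0" using d that f by simp
    finally show ?thesis using ip_eq_0[of "f x - w"] wV fV that by simp
  qed
  have bound: "nrm (f x) \<le> nrm x" if x: "x \<in> V" for x
  proof -
    have "ip (x - f x) (f x) = 0" using f x by blast
    then have "(nrm x)\<^sup>2 = (nrm (x - f x))\<^sup>2 + (nrm (f x))\<^sup>2"
      using nrm_add_sq[of "x - f x" "f x"] x fV by simp
    then show ?thesis using x fV by (metis le_add_same_cancel2 nrm_ge0 power2_le_imp_le zero_le_power2)
  qed
  have bd: "p \<in> Bd"
  proof (rule bdI[where c=1])
    fix x y assume x: "x \<in> V" and y: "y \<in> V"
    have fx: "f x \<in> V" "f y \<in> V" using x y fV by auto
    have "f x + f y = f (x + y)"
    proof (rule uniq)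
      fix v assume v: "v \<in> W"
      then have vV: "v \<in> V" using WV by auto
      have "ip (x + y - (f x + f y)) v = ip (x - f x) v + ip (y - f y) v"
        using x y fx vV by (simp add: ip_simps)
      then show "ip (x + y - (f x + f y)) v = 0" using f(2) x y v by simp
    qed (use x y f Ws in \<open>auto simp: vs.subspace_add\<close>)
    then show "p (x + y) = p x + p y" using x y by (simp add: p_def)
  next
    fix c x assume x: "x \<in> V"
    have "sc c (f x) = f (sc c x)"
    proof (rule uniq)
      fix v assume v: "v \<in> W"
      then have vV: "v \<in> V" using WV by auto
      have "ip (sc c x - sc c (f x)) v = c * ip (x - f x) v"
        using x fV[OF x] vV by (simp add: ip_simps algebra_simps)
      then show "ip (sc c x - sc c (f x)) v = 0" using f(2) x v by simp
    qed (use x f Ws in \<open>auto simp: vs.subspace_scale\<close>)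
    then show "p (sc c x) = sc c (p x)" using x by (simp add: p_def)
  qed (use fV bound in \<open>auto simp: p_def\<close>)
  have pW: "p x \<in> W" for x using f(1) vs.subspace_0[OF Ws] by (simp add: p_def)
  have pfix: "p x = x" if "x \<in> W" for x
  proof -
    have xV: "x \<in> V" using that WV by auto
    have "x = f x" by (rule uniq) (use xV that WV in auto)
    then show ?thesis using xV by (simp add: p_def)
  qed
  have "p \<circ> p = p" using pW pfix by auto
  moreover have "adj p = p"
  proof (rule adj_eqI[OF bd bd])
    fix x y assume x: "x \<in> V" and y: "y \<in> V"
    have 1: "ip (x - p x) (p y) = 0" using f(2)[OF x pW[of y]] x by (simp add: p_def)
    have "ip (y - p y) (p x) = 0" using f(2)[OF y pW[of x]] y by (simp add: p_def)
    then have 2: "ip (p x) (y - p y) = 0" using ip_commute[of "y - p y" "p x"] x y bd by simp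
    show "ip (p x) y = ip x (p y)" using 1 2 x y bd by (simp add: ip_simps)
  qed
  moreover have "ip (x - p x) v = 0" if "x \<in> V" "v \<in> W" for x v
    using f(2)[OF that] that by (simp add: p_def)
  ultimately show thesis using that[of p] bd pW pfix by blast
qed

lemma range_projection_closed:
  assumes p: "p \<in> Bd" "p \<circ> p = p"
  shows "closed_subspace H (range p)"
proof -
  have fix_p: "p y = y" if "y \<in> range p" for y
    using that p(2) by (metis comp_apply imageE)
  have rV: "range p \<subseteq> V" using p(1) by auto
  have "vs.subspace (range p)"
  proof (rule vs.subspaceI)
    show "0 \<in> range p" using p(1) by (metis bd_0 rangeI)
    show "x + y \<in> range p" if "x \<in> range p" "y \<in> range p" for x y
      using fix_p[OF that(1)] fix_p[OF that(2)] bd_add[OF p(1), of x y] rV that by (metis rangeI subsetD)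
    show "sc c x \<in> range p" if "x \<in> range p" for c x
      using fix_p[OF that] bd_sc[OF p(1), of x c] rV that by (metis rangeI subsetD)
  qed
  moreover have "x \<in> range p" if x: "x \<in> V" and f: "\<forall>n::nat. f n \<in> range p"
    and lim: "(\<lambda>n. nrm (f n - x)) \<longlonglongrightarrow> 0" for f x
  proof -
    obtain c where c: "c > 0" "\<And>x. x \<in> V \<Longrightarrow> nrm (p x) \<le> c * nrm x" using bd_bound[OF p(1)] by blast
    have "nrm (p x - x) \<le> (c + 1) * nrm (f n - x)" for n
    proof -
      have fn: "f n \<in> V" "p (f n) = f n" using f rV fix_p by blast+
      have "nrm (p x - x) \<le> nrm (p x - f n) + nrm (f n - x)"
        using nrm_triangle3[of "p x" "f n" x] x fn p(1) by simp
      also have "p x - f n = p (x - f n)" using x fn p(1) by (simp add: bd_diff)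
      also have "nrm (p (x - f n)) \<le> c * nrm (f n - x)" using c(2)[of "x - f n"] x fn nrm_minus_commute by simp
      finally show ?thesis by (simp add: algebra_simps)
    qed
    moreover have "(\<lambda>n. (c + 1) * nrm (f n - x)) \<longlonglongrightarrow> (c + 1) * 0" by (intro tendsto_intros lim)
    ultimately have "nrm (p x - x) \<le> (c + 1) * 0"
      by (intro tendsto_lowerbound) (auto intro!: always_eventually)
    then have "p x = x" using x p(1) nrm_ge0[of "p x - x"] nrm_eq_0[of "p x - x"] by (simp add: order_antisym_conv)
    then show ?thesis by (metis rangeI)
  qed
  ultimately show ?thesis using rV by (auto simp: closed_subspace_def)
qed

subsection \<open>Commutants\<close>

lemma commutant_sub: "commutant H A \<subseteq> Bd"
  by (auto simp: commutant_def)
lemma commutant_anti: "A \<subseteq> B \<Longrightarrow> commutant H B \<subseteq> commutant H A"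
  by (auto simp: commutant_def)
lemma bicommutant_ext: "A \<subseteq> Bd \<Longrightarrow> A \<subseteq> bicommutant H A"
  by (fastforce simp: commutant_def)
lemma commutant3: "A \<subseteq> Bd \<Longrightarrow> commutant H (bicommutant H A) = commutant H A"
  using bicommutant_ext[of A] bicommutant_ext[OF commutant_sub, of A] commutant_anti by blast
lemma commutant_id [simp]: "A \<subseteq> Bd \<Longrightarrow> id_op H \<in> commutant H A"
  by (auto simp: commutant_def)
lemma commutant_comp: "A \<subseteq> Bd \<Longrightarrow> S \<in> commutant H A \<Longrightarrow> T \<in> commutant H A \<Longrightarrow> S \<circ> T \<in> commutant H A"
proof -
  assume A: "A \<subseteq> Bd" and S: "S \<in> commutant H A" and T: "T \<in> commutant H A"
  have "S \<circ> T \<circ> a = a \<circ> (S \<circ> T)" if "a \<in> A" for a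
    using S T that by (metis (mono_tags, lifting) commutant_def comp_assoc mem_Collect_eq)
  then show ?thesis using S T by (simp add: commutant_def)
qed
lemma commutant_scale: "A \<subseteq> Bd \<Longrightarrow> T \<in> commutant H A \<Longrightarrow> scale_op H c T \<in> commutant H A"
proof -
  assume A: "A \<subseteq> Bd" and T: "T \<in> commutant H A"
  then have TB: "T \<in> Bd" by (simp add: commutant_def)
  have "scale_op H c T \<circ> a = a \<circ> scale_op H c T" if "a \<in> A" for a
  proof -
    have "a \<in> Bd" "T \<circ> a = a \<circ> T" using A T that by (auto simp: commutant_def)
    then show ?thesis using TB by (simp add: bd_compose_distrib)
  qed
  then show ?thesis using TB by (simp add: commutant_def)
qed
lemma commutant_adj:
  assumes A: "A \<subseteq> Bd" "\<And>a. a \<in> A \<Longrightarrow> adj a \<in> A" and T: "T \<in> commutant H A"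
  shows "adj T \<in> commutant H A"
proof -
  have TB: "T \<in> Bd" using T by (simp add: commutant_def)
  have "adj T \<circ> a = a \<circ> adj T" if a: "a \<in> A" for a
  proof -
    have aB: "a \<in> Bd" using a A by auto
    have "T \<circ> adj a = adj a \<circ> T" using T A(2)[OF a] by (auto simp: commutant_def)
    then have "adj (T \<circ> adj a) = adj (adj a \<circ> T)" by simp
    then show ?thesis using TB aB by (simp add: adj_comp)
  qed
  then show ?thesis using TB by (simp add: commutant_def)
qed

text \<open>
  A closed subspace is invariant under a self-adjoint set of operators precisely when its
  projection lies in the commutant.
\<close>

lemma projection_in_commutant:
  assumes A: "A \<subseteq> Bd" "\<And>a. a \<in> A \<Longrightarrow> adj a \<in> A"
    and p: "p \<in> Bd" "p \<circ> p = p" "adj p = p"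
    and inv: "\<And>a x. a \<in> A \<Longrightarrow> x \<in> range p \<Longrightarrow> a x \<in> range p"
  shows "p \<in> commutant H A"
proof -
  have key: "p \<circ> a \<circ> p = a \<circ> p" if "a \<in> A" for a
  proof
    fix x
    have "a (p x) \<in> range p" using inv[OF that] by auto
    then obtain z where z: "a (p x) = p z" by auto
    then show "(p \<circ> a \<circ> p) x = (a \<circ> p) x" using p(2) by (auto simp: fun_eq_iff)
  qed
  have "p \<circ> a = a \<circ> p" if a: "a \<in> A" for a
  proof -
    have aB: "a \<in> Bd" using a A by auto
    have "adj (p \<circ> adj a \<circ> p) = adj (adj a \<circ> p)" using key[OF A(2)[OF a]] by simp
    then have "p \<circ> a \<circ> p = p \<circ> a" using aB p by (simp add: adj_comp comp_assoc)
    then show ?thesis using key[OF a] by simp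
  qed
  then show ?thesis using p(1) by (simp add: commutant_def)
qed

end

section \<open>Square-summable families in a Hilbert space\<close>

lemma infsum_of_real_summable:
  assumes "f summable_on A"
  shows "(\<Sum>\<^sub>\<infinity>x\<in>A. complex_of_real (f x)) = complex_of_real (\<Sum>\<^sub>\<infinity>x\<in>A. f x)"
proof -
  have "(f has_sum (\<Sum>\<^sub>\<infinity>x\<in>A. f x)) A" using assms by (rule has_sum_infsum)
  then have "((\<lambda>x. complex_of_real (f x)) has_sum complex_of_real (\<Sum>\<^sub>\<infinity>x\<in>A. f x)) A"
    by (simp only: has_sum_of_real_iff)
  then show ?thesis by (rule infsumI)
qed

locale square_summable = hilbert H for H :: "'v::ab_group_add hilbert" +
  fixes X :: "'i set"
begin

abbreviation "L \<equiv> ell2 X H"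

lemma L_mem: "f \<in> hcarrier L \<longleftrightarrow> (\<forall>s\<in>X. f s \<in> V) \<and> (\<forall>s. s \<notin> X \<longrightarrow> f s = 0) \<and>
    (\<lambda>s. (nrm (f s))\<^sup>2) summable_on X"
  by (simp add: ell2_def)
lemma L_ip: "hinner L f g = (\<Sum>\<^sub>\<infinity>s\<in>X. ip (f s) (g s))"
  by (simp add: ell2_def)
lemma L_sc: "hscale L c f = (\<lambda>s. sc c (f s))"
  by (simp add: ell2_def)
lemma L_V: "f \<in> hcarrier L \<Longrightarrow> f s \<in> V"
  by (cases "s \<in> X") (auto simp: L_mem)
lemma L_off: "f \<in> hcarrier L \<Longrightarrow> s \<notin> X \<Longrightarrow> f s = 0"
  by (auto simp: L_mem)
lemma L_summable: "f \<in> hcarrier L \<Longrightarrow> (\<lambda>s. (nrm (f s))\<^sup>2) summable_on X"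
  by (auto simp: L_mem)

lemma L_memI:
  assumes "\<And>s. s \<in> X \<Longrightarrow> f s \<in> V" "\<And>s. s \<notin> X \<Longrightarrow> f s = 0" "g summable_on X"
    "\<And>s. s \<in> X \<Longrightarrow> (nrm (f s))\<^sup>2 \<le> g s"
  shows "f \<in> hcarrier L"
  using assms summable_on_comparison_test[of g X "\<lambda>s. (nrm (f s))\<^sup>2"] by (simp add: L_mem)

lemma L_ip_abs_summable:
  assumes f: "f \<in> hcarrier L" and g: "g \<in> hcarrier L"
  shows "(\<lambda>s. norm (ip (f s) (g s))) summable_on X"
proof (rule summable_on_comparison_test)
  show "(\<lambda>s. (nrm (f s))\<^sup>2 + (nrm (g s))\<^sup>2) summable_on X"
    using L_summable[OF f] L_summable[OF g] by (rule summable_on_add)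
  fix s
  have "cmod (ip (f s) (g s)) \<le> nrm (f s) * nrm (g s)"
    using L_V[OF f] L_V[OF g] by (rule cauchy_schwarz)
  also have "2 * \<dots> \<le> (nrm (f s))\<^sup>2 + (nrm (g s))\<^sup>2"
    using sum_squares_bound[of "nrm (f s)" "nrm (g s)"] by simp
  moreover have "nrm (f s) * nrm (g s) \<ge> 0" using L_V[OF f] L_V[OF g] by simp
  ultimately show "norm (ip (f s) (g s)) \<le> (nrm (f s))\<^sup>2 + (nrm (g s))\<^sup>2" by linarith
qed auto

lemma L_ip_summable:
  "f \<in> hcarrier L \<Longrightarrow> g \<in> hcarrier L \<Longrightarrow> (\<lambda>s. ip (f s) (g s)) summable_on X"
  by (rule abs_summable_summable[OF L_ip_abs_summable])

lemma L_self: "f \<in> hcarrier L \<Longrightarrow> hinner L f f = of_real (\<Sum>\<^sub>\<infinity>s\<in>X. (nrm (f s))\<^sup>2)"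
  by (simp add: L_ip ip_nrm[OF L_V] infsum_of_real_summable[OF L_summable] flip: of_real_power)

lemma L_nrm_sq: "f \<in> hcarrier L \<Longrightarrow> (hnorm L f)\<^sup>2 = (\<Sum>\<^sub>\<infinity>s\<in>X. (nrm (f s))\<^sup>2)"
  by (simp add: hnorm_def[of L] L_self infsum_nonneg)

lemma L_nrm_ge: "f \<in> hcarrier L \<Longrightarrow> nrm (f s) \<le> hnorm L f"
proof (cases "s \<in> X")
  case True
  assume f: "f \<in> hcarrier L"
  have "(nrm (f s))\<^sup>2 \<le> (hnorm L f)\<^sup>2"
    using finite_sum_le_infsum[OF L_summable[OF f], of "{s}"] True by (simp add: L_nrm_sq[OF f])
  then show ?thesis
    by (rule power2_le_imp_le) (simp add: hnorm_def[of L] L_self[OF f] infsum_nonneg)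
next
  case False
  assume f: "f \<in> hcarrier L"
  show ?thesis using L_off[OF f False] by (simp add: hnorm_def[of L] L_self[OF f] infsum_nonneg)
qed

lemma L_subspace: "f \<in> hcarrier L \<Longrightarrow> g \<in> hcarrier L \<Longrightarrow> f + g \<in> hcarrier L"
    "f \<in> hcarrier L \<Longrightarrow> hscale L c f \<in> hcarrier L" "0 \<in> hcarrier L"
proof -
  assume f: "f \<in> hcarrier L" and g: "g \<in> hcarrier L"
  show "f + g \<in> hcarrier L"
  proof (rule L_memI)
    show "(\<lambda>s. 2 * (nrm (f s))\<^sup>2 + 2 * (nrm (g s))\<^sup>2) summable_on X"
      using L_summable[OF f] L_summable[OF g] by (intro summable_on_add summable_on_cmult_right)
    show "(nrm ((f + g) s))\<^sup>2 \<le> 2 * (nrm (f s))\<^sup>2 + 2 * (nrm (g s))\<^sup>2" for s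
      using parallelogram[of "f s" "g s"] L_V[OF f] L_V[OF g] by (simp add: op_apply) (metis zero_le_power2 le_add_same_cancel1)
  qed (use L_V[OF f] L_V[OF g] L_off[OF f] L_off[OF g] in \<open>auto simp: op_apply\<close>)
next
  assume f: "f \<in> hcarrier L"
  show "hscale L c f \<in> hcarrier L"
    by (rule L_memI[where g="\<lambda>s. (cmod c)\<^sup>2 * (nrm (f s))\<^sup>2"])
      (use L_summable[OF f] L_V[OF f] L_off[OF f] in \<open>auto simp: L_sc nrm_sc power_mult_distrib intro!: summable_on_cmult_right\<close>)
next
  show "0 \<in> hcarrier L" by (simp add: L_mem)
qed

text \<open>
  A Cauchy sequence converges in each coordinate, and the bounds on finite partial sums pass to the limit.
\<close>

theorem hilbert_space_ell2: "hilbert_space L"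
proof -
  have vs: "vector_space (hscale L)"
    by unfold_locales (auto simp: L_sc fun_eq_iff op_apply vs.scale_right_distrib vs.scale_left_distrib)
  interpret Lv: vector_space "hscale L" by (rule vs)
  have sub: "Lv.subspace (hcarrier L)"
    by (auto simp: Lv.subspace_def L_subspace)
  have diff: "f - g \<in> hcarrier L" if "f \<in> hcarrier L" "g \<in> hcarrier L" for f g
    using sub that by (rule Lv.subspace_diff)
  have compl: "\<exists>g\<in>hcarrier L. (\<lambda>n. hnorm L (F n - g)) \<longlonglongrightarrow> 0"
    if F: "\<And>n::nat. F n \<in> hcarrier L"
      and cauchy: "\<And>e. e > 0 \<Longrightarrow> \<exists>N. \<forall>m\<ge>N. \<forall>n\<ge>N. hnorm L (F m - F n) < e" for F
  proof -
    have FV: "F n s \<in> V" for n s using L_V[OF F] .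
    have "\<exists>x\<in>V. (\<lambda>n. nrm (F n s - x)) \<longlonglongrightarrow> 0" for s
    proof -
      have cs: "\<exists>N. \<forall>m\<ge>N. \<forall>n\<ge>N. nrm (F m s - F n s) < e" if e: "e > 0" for e
      proof -
        obtain N where N: "\<forall>m\<ge>N. \<forall>n\<ge>N. hnorm L (F m - F n) < e" using cauchy[OF e] by blast
        have "nrm (F m s - F n s) < e" if "m \<ge> N" "n \<ge> N" for m n
          using N[rule_format, OF that] L_nrm_ge[OF diff[OF F[of m] F[of n]], of s] by (simp add: op_apply)
        then show ?thesis by blast
      qed
      show ?thesis
        by (rule complete[of "\<lambda>n. F n s"]) (use FV cs in blast)+
    qed
    then obtain g0 where g0: "\<And>s. g0 s \<in> V" "\<And>s. (\<lambda>n. nrm (F n s - g0 s)) \<longlonglongrightarrow> 0" by metis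
    define g where "g = (\<lambda>s. if s \<in> X then g0 s else 0)"
    have goff: "g s = 0" if "s \<notin> X" for s using that by (simp add: g_def)
    have gV: "g s \<in> V" for s using g0 by (simp add: g_def)
    have glim: "(\<lambda>n. nrm (F n s - g s)) \<longlonglongrightarrow> 0" if "s \<in> X" for s using g0 that by (simp add: g_def)
    \<comment> \<open>Finite partial sums of the squared distance pass to the limit in the second index.\<close>
    have fin: "(\<Sum>s\<in>A. (nrm (F n s - g s))\<^sup>2) \<le> e\<^sup>2"
      if "finite A" "A \<subseteq> X" and N: "\<forall>m\<ge>N. \<forall>n\<ge>N. hnorm L (F m - F n) < e" and "n \<ge> N" for A n N e
    proof -
      have "(\<lambda>m. (\<Sum>s\<in>A. (nrm (F n s - F m s) + nrm (F m s - g s))\<^sup>2) - 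
              (\<Sum>s\<in>A. (nrm (F n s - F m s))\<^sup>2)) \<longlonglongrightarrow> 0"
      proof -
        have "(\<lambda>m. \<Sum>s\<in>A. 2 * (nrm (F n s - F m s) * nrm (F m s - g s)) + (nrm (F m s - g s))\<^sup>2) \<longlonglongrightarrow> (\<Sum>s\<in>A. 2 * 0 + 0\<^sup>2)"
        proof (intro tendsto_sum tendsto_add tendsto_mult[OF tendsto_const] tendsto_power)
          fix s assume s: "s \<in> A"
          show l: "(\<lambda>m. nrm (F m s - g s)) \<longlonglongrightarrow> 0" using s that glim by auto
          show "(\<lambda>m. nrm (F n s - F m s) * nrm (F m s - g s)) \<longlonglongrightarrow> 0"
          proof (rule Lim_null_comparison)
            show "\<forall>\<^sub>F m in sequentially. norm (nrm (F n s - F m s) * nrm (F m s - g s)) \<le> e * nrm (F m s - g s)"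
            proof (rule eventually_sequentiallyI[of N])
              fix m assume "m \<ge> N"
              then have "nrm (F n s - F m s) \<le> e"
                using N[rule_format, of n m] \<open>n \<ge> N\<close> L_nrm_ge[OF diff[OF F[of n] F[of m]], of s] by (simp add: op_apply)
              then show "norm (nrm (F n s - F m s) * nrm (F m s - g s)) \<le> e * nrm (F m s - g s)"
                using FV gV by (simp add: mult_right_mono)
            qed
            show "(\<lambda>m. e * nrm (F m s - g s)) \<longlonglongrightarrow> 0" using tendsto_mult[OF tendsto_const l, of e] by simp
          qed
        qed
        then show ?thesis
          by (simp add: sum_subtractf[symmetric] power2_sum algebra_simps)
      qed
      then have lim: "(\<lambda>m. e\<^sup>2 + ((\<Sum>s\<in>A. (nrm (F n s - F m s) + nrm (F m s - g s))\<^sup>2) - 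
              (\<Sum>s\<in>A. (nrm (F n s - F m s))\<^sup>2))) \<longlonglongrightarrow> e\<^sup>2 + 0"
        by (intro tendsto_add tendsto_const)
      have "(\<Sum>s\<in>A. (nrm (F n s - g s))\<^sup>2) \<le> e\<^sup>2 + 0"
      proof (rule tendsto_lowerbound[OF lim])
        show "\<forall>\<^sub>F m in sequentially. (\<Sum>s\<in>A. (nrm (F n s - g s))\<^sup>2)
           \<le> e\<^sup>2 + ((\<Sum>s\<in>A. (nrm (F n s - F m s) + nrm (F m s - g s))\<^sup>2) - (\<Sum>s\<in>A. (nrm (F n s - F m s))\<^sup>2))"
        proof (rule eventually_sequentiallyI[of N])
          fix m assume m: "m \<ge> N"
          have d: "F n - F m \<in> hcarrier L" by (rule diff[OF F F])
          have "(\<Sum>s\<in>A. (nrm (F n s - F m s))\<^sup>2) \<le> (hnorm L (F n - F m))\<^sup>2"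
            using finite_sum_le_infsum[OF L_summable[OF d] that(1,2)] by (simp add: L_nrm_sq[OF d] op_apply)
          also have "\<dots> \<le> e\<^sup>2"
          proof (rule power_mono)
            show "hnorm L (F n - F m) \<le> e" using N m \<open>n \<ge> N\<close> by (simp add: less_imp_le)
            show "0 \<le> hnorm L (F n - F m)" by (simp add: hnorm_def[of L] L_self[OF d] infsum_nonneg)
          qed
          finally have 1: "(\<Sum>s\<in>A. (nrm (F n s - F m s))\<^sup>2) \<le> e\<^sup>2" .
          have "(\<Sum>s\<in>A. (nrm (F n s - g s))\<^sup>2) \<le> (\<Sum>s\<in>A. (nrm (F n s - F m s) + nrm (F m s - g s))\<^sup>2)"
            using nrm_triangle3 FV gV by (intro sum_mono power_mono) auto
          then show "(\<Sum>s\<in>A. (nrm (F n s - g s))\<^sup>2)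
           \<le> e\<^sup>2 + ((\<Sum>s\<in>A. (nrm (F n s - F m s) + nrm (F m s - g s))\<^sup>2) - (\<Sum>s\<in>A. (nrm (F n s - F m s))\<^sup>2))"
            using 1 by linarith
        qed
      qed simp
      then show ?thesis by simp
    qed
    have small: "F n - g \<in> hcarrier L \<and> hnorm L (F n - g) \<le> e"
      if "e > 0" and N: "\<forall>m\<ge>N. \<forall>n\<ge>N. hnorm L (F m - F n) < e" and "n \<ge> N" for n N e
    proof -
      have "(\<lambda>s. (nrm (F n s - g s))\<^sup>2) summable_on X"
        using fin[OF _ _ N \<open>n \<ge> N\<close>] by (intro nonneg_bdd_above_summable_on bdd_aboveI2[of _ _ "e\<^sup>2"]) auto
      then have mem: "F n - g \<in> hcarrier L"
        using V_diff[OF FV gV] L_off[OF F] goff unfolding L_mem op_apply by simp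
      have "(hnorm L (F n - g))\<^sup>2 \<le> e\<^sup>2"
        using fin[OF _ _ N \<open>n \<ge> N\<close>] L_summable[OF mem]
        by (simp add: L_nrm_sq[OF mem] op_apply infsum_le_finite_sums)
      then show ?thesis using mem \<open>e > 0\<close> by (auto intro: power2_le_imp_le)
    qed
    obtain N1 where "\<forall>m\<ge>N1. \<forall>n\<ge>N1. hnorm L (F m - F n) < 1" using cauchy[of 1] by auto
    then have "F N1 - g \<in> hcarrier L" using small[of 1 N1 N1] by simp
    then have "F N1 - (F N1 - g) \<in> hcarrier L" by (rule diff[OF F])
    then have g: "g \<in> hcarrier L" by simp
    have "(\<lambda>n. hnorm L (F n - g)) \<longlonglongrightarrow> 0"
    proof (rule LIMSEQ_I)
      fix r :: real assume r: "r > 0"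
      obtain N where N: "\<forall>m\<ge>N. \<forall>n\<ge>N. hnorm L (F m - F n) < r/2" using cauchy[of "r/2"] r by auto
      have "norm (hnorm L (F n - g) - 0) < r" if "n \<ge> N" for n
        using small[OF _ N that] r L_self[OF diff[OF F g], of n]
        by (auto simp: hnorm_def[of L] infsum_nonneg abs_of_nonneg)
      then show "\<exists>no. \<forall>n\<ge>no. norm (hnorm L (F n - g) - 0) < r" by blast
    qed
    then show ?thesis using g by blast
  qed
  show ?thesis unfolding hilbert_space_def
  proof (intro conjI ballI allI impI)
    show "vector_space (hscale L)" by (rule vs)
    show "Lv.subspace (hcarrier L)" by (rule sub)
    show "hinner L (x + y) z = hinner L x z + hinner L y z"
      if "x \<in> hcarrier L" "y \<in> hcarrier L" "z \<in> hcarrier L" for x y z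
      using that by (simp add: L_ip op_apply ip_add_left L_V infsum_add L_ip_summable)
    show "hinner L (hscale L c x) y = c * hinner L x y" if "x \<in> hcarrier L" "y \<in> hcarrier L" for c x y
      using that by (simp add: L_ip L_sc ip_sc_left L_V infsum_cmult_right L_ip_summable)
    show "hinner L y x = cnj (hinner L x y)" if "x \<in> hcarrier L" "y \<in> hcarrier L" for x y
      using that ip_commute[OF L_V L_V, of x y] by (simp add: L_ip flip: infsum_cnj)
    show "Im (hinner L x x) = 0" "Re (hinner L x x) \<ge> 0" if "x \<in> hcarrier L" for x
      using that by (simp_all add: L_self infsum_nonneg)
    show "x = 0" if x: "x \<in> hcarrier L" "hinner L x x = 0" for x
    proof
      fix s
      have "nrm (x s) \<le> 0" using L_nrm_ge[OF x(1), of s] x(2) by (simp add: hnorm_def[of L])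
      then show "x s = 0 s" using nrm_ge0[OF L_V[OF x(1)]] nrm_eq_0[OF L_V[OF x(1)]] by (simp add: order_antisym_conv)
    qed
    show "\<exists>x\<in>hcarrier L. (\<lambda>n. hnorm L (Xa n - x)) \<longlonglongrightarrow> 0"
      if "(\<forall>n. Xa n \<in> hcarrier L) \<and> (\<forall>e>0. \<exists>N. \<forall>m\<ge>N. \<forall>n\<ge>N. hnorm L (Xa m - Xa n) < e)" for Xa :: "nat \<Rightarrow> 'i \<Rightarrow> 'v"
      using compl[of Xa] that by blast
  qed
qed

sublocale L: hilbert L
  by unfold_locales (rule hilbert_space_ell2)

lemma pointwise_bound:
  assumes f: "f \<in> hcarrier L" and g: "\<And>s. s \<in> X \<Longrightarrow> g s \<in> V" "\<And>s. s \<notin> X \<Longrightarrow> g s = 0"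
    and c: "c \<ge> 0" "\<And>s. s \<in> X \<Longrightarrow> nrm (g s) \<le> c * nrm (f s)"
  shows "g \<in> hcarrier L" "hnorm L g \<le> c * hnorm L f"
proof -
  have le: "(nrm (g s))\<^sup>2 \<le> c\<^sup>2 * (nrm (f s))\<^sup>2" if "s \<in> X" for s
    using power_mono[OF c(2)[OF that] nrm_ge0[OF g(1)[OF that]], of 2] by (simp add: power_mult_distrib)
  have sm: "(\<lambda>s. c\<^sup>2 * (nrm (f s))\<^sup>2) summable_on X"
    using L_summable[OF f] by (rule summable_on_cmult_right)
  show gL: "g \<in> hcarrier L" by (rule L_memI[OF g sm le])
  have "(hnorm L g)\<^sup>2 \<le> (\<Sum>\<^sub>\<infinity>s\<in>X. c\<^sup>2 * (nrm (f s))\<^sup>2)"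
    unfolding L_nrm_sq[OF gL] using L_summable[OF gL] sm le by (rule infsum_mono)
  also have "\<dots> = (c * hnorm L f)\<^sup>2"
    by (subst infsum_cmult_right) (auto simp: L_summable f power_mult_distrib L_nrm_sq)
  finally show "hnorm L g \<le> c * hnorm L f"
    by (rule power2_le_imp_le) (use c f in auto)
qed

lemma basis_vec_L [simp]: "s \<in> X \<Longrightarrow> \<xi> \<in> V \<Longrightarrow> basis_vec s \<xi> \<in> hcarrier L"
proof -
  assume s: "s \<in> X" "\<xi> \<in> V"
  have "(\<lambda>r. (nrm (basis_vec s \<xi> r))\<^sup>2) summable_on {s}" by simp
  then have "(\<lambda>r. (nrm (basis_vec s \<xi> r))\<^sup>2) summable_on X"
    by (rule summable_on_cong_neutral[THEN iffD1, rotated -1])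
      (use s in \<open>auto simp: basis_vec_def\<close>)
  then show ?thesis using s by (auto simp: L_mem basis_vec_def)
qed

lemma ip_basis_vec_right: "s \<in> X \<Longrightarrow> \<xi> \<in> V \<Longrightarrow> f \<in> hcarrier L \<Longrightarrow> hinner L f (basis_vec s \<xi>) = ip (f s) \<xi>"
proof -
  assume s: "s \<in> X" "\<xi> \<in> V" and f: "f \<in> hcarrier L"
  have "hinner L f (basis_vec s \<xi>) = (\<Sum>\<^sub>\<infinity>r\<in>{s}. ip (f r) (basis_vec s \<xi> r))"
    unfolding L_ip by (rule infsum_cong_neutral) (use s L_V[OF f] in \<open>auto simp: basis_vec_def\<close>)
  then show ?thesis by (simp add: basis_vec_def)
qed

lemma ip_basis_vec_left: "s \<in> X \<Longrightarrow> \<xi> \<in> V \<Longrightarrow> f \<in> hcarrier L \<Longrightarrow> hinner L (basis_vec s \<xi>) f = ip \<xi> (f s)"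
  using ip_basis_vec_right[of s \<xi> f] L.ip_commute[of f "basis_vec s \<xi>"] ip_commute[OF L_V, of f \<xi> s] by simp

lemma nrm_basis_vec [simp]: "s \<in> X \<Longrightarrow> \<xi> \<in> V \<Longrightarrow> hnorm L (basis_vec s \<xi>) = nrm \<xi>"
  by (simp add: hnorm_def ip_basis_vec_right) (simp add: basis_vec_def)

lemma basis_vec_off: "s \<in> X \<Longrightarrow> \<xi> \<notin> V \<Longrightarrow> basis_vec s \<xi> \<notin> hcarrier L"
  using L_V[of "basis_vec s \<xi>" s] by (auto simp: basis_vec_def)

lemma L_eq_if_basis:
  assumes "f \<in> hcarrier L" "g \<in> hcarrier L" "\<And>s. s \<in> X \<Longrightarrow> f s = g s"
  shows "f = g"
  using assms L_off by (metis ext)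

lemma basis_vec_add: "basis_vec s (x + y) = basis_vec s x + (basis_vec s y :: 'i \<Rightarrow> 'v)"
  by (auto simp: basis_vec_def fun_eq_iff op_apply)
lemma basis_vec_sc: "basis_vec s (sc c x) = hscale L c (basis_vec s x)"
  by (auto simp: basis_vec_def fun_eq_iff L_sc)

text \<open>
  A bounded operator is determined by its values on the vectors \<open>\<delta>\<^sub>s \<otimes> \<xi>\<close>: the adjoint of the
  difference is orthogonal to all of them.
\<close>

lemma bd_eq_if_basis:
  assumes S: "S \<in> bounded_ops L" and T: "T \<in> bounded_ops L"
    and eq: "\<And>s \<xi>. s \<in> X \<Longrightarrow> \<xi> \<in> V \<Longrightarrow> S (basis_vec s \<xi>) = T (basis_vec s \<xi>)"
  shows "S = T"
proof -
  have "adjoint_op L S = adjoint_op L T"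
  proof (rule L.bd_eqI)
    fix g assume g: "g \<in> hcarrier L"
    have gS: "adjoint_op L S g \<in> hcarrier L" "adjoint_op L T g \<in> hcarrier L" using S T by simp_all
    show "adjoint_op L S g = adjoint_op L T g"
    proof (rule L_eq_if_basis[OF gS])
      fix s assume s: "s \<in> X"
      show "adjoint_op L S g s = adjoint_op L T g s"
      proof (rule eq_if_ip_eq')
        fix \<xi> assume \<xi>: "\<xi> \<in> V"
        show "ip \<xi> (adjoint_op L S g s) = ip \<xi> (adjoint_op L T g s)"
          using ip_basis_vec_left[OF s \<xi>] gS L.adj_ip[OF S, of "basis_vec s \<xi>" g] L.adj_ip[OF T, of "basis_vec s \<xi>" g]
            eq[OF s \<xi>] s \<xi> g by simp
      qed (use gS L_V in auto)
    qed
  qed (use S T in auto)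
  then show ?thesis using S T by (metis L.adj_adj)
qed

subsection \<open>Matrix entries, amplifications and matrix units\<close>

definition entry :: "(('i \<Rightarrow> 'v) \<Rightarrow> 'i \<Rightarrow> 'v) \<Rightarrow> 'i \<Rightarrow> 'i \<Rightarrow> 'v \<Rightarrow> 'v" where
  "entry T s r = (\<lambda>\<xi>. T (basis_vec r \<xi>) s)"

definition amp :: "('v \<Rightarrow> 'v) \<Rightarrow> ('i \<Rightarrow> 'v) \<Rightarrow> 'i \<Rightarrow> 'v" where
  "amp T = (\<lambda>f. if f \<in> hcarrier L then (\<lambda>s. T (f s)) else 0)"

definition unit_tensor :: "'i \<Rightarrow> 'i \<Rightarrow> ('v \<Rightarrow> 'v) \<Rightarrow> ('i \<Rightarrow> 'v) \<Rightarrow> 'i \<Rightarrow> 'v" where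
  "unit_tensor s r T = (\<lambda>f. if f \<in> hcarrier L then basis_vec s (T (f r)) else 0)"

lemma entry_bd [simp]:
  assumes T: "T \<in> bounded_ops L" and s: "s \<in> X" "r \<in> X" shows "entry T s r \<in> Bd"
proof -
  obtain c where c: "c > 0" "\<And>x. x \<in> hcarrier L \<Longrightarrow> hnorm L (T x) \<le> c * hnorm L x" using L.bd_bound[OF T] by blast
  show ?thesis
  proof (rule bdI[where c=c])
    show "entry T s r \<xi> \<in> V" for \<xi> using T L_V by (simp add: entry_def)
    show "entry T s r \<xi> = 0" if "\<xi> \<notin> V" for \<xi>
      using L.bd_off[OF T basis_vec_off] that s by (simp add: entry_def)
    show "entry T s r (x + y) = entry T s r x + entry T s r y" if "x \<in> V" "y \<in> V" for x y
      using L.bd_add[OF T, of "basis_vec r x" "basis_vec r y"] that s by (simp add: entry_def basis_vec_add op_apply)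
    show "entry T s r (sc a x) = sc a (entry T s r x)" if "x \<in> V" for a x
      using L.bd_sc[OF T, of "basis_vec r x" a] that s by (simp add: entry_def basis_vec_sc L_sc)
    show "nrm (entry T s r x) \<le> c * nrm x" if "x \<in> V" for x
      using L_nrm_ge[of "T (basis_vec r x)" s] c(2)[of "basis_vec r x"] that s T by (simp add: entry_def)
  qed
qed

lemma eq_if_entries:
  assumes S: "S \<in> bounded_ops L" and T: "T \<in> bounded_ops L"
    and eq: "\<And>s r. s \<in> X \<Longrightarrow> r \<in> X \<Longrightarrow> entry S s r = entry T s r"
  shows "S = T"
proof (rule bd_eq_if_basis[OF S T])
  fix r \<xi> assume r: "r \<in> X"
  show "S (basis_vec r \<xi>) = T (basis_vec r \<xi>)"
    by (rule L_eq_if_basis) (use S T eq[OF _ r] in \<open>auto simp: entry_def dest: fun_cong\<close>)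
qed

lemma amp_bd [simp]: assumes T: "T \<in> Bd" shows "amp T \<in> bounded_ops L"
proof -
  obtain c where c: "c > 0" "\<And>x. x \<in> V \<Longrightarrow> nrm (T x) \<le> c * nrm x" using bd_bound[OF T] by blast
  have b: "(\<lambda>s. T (f s)) \<in> hcarrier L \<and> hnorm L (\<lambda>s. T (f s)) \<le> c * hnorm L f" if f: "f \<in> hcarrier L" for f
    using pointwise_bound[OF f, of "\<lambda>s. T (f s)" c] c L_V[OF f] L_off[OF f] T by (simp add: bd_0)
  show ?thesis
    by (rule L.bdI[where c=c]) (use b L_V T in \<open>auto simp: amp_def op_apply fun_eq_iff bd_add bd_sc L_sc L_subspace[unfolded L_sc]\<close>)
qed

lemma amp_apply: "f \<in> hcarrier L \<Longrightarrow> amp T f s = T (f s)"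
  by (simp add: amp_def)

lemma unit_tensor_bd [simp]:
  assumes T: "T \<in> Bd" and s: "s \<in> X" "r \<in> X" shows "unit_tensor s r T \<in> bounded_ops L"
proof -
  obtain c where c: "c > 0" "\<And>x. x \<in> V \<Longrightarrow> nrm (T x) \<le> c * nrm x" using bd_bound[OF T] by blast
  show ?thesis
  proof (rule L.bdI[where c=c])
    fix f assume f: "f \<in> hcarrier L"
    have "nrm (T (f r)) \<le> c * nrm (f r)" using c(2) L_V[OF f] by simp
    also have "\<dots> \<le> c * hnorm L f" using c(1) L_nrm_ge[OF f] by simp
    finally show "hnorm L (unit_tensor s r T f) \<le> c * hnorm L f" using f s T L_V[OF f] by (simp add: unit_tensor_def)
  qed (use T s L_V in \<open>auto simp: unit_tensor_def op_apply bd_add bd_sc basis_vec_add basis_vec_sc L_sc L_subspace[unfolded L_sc]\<close>)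
qed

lemma unit_tensor_apply: "f \<in> hcarrier L \<Longrightarrow> unit_tensor s r T f = basis_vec s (T (f r))"
  by (simp add: unit_tensor_def)

lemma basis_vec_same [simp]: "basis_vec s \<xi> s = \<xi>"
  by (simp add: basis_vec_def)

lemma entry_app: "entry T s r \<xi> = T (basis_vec r \<xi>) s"
  by (simp add: entry_def)

lemma basis_vec_app: "basis_vec r \<xi> s = (if s = r then \<xi> else 0)"
  by (simp add: basis_vec_def)

lemma basis_vec_0 [simp]: "basis_vec r 0 = (0 :: 'i \<Rightarrow> 'v)"
  by (auto simp: basis_vec_def)

lemma amp_basis_vec:
  "A \<in> Bd \<Longrightarrow> r \<in> X \<Longrightarrow> \<xi> \<in> V \<Longrightarrow> amp A (basis_vec r \<xi>) = basis_vec r (A \<xi>)"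
  by (auto simp: fun_eq_iff amp_apply basis_vec_app bd_0)

lemma entry_amp:
  assumes "T \<in> Bd" "s \<in> X" "r \<in> X"
  shows "entry (amp T) s r = (if s = r then T else (\<lambda>x. 0))"
proof (rule bd_eqI)
  show "entry (amp T) s r \<in> Bd" "(if s = r then T else (\<lambda>x. 0)) \<in> Bd" using assms by simp_all
qed (use assms in \<open>simp add: entry_app amp_basis_vec basis_vec_app\<close>)

lemma entry_unit_tensor:
  assumes "T \<in> Bd" "s \<in> X" "r \<in> X" "p \<in> X" "q \<in> X"
  shows "entry (unit_tensor p q T) s r = (if s = p \<and> r = q then T else (\<lambda>x. 0))"
proof (rule bd_eqI)
  show "entry (unit_tensor p q T) s r \<in> Bd" "(if s = p \<and> r = q then T else (\<lambda>x. 0)) \<in> Bd" using assms by simp_all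
qed (use assms in \<open>simp add: entry_app unit_tensor_apply basis_vec_app bd_0\<close>)

lemma entry_comp_amp:
  assumes "T \<in> bounded_ops L" "A \<in> Bd" "s \<in> X" "r \<in> X"
  shows "entry (T \<circ> amp A) s r = entry T s r \<circ> A" "entry (amp A \<circ> T) s r = A \<circ> entry T s r"
proof -
  have 1: "entry (T \<circ> amp A) s r \<in> Bd" "entry T s r \<circ> A \<in> Bd"
    and 2: "entry (amp A \<circ> T) s r \<in> Bd" "A \<circ> entry T s r \<in> Bd" using assms by auto
  show "entry (T \<circ> amp A) s r = entry T s r \<circ> A"
    by (rule bd_eqI[OF 1]) (use assms in \<open>simp add: entry_app amp_basis_vec\<close>)
  show "entry (amp A \<circ> T) s r = A \<circ> entry T s r"
    by (rule bd_eqI[OF 2]) (use assms in \<open>simp add: entry_app amp_apply\<close>)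
qed

lemma entry_comp_unit_tensor:
  assumes "T \<in> bounded_ops L" "A \<in> Bd" "s \<in> X" "r \<in> X" "p \<in> X" "q \<in> X"
  shows "entry (T \<circ> unit_tensor p q A) s r = (if r = q then entry T s p \<circ> A else (\<lambda>x. 0))"
    "entry (unit_tensor p q A \<circ> T) s r = (if s = p then A \<circ> entry T q r else (\<lambda>x. 0))"
proof -
  have 1: "entry (T \<circ> unit_tensor p q A) s r \<in> Bd" "(if r = q then entry T s p \<circ> A else (\<lambda>x. 0)) \<in> Bd"
    and 2: "entry (unit_tensor p q A \<circ> T) s r \<in> Bd" "(if s = p then A \<circ> entry T q r else (\<lambda>x. 0)) \<in> Bd"
    using assms by auto
  show "entry (T \<circ> unit_tensor p q A) s r = (if r = q then entry T s p \<circ> A else (\<lambda>x. 0))"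
    by (rule bd_eqI[OF 1]) (use assms in \<open>auto simp add: entry_app unit_tensor_apply basis_vec_app bd_0 L.bd_0\<close>)
  show "entry (unit_tensor p q A \<circ> T) s r = (if s = p then A \<circ> entry T q r else (\<lambda>x. 0))"
    by (rule bd_eqI[OF 2]) (use assms in \<open>auto simp add: entry_app unit_tensor_apply basis_vec_app\<close>)
qed

lemma unit_tensor_compress:
  assumes "T \<in> bounded_ops L" "A \<in> Bd" "B \<in> Bd" "s \<in> X" "r \<in> X" "p \<in> X" "q \<in> X"
  shows "unit_tensor s p A \<circ> T \<circ> unit_tensor r q B = unit_tensor s q (A \<circ> entry T p r \<circ> B)"
proof (rule L.bd_eqI)
  show "unit_tensor s p A \<circ> T \<circ> unit_tensor r q B \<in> bounded_ops L"
    "unit_tensor s q (A \<circ> entry T p r \<circ> B) \<in> bounded_ops L" using assms by simp_all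
qed (use assms L_V in \<open>simp add: unit_tensor_apply entry_app\<close>)

lemma unit_tensor_comp:
  assumes "A \<in> Bd" "B \<in> Bd" "s \<in> X" "r \<in> X" "q \<in> X"
  shows "unit_tensor s r A \<circ> unit_tensor r q B = unit_tensor s q (A \<circ> B)"
proof (rule L.bd_eqI)
  show "unit_tensor s r A \<circ> unit_tensor r q B \<in> bounded_ops L"
    "unit_tensor s q (A \<circ> B) \<in> bounded_ops L" using assms by simp_all
qed (use assms L_V in \<open>simp add: unit_tensor_apply\<close>)

lemma entry_adj:
  assumes T: "T \<in> bounded_ops L" and s: "s \<in> X" "r \<in> X"
  shows "entry (adjoint_op L T) s r = adj (entry T r s)"
proof (rule adj_eqI[symmetric])
  fix x y assume x: "x \<in> V" and y: "y \<in> V"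
  have "ip (entry T r s x) y = hinner L (T (basis_vec s x)) (basis_vec r y)"
    using x y s T by (simp add: ip_basis_vec_right entry_def)
  also have "\<dots> = hinner L (basis_vec s x) (adjoint_op L T (basis_vec r y))"
    using x y s T by (simp add: L.adj_ip)
  also have "\<dots> = ip x (entry (adjoint_op L T) s r y)"
    using x y s T by (simp add: ip_basis_vec_left entry_def)
  finally show "ip (entry T r s x) y = ip x (entry (adjoint_op L T) s r y)" .
qed (use assms in auto)

lemma adj_unit_tensor:
  assumes "A \<in> Bd" "s \<in> X" "r \<in> X"
  shows "adjoint_op L (unit_tensor s r A) = unit_tensor r s (adj A)"
  by (rule eq_if_entries) (use assms in \<open>auto simp: entry_adj entry_unit_tensor\<close>)

lemma adj_amp:
  assumes "A \<in> Bd" shows "adjoint_op L (amp A) = amp (adj A)"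
  by (rule eq_if_entries) (use assms in \<open>auto simp: entry_adj entry_amp\<close>)

lemma amp_comp: "A \<in> Bd \<Longrightarrow> B \<in> Bd \<Longrightarrow> amp A \<circ> amp B = amp (A \<circ> B)"
  by (rule L.bd_eqI) (auto simp: amp_apply fun_eq_iff L_V)

lemma amp_id: "amp (id_op H) = id_op L"
  by (rule L.bd_eqI) (auto simp: amp_apply fun_eq_iff L_V)

lemma amp_scale: "A \<in> Bd \<Longrightarrow> amp (scale_op H c A) = scale_op L c (amp A)"
  by (rule L.bd_eqI) (auto simp: amp_apply fun_eq_iff L_V op_apply L_sc)

lemma amp_inj: "A \<in> Bd \<Longrightarrow> B \<in> Bd \<Longrightarrow> X \<noteq> {} \<Longrightarrow> amp A = amp B \<Longrightarrow> A = B"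
  using entry_amp by (metis ex_in_conv)

text \<open>
  An operator commutes with \<open>1 \<otimes> A\<close> if and only if its matrix entries commute with \<open>A\<close>.
\<close>

lemma commutant_amp:
  assumes A: "A \<subseteq> Bd"
  shows "T \<in> commutant L (amp ` A) \<longleftrightarrow>
    T \<in> bounded_ops L \<and> (\<forall>s\<in>X. \<forall>r\<in>X. entry T s r \<in> commutant H A)"
proof (cases "T \<in> bounded_ops L")
  case T: True
  have "T \<circ> amp a = amp a \<circ> T \<longleftrightarrow> (\<forall>s\<in>X. \<forall>r\<in>X. entry T s r \<circ> a = a \<circ> entry T s r)" if "a \<in> A" for a
  proof
    have aB: "a \<in> Bd" using that A by auto
    show "\<forall>s\<in>X. \<forall>r\<in>X. entry T s r \<circ> a = a \<circ> entry T s r" if "T \<circ> amp a = amp a \<circ> T"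
      using that entry_comp_amp[OF T aB] by metis
    show "T \<circ> amp a = amp a \<circ> T" if "\<forall>s\<in>X. \<forall>r\<in>X. entry T s r \<circ> a = a \<circ> entry T s r"
      using that T aB by (intro eq_if_entries) (auto simp: entry_comp_amp)
  qed
  then show ?thesis using T by (auto simp: commutant_def)
qed (auto simp: commutant_def)

text \<open>Commuting with all matrix units \<open>E\<^bsub>sr\<^esub> \<otimes> 1\<close> means to be an amplification.\<close>

lemma amp_if_commutes_unit_tensors:
  assumes T: "T \<in> bounded_ops L" and p: "p \<in> X"
    and comm: "\<And>s r. s \<in> X \<Longrightarrow> r \<in> X \<Longrightarrow> T \<circ> unit_tensor s r (id_op H) = unit_tensor s r (id_op H) \<circ> T"
  shows "T = amp (entry T p p)"
proof (rule eq_if_entries[OF T])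
  show "amp (entry T p p) \<in> bounded_ops L" using T p by simp
  fix s r assume s: "s \<in> X" and r: "r \<in> X"
  have "entry T s r = entry (T \<circ> unit_tensor r p (id_op H)) s p"
    using T s r p by (simp add: entry_comp_unit_tensor)
  also have "\<dots> = (if s = r then entry T p p else (\<lambda>x. 0))"
    using T s r p by (simp add: comm entry_comp_unit_tensor)
  finally show "entry T s r = entry (amp (entry T p p)) s r"
    using T s r p by (simp add: entry_amp)
qed

end

lemma hilbert_space_complex: "hilbert_space complex_hilbert"
proof -
  have n: "hnorm complex_hilbert = cmod"
    by (auto simp: hnorm_def complex_hilbert_def cmod_def power2_eq_square)
  have vs: "vector_space ((*) :: complex \<Rightarrow> complex \<Rightarrow> complex)"
    by unfold_locales (auto simp: algebra_simps)
  interpret vector_space "(*) :: complex \<Rightarrow> complex \<Rightarrow> complex" by (rule vs)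
  have "\<exists>x. (\<lambda>n. cmod (Y n - x)) \<longlonglongrightarrow> 0"
    if "\<forall>e>0. \<exists>N. \<forall>m\<ge>N. \<forall>n\<ge>N. cmod (Y m - Y n) < e" for Y :: "nat \<Rightarrow> complex"
  proof -
    have "Cauchy Y" using that by (simp add: Cauchy_def dist_norm)
    then obtain x where "Y \<longlonglongrightarrow> x" using Cauchy_convergent convergent_def by blast
    then show ?thesis using tendsto_norm_zero LIM_zero by blast
  qed
  then show ?thesis
    unfolding hilbert_space_def n
    by (auto simp: complex_hilbert_def vs algebra_simps complex_eq_iff intro!: subspace_UNIV)
qed

context square_summable
begin

interpretation C: square_summable complex_hilbert X
  by unfold_locales (rule hilbert_space_complex)

lemma elem_tensor_L:
  assumes f: "f \<in> hcarrier (ell2 X complex_hilbert)" and \<xi>: "\<xi> \<in> V"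
  shows "elem_tensor H f \<xi> \<in> hcarrier L"
proof (rule L_memI)
  show "(\<lambda>s. (nrm \<xi>)\<^sup>2 * (hnorm complex_hilbert (f s))\<^sup>2) summable_on X"
    using C.L_summable[OF f] by (rule summable_on_cmult_right)
  have "hnorm complex_hilbert z = cmod z" for z
    by (auto simp: hnorm_def complex_hilbert_def cmod_def power2_eq_square)
  then show "(nrm (elem_tensor H f \<xi> s))\<^sup>2 \<le> (nrm \<xi>)\<^sup>2 * (hnorm complex_hilbert (f s))\<^sup>2" for s
    using \<xi> by (simp add: elem_tensor_def nrm_sc power_mult_distrib)
qed (use \<xi> C.L_off[OF f] in \<open>auto simp: elem_tensor_def\<close>)

text \<open>
  The commutant of \<open>B(\<ell>\<^sup>2 X) \<otimes> N\<close>: matrix units force an operator to be an amplification, and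
  the operators \<open>1 \<otimes> b\<close> force the amplified operator into the commutant of \<open>N\<close>.
\<close>

lemma commutant_elementary:
  assumes N: "N \<subseteq> Bd" "id_op H \<in> N" and X: "X \<noteq> {}"
  shows "commutant L {T \<in> bounded_ops L. \<exists>a\<in>bounded_ops (ell2 X complex_hilbert). \<exists>b\<in>N.
        \<forall>f\<in>hcarrier (ell2 X complex_hilbert). \<forall>\<xi>\<in>V. T (elem_tensor H f \<xi>) = elem_tensor H (a f) (b \<xi>)}
      = amp ` commutant H N" (is "commutant L ?E = _")
proof
  have idC: "id_op complex_hilbert \<in> bounded_ops complex_hilbert" by simp
  have unit: "unit_tensor s r (id_op H) \<in> ?E" if "s \<in> X" "r \<in> X" for s r
  proof -
    have "unit_tensor s r (id_op H) (elem_tensor H f \<xi>) = elem_tensor H (C.unit_tensor s r (id_op complex_hilbert) f) (id_op H \<xi>)"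
      if f: "f \<in> hcarrier (ell2 X complex_hilbert)" and \<xi>: "\<xi> \<in> V" for f \<xi>
      using elem_tensor_L[OF f \<xi>] f \<xi>
      by (simp add: unit_tensor_apply C.unit_tensor_apply)
         (auto simp: elem_tensor_def basis_vec_def fun_eq_iff id_op_def complex_hilbert_def)
    moreover have "C.unit_tensor s r (id_op complex_hilbert) \<in> bounded_ops (ell2 X complex_hilbert)"
      using that by simp
    ultimately show ?thesis using that N(2)
      by (intro CollectI conjI bexI[of _ "C.unit_tensor s r (id_op complex_hilbert)"] bexI[of _ "id_op H"]) simp_all
  qed
  have ampE: "amp b \<in> ?E" if "b \<in> N" for b
  proof -
    have "amp b (elem_tensor H f \<xi>) = elem_tensor H (id_op (ell2 X complex_hilbert) f) (b \<xi>)"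
      if f: "f \<in> hcarrier (ell2 X complex_hilbert)" and \<xi>: "\<xi> \<in> V" for f \<xi>
      using elem_tensor_L[OF f \<xi>] f \<xi> \<open>b \<in> N\<close> N
      by (auto simp: fun_eq_iff amp_apply elem_tensor_def bd_sc subset_iff)
    then show ?thesis using that N C.L.bd_id
      by (intro CollectI conjI bexI[of _ "id_op (ell2 X complex_hilbert)"] bexI[of _ b]) auto
  qed
  show "commutant L ?E \<subseteq> amp ` commutant H N"
  proof
    fix T assume T: "T \<in> commutant L ?E"
    then have TB: "T \<in> bounded_ops L" by (simp add: commutant_def)
    obtain p where p: "p \<in> X" using X by auto
    have Teq: "T = amp (entry T p p)"
      by (rule amp_if_commutes_unit_tensors[OF TB p]) (use T unit in \<open>auto simp: commutant_def\<close>)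
    have "T \<in> commutant L (amp ` N)" using T ampE by (auto simp: commutant_def)
    then have "entry T p p \<in> commutant H N" using commutant_amp[OF N(1)] p by blast
    then show "T \<in> amp ` commutant H N" using Teq by blast
  qed
  show "amp ` commutant H N \<subseteq> commutant L ?E"
  proof clarify
    fix T0 assume T0: "T0 \<in> commutant H N"
    then have T0B: "T0 \<in> Bd" by (simp add: commutant_def)
    have "amp T0 \<circ> S = S \<circ> amp T0" if SE: "S \<in> ?E" for S
    proof -
      obtain a b where S: "S \<in> bounded_ops L" and a: "a \<in> bounded_ops (ell2 X complex_hilbert)" and b: "b \<in> N"
        and Sab: "\<And>f \<xi>. f \<in> hcarrier (ell2 X complex_hilbert) \<Longrightarrow> \<xi> \<in> V \<Longrightarrow> S (elem_tensor H f \<xi>) = elem_tensor H (a f) (b \<xi>)"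
        using SE by auto
      have bB: "b \<in> Bd" and comm: "T0 \<circ> b = b \<circ> T0" using b N T0 by (auto simp: commutant_def)
      have ent: "entry S s r \<xi> = sc (a (basis_vec r 1) s) (b \<xi>)" if "r \<in> X" "\<xi> \<in> V" for s r \<xi>
      proof -
        have "basis_vec r (1::complex) \<in> hcarrier (ell2 X complex_hilbert)"
          using that C.basis_vec_L[of r 1] by (simp add: complex_hilbert_def)
        moreover have "elem_tensor H (basis_vec r 1) \<xi> = basis_vec r \<xi>"
          by (auto simp: elem_tensor_def basis_vec_def)
        ultimately show ?thesis using Sab[of "basis_vec r 1" \<xi>] that by (simp add: entry_def elem_tensor_def)
      qed
      show ?thesis
      proof (rule eq_if_entries)
        fix s r assume s: "s \<in> X" and r: "r \<in> X"
        have "T0 \<circ> entry S s r = entry S s r \<circ> T0"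
        proof (rule bd_eqI)
          fix \<xi> assume \<xi>: "\<xi> \<in> V"
          show "(T0 \<circ> entry S s r) \<xi> = (entry S s r \<circ> T0) \<xi>"
            using ent[OF r \<xi>] ent[OF r, of "T0 \<xi>"] \<xi> T0B bB fun_cong[OF comm, of \<xi>] by (simp add: bd_sc)
        qed (use S T0B s r in auto)
        then show "entry (amp T0 \<circ> S) s r = entry (S \<circ> amp T0) s r"
          using S T0B s r by (simp add: entry_comp_amp)
      qed (use S T0B in auto)
    qed
    then show "amp T0 \<in> commutant L ?E" using T0B by (auto simp: commutant_def)
  qed
qed

subsection \<open>Isometries permuting the basis up to unitaries\<close>

lemma basis_op_apply:
  assumes "f \<in> hcarrier L" "inj_on \<phi> X" "s \<in> X"
  shows "basis_op X H \<phi> W f (\<phi> s) = W s (f s)"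
proof -
  have "{s' \<in> X. \<phi> s' = \<phi> s} = {s}" using assms by (auto simp: inj_on_def)
  then show ?thesis using assms by (simp add: basis_op_def)
qed

lemma basis_op_apply_off:
  assumes "r \<notin> \<phi> ` X"
  shows "basis_op X H \<phi> W f r = 0"
proof -
  have "(\<Sum>s\<in>{s \<in> X. \<phi> s = r}. W s (f s)) = 0" using assms by (intro sum.neutral) auto
  then show ?thesis by (simp add: basis_op_def)
qed

lemma basis_op_isometry:
  assumes inj: "inj_on \<phi> X" and im: "\<phi> ` X \<subseteq> X"
    and W: "\<And>s. s \<in> X \<Longrightarrow> W s \<in> Bd"
    and iso: "\<And>s x y. s \<in> X \<Longrightarrow> x \<in> V \<Longrightarrow> y \<in> V \<Longrightarrow> ip (W s x) (W s y) = ip x y"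
  shows "basis_op X H \<phi> W \<in> bounded_ops L"
    and "\<And>f g. f \<in> hcarrier L \<Longrightarrow> g \<in> hcarrier L \<Longrightarrow>
      hinner L (basis_op X H \<phi> W f) (basis_op X H \<phi> W g) = hinner L f g"
proof -
  let ?B = "basis_op X H \<phi> W"
  have nW: "nrm (W s x) = nrm x" if "s \<in> X" "x \<in> V" for s x
    using iso[OF that(1) that(2) that(2)] by (simp add: hnorm_def)
  have mem: "?B f \<in> hcarrier L" if f: "f \<in> hcarrier L" for f
  proof -
    have "(\<lambda>s. (nrm (?B f (\<phi> s)))\<^sup>2) summable_on X"
      by (rule summable_on_cong[THEN iffD1, OF _ L_summable[OF f]])
         (simp add: basis_op_apply[OF f inj] nW L_V[OF f])
    then have "(\<lambda>r. (nrm (?B f r))\<^sup>2) summable_on \<phi> ` X"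
      using summable_on_reindex[OF inj, of "\<lambda>r. (nrm (?B f r))\<^sup>2"] by (simp add: o_def)
    then have "(\<lambda>r. (nrm (?B f r))\<^sup>2) summable_on X"
      by (rule summable_on_cong_neutral[THEN iffD1, rotated -1])
         (use im in \<open>auto simp: basis_op_apply_off\<close>)
    moreover have "?B f r \<in> V" for r
      by (cases "r \<in> \<phi> ` X") (use basis_op_apply[OF f inj, of _ W] W in \<open>auto simp: basis_op_apply_off\<close>)
    moreover have "?B f r = 0" if "r \<notin> X" for r
      using that im by (intro basis_op_apply_off) auto
    ultimately show ?thesis by (simp add: L_mem)
  qed
  show ip: "hinner L (?B f) (?B g) = hinner L f g" if f: "f \<in> hcarrier L" and g: "g \<in> hcarrier L" for f g
  proof -
    have "hinner L (?B f) (?B g) = (\<Sum>\<^sub>\<infinity>r\<in>\<phi> ` X. ip (?B f r) (?B g r))"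
      unfolding L_ip by (rule infsum_cong_neutral) (use im in \<open>auto simp: basis_op_apply_off\<close>)
    also have "\<dots> = (\<Sum>\<^sub>\<infinity>s\<in>X. ip (?B f (\<phi> s)) (?B g (\<phi> s)))"
      using infsum_reindex[OF inj, of "\<lambda>r. ip (?B f r) (?B g r)"] by (simp add: o_def)
    also have "\<dots> = hinner L f g"
      unfolding L_ip by (rule infsum_cong) (simp add: basis_op_apply[OF f inj] basis_op_apply[OF g inj] iso L_V[OF f] L_V[OF g])
    finally show ?thesis .
  qed
  show "?B \<in> bounded_ops L"
  proof (rule L.bdI[where c=1])
    show "?B f = 0" if "f \<notin> hcarrier L" for f using that by (simp add: basis_op_def)
    show "?B (f + g) = ?B f + ?B g" if f: "f \<in> hcarrier L" and g: "g \<in> hcarrier L" for f g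
      using f g W L_V[OF f] L_V[OF g] by (auto simp: basis_op_def fun_eq_iff op_apply bd_add intro!: trans[OF _ sum.distrib] sum.cong)
    show "?B (hscale L c f) = hscale L c (?B f)" if f: "f \<in> hcarrier L" for c f
      using f W L_V[OF f] L_subspace(2)[OF f, of c]
      by (auto simp: basis_op_def fun_eq_iff L_sc bd_sc vs.scale_sum_right intro!: sum.cong)
    show "hnorm L (?B f) \<le> 1 * hnorm L f" if f: "f \<in> hcarrier L" for f
      using ip[OF f f] by (simp add: hnorm_def)
  qed (rule mem)
qed

end

section \<open>Types of amplified factors\<close>

context hilbert
begin

lemma kernel_closed:
  assumes x: "x \<in> Bd"
  shows "closed_subspace H {y \<in> V. x y = 0}"
proof -
  have "vs.subspace {y \<in> V. x y = 0}"
    using x by (auto simp: vs.subspace_def bd_0 bd_add bd_sc)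
  moreover have "x z = 0" if z: "z \<in> V" and f: "\<forall>n::nat. f n \<in> {y \<in> V. x y = 0}"
    and lim: "(\<lambda>n. nrm (f n - z)) \<longlonglongrightarrow> 0" for f z
  proof -
    obtain c where c: "c > 0" "\<And>y. y \<in> V \<Longrightarrow> nrm (x y) \<le> c * nrm y" using bd_bound[OF x] by blast
    have "nrm (x z) \<le> c * nrm (f n - z)" for n
      using f c(2)[of "f n - z"] x z by (simp add: bd_diff nrm_minus)
    moreover have "(\<lambda>n. c * nrm (f n - z)) \<longlonglongrightarrow> c * 0" by (intro tendsto_intros lim)
    ultimately have "nrm (x z) \<le> c * 0"
      by (intro tendsto_lowerbound) (auto intro!: always_eventually)
    then show ?thesis using x nrm_ge0[of "x z"] nrm_eq_0[of "x z"] by (simp add: order_antisym_conv)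
  qed
  ultimately show ?thesis by (auto simp: closed_subspace_def)
qed

text \<open>
  The support projection of a self-adjoint operator, obtained from the projection onto its kernel.
\<close>

lemma support_projection:
  assumes x: "x \<in> Bd" "adj x = x"
  obtains p where "p \<in> Bd" "p \<circ> p = p" "adj p = p" "x \<circ> p = x" "p \<circ> x = x"
    "\<forall>y\<in>V. x y = 0 \<longrightarrow> p y = 0"
    "\<forall>T\<in>Bd. T \<circ> x = x \<circ> T \<and> adj T \<circ> x = x \<circ> adj T \<longrightarrow> p \<circ> T = T \<circ> p"
proof -
  obtain q where q: "q \<in> Bd" "q \<circ> q = q" "adj q = q" "\<And>y. q y \<in> {y \<in> V. x y = 0}"
    "\<And>y. y \<in> {y \<in> V. x y = 0} \<Longrightarrow> q y = y"
    by (rule projection_onto[OF kernel_closed[OF x(1)]]) (rule that; assumption)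
  define p where "p = id_op H - q"
  have pB: "p \<in> Bd" using q by (simp add: p_def)
  have papp: "p y = y - q y" if "y \<in> V" for y using that by (simp add: p_def op_apply)
  have qq: "q (q y) = q y" for y using q(2) by (simp add: fun_eq_iff)
  have pp: "p \<circ> p = p"
    by (rule bd_eqI) (use pB q in \<open>auto simp: papp bd_diff qq\<close>)
  have ap: "adj p = p"
  proof (rule adj_eqI[OF pB pB])
    fix y z assume y: "y \<in> V" and z: "z \<in> V"
    have "ip (q y) z = ip y (q z)" using adj_ip[OF q(1) y z] q(3) by simp
    then show "ip (p y) z = ip y (p z)" using y z q(1) by (simp add: papp ip_simps)
  qed
  have xp: "x \<circ> p = x"
    by (rule bd_eqI) (use pB q x in \<open>auto simp: papp bd_diff\<close>)
  then have "adj (x \<circ> p) = adj x" by simp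
  then have px: "p \<circ> x = x" using pB x ap by (simp add: adj_comp)
  have ker: "p y = 0" if "y \<in> V" "x y = 0" for y
    using q(5)[of y] that by (simp add: papp)
  have comm: "p \<circ> T = T \<circ> p" if T: "T \<in> Bd" "T \<circ> x = x \<circ> T" "adj T \<circ> x = x \<circ> adj T" for T
  proof -
    have "q \<in> commutant H {T, adj T}"
    proof (rule projection_in_commutant)
      fix a y assume a: "a \<in> {T, adj T}" and y: "y \<in> range q"
      have yk: "y \<in> V" "x y = 0" using y q(4) by auto
      have aB: "a \<in> Bd" "a \<circ> x = x \<circ> a" using a T by auto
      have "x (a y) = a (x y)" using aB(2) by (metis comp_apply)
      then have "q (a y) = a y" using yk aB by (intro q(5)) (simp add: bd_0)
      then show "a y \<in> range q" by (metis rangeI)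
    qed (use T q in auto)
    then have "q \<circ> T = T \<circ> q" by (auto simp: commutant_def)
    then have qT: "q (T y) = T (q y)" for y by (metis comp_apply)
    show ?thesis by (rule bd_eqI) (use pB T q qT in \<open>auto simp: papp bd_diff\<close>)
  qed
  show thesis by (rule that[OF pB pp ap xp px]) (use ker comm in blast)+
qed

lemma vn_facts:
  assumes N: "von_neumann_algebra H N"
  shows "N \<subseteq> Bd" "\<And>a. a \<in> N \<Longrightarrow> adj a \<in> N" "bicommutant H N = N" "id_op H \<in> N" "(\<lambda>x. 0) \<in> N"
    "\<And>a b. a \<in> N \<Longrightarrow> b \<in> N \<Longrightarrow> a \<circ> b \<in> N"
proof -
  show 1: "N \<subseteq> Bd" and 2: "\<And>a. a \<in> N \<Longrightarrow> adj a \<in> N" and 3: "bicommutant H N = N"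
    using N by (auto simp: von_neumann_algebra_def)
  show "id_op H \<in> N" using commutant_id[OF commutant_sub, of N] 3 by simp
  have "(\<lambda>x. 0) \<in> commutant H (commutant H N)" by (auto simp: commutant_def fun_eq_iff bd_0)
  then show "(\<lambda>x. 0) \<in> N" using 3 by simp
  show "a \<circ> b \<in> N" if "a \<in> N" "b \<in> N" for a b
    using commutant_comp[OF commutant_sub, of a N b] that 3 by simp
qed

text \<open>
  If \<open>x N x\<close> is commutative up to the middle factor \<open>x\<close>, then \<open>x\<close> is central in \<open>p N p\<close> for the
  support projection \<open>p\<close> of \<open>x\<close>, and cancelling \<open>x\<close> shows that \<open>p N p\<close> is commutative.
\<close>

lemma abelian_support:
  assumes N: "von_neumann_algebra H N" and x: "x \<in> N" "adj x = x" "x \<noteq> (\<lambda>x. 0)"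
    and comm: "\<And>y z \<xi>. y \<in> N \<Longrightarrow> z \<in> N \<Longrightarrow> \<xi> \<in> V \<Longrightarrow> x (y (x (z (x \<xi>)))) = x (z (x (y (x \<xi>))))"
  shows "\<exists>p. abelian_projection H N p \<and> p \<noteq> (\<lambda>x. 0)"
proof -
  note Nf = vn_facts[OF N]
  have xB: "x \<in> Bd" using x Nf by auto
  obtain p where p: "p \<in> Bd" "p \<circ> p = p" "adj p = p" "x \<circ> p = x" "p \<circ> x = x"
    "\<forall>y\<in>V. x y = 0 \<longrightarrow> p y = 0"
    "\<forall>T\<in>Bd. T \<circ> x = x \<circ> T \<and> adj T \<circ> x = x \<circ> adj T \<longrightarrow> p \<circ> T = T \<circ> p"
    by (rule support_projection[OF xB x(2)]) (rule that; assumption)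
  have pp: "p (p \<xi>) = p \<xi>" and xp: "x (p \<xi>) = x \<xi>" and px: "p (x \<xi>) = x \<xi>" for \<xi>
    using p(2,4,5) by (metis comp_apply)+
  have "p \<in> bicommutant H N"
    unfolding commutant_def[of H "commutant H N"]
  proof (intro CollectI conjI ballI)
    fix T assume T: "T \<in> commutant H N"
    have "adj T \<in> commutant H N" using commutant_adj[OF Nf(1,2) T] .
    then show "p \<circ> T = T \<circ> p" using T x(1) by (intro p(7)[rule_format]) (auto simp: commutant_def)
  qed (rule p(1))
  then have pN: "p \<in> N" using Nf(3) by simp
  have cancel: "p u = p v" if "u \<in> V" "v \<in> V" "x u = x v" for u v
    using p(6)[rule_format, of "u - v"] that xB p(1) by (simp add: bd_diff)
  have yB: "y \<in> Bd" if "y \<in> N" for y using that Nf by auto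
  have 1: "p (y (x (z (x \<xi>)))) = p (z (x (y (x \<xi>))))" if "y \<in> N" "z \<in> N" "\<xi> \<in> V" for y z \<xi>
    by (rule cancel[OF _ _ comm[OF that]]) (use that yB xB in auto)
  have 2: "x (z (x (y (p \<xi>)))) = x (y (x (z (p \<xi>))))" if y: "y \<in> N" and z: "z \<in> N" and \<xi>: "\<xi> \<in> V" for y z \<xi>
  proof -
    have B: "y \<in> Bd" "z \<in> Bd" using y z yB by auto
    have "p \<circ> adj y \<circ> x \<circ> adj z \<circ> x = p \<circ> adj z \<circ> x \<circ> adj y \<circ> x"
    proof (rule bd_eqI)
      show "(p \<circ> adj y \<circ> x \<circ> adj z \<circ> x) \<xi> = (p \<circ> adj z \<circ> x \<circ> adj y \<circ> x) \<xi>" if "\<xi> \<in> V" for \<xi>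
        unfolding comp_apply by (rule 1[OF Nf(2)[OF y] Nf(2)[OF z] that])
    qed (use B p(1) xB in auto)
    then have "adj (p \<circ> adj y \<circ> x \<circ> adj z \<circ> x) = adj (p \<circ> adj z \<circ> x \<circ> adj y \<circ> x)" by simp
    then have "x \<circ> (z \<circ> (x \<circ> (y \<circ> p))) = x \<circ> (y \<circ> (x \<circ> (z \<circ> p)))"
      using B p(1,3) xB x(2) by (simp add: adj_comp comp_assoc)
    from fun_cong[OF this, of \<xi>] show ?thesis by simp
  qed
  have 3: "p (z (x (y (p \<xi>)))) = p (y (x (z (p \<xi>))))" if "y \<in> N" "z \<in> N" "\<xi> \<in> V" for y z \<xi>
    by (rule cancel[OF _ _ 2[OF that]]) (use that yB xB in auto)
  have 4: "p (z (x \<xi>)) = x (z (p \<xi>))" if z: "z \<in> N" and \<xi>: "\<xi> \<in> V" for z \<xi>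
    using 3[OF Nf(4) z \<xi>] p(1) yB[OF z] xB by (simp add: xp px)
  have ab: "(p \<circ> y \<circ> p) \<circ> (p \<circ> z \<circ> p) = (p \<circ> z \<circ> p) \<circ> (p \<circ> y \<circ> p)" if y: "y \<in> N" and z: "z \<in> N" for y z
  proof (rule bd_eqI)
    fix \<xi> assume \<xi>: "\<xi> \<in> V"
    have "p (y (p (z (p \<xi>)))) = p (z (p (y (p \<xi>))))"
    proof -
      have "x (p (y (p (p (z (p \<xi>)))))) = p (y (x (z (p \<xi>))))"
        using 4[OF y, of "z (p \<xi>)"] yB z by (simp add: pp xp)
      also have "\<dots> = p (z (x (y (p \<xi>))))" using 3[OF z y \<xi>] .
      also have "\<dots> = x (p (z (p (p (y (p \<xi>))))))"
        using 4[OF z, of "y (p \<xi>)"] yB y by (simp add: pp xp)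
      finally show ?thesis using cancel[of "p (y (p (z (p \<xi>))))" "p (z (p (y (p \<xi>))))"] p(1) by (simp add: pp)
    qed
    then show "((p \<circ> y \<circ> p) \<circ> (p \<circ> z \<circ> p)) \<xi> = ((p \<circ> z \<circ> p) \<circ> (p \<circ> y \<circ> p)) \<xi>" by (simp add: pp)
  qed (use yB y z p(1) in auto)
  have "p \<noteq> (\<lambda>x. 0)"
  proof
    assume "p = (\<lambda>x. 0)"
    then have "x = (\<lambda>x. 0)" using xp xB bd_0 by (metis ext)
    then show False using x(3) by simp
  qed
  then show ?thesis using pN p(1-3) ab by (auto simp: abelian_projection_def projections_def)
qed

end

locale amplified_algebra = square_summable H X for H :: "'v::ab_group_add hilbert" and X :: "'i set" +
  fixes N :: "('v \<Rightarrow> 'v) set"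
  assumes N: "von_neumann_algebra H N" and X_nonempty: "X \<noteq> {}"
begin

text \<open>
  The algebra \<open>B(\<ell>\<^sup>2 X) \<otimes> N\<close>, through its commutant \<open>1 \<otimes> N'\<close>; by \<open>M_iff\<close> its elements are the operators
  with matrix entries in \<open>N\<close>.
\<close>

definition M :: "(('i \<Rightarrow> 'v) \<Rightarrow> 'i \<Rightarrow> 'v) set" where
  "M = commutant L (amp ` commutant H N)"

lemmas Nf = vn_facts[OF N]

lemma N_bd [simp]: "a \<in> N \<Longrightarrow> a \<in> Bd" using Nf by auto

lemma M_iff: "T \<in> M \<longleftrightarrow> T \<in> bounded_ops L \<and> (\<forall>s\<in>X. \<forall>r\<in>X. entry T s r \<in> N)"
  unfolding M_def using commutant_amp[OF commutant_sub, of T N] Nf(3) by simp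

lemma unit_tensor_M: "a \<in> N \<Longrightarrow> s \<in> X \<Longrightarrow> r \<in> X \<Longrightarrow> unit_tensor s r a \<in> M"
  using Nf by (simp add: M_iff entry_unit_tensor)

lemma amp_M: "a \<in> N \<Longrightarrow> amp a \<in> M"
  using Nf by (simp add: M_iff entry_amp)

lemma von_neumann_M: "von_neumann_algebra L M"
  unfolding von_neumann_algebra_def
proof (intro conjI ballI)
  have sub: "amp ` commutant H N \<subseteq> bounded_ops L" by (auto simp: commutant_def)
  show "M \<subseteq> bounded_ops L" by (auto simp: M_iff)
  show "adjoint_op L T \<in> M" if "T \<in> M" for T
    using that unfolding M_def
  proof (rule L.commutant_adj[OF sub, rotated])
    fix a assume "a \<in> amp ` commutant H N"
    then obtain b where b: "b \<in> commutant H N" "a = amp b" by auto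
    then have "adj b \<in> commutant H N" using commutant_adj[OF Nf(1,2)] by blast
    then show "adjoint_op L a \<in> amp ` commutant H N" using b by (auto simp: adj_amp commutant_def)
  qed
  show "bicommutant L M = M" unfolding M_def by (rule L.commutant3[OF sub])
qed

lemmas Mf = L.vn_facts[OF von_neumann_M]

text \<open>
  A central operator commutes with the matrix units, hence is an amplification \<open>1 \<otimes> a\<close>, and \<open>a\<close> is then
  central in \<open>N\<close>.
\<close>

lemma factor_M:
  assumes "factor H N" shows "factor L M"
  unfolding factor_def
proof (intro conjI)
  have sc: "N \<inter> commutant H N = range (\<lambda>c. scale_op H c (id_op H))" and nz: "V \<noteq> {0}"
    using assms by (auto simp: factor_def)
  obtain s where s: "s \<in> X" using X_nonempty by auto
  show "von_neumann_algebra L M" by (rule von_neumann_M)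
  obtain \<xi> where \<xi>: "\<xi> \<in> V" "\<xi> \<noteq> 0" using nz V_0 by blast
  have "basis_vec s \<xi> \<in> hcarrier L" "basis_vec s \<xi> \<noteq> 0"
    using s \<xi> by (simp, metis basis_vec_same zero_fun_def)
  then show "hcarrier L \<noteq> {0}" by auto
  show "M \<inter> commutant L M = range (\<lambda>c. scale_op L c (id_op L))"
  proof
    show "range (\<lambda>c. scale_op L c (id_op L)) \<subseteq> M \<inter> commutant L M"
    proof clarify
      fix c
      have "scale_op L c (id_op L) \<in> commutant L A" if "A \<subseteq> bounded_ops L" for A
        using that by (intro L.commutant_scale L.commutant_id)
      then show "scale_op L c (id_op L) \<in> M \<inter> commutant L M"
        using Mf(1,3) L.commutant_sub by (metis IntI)
    qed
    show "M \<inter> commutant L M \<subseteq> range (\<lambda>c. scale_op L c (id_op L))"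
    proof
      fix T assume T: "T \<in> M \<inter> commutant L M"
      have TB: "T \<in> bounded_ops L" using T by (simp add: M_iff)
      have Teq: "T = amp (entry T s s)"
        by (rule amp_if_commutes_unit_tensors[OF TB s])
           (use T unit_tensor_M Nf(4) in \<open>auto simp: commutant_def\<close>)
      have "T \<in> commutant L (amp ` N)" using T amp_M by (auto simp: commutant_def)
      then have "entry T s s \<in> commutant H N" using commutant_amp[OF Nf(1)] s by blast
      moreover have "entry T s s \<in> N" using T s by (simp add: M_iff)
      ultimately obtain c where "entry T s s = scale_op H c (id_op H)" using sc by blast
      then have "T = scale_op L c (id_op L)" using Teq by (simp add: amp_scale amp_id)
      then show "T \<in> range (\<lambda>c. scale_op L c (id_op L))" by blast
    qed
  qed
qed

lemma entry_unit_tensor_same: "a \<in> Bd \<Longrightarrow> s \<in> X \<Longrightarrow> entry (unit_tensor s s a) s s = a"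
  by (simp add: entry_unit_tensor)

text \<open>
  The corners of \<open>M\<close> at \<open>E\<^bsub>ss\<^esub> \<otimes> p\<close> and of \<open>N\<close> at \<open>p\<close> are the same.
\<close>

lemma abelian_unit_tensor:
  assumes p: "abelian_projection H N p" and s: "s \<in> X"
  shows "abelian_projection L M (unit_tensor s s p)"
proof -
  have pN: "p \<in> N" "p \<circ> p = p" "adj p = p" using p by (auto simp: abelian_projection_def projections_def)
  have comp: "unit_tensor s s p \<circ> T \<circ> unit_tensor s s p = unit_tensor s s (p \<circ> entry T s s \<circ> p)" if "T \<in> M" for T
    using that pN s by (intro unit_tensor_compress) (auto simp: M_iff)
  have "(unit_tensor s s p \<circ> S \<circ> unit_tensor s s p) \<circ> (unit_tensor s s p \<circ> T \<circ> unit_tensor s s p) =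
    (unit_tensor s s p \<circ> T \<circ> unit_tensor s s p) \<circ> (unit_tensor s s p \<circ> S \<circ> unit_tensor s s p)"
    if S: "S \<in> M" and T: "T \<in> M" for S T
  proof -
    have e: "entry S s s \<in> N" "entry T s s \<in> N" using S T s by (auto simp: M_iff)
    have "(p \<circ> entry S s s \<circ> p) \<circ> (p \<circ> entry T s s \<circ> p) = (p \<circ> entry T s s \<circ> p) \<circ> (p \<circ> entry S s s \<circ> p)"
      using p e by (auto simp: abelian_projection_def)
    then show ?thesis unfolding comp[OF S] comp[OF T]
      using e pN s by (subst (1 2) unit_tensor_comp) auto
  qed
  then show ?thesis using pN s unit_tensor_M[OF pN(1) s s]
    by (simp add: abelian_projection_def projections_def unit_tensor_comp adj_unit_tensor)
qed

text \<open>
  Some diagonal entry \<open>x = P\<^bsub>ss\<^esub>\<close> is nonzero, and \<open>x y x z x = x z x y x\<close> for \<open>y, z \<in> N\<close> because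
  \<open>P (E\<^bsub>ss\<^esub> \<otimes> y) P\<close> and \<open>P (E\<^bsub>ss\<^esub> \<otimes> z) P\<close> commute.
\<close>

lemma abelian_descends:
  assumes P: "abelian_projection L M P" "P \<noteq> (\<lambda>x. 0)"
  shows "\<exists>p. abelian_projection H N p \<and> p \<noteq> (\<lambda>x. 0)"
proof -
  have PM: "P \<in> M" "P \<circ> P = P" "adjoint_op L P = P" using P by (auto simp: abelian_projection_def projections_def)
  have PB: "P \<in> bounded_ops L" using PM by (simp add: M_iff)
  have PP: "P (P f) = P f" for f using PM(2) by (metis comp_apply)
  have "\<exists>s\<in>X. entry P s s \<noteq> (\<lambda>x. 0)"
  proof (rule ccontr)
    assume "\<not> (\<exists>s\<in>X. entry P s s \<noteq> (\<lambda>x. 0))"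
    then have z: "entry P s s = (\<lambda>x. 0)" if "s \<in> X" for s using that by blast
    have "P = (\<lambda>x. 0)"
    proof (rule bd_eq_if_basis[OF PB])
      fix s \<xi> assume s: "s \<in> X" and \<xi>: "\<xi> \<in> V"
      let ?b = "basis_vec s \<xi>"
      have "hinner L (P ?b) (P ?b) = hinner L (P (P ?b)) ?b"
        using L.adj_ip[OF PB, of "P ?b" ?b] s \<xi> PB PM(3) by simp
      also have "\<dots> = ip (entry P s s \<xi>) \<xi>" using s \<xi> PB by (simp add: PP ip_basis_vec_right entry_app)
      also have "\<dots> = 0" using z[OF s] \<xi> by simp
      finally show "P ?b = 0" using L.ip_eq_0[of "P ?b"] PB by simp
    qed auto
    then show False using P(2) by simp
  qed
  then obtain s where s: "s \<in> X" "entry P s s \<noteq> (\<lambda>x. 0)" by auto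
  define x where "x = entry P s s"
  have xN: "x \<in> N" using PM s by (simp add: x_def M_iff)
  have ax: "adj x = x" using entry_adj[OF PB s(1) s(1)] PM(3) by (simp add: x_def)
  have "x (y (x (z (x \<xi>)))) = x (z (x (y (x \<xi>))))" if y: "y \<in> N" and z: "z \<in> N" and \<xi>: "\<xi> \<in> V" for y z \<xi>
  proof -
    have e: "(P \<circ> unit_tensor s s y \<circ> P) ((P \<circ> unit_tensor s s z \<circ> P) (basis_vec s \<xi>)) s = x (y (x (z (x \<xi>))))"
      if "y \<in> N" "z \<in> N" for y z
      using that PB s \<xi> xN by (simp add: PP unit_tensor_apply x_def entry_app)
    have "(P \<circ> unit_tensor s s y \<circ> P) \<circ> (P \<circ> unit_tensor s s z \<circ> P) =
      (P \<circ> unit_tensor s s z \<circ> P) \<circ> (P \<circ> unit_tensor s s y \<circ> P)"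
      using P(1) unit_tensor_M[OF y s(1) s(1)] unit_tensor_M[OF z s(1) s(1)] by (auto simp: abelian_projection_def)
    from fun_cong[OF fun_cong[OF this, of "basis_vec s \<xi>"], of s]
    show ?thesis using e[OF y z] e[OF z y] by simp
  qed
  then show ?thesis using abelian_support[OF N xN ax] s(2) by (simp add: x_def)
qed

text \<open>
  A partial isometry realising an equivalence inside the corner at \<open>E\<^bsub>ss\<^esub> \<otimes> 1\<close> is determined by its
  entry at \<open>(s, s)\<close>, an isometry in \<open>N\<close>.
\<close>

lemma finite_unit_tensor:
  assumes fin: "finite_projection H N (id_op H)" and s: "s \<in> X"
  shows "finite_projection L M (unit_tensor s s (id_op H))"
  unfolding finite_projection_def
proof (intro conjI ballI impI)
  let ?E = "unit_tensor s s (id_op H)"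
  have EB: "?E \<in> bounded_ops L" using s by simp
  show "?E \<in> projections L M"
    using unit_tensor_M[OF Nf(4) s s] s by (simp add: projections_def unit_tensor_comp adj_unit_tensor)
  fix Q assume Q: "Q \<in> projections L M" and "?E \<circ> Q = Q \<and> mvn_equiv L M ?E Q"
  then obtain v where EQ: "?E \<circ> Q = Q" and v: "v \<in> M" "adjoint_op L v \<circ> v = ?E" "v \<circ> adjoint_op L v = Q"
    by (auto simp: mvn_equiv_def)
  have QQ: "Q \<circ> Q = Q" using Q by (simp add: projections_def)
  have vB: "v \<in> bounded_ops L" using v by (simp add: M_iff)
  define v0 where "v0 = entry v s s"
  have v0: "v0 \<in> N" using v s by (simp add: v0_def M_iff)
  have a1: "adjoint_op L v (v f) = ?E f" "v (adjoint_op L v f) = Q f" "?E (Q f) = Q f" "Q (Q f) = Q f" for f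
    using v EQ QQ by (metis comp_apply)+
  have EvE: "?E \<circ> v \<circ> ?E = v \<circ> ?E"
  proof
    fix f show "(?E \<circ> v \<circ> ?E) f = (v \<circ> ?E) f"
      using a1(1)[of f] a1(2)[of "v f"] a1(3)[of "v f"] by simp
  qed
  have w: "unit_tensor s s v0 = v \<circ> ?E"
    using EvE unit_tensor_compress[OF vB bd_id bd_id s s s s] vB s by (simp add: v0_def)
  have "unit_tensor s s (adj v0 \<circ> v0) = adjoint_op L (v \<circ> ?E) \<circ> (v \<circ> ?E)"
    unfolding w[symmetric] using v0 s by (simp add: adj_unit_tensor unit_tensor_comp)
  also have "\<dots> = ?E \<circ> (adjoint_op L v \<circ> v) \<circ> ?E"
    using vB EB s by (simp add: L.adj_comp adj_unit_tensor comp_assoc)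
  also have "\<dots> = ?E" unfolding v(2) using s by (simp add: unit_tensor_comp)
  finally have "adj v0 \<circ> v0 = id_op H"
    using entry_unit_tensor_same[OF _ s] v0 by (metis N_bd adj_bd bd_comp bd_id)
  moreover have q0: "unit_tensor s s (v0 \<circ> adj v0) = Q"
  proof -
    have "unit_tensor s s (v0 \<circ> adj v0) = (v \<circ> ?E) \<circ> adjoint_op L (v \<circ> ?E)"
      unfolding w[symmetric] using v0 s by (simp add: adj_unit_tensor unit_tensor_comp)
    also have "\<dots> = v \<circ> (?E \<circ> ?E) \<circ> adjoint_op L v"
      using vB EB s by (simp add: L.adj_comp adj_unit_tensor comp_assoc)
    also have "\<dots> = Q"
    proof
      fix f
      have "?E \<circ> ?E = ?E" using s by (simp add: unit_tensor_comp)
      then show "(v \<circ> (?E \<circ> ?E) \<circ> adjoint_op L v) f = Q f"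
        using a1(1)[of "adjoint_op L v f"] a1(2) a1(4) by (metis comp_apply)
    qed
    finally show ?thesis .
  qed
  ultimately have mv: "mvn_equiv H N (id_op H) (v0 \<circ> adj v0)" using v0 by (auto simp: mvn_equiv_def)
  have av: "adj v0 (v0 f) = id_op H f" for f using \<open>adj v0 \<circ> v0 = id_op H\<close> by (metis comp_apply)
  have "v0 \<circ> adj v0 \<in> projections H N"
  proof -
    have "(v0 \<circ> adj v0) \<circ> (v0 \<circ> adj v0) = v0 \<circ> (id_op H \<circ> adj v0)"
      unfolding \<open>adj v0 \<circ> v0 = id_op H\<close>[symmetric] by (simp add: comp_assoc)
    then show ?thesis using v0 Nf(2,6) by (simp add: projections_def adj_comp)
  qed
  then have "v0 \<circ> adj v0 = id_op H"
    using fin mv v0 by (auto simp: finite_projection_def)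
  then show "Q = ?E" using q0 by simp
qed

lemma infinite_M:
  assumes v: "v \<in> M" "adjoint_op L v \<circ> v = id_op L" "v \<circ> adjoint_op L v \<noteq> id_op L"
  shows "\<not> finite_projection L M (id_op L)"
proof
  assume fin: "finite_projection L M (id_op L)"
  have vB: "v \<in> bounded_ops L" using v by (simp add: M_iff)
  have "(v \<circ> adjoint_op L v) \<circ> (v \<circ> adjoint_op L v) = v \<circ> (id_op L \<circ> adjoint_op L v)"
    unfolding v(2)[symmetric] by (simp add: comp_assoc)
  then have "v \<circ> adjoint_op L v \<in> projections L M"
    using vB v Mf(2,6) by (simp add: projections_def L.adj_comp)
  moreover have "mvn_equiv L M (id_op L) (v \<circ> adjoint_op L v)" using v by (auto simp: mvn_equiv_def)
  ultimately have "v \<circ> adjoint_op L v = id_op L"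
    using fin vB by (auto simp: finite_projection_def)
  then show False using v(3) by simp
qed

theorem amplification_type_I:
  assumes "type_I_factor H N" "\<not> finite_projection L M (id_op L)"
  shows "type_I_infinite_factor L M"
proof -
  obtain s where s: "s \<in> X" using X_nonempty by auto
  obtain p where p: "abelian_projection H N p" "p \<noteq> (\<lambda>x. 0)" using assms by (auto simp: type_I_factor_def)
  have pB: "p \<in> Bd" using p by (auto simp: abelian_projection_def projections_def)
  have "unit_tensor s s p \<noteq> (\<lambda>x. 0)"
    using entry_unit_tensor_same[OF pB s] p(2) by (auto simp: entry_def)
  then show ?thesis using assms factor_M abelian_unit_tensor[OF p(1) s]
    unfolding type_I_infinite_factor_def type_I_factor_def by blast
qed

theorem amplification_type_II:
  assumes "type_II_1_factor H N" "\<not> finite_projection L M (id_op L)"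
  shows "type_II_infinite_factor L M"
proof -
  obtain s where s: "s \<in> X" using X_nonempty by auto
  have f: "factor H N" and na: "\<not> (\<exists>p. abelian_projection H N p \<and> p \<noteq> (\<lambda>x. 0))"
    and fin: "finite_projection H N (id_op H)"
    using assms by (auto simp: type_II_1_factor_def type_II_factor_def)
  have "V \<noteq> {0}" using f by (simp add: factor_def)
  then obtain \<xi> where "\<xi> \<in> V" "\<xi> \<noteq> 0" using V_0 by blast
  then have "id_op H \<noteq> (\<lambda>x. 0)" by (metis id_op_apply)
  then have "unit_tensor s s (id_op H) \<noteq> (\<lambda>x. 0)"
    using entry_unit_tensor_same[OF bd_id s] by (auto simp: entry_def)
  then show ?thesis using assms(2) factor_M[OF f] finite_unit_tensor[OF fin s] abelian_descends na
    unfolding type_II_infinite_factor_def type_II_factor_def by blast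
qed

end

section \<open>Automatic contractivity of representations\<close>

context hilbert
begin

lemma rep_bd: "representation A H \<pi> \<Longrightarrow> a \<in> acarrier A \<Longrightarrow> \<pi> a \<in> Bd"
  and rep_add: "representation A H \<pi> \<Longrightarrow> a \<in> acarrier A \<Longrightarrow> b \<in> acarrier A \<Longrightarrow> \<pi> (aadd A a b) = \<pi> a + \<pi> b"
  and rep_scale: "representation A H \<pi> \<Longrightarrow> a \<in> acarrier A \<Longrightarrow> \<pi> (ascale A c a) = scale_op H c (\<pi> a)"
  and rep_mult: "representation A H \<pi> \<Longrightarrow> a \<in> acarrier A \<Longrightarrow> b \<in> acarrier A \<Longrightarrow> \<pi> (amult A a b) = \<pi> a \<circ> \<pi> b"
  and rep_star: "representation A H \<pi> \<Longrightarrow> a \<in> acarrier A \<Longrightarrow> \<pi> (astar A a) = adj (\<pi> a)"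
  unfolding representation_def by blast+

text \<open>
  If \<open>2b = a\<^sup>*a + b\<^sup>2\<close> with \<open>b\<close> self-adjoint, then \<open>1 - a\<^sup>*a = (1 - b)\<^sup>2\<close>, so that
  \<open>\<parallel>\<xi>\<parallel>\<^sup>2 - \<parallel>\<pi>(a)\<xi>\<parallel>\<^sup>2 = \<parallel>\<xi> - \<pi>(b)\<xi>\<parallel>\<^sup>2 \<ge> 0\<close>.
\<close>

lemma rep_contractive_if_root:
  assumes \<pi>: "representation A H \<pi>" and a: "a \<in> acarrier A" and b: "b \<in> acarrier A"
    and a2: "astar A a \<in> acarrier A" "amult A (astar A a) a \<in> acarrier A" "amult A b b \<in> acarrier A"
    and sa: "astar A b = b"
    and root: "aadd A b b = aadd A (amult A (astar A a) a) (amult A b b)" and \<xi>: "\<xi> \<in> V"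
  shows "nrm (\<pi> a \<xi>) \<le> nrm \<xi>"
proof -
  note B = rep_bd[OF \<pi> a] rep_bd[OF \<pi> b]
  have "adj (\<pi> b) = \<pi> b" using rep_star[OF \<pi> b] sa by simp
  then have bip: "ip (\<pi> b x) y = ip x (\<pi> b y)" if "x \<in> V" "y \<in> V" for x y
    using adj_ip[OF B(2) that] by simp
  have "\<pi> b + \<pi> b = (adj (\<pi> a) \<circ> \<pi> a) + (\<pi> b \<circ> \<pi> b)"
  proof -
    have "\<pi> (aadd A b b) = \<pi> b + \<pi> b" by (rule rep_add[OF \<pi> b b])
    moreover have "\<pi> (aadd A (amult A (astar A a) a) (amult A b b)) = (adj (\<pi> a) \<circ> \<pi> a) + (\<pi> b \<circ> \<pi> b)"
      unfolding rep_add[OF \<pi> a2(2,3)] rep_mult[OF \<pi> a2(1) a] rep_mult[OF \<pi> b b] rep_star[OF \<pi> a] ..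
    ultimately show ?thesis using root by simp
  qed
  from fun_cong[OF this, of \<xi>] have eq: "\<pi> b \<xi> + \<pi> b \<xi> = adj (\<pi> a) (\<pi> a \<xi>) + \<pi> b (\<pi> b \<xi>)" by (simp add: op_apply)
  have "(nrm (\<pi> a \<xi>))\<^sup>2 + (nrm (\<pi> b \<xi>))\<^sup>2 = Re (ip (adj (\<pi> a) (\<pi> a \<xi>) + \<pi> b (\<pi> b \<xi>)) \<xi>)"
    using \<xi> B by (simp add: nrm_sq ip_simps adj_ip' bip)
  also have "\<dots> = 2 * Re (ip (\<pi> b \<xi>) \<xi>)"
    unfolding eq[symmetric] using \<xi> B by (simp add: ip_simps)
  finally have "(nrm \<xi>)\<^sup>2 - (nrm (\<pi> a \<xi>))\<^sup>2 = (nrm (\<pi> b \<xi> - \<xi>))\<^sup>2"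
    using nrm_diff_sq[of "\<pi> b \<xi>" \<xi>] \<xi> B by simp
  then have "(nrm (\<pi> a \<xi>))\<^sup>2 \<le> (nrm \<xi>)\<^sup>2" using zero_le_power2[of "nrm (\<pi> b \<xi> - \<xi>)"] by linarith
  then show ?thesis by (rule power2_le_imp_le) (use \<xi> in auto)
qed

text \<open>
  Closed invariant subspaces correspond to the projections in the commutant.
\<close>

lemma irreducible_iff_projections:
  assumes \<pi>: "representation A H \<pi>" and star: "\<And>a. a \<in> acarrier A \<Longrightarrow> astar A a \<in> acarrier A"
  shows "irreducible_rep A H \<pi> \<longleftrightarrow> V \<noteq> {0} \<and>
    (\<forall>p\<in>commutant H (\<pi> ` acarrier A). p \<circ> p = p \<and> adj p = p \<longrightarrow> p = (\<lambda>x. 0) \<or> p = id_op H)"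
proof -
  let ?I = "\<pi> ` acarrier A"
  have I: "?I \<subseteq> Bd" "\<And>a. a \<in> ?I \<Longrightarrow> adj a \<in> ?I"
    using rep_bd[OF \<pi>] rep_star[OF \<pi>] star by (auto simp flip: rep_star[OF \<pi>])
  have "(\<forall>W. closed_subspace H W \<and> (\<forall>a\<in>acarrier A. \<forall>\<xi>\<in>W. \<pi> a \<xi> \<in> W) \<longrightarrow> W = {0} \<or> W = V) \<longleftrightarrow>
    (\<forall>p\<in>commutant H ?I. p \<circ> p = p \<and> adj p = p \<longrightarrow> p = (\<lambda>x. 0) \<or> p = id_op H)" (is "?L \<longleftrightarrow> ?R")
  proof
    assume l: ?L
    show ?R
    proof (intro ballI impI)
      fix p assume p: "p \<in> commutant H ?I" "p \<circ> p = p \<and> adj p = p"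
      have pB: "p \<in> Bd" using p by (simp add: commutant_def)
      have pp: "p (p x) = p x" for x using p(2) by (metis comp_apply)
      have "\<pi> a \<xi> \<in> range p" if a: "a \<in> acarrier A" and \<xi>: "\<xi> \<in> range p" for a \<xi>
      proof -
        obtain x where "\<xi> = p x" using \<xi> by auto
        moreover have "p \<circ> \<pi> a = \<pi> a \<circ> p" using p a by (auto simp: commutant_def)
        ultimately show ?thesis by (metis comp_apply rangeI)
      qed
      then have "range p = {0} \<or> range p = V"
        using l range_projection_closed[OF pB] p(2) by blast
      then show "p = (\<lambda>x. 0) \<or> p = id_op H"
      proof
        assume "range p = {0}" then show ?thesis by auto
      next
        assume r: "range p = V"
        have "p = id_op H"
        proof (rule bd_eqI[OF pB bd_id])
          fix x assume x: "x \<in> V"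
          then obtain y where "x = p y" using r by auto
          then show "p x = id_op H x" using pp x by simp
        qed
        then show ?thesis ..
      qed
    qed
  next
    assume r: ?R
    show ?L
    proof (intro allI impI)
      fix W assume W: "closed_subspace H W \<and> (\<forall>a\<in>acarrier A. \<forall>\<xi>\<in>W. \<pi> a \<xi> \<in> W)"
      then obtain p where p: "p \<in> Bd" "p \<circ> p = p" "adj p = p" "\<And>x. p x \<in> W" "\<And>x. x \<in> W \<Longrightarrow> p x = x"
        using projection_onto[of W] by metis
      have rW: "range p = W" using p(4,5) by (metis UNIV_I image_subset_iff rangeI subsetI subset_antisym)
      have "p \<in> commutant H ?I"
        using W by (intro projection_in_commutant[OF I p(1-3)]) (auto simp: rW)
      then have "p = (\<lambda>x. 0) \<or> p = id_op H" using r p by blast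
      moreover have "W \<subseteq> V" using W by (auto simp: closed_subspace_def)
      ultimately show "W = {0} \<or> W = V"
        using p(5) rW by (auto simp: id_op_def split: if_splits)
    qed
  qed
  then show ?thesis using \<pi> by (auto simp: irreducible_rep_def)
qed

subsection \<open>The operator norm\<close>

abbreviation "opn \<equiv> op_norm H"

lemma opn_bdd:
  assumes "T \<in> Bd" shows "bdd_above ((\<lambda>x. nrm (T x)) ` {x \<in> V. nrm x \<le> 1})"
proof -
  obtain c where c: "c > 0" "\<And>x. x \<in> V \<Longrightarrow> nrm (T x) \<le> c * nrm x" using bd_bound[OF assms] by blast
  have "nrm (T x) \<le> c" if "x \<in> V" "nrm x \<le> 1" for x
    using c(2)[OF that(1)] mult_left_mono[OF that(2), of c] c(1) by linarith
  then show ?thesis by (intro bdd_aboveI2[of _ _ c]) auto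
qed

lemma opn_ge0: "T \<in> Bd \<Longrightarrow> opn T \<ge> 0"
  unfolding op_norm_def by (rule cSUP_upper2[OF opn_bdd, of T 0]) auto

lemma opn_bound:
  assumes T: "T \<in> Bd" and x: "x \<in> V" shows "nrm (T x) \<le> opn T * nrm x"
proof (cases "x = 0")
  case True then show ?thesis using T by (simp add: bd_0)
next
  case False
  then have n: "nrm x > 0" using nrm_ge0[OF x] nrm_eq_0[OF x] by linarith
  let ?y = "sc (of_real (inverse (nrm x))) x"
  have y: "?y \<in> V" "nrm ?y = 1" using x n less_imp_neq[OF n] by (simp_all add: nrm_sc norm_inverse)
  have "nrm (T ?y) \<le> opn T"
    unfolding op_norm_def by (rule cSUP_upper[OF _ opn_bdd[OF T]]) (use y in auto)
  moreover have "nrm (T ?y) = inverse (nrm x) * nrm (T x)" using x T n by (simp add: bd_sc nrm_sc norm_inverse)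
  ultimately have "inverse (nrm x) * nrm (T x) \<le> opn T" by simp
  then show ?thesis using n by (simp add: field_simps)
qed

lemma opn_leI:
  assumes "c \<ge> 0" "\<And>x. x \<in> V \<Longrightarrow> nrm (T x) \<le> c * nrm x" shows "opn T \<le> c"
  unfolding op_norm_def
proof (rule cSUP_least)
  show "{x \<in> V. nrm x \<le> 1} \<noteq> {}" using V_0 nrm_0 by (auto intro!: exI[of _ 0])
  show "nrm (T x) \<le> c" if "x \<in> {x \<in> V. nrm x \<le> 1}" for x
  proof -
    have "nrm (T x) \<le> c * nrm x" using assms that by auto
    moreover have "c * nrm x \<le> c * 1" using assms(1) that by (intro mult_left_mono) auto
    ultimately show ?thesis by linarith
  qed
qed

lemma opn_triangle: assumes "S \<in> Bd" "T \<in> Bd" shows "opn (S + T) \<le> opn S + opn T"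
proof (rule opn_leI)
  show "nrm ((S + T) x) \<le> (opn S + opn T) * nrm x" if "x \<in> V" for x
    using nrm_triangle[of "S x" "T x"] opn_bound[OF assms(1) that] opn_bound[OF assms(2) that] assms
    by (simp add: op_apply algebra_simps)
qed (simp add: assms opn_ge0)

lemma opn_comp: assumes "S \<in> Bd" "T \<in> Bd" shows "opn (S \<circ> T) \<le> opn S * opn T"
proof (rule opn_leI)
  show "nrm ((S \<circ> T) x) \<le> (opn S * opn T) * nrm x" if "x \<in> V" for x
    using opn_bound[OF assms(1), of "T x"] mult_left_mono[OF opn_bound[OF assms(2) that] opn_ge0[OF assms(1)]] assms
    by (simp add: mult.assoc)
qed (simp add: assms opn_ge0)

lemma opn_scale_le: assumes T: "T \<in> Bd" shows "opn (scale_op H c T) \<le> cmod c * opn T"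
proof (rule opn_leI)
  show "nrm (scale_op H c T x) \<le> cmod c * opn T * nrm x" if "x \<in> V" for x
    using opn_bound[OF T that] T by (simp add: op_apply nrm_sc mult.assoc mult_left_mono)
qed (simp add: assms opn_ge0)

lemma opn_minus: "opn (- T) = opn T" if T: "T \<in> Bd"
proof (rule antisym)
  show "opn (- T) \<le> opn T" using opn_scale_le[OF T, of "-1"] by (simp add: scale_op_minus1)
  show "opn T \<le> opn (- T)" using opn_scale_le[of "-T" "-1"] T by (simp add: scale_op_minus1)
qed

lemma opn_adj: assumes T: "T \<in> Bd" shows "opn (adj T) \<le> opn T"
proof (rule opn_leI)
  show "nrm (adj T x) \<le> opn T * nrm x" if x: "x \<in> V" for x
  proof (cases "adj T x = 0")
    case True then show ?thesis using x T by (simp add: opn_ge0)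
  next
    case False
    let ?y = "adj T x"
    have y: "?y \<in> V" using T by simp
    have "(nrm ?y)\<^sup>2 = Re (ip (T ?y) x)" using y x T by (simp add: nrm_sq adj_ip)
    also have "\<dots> \<le> nrm (T ?y) * nrm x"
      using cauchy_schwarz[of "T ?y" x] complex_Re_le_cmod[of "ip (T ?y) x"] x T by simp
    also have "\<dots> \<le> (opn T * nrm ?y) * nrm x" using opn_bound[OF T y] x by (intro mult_right_mono) auto
    finally have "nrm ?y * nrm ?y \<le> nrm ?y * (opn T * nrm x)" by (simp add: power2_eq_square mult_ac)
    moreover have "nrm ?y > 0" using False nrm_ge0[OF y] nrm_eq_0[OF y] by linarith
    ultimately show ?thesis by simp
  qed
qed (use T opn_ge0 in auto)

lemma bd_complete:
  assumes F: "\<And>n::nat. F n \<in> Bd" and cauchy: "\<And>e. e > 0 \<Longrightarrow> \<exists>N. \<forall>m\<ge>N. \<forall>n\<ge>N. opn (F m - F n) < e"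
  shows "\<exists>T\<in>Bd. (\<lambda>n. opn (F n - T)) \<longlonglongrightarrow> 0"
proof -
  have est: "nrm (F m x - F n x) \<le> opn (F m - F n) * nrm x" if "x \<in> V" for m n x
    using opn_bound[of "F m - F n" x] that F by (simp add: op_apply)
  have lim: "\<exists>y\<in>V. (\<lambda>n. nrm (F n x - y)) \<longlonglongrightarrow> 0" if x: "x \<in> V" for x
  proof (rule complete[of "\<lambda>n. F n x"])
    show "F n x \<in> V" for n using F by simp
    show "\<exists>N. \<forall>m\<ge>N. \<forall>n\<ge>N. nrm (F m x - F n x) < e" if e: "e > 0" for e
    proof -
      have "e / (nrm x + 1) > 0" using e x by (simp add: add_nonneg_pos)
      then obtain N where N: "\<forall>m\<ge>N. \<forall>n\<ge>N. opn (F m - F n) < e / (nrm x + 1)" using cauchy by blast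
      have "nrm (F m x - F n x) < e" if "m \<ge> N" "n \<ge> N" for m n
      proof -
        have p: "nrm x + 1 > 0" using x by (simp add: add_nonneg_pos)
        have "nrm (F m x - F n x) \<le> opn (F m - F n) * (nrm x + 1)"
          using est[OF x, of m n] opn_ge0[of "F m - F n"] F by (simp add: distrib_left)
        also have "\<dots> < e" using N that p by (simp add: pos_less_divide_eq)
        finally show ?thesis .
      qed
      then show ?thesis by blast
    qed
  qed blast
  then obtain f where f: "\<And>x. x \<in> V \<Longrightarrow> f x \<in> V" "\<And>x. x \<in> V \<Longrightarrow> (\<lambda>n. nrm (F n x - f x)) \<longlonglongrightarrow> 0" by metis
  have uniq: "y = z" if "y \<in> V" "z \<in> V" "\<And>n. g n \<in> V" "(\<lambda>n. nrm (g n - y)) \<longlonglongrightarrow> 0" "(\<lambda>n. nrm (g n - z)) \<longlonglongrightarrow> 0" for y z and g :: "nat \<Rightarrow> 'v"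
  proof -
    have "(\<lambda>n. nrm (g n - y) + nrm (g n - z)) \<longlonglongrightarrow> 0 + 0" by (intro tendsto_add that)
    moreover have "nrm (y - z) \<le> nrm (g n - y) + nrm (g n - z)" for n
      using nrm_triangle3[of y "g n" z] nrm_minus_commute[of y "g n"] that by simp
    ultimately have "nrm (y - z) \<le> 0 + 0"
      by (intro tendsto_lowerbound) (auto intro!: always_eventually)
    then show ?thesis using that nrm_ge0[of "y - z"] nrm_eq_0[of "y - z"] by (simp add: order_antisym_conv)
  qed
  have close: "nrm (F n x - f x) \<le> e * nrm x"
    if N: "\<forall>m\<ge>N. \<forall>n\<ge>N. opn (F m - F n) < e" and n: "n \<ge> N" and x: "x \<in> V" for n N e x
  proof -
    have "(\<lambda>m. e * nrm x + nrm (F m x - f x)) \<longlonglongrightarrow> e * nrm x + 0" by (intro tendsto_intros f(2) x)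
    moreover have "\<forall>\<^sub>F m in sequentially. nrm (F n x - f x) \<le> e * nrm x + nrm (F m x - f x)"
    proof (rule eventually_sequentiallyI[of N])
      fix m assume m: "m \<ge> N"
      have "nrm (F n x - f x) \<le> nrm (F n x - F m x) + nrm (F m x - f x)"
        using nrm_triangle3[of "F n x" "F m x" "f x"] F f x by simp
      moreover have "opn (F n - F m) * nrm x \<le> e * nrm x"
        using N n m x by (intro mult_right_mono) (auto simp: less_imp_le)
      ultimately show "nrm (F n x - f x) \<le> e * nrm x + nrm (F m x - f x)" using est[OF x, of n m] by linarith
    qed
    ultimately have "nrm (F n x - f x) \<le> e * nrm x + 0" by (intro tendsto_lowerbound) auto
    then show ?thesis by simp
  qed
  define T where "T = (\<lambda>x. if x \<in> V then f x else 0)"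
  obtain N1 where N1: "\<forall>m\<ge>N1. \<forall>n\<ge>N1. opn (F m - F n) < 1" using cauchy[of 1] by auto
  have T: "T \<in> Bd"
  proof (rule bdI[where c="1 + opn (F N1)"])
    fix x y assume x: "x \<in> V" and y: "y \<in> V"
    have "f (x + y) = f x + f y"
    proof (rule uniq[of _ _ "\<lambda>n. F n (x + y)"])
      have l: "(\<lambda>n. nrm (F n x - f x) + nrm (F n y - f y)) \<longlonglongrightarrow> 0 + 0" by (intro tendsto_add f x y)
      show "(\<lambda>n. nrm (F n (x + y) - (f x + f y))) \<longlonglongrightarrow> 0"
      proof (rule tendsto_sandwich[of "\<lambda>_. 0"])
        show "\<forall>\<^sub>F n in sequentially. nrm (F n (x + y) - (f x + f y)) \<le> nrm (F n x - f x) + nrm (F n y - f y)"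
          using nrm_triangle[of "F _ x - f x" "F _ y - f y"] x y f F by (intro always_eventually) (simp add: bd_add add_diff_add)
        show "(\<lambda>n. nrm (F n x - f x) + nrm (F n y - f y)) \<longlonglongrightarrow> 0" using l by simp
      qed (use x y f F in \<open>auto intro!: always_eventually\<close>)
    qed (use x y f F in auto)
    then show "T (x + y) = T x + T y" using x y by (simp add: T_def)
  next
    fix c x assume x: "x \<in> V"
    have "f (sc c x) = sc c (f x)"
    proof (rule uniq[of _ _ "\<lambda>n. F n (sc c x)"])
      have "nrm (F n (sc c x) - sc c (f x)) = cmod c * nrm (F n x - f x)" for n
        using x f F by (simp add: bd_sc nrm_sc flip: vs.scale_right_diff_distrib)
      moreover have "(\<lambda>n. cmod c * nrm (F n x - f x)) \<longlonglongrightarrow> cmod c * 0" by (intro tendsto_intros f x)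
      ultimately show "(\<lambda>n. nrm (F n (sc c x) - sc c (f x))) \<longlonglongrightarrow> 0" by simp
    qed (use x f F in auto)
    then show "T (sc c x) = sc c (T x)" using x by (simp add: T_def)
  next
    fix x assume x: "x \<in> V"
    have "nrm (f x) \<le> nrm (f x - F N1 x) + nrm (F N1 x)" using nrm_triangle[of "f x - F N1 x" "F N1 x"] x f F by simp
    also have "nrm (f x - F N1 x) \<le> 1 * nrm x" using close[OF N1 order_refl x] nrm_minus_commute x f F by simp
    also have "nrm (F N1 x) \<le> opn (F N1) * nrm x" by (rule opn_bound[OF F x])
    finally show "nrm (T x) \<le> (1 + opn (F N1)) * nrm x" using x by (simp add: T_def algebra_simps)
  qed (use f in \<open>auto simp: T_def\<close>)
  have "(\<lambda>n. opn (F n - T)) \<longlonglongrightarrow> 0"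
  proof (rule LIMSEQ_I)
    fix r :: real assume r: "r > 0"
    obtain N where N: "\<forall>m\<ge>N. \<forall>n\<ge>N. opn (F m - F n) < r/2" using cauchy[of "r/2"] r by auto
    have "norm (opn (F n - T) - 0) < r" if n: "n \<ge> N" for n
    proof -
      have "opn (F n - T) \<le> r/2"
        by (rule opn_leI) (use r close[OF N n] in \<open>auto simp: op_apply T_def\<close>)
      then show ?thesis using opn_ge0[of "F n - T"] F T r by simp
    qed
    then show "\<exists>no. \<forall>n\<ge>no. norm (opn (F n - T) - 0) < r" by blast
  qed
  then show ?thesis using T by blast
qed

end

subsection \<open>A square root by iteration\<close>

text \<open>
  The common structure of a norm-closed *-algebra of operators and of a group algebra with its
  largest C*-seminorm.
\<close>

locale star_seminorm =
  fixes C :: "'a::ab_group_add set" and mul :: "'a \<Rightarrow> 'a \<Rightarrow> 'a" and star half :: "'a \<Rightarrow> 'a" and p :: "'a \<Rightarrow> real"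
  assumes zero: "0 \<in> C" and plus: "x \<in> C \<Longrightarrow> y \<in> C \<Longrightarrow> x + y \<in> C" and minus: "x \<in> C \<Longrightarrow> y \<in> C \<Longrightarrow> x - y \<in> C"
    and mul: "x \<in> C \<Longrightarrow> y \<in> C \<Longrightarrow> mul x y \<in> C" and star: "x \<in> C \<Longrightarrow> star x \<in> C" and half: "x \<in> C \<Longrightarrow> half x \<in> C"
    and mul_diff: "x \<in> C \<Longrightarrow> y \<in> C \<Longrightarrow> z \<in> C \<Longrightarrow> mul x (y - z) = mul x y - mul x z"
      "x \<in> C \<Longrightarrow> y \<in> C \<Longrightarrow> z \<in> C \<Longrightarrow> mul (y - z) x = mul y x - mul z x"
    and star_plus: "x \<in> C \<Longrightarrow> y \<in> C \<Longrightarrow> star (x + y) = star x + star y"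
    and star_diff: "x \<in> C \<Longrightarrow> y \<in> C \<Longrightarrow> star (x - y) = star x - star y"
    and star_mul: "x \<in> C \<Longrightarrow> y \<in> C \<Longrightarrow> star (mul x y) = mul (star y) (star x)"
    and star_star: "x \<in> C \<Longrightarrow> star (star x) = x"
    and star_half: "x \<in> C \<Longrightarrow> star (half x) = half (star x)"
    and half_diff: "x \<in> C \<Longrightarrow> y \<in> C \<Longrightarrow> half (x - y) = half x - half y"
    and p_ge0: "x \<in> C \<Longrightarrow> p x \<ge> 0" and p_zero: "p 0 = 0"
    and p_plus: "x \<in> C \<Longrightarrow> y \<in> C \<Longrightarrow> p (x + y) \<le> p x + p y"
    and p_diff: "x \<in> C \<Longrightarrow> y \<in> C \<Longrightarrow> p (x - y) \<le> p x + p y"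
    and p_mul: "x \<in> C \<Longrightarrow> y \<in> C \<Longrightarrow> p (mul x y) \<le> p x * p y"
    and p_star: "x \<in> C \<Longrightarrow> p (star x) \<le> p x"
    and p_half: "x \<in> C \<Longrightarrow> p (half x) \<le> p x / 2"
begin

text \<open>
  A fixed point \<open>b\<close> of the iteration solves \<open>2b = x\<^sup>*x + b\<^sup>2\<close>. The argument \<open>X\<close> is a sequence in order that \<open>x\<close> may also
  be an element of a completion, represented by a Cauchy sequence.
\<close>

primrec root_iter :: "(nat \<Rightarrow> 'a) \<Rightarrow> nat \<Rightarrow> 'a" where
  "root_iter X 0 = 0"
| "root_iter X (Suc n) = half (mul (star (X n)) (X n) + mul (root_iter X n) (root_iter X n))"

lemma root_iter_C: "(\<And>n. X n \<in> C) \<Longrightarrow> root_iter X n \<in> C"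
  by (induction n) (auto simp: zero half plus mul star)

lemma star_zero: "star 0 = 0"
  using star_diff[OF zero zero] by simp

lemma root_iter_star: "(\<And>n. X n \<in> C) \<Longrightarrow> star (root_iter X n) = root_iter X n"
  by (induction n) (auto simp: star_zero star_half star_plus star_mul star_star root_iter_C plus mul star)

text \<open>
  With \<open>r = (\<rho>\<^sup>2 + r\<^sup>2)/2 < 1\<close> the iteration stays in the ball of radius \<open>r\<close>, where
  \<open>y \<mapsto> y\<^sup>2/2\<close> is a contraction with factor \<open>r\<close>.
\<close>

lemma root_iter_cauchy:
  assumes X: "\<And>n. X n \<in> C" and bound: "\<And>n. p (X n) \<le> \<rho>" "\<rho> < 1"
    and cauchy: "\<And>e. e > 0 \<Longrightarrow> \<exists>N. \<forall>m\<ge>N. \<forall>n\<ge>N. p (X m - X n) < e"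
    and e: "e > 0"
  shows "\<exists>N. \<forall>m\<ge>N. \<forall>n\<ge>N. p (root_iter X m - root_iter X n) < e"
proof -
  have \<rho>0: "\<rho> \<ge> 0" using bound(1)[of 0] p_ge0[OF X, of 0] by linarith
  have \<rho>2: "\<rho>\<^sup>2 < 1" using \<rho>0 bound(2) by (simp add: power_less_one_iff abs_square_less_1)
  define r where "r = 1 - sqrt (1 - \<rho>\<^sup>2)"
  have r: "r < 1" "r \<ge> 0" using \<rho>2 by (auto simp: r_def)
  have "(sqrt (1 - \<rho>\<^sup>2))\<^sup>2 = 1 - \<rho>\<^sup>2" using \<rho>2 by simp
  then have req: "\<rho>\<^sup>2 + r\<^sup>2 = 2 * r" by (simp add: r_def power2_diff)
  let ?Y = "root_iter X"
  have Y: "?Y n \<in> C" for n using root_iter_C X by blast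
  have sX: "star (X n) \<in> C" "mul (star (X n)) (X n) \<in> C" for n using X by (auto simp: star mul)
  have YY: "mul (?Y n) (?Y n) \<in> C" for n using Y by (simp add: mul)
  have Yr: "p (?Y n) \<le> r" for n
  proof (induction n)
    case 0 then show ?case using r by (simp add: p_zero)
  next
    case (Suc n)
    have "p (mul (star (X n)) (X n)) \<le> p (star (X n)) * p (X n)" using p_mul sX X by blast
    also have "\<dots> \<le> \<rho> * \<rho>" using p_star[OF X, of n] bound(1)[of n] p_ge0[OF X] p_ge0[OF sX(1)] \<rho>0 by (intro mult_mono) auto
    finally have 1: "p (mul (star (X n)) (X n)) \<le> \<rho>\<^sup>2" by (simp add: power2_eq_square)
    have "p (mul (?Y n) (?Y n)) \<le> p (?Y n) * p (?Y n)" by (rule p_mul[OF Y Y])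
    also have "\<dots> \<le> r * r" using Suc p_ge0[OF Y] r by (intro mult_mono) auto
    finally have 2: "p (mul (?Y n) (?Y n)) \<le> r\<^sup>2" by (simp add: power2_eq_square)
    show ?case using p_half[OF plus[OF sX(2) YY], of n n] p_plus[OF sX(2) YY, of n n] 1 2 req by simp
  qed
  have step: "p (?Y (Suc m) - ?Y (Suc n)) \<le> \<rho> * p (X m - X n) + r * p (?Y m - ?Y n)" for m n
  proof -
    have sq: "p (mul a' a - mul b' b) \<le> c * (p (a - b) + p (a' - b'))"
      if "a \<in> C" "b \<in> C" "a' \<in> C" "b' \<in> C" "p a' \<le> c" "p b \<le> c" for a b a' b' c
    proof -
      have eq: "mul a' a - mul b' b = mul a' (a - b) + mul (a' - b') b"
        using that by (simp add: mul_diff)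
      have "p (mul a' a - mul b' b) \<le> p (mul a' (a - b)) + p (mul (a' - b') b)"
        unfolding eq using that by (intro p_plus mul minus)
      moreover have "p (mul a' (a - b)) \<le> p a' * p (a - b)" using that by (intro p_mul minus)
      moreover have "p a' * p (a - b) \<le> c * p (a - b)" using that by (intro mult_right_mono p_ge0 minus)
      moreover have "p (mul (a' - b') b) \<le> p (a' - b') * p b" using that by (intro p_mul minus)
      moreover have "p (a' - b') * p b \<le> p (a' - b') * c" using that by (intro mult_left_mono p_ge0 minus)
      ultimately show ?thesis by (simp add: algebra_simps)
    qed
    have s: "p (star (X m) - star (X n)) \<le> p (X m - X n)"
      using p_star[OF minus[OF X X], of m n] X by (simp add: star_diff)
    define A B where "A = mul (star (X m)) (X m) - mul (star (X n)) (X n)"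
      and "B = mul (?Y m) (?Y m) - mul (?Y n) (?Y n)"
    have AB: "A \<in> C" "B \<in> C" unfolding A_def B_def using sX YY by (auto intro: minus)
    have eq: "?Y (Suc m) - ?Y (Suc n) = half (A + B)"
      using half_diff[OF plus[OF sX(2) YY] plus[OF sX(2) YY], of m m n n] by (simp add: A_def B_def algebra_simps)
    have "p (?Y (Suc m) - ?Y (Suc n)) \<le> p (A + B) / 2" unfolding eq using AB by (intro p_half plus)
    moreover have "p (A + B) \<le> p A + p B" using AB by (rule p_plus)
    moreover have "p A \<le> \<rho> * (p (X m - X n) + p (star (X m) - star (X n)))" unfolding A_def
      using p_star[OF X, of m] bound(1)[of m] bound(1)[of n] by (intro sq X sX) auto
    moreover have "\<dots> \<le> \<rho> * (p (X m - X n) + p (X m - X n))" using s \<rho>0 by (intro mult_left_mono) auto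
    moreover have "p B \<le> r * (p (?Y m - ?Y n) + p (?Y m - ?Y n))" unfolding B_def
      by (intro sq Y Yr)
    ultimately show ?thesis by (simp add: algebra_simps)
  qed
  define \<delta> where "\<delta> = e * (1 - r) / 2"
  have \<delta>: "\<delta> > 0" using e r by (simp add: \<delta>_def)
  then obtain N where N: "\<forall>m\<ge>N. \<forall>n\<ge>N. p (X m - X n) < \<delta>" using cauchy by blast
  have iter: "p (?Y (m + k) - ?Y (n + k)) \<le> e / 2 + 2 * r ^ k" if "m \<ge> N" "n \<ge> N" for m n k
  proof (induction k)
    case 0
    have "p (?Y m - ?Y n) \<le> p (?Y m) + p (?Y n)" by (rule p_diff[OF Y Y])
    then show ?case using Yr[of m] Yr[of n] r e by simp
  next
    case (Suc k)
    have "p (?Y (m + Suc k) - ?Y (n + Suc k)) \<le> \<rho> * p (X (m+k) - X (n+k)) + r * p (?Y (m+k) - ?Y (n+k))"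
      using step[of "m+k" "n+k"] by simp
    also have "\<dots> \<le> 1 * \<delta> + r * (e / 2 + 2 * r ^ k)"
      using N[rule_format, of "m+k" "n+k"] that Suc r \<rho>0 bound(2) p_ge0[OF minus[OF X X], of "m+k" "n+k"] p_ge0[OF minus[OF Y Y], of "m+k" "n+k"]
      by (intro add_mono mult_mono) auto
    also have "\<dots> = e / 2 + 2 * r ^ Suc k" by (simp add: \<delta>_def algebra_simps add_divide_distrib diff_divide_distrib)
    finally show ?case .
  qed
  have "(\<lambda>k. 2 * r ^ k) \<longlonglongrightarrow> 2 * 0" using r by (intro tendsto_intros LIMSEQ_realpow_zero) auto
  then have "(\<lambda>k. 2 * r ^ k) \<longlonglongrightarrow> 0" by simp
  then have "eventually (\<lambda>k. 2 * r ^ k < e / 2) sequentially" by (rule order_tendstoD) (use e in simp)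
  then obtain k where k: "2 * r ^ k < e / 2" by (auto simp: eventually_sequentially)
  have "p (?Y m - ?Y n) < e" if "m \<ge> N + k" "n \<ge> N + k" for m n
  proof -
    have "N \<le> m - k" "N \<le> n - k" "m - k + k = m" "n - k + k = n" using that by linarith+
    then show ?thesis using iter[of "m - k" "n - k" k] k by simp
  qed
  then show ?thesis by blast
qed

end

subsection \<open>Concrete C*-algebras\<close>

context hilbert
begin

lemma op_cstar_subalgebra_facts:
  assumes "op_cstar_subalgebra H A"
  shows "A \<subseteq> Bd" "(\<lambda>x. 0) \<in> A" "\<And>S T. S \<in> A \<Longrightarrow> T \<in> A \<Longrightarrow> S + T \<in> A" "\<And>S T. S \<in> A \<Longrightarrow> T \<in> A \<Longrightarrow> S \<circ> T \<in> A"
    "\<And>c T. T \<in> A \<Longrightarrow> scale_op H c T \<in> A" "\<And>T. T \<in> A \<Longrightarrow> adj T \<in> A"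
    "\<And>F T. T \<in> Bd \<Longrightarrow> (\<And>n::nat. F n \<in> A) \<Longrightarrow> (\<lambda>n. opn (F n - T)) \<longlonglongrightarrow> 0 \<Longrightarrow> T \<in> A"
  using assms unfolding op_cstar_subalgebra_def by blast+

lemma op_cstar_subalgebra_Bd: "op_cstar_subalgebra H Bd"
  by (auto simp: op_cstar_subalgebra_def)

lemma op_cstar_generated_subalgebra:
  assumes "G \<subseteq> Bd" shows "op_cstar_subalgebra H (acarrier (op_cstar_generated H G))"
  unfolding op_cstar_subalgebra_def
proof (intro conjI ballI allI impI)
  let ?A = "acarrier (op_cstar_generated H G)"
  have A: "T \<in> ?A \<longleftrightarrow> (\<forall>A. op_cstar_subalgebra H A \<and> G \<subseteq> A \<longrightarrow> T \<in> A)" for T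
    by (auto simp: op_cstar_generated_def)
  show sub: "?A \<subseteq> Bd" using A op_cstar_subalgebra_Bd assms by blast
  show "(\<lambda>x. 0) \<in> ?A" unfolding A using op_cstar_subalgebra_facts(2) by blast
  show "S + T \<in> ?A" "S \<circ> T \<in> ?A" if "S \<in> ?A" "T \<in> ?A" for S T
    using that op_cstar_subalgebra_facts(3,4) unfolding A by blast+
  show "scale_op H c T \<in> ?A" if "T \<in> ?A" for c T using that op_cstar_subalgebra_facts(5) unfolding A by blast
  show "adj T \<in> ?A" if "T \<in> ?A" for T using that op_cstar_subalgebra_facts(6) unfolding A by blast
  show "T \<in> ?A" if "T \<in> Bd" "(\<forall>n::nat. F n \<in> ?A) \<and> (\<lambda>n. opn (F n - T)) \<longlonglongrightarrow> 0" for F T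
    unfolding A
  proof (intro allI impI)
    fix B assume B: "op_cstar_subalgebra H B \<and> G \<subseteq> B"
    then have "\<And>n. F n \<in> B" using that(2) A by blast
    then show "T \<in> B" using op_cstar_subalgebra_facts(7)[of B T F] B that by blast
  qed
qed

lemma star_seminorm_operators:
  assumes "op_cstar_subalgebra H A"
  shows "star_seminorm A (\<circ>) adj (scale_op H (1/2)) opn"
proof -
  note Af = op_cstar_subalgebra_facts[OF assms]
  have B: "x \<in> Bd" if "x \<in> A" for x using that Af by auto
  have min: "x - y \<in> A" if "x \<in> A" "y \<in> A" for x y
    using Af(3)[OF that(1) Af(5)[OF that(2), of "-1"]] by (simp add: scale_op_minus1)
  have zero: "(0 :: 'v \<Rightarrow> 'v) = (\<lambda>x. 0)" by (simp add: zero_fun_def)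
  have adjm: "adj (- y) = - adj y" if "y \<in> Bd" for y
    using adj_scale[OF that, of "-1"] by (simp add: scale_op_minus1)
  show ?thesis
  proof (unfold_locales, goal_cases)
    case 1 then show ?case using Af zero by simp
  next
    case (7 x y z) then show ?case using B by (auto simp: fun_eq_iff op_apply bd_diff)
  next
    case (8 x y z) then show ?case by (auto simp: fun_eq_iff op_apply)
  next
    case (9 x y) then show ?case using B by (simp add: adj_plus)
  next
    case (10 x y) then show ?case using B adj_plus[of x "-y"] by (simp add: adjm)
  next
    case (11 x y) then show ?case using B by (simp add: adj_comp)
  next
    case (13 x) then show ?case using B by (simp add: adj_scale)
  next
    case (14 x y) then show ?case by (auto simp: fun_eq_iff op_apply vs.scale_right_diff_distrib)
  next
    case 16
    have "opn (\<lambda>x. 0) \<le> 0" by (rule opn_leI) auto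
    then show ?case using opn_ge0[OF bd_zero] unfolding zero by linarith
  next
    case (18 x y) then show ?case using opn_triangle[of x "-y"] B by (simp add: opn_minus)
  next
    case (21 x) then show ?case using opn_scale_le[of x "1/2"] B by simp
  qed (auto simp: Af min B opn_ge0 opn_triangle opn_comp opn_adj)
qed

end

text \<open>
  A representation of a norm-closed *-algebra of operators is contractive: below norm \<open>1\<close> the
  iteration converges to a \<open>b\<close> as required above.
\<close>

locale concrete_representation = K: hilbert K + hilbert H
  for K :: "'w::ab_group_add hilbert" and H :: "'v::ab_group_add hilbert" +
  fixes A :: "('w \<Rightarrow> 'w) set" and \<pi> :: "('w \<Rightarrow> 'w) \<Rightarrow> 'v \<Rightarrow> 'v"
  assumes A: "op_cstar_subalgebra K A"
    and \<pi>: "representation \<lparr>acarrier = A, aadd = (+), ascale = scale_op K, amult = (\<circ>), astar = adjoint_op K\<rparr> H \<pi>"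
begin

lemmas Af = K.op_cstar_subalgebra_facts[OF A]

lemma \<pi>_facts: "a \<in> A \<Longrightarrow> \<pi> a \<in> Bd" "a \<in> A \<Longrightarrow> b \<in> A \<Longrightarrow> \<pi> (a + b) = \<pi> a + \<pi> b"
  "a \<in> A \<Longrightarrow> \<pi> (scale_op K c a) = scale_op H c (\<pi> a)" "a \<in> A \<Longrightarrow> b \<in> A \<Longrightarrow> \<pi> (a \<circ> b) = \<pi> a \<circ> \<pi> b"
  "a \<in> A \<Longrightarrow> \<pi> (adjoint_op K a) = adj (\<pi> a)"
  using rep_bd[OF \<pi>] rep_add[OF \<pi>] rep_scale[OF \<pi>] rep_mult[OF \<pi>] rep_star[OF \<pi>] by simp_all

lemma contractive_below_1:
  assumes a: "a \<in> A" "op_norm K a < 1" and \<xi>: "\<xi> \<in> V"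
  shows "nrm (\<pi> a \<xi>) \<le> nrm \<xi>"
proof -
  interpret S: star_seminorm A "(\<circ>)" "adjoint_op K" "scale_op K (1/2)" "op_norm K"
    by (rule K.star_seminorm_operators[OF A])
  define Y where "Y = S.root_iter (\<lambda>n. a)"
  have YA: "Y n \<in> A" and Ystar: "adjoint_op K (Y n) = Y n" for n
    using S.root_iter_C[of "\<lambda>n. a"] S.root_iter_star[of "\<lambda>n. a"] a by (auto simp: Y_def)
  have YB: "Y n \<in> K.Bd" for n using YA Af by auto
  have cauchy: "\<exists>N. \<forall>m\<ge>N. \<forall>n\<ge>N. op_norm K (Y m - Y n) < e" if "e > 0" for e
    unfolding Y_def by (rule S.root_iter_cauchy[OF _ _ a(2)]) (use a that S.p_zero in auto)
  obtain b where b: "b \<in> K.Bd" "(\<lambda>n. op_norm K (Y n - b)) \<longlonglongrightarrow> 0"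
    using K.bd_complete[OF YB cauchy] by blast
  have bA: "b \<in> A" using Af(7)[of b Y] b YA by blast
  have Yx: "(\<lambda>n. hnorm K (Y n x - b x)) \<longlonglongrightarrow> 0" if x: "x \<in> K.V" for x
  proof (rule tendsto_sandwich[of "\<lambda>_. 0"])
    show "\<forall>\<^sub>F n in sequentially. hnorm K (Y n x - b x) \<le> op_norm K (Y n - b) * hnorm K x"
      using K.opn_bound[of "Y _ - b" x] YB b x by (intro always_eventually) (simp add: op_apply)
    show "(\<lambda>n. op_norm K (Y n - b) * hnorm K x) \<longlonglongrightarrow> 0" using tendsto_mult_right[OF b(2), of "hnorm K x"] by simp
  qed (use YB b in \<open>auto intro!: always_eventually\<close>)
  have unique: "T = S" if "S \<in> K.Bd" "T \<in> K.Bd" and lim: "(\<lambda>n. op_norm K (F n - T)) \<longlonglongrightarrow> 0" "(\<lambda>n. op_norm K (F n - S)) \<longlonglongrightarrow> 0"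
    and F: "\<And>n::nat. F n \<in> K.Bd" for F S T
  proof -
    have "(\<lambda>n. op_norm K (F n - T) + op_norm K (F n - S)) \<longlonglongrightarrow> 0 + 0" by (intro tendsto_add lim)
    moreover have "op_norm K (S - T) \<le> op_norm K (F n - T) + op_norm K (F n - S)" for n
    proof -
      have eq: "S - T = (F n - T) + - (F n - S)" by simp
      have "op_norm K (S - T) \<le> op_norm K (F n - T) + op_norm K (- (F n - S))"
        unfolding eq using that by (intro K.opn_triangle) auto
      then show ?thesis using K.opn_minus[of "F n - S"] that by simp
    qed
    ultimately have "op_norm K (S - T) \<le> 0 + 0"
      by (intro tendsto_lowerbound) (auto intro!: always_eventually)
    then have "hnorm K (S x - T x) \<le> 0" if "x \<in> K.V" for x
      using K.opn_bound[of "S - T" x] \<open>S \<in> _\<close> \<open>T \<in> _\<close> that mult_right_mono[of "op_norm K (S - T)" 0 "hnorm K x"] by (simp add: op_apply)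
    then show ?thesis using that(1,2) by (intro K.bd_eqI) (auto simp: order_antisym_conv)
  qed
  have "adjoint_op K b = b"
  proof (rule unique[of _ _ Y])
    have "op_norm K (Y n - adjoint_op K b) \<le> op_norm K (Y n - b)" for n
      using K.opn_adj[of "Y n - b"] S.star_diff[OF YA bA, of n] YB b Ystar by simp
    then show "(\<lambda>n. op_norm K (Y n - adjoint_op K b)) \<longlonglongrightarrow> 0"
      by (intro tendsto_sandwich[OF _ _ tendsto_const b(2)]) (use YB b K.opn_ge0 in \<open>auto intro!: always_eventually\<close>)
  qed (use b YB in auto)
  define c where "c = scale_op K (1/2) ((adjoint_op K a \<circ> a) + (b \<circ> b))"
  have aB: "a \<in> K.Bd" using a Af by auto
  have cB: "c \<in> K.Bd" using aB b by (simp add: c_def)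
  have bc: "b = c"
  proof (rule unique[of _ _ "\<lambda>n. Y (Suc n)"])
    show "(\<lambda>n. op_norm K (Y (Suc n) - b)) \<longlonglongrightarrow> 0" using LIMSEQ_Suc[OF b(2)] .
    have "op_norm K (Y (Suc n) - c) \<le> 1/2 * ((op_norm K (Y n - b) + op_norm K b) * op_norm K (Y n - b) + op_norm K (Y n - b) * op_norm K b)" for n
    proof -
      define D where "D = Y n - b"
      have DB: "D \<in> K.Bd" using YB b by (simp add: D_def)
      have eq: "Y (Suc n) - c = scale_op K (1/2) ((Y n \<circ> D) + (D \<circ> b))"
      proof
        fix x
        have "(Y n \<circ> D) x + (D \<circ> b) x = Y n (Y n x) - b (b x)"
          using YB b by (simp add: D_def op_apply K.bd_diff)
        moreover have "(Y (Suc n) - c) x = hscale K (1/2) (Y n (Y n x) - b (b x))"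
          unfolding Y_def c_def by (simp add: op_apply K.vs.scale_right_diff_distrib K.vs.scale_right_distrib)
        ultimately show "(Y (Suc n) - c) x = scale_op K (1/2) ((Y n \<circ> D) + (D \<circ> b)) x" by (simp add: op_apply)
      qed
      have "op_norm K (Y (Suc n) - c) \<le> cmod (1/2) * op_norm K ((Y n \<circ> D) + (D \<circ> b))"
        unfolding eq using YB b DB by (intro K.opn_scale_le) auto
      moreover have "op_norm K ((Y n \<circ> D) + (D \<circ> b)) \<le> op_norm K (Y n \<circ> D) + op_norm K (D \<circ> b)"
        using YB b DB by (intro K.opn_triangle) auto
      moreover have "op_norm K (Y n \<circ> D) \<le> op_norm K (Y n) * op_norm K D" "op_norm K (D \<circ> b) \<le> op_norm K D * op_norm K b"
        using YB b DB by (intro K.opn_comp; simp)+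
      moreover have "op_norm K (Y n) * op_norm K D \<le> (op_norm K D + op_norm K b) * op_norm K D"
        using K.opn_triangle[OF DB b(1)] K.opn_ge0[OF DB] by (intro mult_right_mono) (auto simp: D_def)
      ultimately show ?thesis unfolding D_def[symmetric] by simp
    qed
    note est = this
    have lim: "(\<lambda>n. 1/2 * ((op_norm K (Y n - b) + op_norm K b) * op_norm K (Y n - b) + op_norm K (Y n - b) * op_norm K b)) \<longlonglongrightarrow> 1/2 * ((0 + op_norm K b) * 0 + 0 * op_norm K b)"
      by (intro tendsto_intros b(2))
    have lower: "0 \<le> op_norm K (Y (Suc n) - c)" for n using YB cB by (intro K.opn_ge0 K.bd_minus_op)
    show "(\<lambda>n. op_norm K (Y (Suc n) - c)) \<longlonglongrightarrow> 0"
    proof (rule tendsto_sandwich[OF _ _ tendsto_const])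
      show "\<forall>\<^sub>F n in sequentially. 0 \<le> op_norm K (Y (Suc n) - c)" using lower by (rule always_eventually[OF allI])
      show "\<forall>\<^sub>F n in sequentially. op_norm K (Y (Suc n) - c) \<le> 1/2 * ((op_norm K (Y n - b) + op_norm K b) * op_norm K (Y n - b) + op_norm K (Y n - b) * op_norm K b)"
        using est by (rule always_eventually[OF allI])
      show "(\<lambda>n. 1/2 * ((op_norm K (Y n - b) + op_norm K b) * op_norm K (Y n - b) + op_norm K (Y n - b) * op_norm K b)) \<longlonglongrightarrow> 0"
        using lim by simp
    qed
  qed (use b cB YB in auto)
  have "b + b = (adjoint_op K a \<circ> a) + (b \<circ> b)"
  proof -
    have "c + c = (adjoint_op K a \<circ> a) + (b \<circ> b)"
      unfolding c_def by (auto simp: fun_eq_iff op_apply K.vs.scale_left_distrib[symmetric])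
    then show ?thesis by (simp flip: bc)
  qed
  then show ?thesis
    using \<open>adjoint_op K b = b\<close> a bA Af by (intro rep_contractive_if_root[OF \<pi>, of a b] \<xi>) auto
qed

theorem contractive:
  assumes a: "a \<in> A" and \<xi>: "\<xi> \<in> V"
  shows "nrm (\<pi> a \<xi>) \<le> op_norm K a * nrm \<xi>"
proof (rule field_le_epsilon)
  fix e :: real assume e: "e > 0"
  have aB: "a \<in> K.Bd" using a Af by auto
  have n0: "nrm \<xi> \<ge> 0" using \<xi> by simp
  define t where "t = op_norm K a + e / (nrm \<xi> + 1)"
  have t: "t > op_norm K a" "t > 0" using e n0 K.opn_ge0[OF aB] by (auto simp: t_def add_nonneg_pos)
  define s where "s = complex_of_real (inverse t)"
  have "op_norm K (scale_op K s a) \<le> inverse t * op_norm K a"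
    using K.opn_scale_le[OF aB, of s] t by (simp add: s_def norm_inverse)
  also have "\<dots> < 1" using t by (simp add: field_simps)
  finally have "nrm (\<pi> (scale_op K s a) \<xi>) \<le> nrm \<xi>" using Af a \<xi> by (intro contractive_below_1) auto
  then have "inverse t * nrm (\<pi> a \<xi>) \<le> nrm \<xi>"
    using a \<xi> t \<pi>_facts(1)[OF a] by (simp add: \<pi>_facts(3) op_apply nrm_sc s_def norm_inverse)
  then have "nrm (\<pi> a \<xi>) \<le> t * nrm \<xi>" using t by (simp add: field_simps)
  also have "\<dots> = op_norm K a * nrm \<xi> + e * (nrm \<xi> / (nrm \<xi> + 1))" by (simp add: t_def algebra_simps)
  also have "nrm \<xi> / (nrm \<xi> + 1) \<le> 1" using n0 by simp
  finally show "nrm (\<pi> a \<xi>) \<le> op_norm K a * nrm \<xi> + e" using e n0 by (simp add: mult_left_le)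
qed

end

text \<open>By continuity, commuting with the images of generators and their adjoints suffices.\<close>

lemma (in hilbert) commutes_if_commutes_generators:
  assumes K: "hilbert K" and G: "G \<subseteq> bounded_ops K"
    and \<pi>: "representation (op_cstar_generated K G) H \<pi>"
    and T: "T \<in> Bd" and comm: "\<And>g. g \<in> G \<Longrightarrow> T \<circ> \<pi> g = \<pi> g \<circ> T \<and> T \<circ> adj (\<pi> g) = adj (\<pi> g) \<circ> T"
    and a: "a \<in> acarrier (op_cstar_generated K G)"
  shows "T \<circ> \<pi> a = \<pi> a \<circ> T"
proof -
  interpret K: hilbert K by (rule K)
  define A where "A = acarrier (op_cstar_generated K G)"
  have Aalg: "op_cstar_subalgebra K A" unfolding A_def by (rule K.op_cstar_generated_subalgebra[OF G])
  have gen: "op_cstar_generated K G = \<lparr>acarrier = A, aadd = (+), ascale = scale_op K, amult = (\<circ>), astar = adjoint_op K\<rparr>"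
    by (simp add: A_def op_cstar_generated_def)
  interpret concrete_representation K H A \<pi>
    by unfold_locales (use Aalg \<pi> gen in auto)
  have GA: "G \<subseteq> A" by (auto simp: A_def op_cstar_generated_def)
  define C where "C = {a \<in> A. T \<circ> \<pi> a = \<pi> a \<circ> T \<and> T \<circ> adj (\<pi> a) = adj (\<pi> a) \<circ> T}"
  have lim: "T \<circ> \<pi> a = \<pi> a \<circ> T" if F: "\<And>n::nat. F n \<in> A" "\<And>n. T \<circ> \<pi> (F n) = \<pi> (F n) \<circ> T" and a: "a \<in> A"
    and l: "(\<lambda>n. op_norm K (F n - a)) \<longlonglongrightarrow> 0" for F a
  proof (rule bd_eqI)
    fix \<xi> assume \<xi>: "\<xi> \<in> V"
    obtain c where c: "c > 0" "\<And>x. x \<in> V \<Longrightarrow> nrm (T x) \<le> c * nrm x" using bd_bound[OF T] by blast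
    have \<pi>B: "\<pi> a \<in> Bd" "\<pi> (F n) \<in> Bd" for n using F a \<pi>_facts by auto
    have est: "nrm (T (\<pi> a \<xi>) - \<pi> a (T \<xi>)) \<le> (c * nrm \<xi> + nrm (T \<xi>)) * op_norm K (F n - a)" for n
    proof -
      have dA: "F n - a \<in> A" using Af(3)[OF F(1)[of n] Af(5)[OF a, of "-1"]] by (simp add: K.scale_op_minus1)
      have d: "\<pi> (F n - a) = \<pi> (F n) - \<pi> a"
        using \<pi>_facts(2)[OF dA a] by (simp add: fun_eq_iff op_apply)
      have e: "nrm (\<pi> (F n) x - \<pi> a x) \<le> op_norm K (F n - a) * nrm x" if "x \<in> V" for x
        using contractive[OF dA that] by (simp add: d op_apply)
      have "T (\<pi> (F n) \<xi>) = \<pi> (F n) (T \<xi>)" using F(2)[of n] by (metis comp_apply)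
      then have eq: "T (\<pi> a \<xi>) - \<pi> a (T \<xi>) = (\<pi> (F n) (T \<xi>) - \<pi> a (T \<xi>)) - T (\<pi> (F n) \<xi> - \<pi> a \<xi>)"
        using \<pi>B T \<xi> by (simp add: bd_diff[OF T])
      have "nrm (T (\<pi> a \<xi>) - \<pi> a (T \<xi>)) \<le> nrm (\<pi> (F n) (T \<xi>) - \<pi> a (T \<xi>)) + nrm (T (\<pi> (F n) \<xi> - \<pi> a \<xi>))"
        unfolding eq using \<pi>B T \<xi> by (intro nrm_triangle_diff) auto
      moreover have "nrm (\<pi> (F n) (T \<xi>) - \<pi> a (T \<xi>)) \<le> op_norm K (F n - a) * nrm (T \<xi>)" using T by (intro e) simp
      moreover have "nrm (T (\<pi> (F n) \<xi> - \<pi> a \<xi>)) \<le> c * nrm (\<pi> (F n) \<xi> - \<pi> a \<xi>)" using \<pi>B by (intro c) simp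
      moreover have "c * nrm (\<pi> (F n) \<xi> - \<pi> a \<xi>) \<le> c * (op_norm K (F n - a) * nrm \<xi>)" using e[OF \<xi>] c by simp
      ultimately have "nrm (T (\<pi> a \<xi>) - \<pi> a (T \<xi>)) \<le> op_norm K (F n - a) * nrm (T \<xi>) + c * (op_norm K (F n - a) * nrm \<xi>)"
        by linarith
      also have "\<dots> = (c * nrm \<xi> + nrm (T \<xi>)) * op_norm K (F n - a)" by (simp add: distrib_right distrib_left mult_ac)
      finally show ?thesis .
    qed
    have "nrm (T (\<pi> a \<xi>) - \<pi> a (T \<xi>)) \<le> (c * nrm \<xi> + nrm (T \<xi>)) * 0"
    proof (rule tendsto_lowerbound)
      show "(\<lambda>n. (c * nrm \<xi> + nrm (T \<xi>)) * op_norm K (F n - a)) \<longlonglongrightarrow> (c * nrm \<xi> + nrm (T \<xi>)) * 0"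
        by (intro tendsto_intros l)
    qed (use est in auto)
    moreover have dV: "T (\<pi> a \<xi>) - \<pi> a (T \<xi>) \<in> V" using \<pi>B T by simp
    ultimately have "nrm (T (\<pi> a \<xi>) - \<pi> a (T \<xi>)) = 0" using nrm_ge0[OF dV] by linarith
    then show "(T \<circ> \<pi> a) \<xi> = (\<pi> a \<circ> T) \<xi>" using nrm_eq_0[OF dV] by simp
  qed (use T a \<pi>_facts in auto)
  have TT: "T (x + y) = T x + T y" "T (sc c x) = sc c (T x)" if "x \<in> V" "y \<in> V" for x y c
    using that bd_add[OF T] bd_sc[OF T] by auto
  have "op_cstar_subalgebra K C"
    unfolding op_cstar_subalgebra_def
  proof (intro conjI ballI allI impI)
    show "C \<subseteq> K.Bd" using Af by (auto simp: C_def)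
    have "\<pi> (\<lambda>x. 0) = \<pi> (scale_op K 0 (\<lambda>x. 0))" by (simp add: scale_op_def)
    also have "\<dots> = (\<lambda>x. 0)" using Af(2) by (simp add: \<pi>_facts) (simp add: scale_op_def)
    finally have "\<pi> (\<lambda>x. 0) = (\<lambda>x. 0)" .
    then show "(\<lambda>x. 0) \<in> C" using Af(2) bd_0[OF T] by (simp add: C_def comp_def)
    show "S + S' \<in> C" "S \<circ> S' \<in> C" if S: "S \<in> C" and S': "S' \<in> C" for S S'
    proof -
      have SA: "S \<in> A" "S' \<in> A" and B: "\<pi> S \<in> Bd" "\<pi> S' \<in> Bd" using S S' \<pi>_facts by (auto simp: C_def)
      have cm: "T (\<pi> S x) = \<pi> S (T x)" "T (adj (\<pi> S) x) = adj (\<pi> S) (T x)"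
        "T (\<pi> S' x) = \<pi> S' (T x)" "T (adj (\<pi> S') x) = adj (\<pi> S') (T x)" for x
        using S S' unfolding C_def by (metis (mono_tags, lifting) comp_apply mem_Collect_eq)+
      show "S + S' \<in> C" using SA Af(3) B cm
        by (auto simp: C_def \<pi>_facts adj_plus fun_eq_iff op_apply bd_add[OF T])
      show "S \<circ> S' \<in> C" using SA Af(4) B cm
        by (auto simp: C_def \<pi>_facts adj_comp fun_eq_iff)
    qed
    show "scale_op K c S \<in> C" if S: "S \<in> C" for c S
    proof -
      have SA: "S \<in> A" and B: "\<pi> S \<in> Bd" using S \<pi>_facts by (auto simp: C_def)
      have cm: "T (\<pi> S x) = \<pi> S (T x)" "T (adj (\<pi> S) x) = adj (\<pi> S) (T x)" for x
        using S unfolding C_def by (metis (mono_tags, lifting) comp_apply mem_Collect_eq)+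
      show ?thesis using SA Af(5) B cm
        by (auto simp: C_def \<pi>_facts adj_scale fun_eq_iff op_apply bd_sc[OF T])
    qed
    show "adjoint_op K S \<in> C" if "S \<in> C" for S
      using that Af(6) \<pi>_facts(1)[of S] by (auto simp: C_def \<pi>_facts)
    show "S \<in> C" if S: "S \<in> K.Bd" and F: "(\<forall>n::nat. F n \<in> C) \<and> (\<lambda>n. op_norm K (F n - S)) \<longlonglongrightarrow> 0" for F S
    proof -
      have FA: "F n \<in> A" for n using F by (auto simp: C_def)
      have FB: "F n \<in> K.Bd" for n using FA Af by auto
      have SA: "S \<in> A" using Af(7)[of S F] S FA F by blast
      have 1: "T \<circ> \<pi> S = \<pi> S \<circ> T" by (rule lim[of F]) (use F SA in \<open>auto simp: C_def\<close>)
      have 2: "T \<circ> \<pi> (adjoint_op K S) = \<pi> (adjoint_op K S) \<circ> T"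
      proof (rule lim[of "\<lambda>n. adjoint_op K (F n)"])
        show "T \<circ> \<pi> (adjoint_op K (F n)) = \<pi> (adjoint_op K (F n)) \<circ> T" for n
          using F FA \<pi>_facts(5) by (auto simp: C_def)
        have "adjoint_op K (F n) - adjoint_op K S = adjoint_op K (F n - S)" for n
          using star_seminorm.star_diff[OF K.star_seminorm_operators[OF A] FA SA, of n] by simp
        then have le: "op_norm K (adjoint_op K (F n) - adjoint_op K S) \<le> op_norm K (F n - S)" for n
          using K.opn_adj[OF K.bd_minus_op[OF FB S], of n] by simp
        have ge: "0 \<le> op_norm K (adjoint_op K (F n) - adjoint_op K S)" for n
          by (intro K.opn_ge0 K.bd_minus_op K.adj_bd FB S)
        have Fl: "(\<lambda>n. op_norm K (F n - S)) \<longlonglongrightarrow> 0" using F by blast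
        show "(\<lambda>n. op_norm K (adjoint_op K (F n) - adjoint_op K S)) \<longlonglongrightarrow> 0"
          by (rule tendsto_sandwich[OF always_eventually[OF allI, OF ge] always_eventually[OF allI, OF le] tendsto_const Fl])
      qed (use FA SA Af in auto)
      show ?thesis using 1 2 SA \<pi>_facts(5)[OF SA] by (simp add: C_def)
    qed
  qed
  moreover have "G \<subseteq> C" using GA comm by (auto simp: C_def)
  ultimately have "a \<in> C" using a by (auto simp: op_cstar_generated_def)
  then show ?thesis by (simp add: C_def)
qed

section \<open>Representations of full group C*-algebras\<close>

locale group_cstar = group G for G :: "('g, 'x) monoid_scheme" (structure)
begin

abbreviation "GA \<equiv> group_algebra G"
abbreviation "fn \<equiv> full_norm G"
abbreviation "delta g \<equiv> basis_vec g (1::complex)"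
abbreviation "cls Y \<equiv> full_rel G `` {Y}"

lemma GA_iff: "f \<in> GA \<longleftrightarrow> finite {g. f g \<noteq> 0} \<and> {g. f g \<noteq> 0} \<subseteq> carrier G"
  by (simp add: group_algebra_def)

lemma GA_finite: "f \<in> GA \<Longrightarrow> finite {g. f g \<noteq> 0}"
  and GA_carrier: "f \<in> GA \<Longrightarrow> f g \<noteq> 0 \<Longrightarrow> g \<in> carrier G"
  by (auto simp: GA_iff)

lemma GA_comb: "f \<in> GA \<Longrightarrow> h \<in> GA \<Longrightarrow> (\<lambda>x. c * f x + d * h x) \<in> GA"
proof -
  assume f: "f \<in> GA" and h: "h \<in> GA"
  have "{g. c * f g + d * h g \<noteq> 0} \<subseteq> {g. f g \<noteq> 0} \<union> {g. h g \<noteq> 0}" by auto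
  then show ?thesis using f h by (auto simp: GA_iff dest: finite_subset)
qed

lemma fun_comb:
  fixes f h :: "'g \<Rightarrow> complex"
  shows "f + h = (\<lambda>x. 1 * f x + 1 * h x)" "f - h = (\<lambda>x. 1 * f x + (-1) * h x)" "(\<lambda>x. c * f x) = (\<lambda>x. c * f x + 0 * f x)"
  by (auto simp: fun_eq_iff op_apply)

lemma GA_zero [simp]: "0 \<in> GA" by (simp add: GA_iff)
lemma GA_plus [simp]: "f \<in> GA \<Longrightarrow> h \<in> GA \<Longrightarrow> f + h \<in> GA" unfolding fun_comb by (rule GA_comb)
lemma GA_minus [simp]: "f \<in> GA \<Longrightarrow> h \<in> GA \<Longrightarrow> f - h \<in> GA" unfolding fun_comb by (rule GA_comb)
lemma GA_scale [simp]: "f \<in> GA \<Longrightarrow> (\<lambda>x. c * f x) \<in> GA" using GA_comb[of f f c 0] by simp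
lemma GA_delta [simp]: "g \<in> carrier G \<Longrightarrow> delta g \<in> GA"
  by (auto simp: GA_iff basis_vec_def)

lemma conv_finite:
  assumes "finite A" "finite B" "{g. f g \<noteq> 0} \<subseteq> A" "{g. h g \<noteq> 0} \<subseteq> B"
  shows "conv G f h x = (\<Sum>a\<in>A. \<Sum>b\<in>B. if a \<otimes> b = x then f a * h b else 0)"
proof -
  have "(\<Sum>a\<in>A. \<Sum>b\<in>B. if a \<otimes> b = x then f a * h b else 0) =
    (\<Sum>(a, b)\<in>A \<times> B. if a \<otimes> b = x then f a * h b else 0)" by (simp add: sum.cartesian_product)
  also have "\<dots> = conv G f h x" unfolding conv_def
    by (rule sum.mono_neutral_cong_right) (use assms in \<open>auto split: if_splits\<close>)
  finally show ?thesis by simp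
qed

lemma conv_GA [simp]:
  assumes f: "f \<in> GA" and h: "h \<in> GA" shows "conv G f h \<in> GA"
proof -
  have "{x. conv G f h x \<noteq> 0} \<subseteq> (\<lambda>(a, b). a \<otimes> b) ` ({g. f g \<noteq> 0} \<times> {g. h g \<noteq> 0})"
  proof
    fix x assume "x \<in> {x. conv G f h x \<noteq> 0}"
    then have "\<exists>ab\<in>{(a, b). f a \<noteq> 0 \<and> h b \<noteq> 0 \<and> a \<otimes> b = x}. (case ab of (a, b) \<Rightarrow> f a * h b) \<noteq> 0"
      unfolding conv_def mem_Collect_eq by (rule contrapos_np) (auto intro: sum.neutral)
    then show "x \<in> (\<lambda>(a, b). a \<otimes> b) ` ({g. f g \<noteq> 0} \<times> {g. h g \<noteq> 0})" by force
  qed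
  moreover have "finite ((\<lambda>(a, b). a \<otimes> b) ` ({g. f g \<noteq> 0} \<times> {g. h g \<noteq> 0}))"
    using GA_finite[OF f] GA_finite[OF h] by simp
  moreover have "(\<lambda>(a, b). a \<otimes> b) ` ({g. f g \<noteq> 0} \<times> {g. h g \<noteq> 0}) \<subseteq> carrier G"
    using GA_carrier[OF f] GA_carrier[OF h] by auto
  ultimately show ?thesis unfolding GA_iff by (meson finite_subset subset_trans)
qed

lemma conv_comb_left:
  assumes f: "f \<in> GA" and g: "g \<in> GA" and h: "h \<in> GA"
  shows "conv G (\<lambda>x. c * f x + d * g x) h x = c * conv G f h x + d * conv G g h x"
proof -
  let ?A = "{x. f x \<noteq> 0} \<union> {x. g x \<noteq> 0}" and ?B = "{x. h x \<noteq> 0}"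
  have fin: "finite ?A" "finite ?B" using assms GA_finite by auto
  show ?thesis
    by (subst (1 2 3) conv_finite[OF fin]) (auto simp: sum_distrib_left sum.distrib[symmetric] algebra_simps intro!: sum.cong)
qed

lemma conv_comb_right:
  assumes f: "f \<in> GA" and g: "g \<in> GA" and h: "h \<in> GA"
  shows "conv G h (\<lambda>x. c * f x + d * g x) x = c * conv G h f x + d * conv G h g x"
proof -
  let ?A = "{x. f x \<noteq> 0} \<union> {x. g x \<noteq> 0}" and ?B = "{x. h x \<noteq> 0}"
  have fin: "finite ?A" "finite ?B" using assms GA_finite by auto
  show ?thesis
    by (subst (1 2 3) conv_finite[OF fin(2,1)]) (auto simp: sum_distrib_left sum.distrib[symmetric] algebra_simps intro!: sum.cong)
qed

lemma conv_diff: "f \<in> GA \<Longrightarrow> g \<in> GA \<Longrightarrow> h \<in> GA \<Longrightarrow> conv G h (f - g) = conv G h f - conv G h g"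
  "f \<in> GA \<Longrightarrow> g \<in> GA \<Longrightarrow> h \<in> GA \<Longrightarrow> conv G (f - g) h = conv G f h - conv G g h"
  unfolding fun_diff_def using conv_comb_right[of f g h 1 "-1"] conv_comb_left[of f g h 1 "-1"]
  by (simp_all add: fun_eq_iff)

lemma star_GA [simp]: assumes f: "f \<in> GA" shows "conv_star G f \<in> GA"
proof -
  have "{x. conv_star G f x \<noteq> 0} \<subseteq> (\<lambda>x. inv x) ` {x. f x \<noteq> 0}"
  proof
    fix x assume "x \<in> {x. conv_star G f x \<noteq> 0}"
    then have "x \<in> carrier G" "f (inv x) \<noteq> 0" by (auto simp: conv_star_def split: if_splits)
    then show "x \<in> (\<lambda>x. inv x) ` {x. f x \<noteq> 0}" by (intro image_eqI[of _ _ "inv x"]) auto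
  qed
  then show ?thesis using GA_finite[OF f] unfolding GA_iff by (auto simp: conv_star_def dest: finite_subset split: if_splits)
qed

lemma star_comb: "conv_star G (\<lambda>x. c * f x + d * h x) = (\<lambda>x. cnj c * conv_star G f x + cnj d * conv_star G h x)"
  by (auto simp: conv_star_def)

lemma star_star: "f \<in> GA \<Longrightarrow> conv_star G (conv_star G f) = f"
  using GA_carrier[of f] by (force simp: conv_star_def)

lemma star_conv:
  assumes f: "f \<in> GA" and h: "h \<in> GA"
  shows "conv_star G (conv G f h) = conv G (conv_star G h) (conv_star G f)"
proof
  fix x
  let ?A = "{g. f g \<noteq> 0}" and ?B = "{g. h g \<noteq> 0}"
  have A: "finite ?A" "?A \<subseteq> carrier G" and B: "finite ?B" "?B \<subseteq> carrier G" using f h by (auto simp: GA_iff)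
  show "conv_star G (conv G f h) x = conv G (conv_star G h) (conv_star G f) x"
  proof (cases "x \<in> carrier G")
    case True
    have inj: "inj_on (\<lambda>x. inv x) ?A" "inj_on (\<lambda>x. inv x) ?B" using A B by (auto intro: inj_on_subset[OF inv_inj])
    have eqv: "inv b \<otimes> inv a = x \<longleftrightarrow> a \<otimes> b = inv x" if "a \<in> ?A" "b \<in> ?B" for a b
    proof -
      have ab: "a \<in> carrier G" "b \<in> carrier G" using that A B by auto
      then have "inv b \<otimes> inv a = inv (a \<otimes> b)" by (simp add: inv_mult_group)
      then show ?thesis using True ab by (metis inv_inv m_closed)
    qed
    have "conv G (conv_star G h) (conv_star G f) x =
      (\<Sum>b\<in>(\<lambda>x. inv x) ` ?B. \<Sum>a\<in>(\<lambda>x. inv x) ` ?A. if b \<otimes> a = x then conv_star G h b * conv_star G f a else 0)"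
      by (rule conv_finite) (use A B in \<open>auto simp: conv_star_def image_iff split: if_splits\<close>, (metis inv_inv)+)
    also have "\<dots> = (\<Sum>b\<in>?B. \<Sum>a\<in>?A. if inv b \<otimes> inv a = x then conv_star G h (inv b) * conv_star G f (inv a) else 0)"
      by (simp add: sum.reindex[OF inj(1)] sum.reindex[OF inj(2)])
    also have "\<dots> = (\<Sum>b\<in>?B. \<Sum>a\<in>?A. if a \<otimes> b = inv x then cnj (h b) * cnj (f a) else 0)"
      using A B by (intro sum.cong refl) (auto simp: eqv conv_star_def subset_iff)
    also have "\<dots> = (\<Sum>a\<in>?A. \<Sum>b\<in>?B. if a \<otimes> b = inv x then cnj (h b) * cnj (f a) else 0)" by (rule sum.swap)
    also have "\<dots> = cnj (conv G f h (inv x))"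
    proof -
      have "cnj (conv G f h (inv x)) = (\<Sum>a\<in>?A. \<Sum>b\<in>?B. cnj (if a \<otimes> b = inv x then f a * h b else 0))"
        unfolding conv_finite[OF A(1) B(1) subset_refl subset_refl] by (simp only: cnj_sum)
      also have "\<dots> = (\<Sum>a\<in>?A. \<Sum>b\<in>?B. if a \<otimes> b = inv x then cnj (h b) * cnj (f a) else 0)"
        by (intro sum.cong refl) simp
      finally show ?thesis ..
    qed
    finally show ?thesis using True by (simp add: conv_star_def)
  next
    case False
    have "conv G (conv_star G h) (conv_star G f) x = 0"
      using GA_carrier[OF conv_GA[OF star_GA[OF h] star_GA[OF f]], of x] False by blast
    moreover have "conv_star G (conv G f h) x = 0" using False unfolding conv_star_def[of G "conv G f h"] by simp
    ultimately show ?thesis by simp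
  qed
qed

lemma conv_delta: "g \<in> carrier G \<Longrightarrow> h \<in> carrier G \<Longrightarrow> conv G (delta g) (delta h) = delta (g \<otimes> h)"
  by (rule ext, subst conv_finite[of "{g}" "{h}"]) (auto simp: basis_vec_def)

lemma conv_one: "f \<in> GA \<Longrightarrow> conv G (delta \<one>) f = f"
proof
  fix x assume f: "f \<in> GA"
  have "conv G (delta \<one>) f x = (\<Sum>b\<in>{g. f g \<noteq> 0}. if \<one> \<otimes> b = x then delta \<one> \<one> * f b else 0)"
    by (subst conv_finite[of "{\<one>}" "{g. f g \<noteq> 0}"]) (use GA_finite[OF f] in \<open>auto simp: basis_vec_def split: if_splits\<close>)
  also have "\<dots> = (\<Sum>b\<in>{g. f g \<noteq> 0}. if b = x then f b else 0)"
    using GA_carrier[OF f] by (intro sum.cong) (auto simp: basis_vec_def)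
  also have "\<dots> = f x" using GA_finite[OF f] by (simp add: sum.delta)
  finally show "conv G (delta \<one>) f x = f x" .
qed

lemma star_delta: "g \<in> carrier G \<Longrightarrow> conv_star G (delta g) = delta (inv g)"
  by (auto simp: conv_star_def basis_vec_def fun_eq_iff)

subsection \<open>The largest C*-seminorm\<close>

lemma seminorm_facts:
  assumes "cstar_seminorm G p"
  shows "f \<in> GA \<Longrightarrow> p f \<ge> 0" "f \<in> GA \<Longrightarrow> p (conv G (conv_star G f) f) = (p f)\<^sup>2"
    "f \<in> GA \<Longrightarrow> p (\<lambda>x. c * f x) = cmod c * p f" "f \<in> GA \<Longrightarrow> h \<in> GA \<Longrightarrow> p (f + h) \<le> p f + p h"
    "f \<in> GA \<Longrightarrow> h \<in> GA \<Longrightarrow> p (conv G f h) \<le> p f * p h"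
  using assms unfolding cstar_seminorm_def by blast+

lemma seminorm_zero: assumes "cstar_seminorm G p" shows "p 0 = 0"
  using seminorm_facts(3)[OF assms GA_zero, of 0] by (simp add: zero_fun_def)

lemma seminorm_delta:
  assumes p: "cstar_seminorm G p" and g: "g \<in> carrier G" shows "p (delta g) \<le> 1"
proof -
  have "p (delta \<one>) = (p (delta \<one>))\<^sup>2"
    using seminorm_facts(2)[OF p GA_delta[OF one_closed]] by (simp add: star_delta conv_delta)
  then have "p (delta \<one>) = 0 \<or> p (delta \<one>) = 1" by (simp add: power2_eq_square)
  moreover have "(p (delta g))\<^sup>2 = p (delta \<one>)"
    using seminorm_facts(2)[OF p GA_delta[OF g]] g by (simp add: star_delta conv_delta)
  ultimately have "(p (delta g))\<^sup>2 \<le> 1\<^sup>2" by auto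
  then show ?thesis by (rule power2_le_imp_le) simp
qed

text \<open>Induction on the support: a finitely supported function is built from point masses.\<close>

lemma GA_induct [consumes 1, case_names zero add]:
  assumes f: "f \<in> GA" and zero: "P 0"
    and add: "\<And>f c g. f \<in> GA \<Longrightarrow> P f \<Longrightarrow> g \<in> carrier G \<Longrightarrow> f g = 0 \<Longrightarrow> P (f + (\<lambda>x. c * delta g x))"
  shows "P f"
proof -
  have "P f" if "finite S" "S \<subseteq> carrier G" "{g. f g \<noteq> 0} \<subseteq> S" for S f
    using that
  proof (induction S arbitrary: f rule: finite_induct)
    case empty
    then have "f = 0" by (auto simp: fun_eq_iff)
    then show ?case using zero by metis
  next
    case (insert g S)
    let ?f = "f(g := 0)"
    have sub: "{x. ?f x \<noteq> 0} \<subseteq> S" using insert by (auto split: if_splits)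
    then have "?f \<in> GA" unfolding GA_iff using insert(1,4) by (meson finite_subset insert_subset subset_trans)
    moreover have "P ?f" using insert sub by auto
    ultimately have "P (?f + (\<lambda>x. f g * delta g x))" using insert by (intro add) auto
    moreover have "?f + (\<lambda>x. f g * delta g x) = f" by (auto simp: fun_eq_iff op_apply basis_vec_def)
    ultimately show ?case by simp
  qed
  then show ?thesis using f by (auto simp: GA_iff)
qed

text \<open>
  A C*-seminorm is at most \<open>1\<close> at point masses, so it is bounded by the \<open>\<ell>\<^sup>1\<close>-norm.
\<close>

lemma seminorms_bounded:
  assumes "f \<in> GA" shows "\<exists>c. \<forall>p. cstar_seminorm G p \<longrightarrow> p f \<le> c"
  using assms
proof (induction rule: GA_induct)
  case zero then show ?case using seminorm_zero by (metis order_refl)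
next
  case (add f c g)
  obtain b where b: "\<And>p. cstar_seminorm G p \<Longrightarrow> p f \<le> b" using add.IH by auto
  have "p (f + (\<lambda>x. c * delta g x)) \<le> b + cmod c" if p: "cstar_seminorm G p" for p
  proof -
    have "p (f + (\<lambda>x. c * delta g x)) \<le> p f + cmod c * p (delta g)"
      using seminorm_facts(4)[OF p add.hyps(1), of "\<lambda>x. c * delta g x"] seminorm_facts(3)[OF p, of "delta g" c] add by simp
    also have "\<dots> \<le> b + cmod c * 1" using b[OF p] seminorm_delta[OF p add.hyps(2)] by (intro add_mono mult_left_mono) auto
    finally show ?thesis by simp
  qed
  then show ?case by blast
qed

lemma seminorm_zero_fun: "cstar_seminorm G (\<lambda>_. 0)"
  by (simp add: cstar_seminorm_def)

lemma fn_bdd: assumes "f \<in> GA" shows "bdd_above ((\<lambda>p. p f) ` {p. cstar_seminorm G p})"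
proof -
  obtain c where "\<And>p. cstar_seminorm G p \<Longrightarrow> p f \<le> c" using seminorms_bounded[OF assms] by blast
  then show ?thesis by (intro bdd_aboveI2[of _ _ c]) auto
qed

lemma le_fn: "f \<in> GA \<Longrightarrow> cstar_seminorm G p \<Longrightarrow> p f \<le> fn f"
  unfolding full_norm_def by (rule cSUP_upper[OF _ fn_bdd]) auto

lemma fn_leI: "(\<And>p. cstar_seminorm G p \<Longrightarrow> p f \<le> c) \<Longrightarrow> fn f \<le> c"
  unfolding full_norm_def using seminorm_zero_fun by (intro cSUP_least) auto

lemma fn_ge0: "f \<in> GA \<Longrightarrow> fn f \<ge> 0"
  using le_fn[OF _ seminorm_zero_fun] by simp

lemma fn_zero [simp]: "fn 0 = 0"
  using fn_leI[of 0 0] seminorm_zero fn_ge0[OF GA_zero] by (metis order_antisym order_refl)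

lemma fn_plus: "f \<in> GA \<Longrightarrow> h \<in> GA \<Longrightarrow> fn (f + h) \<le> fn f + fn h"
  by (rule fn_leI) (meson add_mono le_fn order_trans seminorm_facts(4))

lemma fn_scale_le: "f \<in> GA \<Longrightarrow> fn (\<lambda>x. c * f x) \<le> cmod c * fn f"
  by (rule fn_leI) (simp add: seminorm_facts(3) le_fn mult_left_mono)

lemma fn_conv: assumes f: "f \<in> GA" and h: "h \<in> GA" shows "fn (conv G f h) \<le> fn f * fn h"
proof (rule fn_leI)
  fix p assume p: "cstar_seminorm G p"
  have "p (conv G f h) \<le> p f * p h" by (rule seminorm_facts(5)[OF p f h])
  also have "\<dots> \<le> fn f * fn h"
    using le_fn[OF f p] le_fn[OF h p] seminorm_facts(1)[OF p] fn_ge0 f h by (intro mult_mono) auto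
  finally show "p (conv G f h) \<le> fn f * fn h" .
qed

lemma fn_star: assumes f: "f \<in> GA" shows "fn (conv_star G f) \<le> fn f"
proof (rule fn_leI)
  fix p assume p: "cstar_seminorm G p"
  let ?h = "conv_star G f"
  have h: "?h \<in> GA" using f by simp
  have "(p ?h)\<^sup>2 = p (conv G (conv_star G ?h) ?h)" using seminorm_facts(2)[OF p h] by simp
  also have "\<dots> \<le> p f * p ?h" using seminorm_facts(5)[OF p f h] by (simp add: star_star f)
  finally have "p ?h * p ?h \<le> p f * p ?h" by (simp add: power2_eq_square)
  then have "p ?h \<le> p f" using seminorm_facts(1)[OF p h] seminorm_facts(1)[OF p f]
    by (cases "p ?h = 0") auto
  then show "p ?h \<le> fn f" using le_fn[OF f p] by simp
qed

lemma fn_diff: "f \<in> GA \<Longrightarrow> h \<in> GA \<Longrightarrow> fn (f - h) \<le> fn f + fn h"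
proof -
  assume f: "f \<in> GA" and h: "h \<in> GA"
  have eq: "f - h = f + (\<lambda>x. (-1) * h x)" by (auto simp: fun_eq_iff op_apply)
  have "fn (f - h) \<le> fn f + fn (\<lambda>x. (-1) * h x)" unfolding eq by (rule fn_plus[OF f GA_scale[OF h]])
  also have "fn (\<lambda>x. (-1) * h x) \<le> fn h" using fn_scale_le[OF h, of "-1"] by simp
  finally show ?thesis by simp
qed

sublocale S: star_seminorm GA "conv G" "conv_star G" "\<lambda>f x. (1/2) * f x" fn
proof (unfold_locales, goal_cases)
  case (6 x) then show ?case using GA_scale[of x "1/2"] by simp
next
  case (9 x y) then show ?case using star_comb[of 1 x 1 y] unfolding fun_comb by simp
next
  case (10 x y) then show ?case using star_comb[of 1 x "-1" y] unfolding fun_comb by simp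
next
  case (13 x) then show ?case using star_comb[of "1/2" x 0 x] by simp
next
  case (14 x y) then show ?case by (auto simp: fun_eq_iff op_apply diff_divide_distrib)
next
  case (21 x) then show ?case using fn_scale_le[of x "1/2"] by simp
qed (simp_all add: conv_diff star_conv star_star fn_ge0 fn_plus fn_diff fn_conv fn_star)

lemma fn_commute: "f \<in> GA \<Longrightarrow> h \<in> GA \<Longrightarrow> fn (f - h) = fn (h - f)"
  using fn_diff[of 0 "f - h"] fn_diff[of 0 "h - f"] by (simp add: antisym)

lemma fn_triangle3: "f \<in> GA \<Longrightarrow> g \<in> GA \<Longrightarrow> h \<in> GA \<Longrightarrow> fn (f - h) \<le> fn (f - g) + fn (g - h)"
  using fn_plus[of "f - g" "g - h"] by simp

lemma fn_conv_diff:
  assumes "a \<in> GA" "b \<in> GA" "c \<in> GA" "d \<in> GA"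
  shows "fn (conv G a b - conv G c d) \<le> fn a * fn (b - d) + fn (a - c) * fn d"
proof -
  have eq: "conv G a b - conv G c d = conv G a (b - d) + conv G (a - c) d" using assms by (simp add: conv_diff)
  have "fn (conv G a b - conv G c d) \<le> fn (conv G a (b - d)) + fn (conv G (a - c) d)"
    unfolding eq using assms by (intro fn_plus) auto
  moreover have "fn (conv G a (b - d)) \<le> fn a * fn (b - d)" "fn (conv G (a - c) d) \<le> fn (a - c) * fn d"
    using assms by (auto intro: fn_conv)
  ultimately show ?thesis by linarith
qed

subsection \<open>The completion\<close>

lemma fc_GA: "Y \<in> full_cauchy G \<Longrightarrow> Y n \<in> GA"
  by (simp add: full_cauchy_def)
lemma fc_cauchy: "Y \<in> full_cauchy G \<Longrightarrow> e > 0 \<Longrightarrow> \<exists>N. \<forall>m\<ge>N. \<forall>n\<ge>N. fn (Y m - Y n) < e"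
  by (simp add: full_cauchy_def)
lemma fcI: "(\<And>n. Y n \<in> GA) \<Longrightarrow> (\<And>e. e > 0 \<Longrightarrow> \<exists>N. \<forall>m\<ge>N. \<forall>n\<ge>N. fn (Y m - Y n) < e) \<Longrightarrow> Y \<in> full_cauchy G"
  by (simp add: full_cauchy_def)

lemma fc_const: "f \<in> GA \<Longrightarrow> (\<lambda>n. f) \<in> full_cauchy G"
  by (rule fcI) auto

lemma fc_bounded:
  assumes Y: "Y \<in> full_cauchy G" obtains c where "c > 0" "\<And>n. fn (Y n) \<le> c"
proof -
  obtain N where N: "\<forall>m\<ge>N. \<forall>n\<ge>N. fn (Y m - Y n) < 1" using fc_cauchy[OF Y, of 1] by auto
  define c where "c = Max ((\<lambda>n. fn (Y n)) ` {..N}) + 1"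
  have le: "fn (Y n) \<le> c" for n
  proof (cases "n \<le> N")
    case True
    then have "fn (Y n) \<le> Max ((\<lambda>n. fn (Y n)) ` {..N})" by (intro Max_ge) auto
    then show ?thesis by (simp add: c_def)
  next
    case False
    have "fn (Y n) \<le> fn (Y n - Y N) + fn (Y N)" using fn_plus[of "Y n - Y N" "Y N"] fc_GA[OF Y] by simp
    moreover have "fn (Y n - Y N) < 1" using N False by simp
    moreover have "fn (Y N) \<le> Max ((\<lambda>n. fn (Y n)) ` {..N})" by (intro Max_ge) auto
    ultimately show ?thesis unfolding c_def by linarith
  qed
  have "c \<ge> 0" using le[of 0] fn_ge0[OF fc_GA[OF Y], of 0] by linarith
  then show thesis using that[of "c + 1"] le by (smt (verit))
qed

text \<open>Cauchy sequences are preserved by maps satisfying a Lipschitz estimate.\<close>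

lemma fc_lipschitz:
  assumes Y: "Y \<in> full_cauchy G" and Z: "Z \<in> full_cauchy G" and F: "\<And>n. F n \<in> GA"
    and est: "\<And>m n. fn (F m - F n) \<le> c * (fn (Y m - Y n) + fn (Z m - Z n))" and c: "c > 0"
  shows "F \<in> full_cauchy G"
proof (rule fcI[OF F])
  fix e :: real assume "e > 0"
  then have e: "e / (2 * c) > 0" using c by simp
  obtain N where N: "\<forall>m\<ge>N. \<forall>n\<ge>N. fn (Y m - Y n) < e / (2 * c)" using fc_cauchy[OF Y e] by blast
  obtain N' where N': "\<forall>m\<ge>N'. \<forall>n\<ge>N'. fn (Z m - Z n) < e / (2 * c)" using fc_cauchy[OF Z e] by blast
  have "fn (F m - F n) < e" if "m \<ge> max N N'" "n \<ge> max N N'" for m n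
  proof -
    have "fn (Y m - Y n) + fn (Z m - Z n) < e / (2 * c) + e / (2 * c)" using N N' that by (intro add_strict_mono) auto
    also have "\<dots> = e / c" by (simp add: field_simps)
    finally have "c * (fn (Y m - Y n) + fn (Z m - Z n)) < e" using c by (simp add: pos_less_divide_eq mult.commute)
    then show ?thesis using est[of m n] by simp
  qed
  then show "\<exists>N. \<forall>m\<ge>N. \<forall>n\<ge>N. fn (F m - F n) < e" by blast
qed

lemma rel_iff: "(Y, Z) \<in> full_rel G \<longleftrightarrow> Y \<in> full_cauchy G \<and> Z \<in> full_cauchy G \<and> (\<lambda>n. fn (Y n - Z n)) \<longlonglongrightarrow> 0"
  by (simp add: full_rel_def)

lemma squeeze0: "(\<And>n::nat. 0 \<le> f n) \<Longrightarrow> (\<And>n. f n \<le> g n) \<Longrightarrow> g \<longlonglongrightarrow> 0 \<Longrightarrow> f \<longlonglongrightarrow> (0::real)"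
  by (rule tendsto_sandwich[of "\<lambda>_. 0" f sequentially g]) (auto intro: always_eventually)

lemma equiv_full_rel: "equiv (full_cauchy G) (full_rel G)"
proof (rule equivI)
  show "full_rel G \<subseteq> full_cauchy G \<times> full_cauchy G" by (auto simp: full_rel_def)
  show "refl_on (full_cauchy G) (full_rel G)" by (auto simp: refl_on_def rel_iff)
  show "sym (full_rel G)"
  proof (rule symI)
    fix X Y assume a: "(X, Y) \<in> full_rel G"
    then have "fn (X n - Y n) = fn (Y n - X n)" for n by (intro fn_commute) (auto simp: rel_iff fc_GA)
    then show "(Y, X) \<in> full_rel G" using a by (simp add: rel_iff)
  qed
  show "trans (full_rel G)"
  proof (rule transI)
    fix X Y Z assume a: "(X, Y) \<in> full_rel G" "(Y, Z) \<in> full_rel G"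
    then have m: "X n \<in> GA" "Y n \<in> GA" "Z n \<in> GA" for n by (auto simp: rel_iff fc_GA)
    have "(\<lambda>n. fn (X n - Y n) + fn (Y n - Z n)) \<longlonglongrightarrow> 0 + 0" using a by (intro tendsto_add) (auto simp: rel_iff)
    then have "(\<lambda>n. fn (X n - Z n)) \<longlonglongrightarrow> 0"
      by (intro squeeze0[of "\<lambda>n. fn (X n - Z n)" "\<lambda>n. fn (X n - Y n) + fn (Y n - Z n)"]) (auto simp: m fn_ge0 intro: fn_triangle3)
    then show "(X, Z) \<in> full_rel G" using a by (auto simp: rel_iff)
  qed
qed

lemma cls_eqI: "(Y, Z) \<in> full_rel G \<Longrightarrow> cls Y = cls Z"
  by (rule equiv_class_eq[OF equiv_full_rel])

lemma cls_carrier: "Y \<in> full_cauchy G \<Longrightarrow> cls Y \<in> acarrier (full_cstar G)"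
  by (auto simp: full_cstar_def intro: quotientI)

lemma carrier_cls: assumes "a \<in> acarrier (full_cstar G)" obtains Y where "Y \<in> full_cauchy G" "a = cls Y"
  using assms by (auto simp: full_cstar_def elim: quotientE)

lemma fc_plus: "Y \<in> full_cauchy G \<Longrightarrow> Z \<in> full_cauchy G \<Longrightarrow> (\<lambda>n. Y n + Z n) \<in> full_cauchy G"
proof (rule fc_lipschitz[of Y Z _ 1])
  assume Y: "Y \<in> full_cauchy G" and Z: "Z \<in> full_cauchy G"
  show "fn (Y m + Z m - (Y n + Z n)) \<le> 1 * (fn (Y m - Y n) + fn (Z m - Z n))" for m n
  proof -
    have eq: "Y m + Z m - (Y n + Z n) = (Y m - Y n) + (Z m - Z n)" by (simp add: algebra_simps)
    show ?thesis unfolding eq mult_1 by (intro fn_plus GA_minus fc_GA[OF Y] fc_GA[OF Z])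
  qed
qed (auto simp: fc_GA)

lemma scale_diff_fun: "(\<lambda>x. c * f x) - (\<lambda>x. c * h x) = (\<lambda>x. c * (f - h) x)" for c :: complex
  by (auto simp: fun_eq_iff op_apply algebra_simps)

lemma fc_scale: "Y \<in> full_cauchy G \<Longrightarrow> (\<lambda>n x. c * Y n x) \<in> full_cauchy G"
proof (rule fc_lipschitz[of Y Y _ "cmod c + 1"])
  assume Y: "Y \<in> full_cauchy G"
  show "fn ((\<lambda>x. c * Y m x) - (\<lambda>x. c * Y n x)) \<le> (cmod c + 1) * (fn (Y m - Y n) + fn (Y m - Y n))" for m n
  proof -
    have g: "fn (Y m - Y n) \<ge> 0" using Y by (intro fn_ge0 GA_minus fc_GA)
    have "fn ((\<lambda>x. c * Y m x) - (\<lambda>x. c * Y n x)) \<le> cmod c * fn (Y m - Y n)"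
      unfolding scale_diff_fun using Y by (intro fn_scale_le GA_minus fc_GA)
    also have "\<dots> \<le> (cmod c + 1) * (fn (Y m - Y n) + fn (Y m - Y n))" using g by (intro mult_mono) auto
    finally show ?thesis .
  qed
qed (auto simp: fc_GA add_nonneg_pos)

lemma fc_conv: assumes Y: "Y \<in> full_cauchy G" and Z: "Z \<in> full_cauchy G" shows "(\<lambda>n. conv G (Y n) (Z n)) \<in> full_cauchy G"
proof -
  obtain c where c: "c > 0" "\<And>n. fn (Y n) \<le> c" using fc_bounded[OF Y] by blast
  obtain d where d: "d > 0" "\<And>n. fn (Z n) \<le> d" using fc_bounded[OF Z] by blast
  show ?thesis
  proof (rule fc_lipschitz[OF Y Z, of _ "c + d"])
    show "fn (conv G (Y m) (Z m) - conv G (Y n) (Z n)) \<le> (c + d) * (fn (Y m - Y n) + fn (Z m - Z n))" for m n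
    proof -
      have g: "fn (Y m - Y n) \<ge> 0" "fn (Z m - Z n) \<ge> 0" by (intro fn_ge0 GA_minus fc_GA[OF Y] fc_GA[OF Z])+
      have "fn (conv G (Y m) (Z m) - conv G (Y n) (Z n)) \<le> fn (Y m) * fn (Z m - Z n) + fn (Y m - Y n) * fn (Z n)"
        using Y Z by (intro fn_conv_diff fc_GA)
      also have "\<dots> \<le> (c + d) * fn (Z m - Z n) + fn (Y m - Y n) * (c + d)"
        using c(2)[of m] d(2)[of n] c(1) d(1) g by (intro add_mono mult_right_mono mult_left_mono) auto
      finally show ?thesis by (simp add: algebra_simps)
    qed
  qed (use Y Z c d in \<open>auto simp: fc_GA\<close>)
qed

lemma fc_star: "Y \<in> full_cauchy G \<Longrightarrow> (\<lambda>n. conv_star G (Y n)) \<in> full_cauchy G"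
proof (rule fc_lipschitz[of Y Y _ 1])
  assume Y: "Y \<in> full_cauchy G"
  show "fn (conv_star G (Y m) - conv_star G (Y n)) \<le> 1 * (fn (Y m - Y n) + fn (Y m - Y n))" for m n
    using fn_star[of "Y m - Y n"] fn_ge0[of "Y m - Y n"] Y by (simp add: fc_GA S.star_diff)
qed (auto simp: fc_GA)

lemma UN_const2: "A \<noteq> {} \<Longrightarrow> B \<noteq> {} \<Longrightarrow> (\<And>x y. x \<in> A \<Longrightarrow> y \<in> B \<Longrightarrow> F x y = c) \<Longrightarrow> (\<Union>x\<in>A. \<Union>y\<in>B. F x y) = c"
  by auto

lemma cls_ne: "Y \<in> full_cauchy G \<Longrightarrow> cls Y \<noteq> {}"
  using equiv_class_self[OF equiv_full_rel] by blast

lemma aadd_cls: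
  assumes Y: "Y \<in> full_cauchy G" and Z: "Z \<in> full_cauchy G"
  shows "aadd (full_cstar G) (cls Y) (cls Z) = cls (\<lambda>n. Y n + Z n)"
proof -
  have "cls (\<lambda>n. Y' n + Z' n) = cls (\<lambda>n. Y n + Z n)" if a: "(Y, Y') \<in> full_rel G" "(Z, Z') \<in> full_rel G" for Y' Z'
  proof (rule cls_eqI[symmetric])
    have m: "Y' n \<in> GA" "Z' n \<in> GA" "Y n \<in> GA" "Z n \<in> GA" for n using a by (auto simp: rel_iff fc_GA)
    have "(\<lambda>n. fn (Y n - Y' n) + fn (Z n - Z' n)) \<longlonglongrightarrow> 0 + 0" using a by (intro tendsto_add) (auto simp: rel_iff)
    moreover have "fn (Y n + Z n - (Y' n + Z' n)) \<le> fn (Y n - Y' n) + fn (Z n - Z' n)" for n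
      using fn_plus[of "Y n - Y' n" "Z n - Z' n"] m by (simp add: algebra_simps)
    ultimately have "(\<lambda>n. fn (Y n + Z n - (Y' n + Z' n))) \<longlonglongrightarrow> 0"
      by (intro squeeze0[of "\<lambda>n. fn (Y n + Z n - (Y' n + Z' n))" "\<lambda>n. fn (Y n - Y' n) + fn (Z n - Z' n)"])
        (auto intro!: fn_ge0 GA_minus GA_plus m)
    then show "(\<lambda>n. Y n + Z n, \<lambda>n. Y' n + Z' n) \<in> full_rel G" using a by (auto simp: rel_iff fc_plus)
  qed
  then show ?thesis using cls_ne[OF Y] cls_ne[OF Z] unfolding full_cstar_def by (auto intro!: UN_const2)
qed

lemma amult_cls:
  assumes Y: "Y \<in> full_cauchy G" and Z: "Z \<in> full_cauchy G"
  shows "amult (full_cstar G) (cls Y) (cls Z) = cls (\<lambda>n. conv G (Y n) (Z n))"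
proof -
  have "cls (\<lambda>n. conv G (Y' n) (Z' n)) = cls (\<lambda>n. conv G (Y n) (Z n))" if a: "(Y, Y') \<in> full_rel G" "(Z, Z') \<in> full_rel G" for Y' Z'
  proof (rule cls_eqI[symmetric])
    have fc: "Y' \<in> full_cauchy G" "Z' \<in> full_cauchy G" using a by (auto simp: rel_iff)
    have m: "Y' n \<in> GA" "Z' n \<in> GA" "Y n \<in> GA" "Z n \<in> GA" for n using a by (auto simp: rel_iff fc_GA)
    obtain c where c: "c > 0" "\<And>n. fn (Y n) \<le> c" using fc_bounded[OF Y] by blast
    obtain d where d: "d > 0" "\<And>n. fn (Z' n) \<le> d" using fc_bounded[OF fc(2)] by blast
    have "(\<lambda>n. c * fn (Z n - Z' n) + fn (Y n - Y' n) * d) \<longlonglongrightarrow> c * 0 + 0 * d"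
      using a by (intro tendsto_intros) (auto simp: rel_iff)
    moreover have "fn (conv G (Y n) (Z n) - conv G (Y' n) (Z' n)) \<le> c * fn (Z n - Z' n) + fn (Y n - Y' n) * d" for n
    proof -
      have g: "fn (Y n - Y' n) \<ge> 0" "fn (Z n - Z' n) \<ge> 0" using m by (auto intro!: fn_ge0)
      have "fn (conv G (Y n) (Z n) - conv G (Y' n) (Z' n)) \<le> fn (Y n) * fn (Z n - Z' n) + fn (Y n - Y' n) * fn (Z' n)"
        using m by (intro fn_conv_diff)
      also have "\<dots> \<le> c * fn (Z n - Z' n) + fn (Y n - Y' n) * d"
        using c(2)[of n] d(2)[of n] g by (intro add_mono mult_right_mono mult_left_mono) auto
      finally show ?thesis .
    qed
    ultimately have "(\<lambda>n. fn (conv G (Y n) (Z n) - conv G (Y' n) (Z' n))) \<longlonglongrightarrow> 0"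
      by (intro squeeze0[of "\<lambda>n. fn (conv G (Y n) (Z n) - conv G (Y' n) (Z' n))" "\<lambda>n. c * fn (Z n - Z' n) + fn (Y n - Y' n) * d"])
        (auto intro!: fn_ge0 GA_minus conv_GA m)
    then show "(\<lambda>n. conv G (Y n) (Z n), \<lambda>n. conv G (Y' n) (Z' n)) \<in> full_rel G" using a by (auto simp: rel_iff fc_conv)
  qed
  then show ?thesis using cls_ne[OF Y] cls_ne[OF Z] unfolding full_cstar_def by (auto intro!: UN_const2)
qed

lemma UN_const1: "A \<noteq> {} \<Longrightarrow> (\<And>x. x \<in> A \<Longrightarrow> F x = c) \<Longrightarrow> (\<Union>x\<in>A. F x) = c"
  by auto

lemma ascale_cls:
  assumes Y: "Y \<in> full_cauchy G"
  shows "ascale (full_cstar G) c (cls Y) = cls (\<lambda>n x. c * Y n x)"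
proof -
  have "cls (\<lambda>n x. c * Y' n x) = cls (\<lambda>n x. c * Y n x)" if a: "(Y, Y') \<in> full_rel G" for Y'
  proof (rule cls_eqI[symmetric])
    have m: "Y' n \<in> GA" "Y n \<in> GA" for n using a by (auto simp: rel_iff fc_GA)
    have "(\<lambda>n. cmod c * fn (Y n - Y' n)) \<longlonglongrightarrow> cmod c * 0" using a by (intro tendsto_intros) (auto simp: rel_iff)
    then have lim: "(\<lambda>n. cmod c * fn (Y n - Y' n)) \<longlonglongrightarrow> 0" by simp
    have "(\<lambda>n. fn ((\<lambda>x. c * Y n x) - (\<lambda>x. c * Y' n x))) \<longlonglongrightarrow> 0"
      unfolding scale_diff_fun
      by (rule squeeze0[OF fn_ge0[OF GA_scale[OF GA_minus[OF m(2,1)]]] fn_scale_le[OF GA_minus[OF m(2,1)]] lim])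
    then show "(\<lambda>n x. c * Y n x, \<lambda>n x. c * Y' n x) \<in> full_rel G" using a by (auto simp: rel_iff fc_scale)
  qed
  then show ?thesis using cls_ne[OF Y] unfolding full_cstar_def by (auto intro!: UN_const1)
qed

lemma astar_cls:
  assumes Y: "Y \<in> full_cauchy G"
  shows "astar (full_cstar G) (cls Y) = cls (\<lambda>n. conv_star G (Y n))"
proof -
  have "cls (\<lambda>n. conv_star G (Y' n)) = cls (\<lambda>n. conv_star G (Y n))" if a: "(Y, Y') \<in> full_rel G" for Y'
  proof (rule cls_eqI[symmetric])
    have m: "Y' n \<in> GA" "Y n \<in> GA" for n using a by (auto simp: rel_iff fc_GA)
    have "(\<lambda>n. fn (conv_star G (Y n) - conv_star G (Y' n))) \<longlonglongrightarrow> 0"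
    proof (rule squeeze0)
      show "(\<lambda>n. fn (Y n - Y' n)) \<longlonglongrightarrow> 0" using a by (auto simp: rel_iff)
      show "fn (conv_star G (Y n) - conv_star G (Y' n)) \<le> fn (Y n - Y' n)" for n
        using fn_star[of "Y n - Y' n"] m by (simp add: S.star_diff)
    qed (auto intro!: fn_ge0 m GA_minus star_GA)
    then show "(\<lambda>n. conv_star G (Y n), \<lambda>n. conv_star G (Y' n)) \<in> full_rel G" using a by (auto simp: rel_iff fc_star)
  qed
  then show ?thesis using cls_ne[OF Y] unfolding full_cstar_def by (auto intro!: UN_const1)
qed

lemma astar_closed: "a \<in> acarrier (full_cstar G) \<Longrightarrow> astar (full_cstar G) a \<in> acarrier (full_cstar G)"
  by (auto elim!: carrier_cls simp: astar_cls fc_star cls_carrier)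

end

locale group_cstar_rep = group_cstar G + hilbert H
  for G :: "('g, 'x) monoid_scheme" (structure) and H :: "'v::ab_group_add hilbert" +
  fixes \<pi> :: "(nat \<Rightarrow> 'g \<Rightarrow> complex) set \<Rightarrow> 'v \<Rightarrow> 'v"
  assumes \<pi>: "representation (full_cstar G) H \<pi>"
begin

abbreviation "\<sigma> g \<equiv> \<pi> (canonical_unitary G g)"

lemma \<pi>_bd: "Y \<in> full_cauchy G \<Longrightarrow> \<pi> (cls Y) \<in> Bd"
  by (rule rep_bd[OF \<pi> cls_carrier])
lemma \<pi>_add: "Y \<in> full_cauchy G \<Longrightarrow> Z \<in> full_cauchy G \<Longrightarrow> \<pi> (cls (\<lambda>n. Y n + Z n)) = \<pi> (cls Y) + \<pi> (cls Z)"
  using rep_add[OF \<pi> cls_carrier cls_carrier, of Y Z] by (simp add: aadd_cls)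
lemma \<pi>_scale: "Y \<in> full_cauchy G \<Longrightarrow> \<pi> (cls (\<lambda>n x. c * Y n x)) = scale_op H c (\<pi> (cls Y))"
  using rep_scale[OF \<pi> cls_carrier, of Y c] by (simp add: ascale_cls)
lemma \<pi>_mult: "Y \<in> full_cauchy G \<Longrightarrow> Z \<in> full_cauchy G \<Longrightarrow> \<pi> (cls (\<lambda>n. conv G (Y n) (Z n))) = \<pi> (cls Y) \<circ> \<pi> (cls Z)"
  using rep_mult[OF \<pi> cls_carrier cls_carrier, of Y Z] by (simp add: amult_cls)
lemma \<pi>_star: "Y \<in> full_cauchy G \<Longrightarrow> \<pi> (cls (\<lambda>n. conv_star G (Y n))) = adj (\<pi> (cls Y))"
  using rep_star[OF \<pi> cls_carrier, of Y] by (simp add: astar_cls)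

lemma fc_delta: "g \<in> carrier G \<Longrightarrow> (\<lambda>n. delta g) \<in> full_cauchy G"
  by (simp add: fc_const)

lemma \<sigma>_bd [simp]: "g \<in> carrier G \<Longrightarrow> \<sigma> g \<in> Bd"
  by (simp add: canonical_unitary_def \<pi>_bd fc_delta)
lemma \<sigma>_mult: "g \<in> carrier G \<Longrightarrow> h \<in> carrier G \<Longrightarrow> \<sigma> (g \<otimes> h) = \<sigma> g \<circ> \<sigma> h"
  using \<pi>_mult[OF fc_delta fc_delta, of g h] by (simp add: canonical_unitary_def conv_delta)
lemma \<sigma>_star: "g \<in> carrier G \<Longrightarrow> adj (\<sigma> g) = \<sigma> (inv g)"
  using \<pi>_star[OF fc_delta, of g] by (simp add: canonical_unitary_def star_delta)

text \<open>Nondegeneracy: \<open>\<sigma>(1)\<close> is the identity on the dense span of the ranges of the \<open>\<pi>(a)\<close>.\<close>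

lemma \<sigma>_one: "\<sigma> \<one> = id_op H"
proof (rule bd_eqI)
  fix \<xi> assume \<xi>: "\<xi> \<in> V"
  let ?S = "{\<pi> a \<zeta> |a \<zeta>. a \<in> acarrier (full_cstar G) \<and> \<zeta> \<in> V}"
  have E: "\<sigma> \<one> \<in> Bd" by simp
  obtain c where c: "c > 0" "\<And>x. x \<in> V \<Longrightarrow> nrm (\<sigma> \<one> x) \<le> c * nrm x" using bd_bound[OF E] by blast
  have gen: "x \<in> V \<and> \<sigma> \<one> x = x" if x: "x \<in> ?S" for x
  proof -
    obtain a \<zeta> where a: "a \<in> acarrier (full_cstar G)" "\<zeta> \<in> V" "x = \<pi> a \<zeta>" using x by auto
    obtain Y where Y: "Y \<in> full_cauchy G" "a = cls Y" using carrier_cls[OF a(1)] .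
    have "\<sigma> \<one> \<circ> \<pi> a = \<pi> a"
    proof -
      have "(\<lambda>n. conv G (delta \<one>) (Y n)) = Y" using fc_GA[OF Y(1)] by (simp add: conv_one)
      then show ?thesis using \<pi>_mult[OF fc_delta[OF one_closed] Y(1)] unfolding Y(2) canonical_unitary_def by metis
    qed
    then show ?thesis using a rep_bd[OF \<pi> a(1)] by (metis bd_V' comp_apply)
  qed
  have span: "\<eta> \<in> V \<and> \<sigma> \<one> \<eta> = \<eta>" if "\<eta> \<in> vs.span ?S" for \<eta>
    using that
  proof (induction rule: vs.span_induct_alt)
    case base then show ?case using E by (simp add: bd_0)
  next
    case (step c x y) then show ?case using gen[of x] E by (simp add: bd_add bd_sc)
  qed
  have small: "nrm (\<sigma> \<one> \<xi> - \<xi>) \<le> 0 + e" if e: "e > 0" for e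
  proof -
    have "e / (c + 1) > 0" using e c by simp
    then obtain \<eta> where \<eta>: "\<eta> \<in> vs.span ?S" "nrm (\<xi> - \<eta>) < e / (c + 1)"
      using \<pi> \<xi> unfolding representation_def by blast
    have \<eta>': "\<eta> \<in> V" "\<sigma> \<one> \<eta> = \<eta>" using span[OF \<eta>(1)] by auto
    have eq: "\<sigma> \<one> \<xi> - \<xi> = \<sigma> \<one> (\<xi> - \<eta>) - (\<xi> - \<eta>)" using E \<xi> \<eta>' by (simp add: bd_diff)
    have "nrm (\<sigma> \<one> \<xi> - \<xi>) \<le> nrm (\<sigma> \<one> (\<xi> - \<eta>)) + nrm (\<xi> - \<eta>)"
      unfolding eq using E \<xi> \<eta>' by (intro nrm_triangle_diff) auto
    also have "\<dots> \<le> (c + 1) * nrm (\<xi> - \<eta>)" using c(2)[of "\<xi> - \<eta>"] \<xi> \<eta>' by (simp add: algebra_simps)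
    also have "\<dots> \<le> e" using \<eta>(2) c by (simp add: field_simps)
    finally show ?thesis by simp
  qed
  have dV: "\<sigma> \<one> \<xi> - \<xi> \<in> V" using E \<xi> by simp
  have "nrm (\<sigma> \<one> \<xi> - \<xi>) \<le> 0" using small by (rule field_le_epsilon)
  then have "nrm (\<sigma> \<one> \<xi> - \<xi>) = 0" using nrm_ge0[OF dV] by simp
  then show "\<sigma> \<one> \<xi> = id_op H \<xi>" using nrm_eq_0[OF dV] \<xi> by simp
qed simp_all

lemma \<sigma>_inv: "g \<in> carrier G \<Longrightarrow> \<xi> \<in> V \<Longrightarrow> \<sigma> (inv g) (\<sigma> g \<xi>) = \<xi>" "g \<in> carrier G \<Longrightarrow> \<xi> \<in> V \<Longrightarrow> \<sigma> g (\<sigma> (inv g) \<xi>) = \<xi>"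
proof -
  assume g: "g \<in> carrier G" and \<xi>: "\<xi> \<in> V"
  have "\<sigma> (inv g) \<circ> \<sigma> g = id_op H" "\<sigma> g \<circ> \<sigma> (inv g) = id_op H"
    using \<sigma>_mult[of "inv g" g] \<sigma>_mult[of g "inv g"] \<sigma>_one g by simp_all
  then show "\<sigma> (inv g) (\<sigma> g \<xi>) = \<xi>" "\<sigma> g (\<sigma> (inv g) \<xi>) = \<xi>"
    using \<xi> by (metis comp_apply id_op_apply)+
qed

lemma \<sigma>_isometry:
  assumes "g \<in> carrier G" "x \<in> V" "y \<in> V" shows "ip (\<sigma> g x) (\<sigma> g y) = ip x y"
  using adj_ip[of "\<sigma> g" x "\<sigma> g y"] assms by (simp add: \<sigma>_star \<sigma>_inv)

text \<open>
  The iteration along the Cauchy sequence \<open>Y\<close> converges in the completion; the bound \<open>1/2\<close> stands for any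
  bound below \<open>1\<close>.
\<close>

lemma contractive_if_small:
  assumes Y: "Y \<in> full_cauchy G" and small: "\<And>n. fn (Y n) \<le> 1/2" and \<xi>: "\<xi> \<in> V"
  shows "nrm (\<pi> (cls Y) \<xi>) \<le> nrm \<xi>"
proof -
  define B where "B = S.root_iter Y"
  have BG: "B n \<in> GA" and Bstar: "conv_star G (B n) = B n" for n
    using S.root_iter_C[of Y] S.root_iter_star[of Y] fc_GA[OF Y] by (auto simp: B_def)
  have B: "B \<in> full_cauchy G"
    by (rule fcI[OF BG]) (unfold B_def, rule S.root_iter_cauchy[of Y "1/2"], use fc_GA[OF Y] small fc_cauchy[OF Y] in auto)
  let ?Q = "\<lambda>n. conv G (conv_star G (Y n)) (Y n) + conv G (B n) (B n)"
  have Q: "?Q \<in> full_cauchy G" using Y B by (intro fc_plus fc_conv fc_star)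
  have eq: "(B n + B n) - ?Q n = (B n - B (Suc n)) + (B n - B (Suc n))" for n
  proof -
    have "B (Suc n) + B (Suc n) = ?Q n" unfolding B_def S.root_iter.simps by (simp add: fun_eq_iff op_apply)
    then show ?thesis by (simp add: algebra_simps)
  qed
  have lim: "(\<lambda>n. fn (B n - B (Suc n))) \<longlonglongrightarrow> 0"
  proof (rule LIMSEQ_I)
    fix e :: real assume "e > 0"
    then obtain N where N: "\<forall>m\<ge>N. \<forall>n\<ge>N. fn (B m - B n) < e" using fc_cauchy[OF B] by blast
    have "norm (fn (B n - B (Suc n)) - 0) < e" if "n \<ge> N" for n
      using N that fn_ge0[OF GA_minus[OF BG BG], of n "Suc n"] by simp
    then show "\<exists>no. \<forall>n\<ge>no. norm (fn (B n - B (Suc n)) - 0) < e" by blast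
  qed
  have "(\<lambda>n. fn ((B n + B n) - ?Q n)) \<longlonglongrightarrow> 0"
  proof (rule squeeze0)
    show "(\<lambda>n. fn (B n - B (Suc n)) + fn (B n - B (Suc n))) \<longlonglongrightarrow> 0" using tendsto_add[OF lim lim] by simp
    show "fn ((B n + B n) - ?Q n) \<le> fn (B n - B (Suc n)) + fn (B n - B (Suc n))" for n
      unfolding eq by (intro fn_plus GA_minus BG)
  qed (intro fn_ge0 GA_minus GA_plus conv_GA star_GA BG fc_GA[OF Y])
  then have "(\<lambda>n. B n + B n, ?Q) \<in> full_rel G" unfolding rel_iff using fc_plus[OF B B] Q by blast
  then have "cls (\<lambda>n. B n + B n) = cls ?Q" by (rule cls_eqI)
  then have root: "aadd (full_cstar G) (cls B) (cls B) = aadd (full_cstar G) (amult (full_cstar G) (astar (full_cstar G) (cls Y)) (cls Y)) (amult (full_cstar G) (cls B) (cls B))"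
    using Y B by (simp add: aadd_cls amult_cls astar_cls fc_conv fc_star)
  show ?thesis
  proof (rule rep_contractive_if_root[OF \<pi> cls_carrier[OF Y] cls_carrier[OF B] _ _ _ _ root \<xi>])
    show "astar (full_cstar G) (cls Y) \<in> acarrier (full_cstar G)"
      using Y by (intro astar_closed cls_carrier)
    show "amult (full_cstar G) (astar (full_cstar G) (cls Y)) (cls Y) \<in> acarrier (full_cstar G)"
      unfolding astar_cls[OF Y] amult_cls[OF fc_star[OF Y] Y] by (intro cls_carrier fc_conv fc_star Y)
    show "amult (full_cstar G) (cls B) (cls B) \<in> acarrier (full_cstar G)"
      unfolding amult_cls[OF B B] by (intro cls_carrier fc_conv B)
    show "astar (full_cstar G) (cls B) = cls B" unfolding astar_cls[OF B] Bstar ..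
  qed
qed

lemma bound_if_small:
  assumes Y: "Y \<in> full_cauchy G" and small: "\<And>n. fn (Y n) \<le> e" and e: "e > 0" and \<xi>: "\<xi> \<in> V"
  shows "nrm (\<pi> (cls Y) \<xi>) \<le> 2 * e * nrm \<xi>"
proof -
  let ?c = "complex_of_real (1 / (2 * e))"
  have nc: "cmod ?c = 1 / (2 * e)" using e by (subst norm_of_real) simp
  have "fn (\<lambda>x. ?c * Y n x) \<le> 1/2" for n
  proof -
    have "fn (\<lambda>x. ?c * Y n x) \<le> 1 / (2 * e) * fn (Y n)" using fn_scale_le[OF fc_GA[OF Y], of ?c n] unfolding nc .
    also have "\<dots> \<le> 1 / (2 * e) * e" using small e by (intro mult_left_mono) auto
    finally show ?thesis using e by simp
  qed
  then have "nrm (\<pi> (cls (\<lambda>n x. ?c * Y n x)) \<xi>) \<le> nrm \<xi>" by (intro contractive_if_small fc_scale Y \<xi>)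
  then have "1 / (2 * e) * nrm (\<pi> (cls Y) \<xi>) \<le> nrm \<xi>"
    unfolding \<pi>_scale[OF Y] op_apply nrm_sc[OF bd_V'[OF \<pi>_bd[OF Y]]] nc .
  then show ?thesis using e by (simp add: field_simps)
qed

text \<open>
  The canonical unitaries span a dense subalgebra, on which the representation is continuous by the
  preceding estimate.
\<close>

theorem commutes_if_commutes_unitaries:
  assumes T: "T \<in> Bd" and comm: "\<And>g. g \<in> carrier G \<Longrightarrow> T \<circ> \<sigma> g = \<sigma> g \<circ> T" and a: "a \<in> acarrier (full_cstar G)"
  shows "T \<circ> \<pi> a = \<pi> a \<circ> T"
proof -
  have const: "T (\<pi> (cls (\<lambda>n. f)) \<xi>) = \<pi> (cls (\<lambda>n. f)) (T \<xi>)" if "f \<in> GA" for f \<xi>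
    using that
  proof (induction arbitrary: \<xi> rule: GA_induct)
    case zero
    have "\<pi> (cls (\<lambda>n. 0)) = scale_op H 0 (\<pi> (cls (\<lambda>n. 0)))"
      using \<pi>_scale[OF fc_const[OF GA_zero], of 0] by (simp add: zero_fun_def)
    then have "\<pi> (cls (\<lambda>n. 0)) x = 0" for x by (metis op_apply(4) vs.scale_zero_left)
    then show ?case using bd_0[OF T] by metis
  next
    case (add f c g)
    have fc: "(\<lambda>n::nat. f) \<in> full_cauchy G" "(\<lambda>n::nat. (\<lambda>x. c * delta g x)) \<in> full_cauchy G"
      using add by (auto intro!: fc_const GA_scale)
    have B: "\<pi> (cls (\<lambda>n. f)) \<in> Bd" "\<sigma> g \<in> Bd" using fc add by (auto intro!: \<pi>_bd)
    have eq: "\<pi> (cls (\<lambda>n. f + (\<lambda>x. c * delta g x))) = \<pi> (cls (\<lambda>n. f)) + scale_op H c (\<sigma> g)"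
      using \<pi>_add[OF fc] \<pi>_scale[OF fc_delta[OF add.hyps(2)], of c] by (simp add: canonical_unitary_def)
    have "T (\<sigma> g \<xi>) = \<sigma> g (T \<xi>)" using comm[OF add.hyps(2)] by (metis comp_apply)
    then show ?case unfolding eq using add.IH B by (simp add: op_apply bd_add[OF T] bd_sc[OF T])
  qed
  obtain Y where Y: "Y \<in> full_cauchy G" "a = cls Y" using carrier_cls[OF a] .
  have aB: "\<pi> a \<in> Bd" using rep_bd[OF \<pi> a] .
  obtain c where c: "c > 0" "\<And>x. x \<in> V \<Longrightarrow> nrm (T x) \<le> c * nrm x" using bd_bound[OF T] by blast
  show ?thesis
  proof (rule bd_eqI)
    fix \<xi> assume \<xi>: "\<xi> \<in> V"
    define K where "K = 2 * (c * nrm \<xi> + nrm (T \<xi>)) + 1"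
    have K: "K > 0" using c \<xi> T by (simp add: K_def add_nonneg_pos)
    have small: "nrm (T (\<pi> a \<xi>) - \<pi> a (T \<xi>)) \<le> 0 + e" if e: "e > 0" for e
    proof -
      define \<epsilon> where "\<epsilon> = e / K"
      have \<epsilon>: "\<epsilon> > 0" using e K by (simp add: \<epsilon>_def)
      obtain N where N: "\<forall>m\<ge>N. \<forall>n\<ge>N. fn (Y m - Y n) < \<epsilon>" using fc_cauchy[OF Y(1) \<epsilon>] by blast
      have YG: "Y n \<in> GA" for n using fc_GA[OF Y(1)] .
      define Z where "Z = (\<lambda>n. Y (n + N) - Y N)"
      have sh: "(\<lambda>n. Y (n + N)) \<in> full_cauchy G"
      proof (rule fcI)
        fix e' :: real assume "e' > 0"
        then obtain M where "\<forall>m\<ge>M. \<forall>n\<ge>M. fn (Y m - Y n) < e'" using fc_cauchy[OF Y(1)] by blast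
        then show "\<exists>M. \<forall>m\<ge>M. \<forall>n\<ge>M. fn (Y (m + N) - Y (n + N)) < e'" by (intro exI[of _ M]) simp
      qed (rule YG)
      have Z: "Z \<in> full_cauchy G" unfolding Z_def
        by (rule fc_lipschitz[OF sh sh, of _ 1]) (use fn_ge0[OF GA_minus[OF YG YG]] YG in auto)
      have Zs: "fn (Z n) \<le> \<epsilon>" for n using N by (simp add: Z_def less_imp_le)
      have fcN: "(\<lambda>n::nat. Y N) \<in> full_cauchy G" by (rule fc_const[OF YG])
      have "(Y, \<lambda>n. Y (n + N)) \<in> full_rel G"
        unfolding rel_iff
      proof (intro conjI Y sh LIMSEQ_I)
        fix r :: real assume "r > 0"
        then obtain M where M: "\<forall>m\<ge>M. \<forall>n\<ge>M. fn (Y m - Y n) < r" using fc_cauchy[OF Y(1)] by blast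
        have "norm (fn (Y n - Y (n + N)) - 0) < r" if "n \<ge> M" for n
          using M that fn_ge0[OF GA_minus[OF YG YG], of n "n + N"] by simp
        then show "\<exists>no. \<forall>n\<ge>no. norm (fn (Y n - Y (n + N)) - 0) < r" by blast
      qed
      then have "a = cls (\<lambda>n. Y N + Z n)" unfolding Y(2) Z_def by (subst cls_eqI) (simp_all add: algebra_simps)
      then have \<pi>a: "\<pi> a = \<pi> (cls (\<lambda>n. Y N)) + \<pi> (cls Z)" using \<pi>_add[OF fcN Z] by simp
      have B: "\<pi> (cls (\<lambda>n. Y N)) \<in> Bd" "\<pi> (cls Z) \<in> Bd" using \<pi>_bd fcN Z by auto
      have "T (\<pi> a \<xi>) - \<pi> a (T \<xi>) = T (\<pi> (cls Z) \<xi>) - \<pi> (cls Z) (T \<xi>)"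
        using B const[OF YG, of N \<xi>] by (simp add: \<pi>a op_apply bd_add[OF T])
      then have "nrm (T (\<pi> a \<xi>) - \<pi> a (T \<xi>)) \<le> nrm (T (\<pi> (cls Z) \<xi>)) + nrm (\<pi> (cls Z) (T \<xi>))"
        using B T by (simp add: nrm_triangle_diff)
      moreover have "nrm (T (\<pi> (cls Z) \<xi>)) \<le> c * nrm (\<pi> (cls Z) \<xi>)" using B by (intro c) simp
      moreover have "c * nrm (\<pi> (cls Z) \<xi>) \<le> c * (2 * \<epsilon> * nrm \<xi>)"
        using bound_if_small[OF Z Zs \<epsilon> \<xi>] c by simp
      moreover have "nrm (\<pi> (cls Z) (T \<xi>)) \<le> 2 * \<epsilon> * nrm (T \<xi>)" using bound_if_small[OF Z Zs \<epsilon>] T by simp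
      ultimately have "nrm (T (\<pi> a \<xi>) - \<pi> a (T \<xi>)) \<le> \<epsilon> * (2 * (c * nrm \<xi> + nrm (T \<xi>)))"
        by (simp add: algebra_simps)
      also have "\<dots> \<le> \<epsilon> * K" using \<epsilon> by (simp add: K_def)
      also have "\<dots> = e" using K by (simp add: \<epsilon>_def)
      finally show ?thesis by simp
    qed
    have dV: "T (\<pi> a \<xi>) - \<pi> a (T \<xi>) \<in> V" using aB T by simp
    have "nrm (T (\<pi> a \<xi>) - \<pi> a (T \<xi>)) \<le> 0" using small by (rule field_le_epsilon)
    then have "nrm (T (\<pi> a \<xi>) - \<pi> a (T \<xi>)) = 0" using nrm_ge0[OF dV] by simp
    then show "(T \<circ> \<pi> a) \<xi> = (\<pi> a \<circ> T) \<xi>" using nrm_eq_0[OF dV] by simp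
  qed (use T aB in auto)
qed

corollary commutant_rep:
  "commutant H (\<pi> ` acarrier (full_cstar G)) = {T \<in> Bd. \<forall>g\<in>carrier G. T \<circ> \<sigma> g = \<sigma> g \<circ> T}"
proof -
  have "canonical_unitary G g \<in> acarrier (full_cstar G)" if "g \<in> carrier G" for g
    using that by (simp add: canonical_unitary_def cls_carrier fc_delta)
  then show ?thesis using commutes_if_commutes_unitaries by (auto simp: commutant_def)
qed

end

section \<open>Ideals in rings of integers\<close>

locale number_ring =
  fixes R :: "'k::field_char_0 set"
  assumes R_def: "R = {x. algebraic_int x}" and field: "number_field TYPE('k)" and ring: "ring (int_ring :: 'k ring)"
begin

lemma int_ring_simps: "carrier (int_ring :: 'k ring) = R" "x \<otimes>\<^bsub>int_ring\<^esub> y = x * (y::'k)" "\<one>\<^bsub>int_ring\<^esub> = (1::'k)"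
  "\<zero>\<^bsub>int_ring\<^esub> = (0::'k)" "x \<oplus>\<^bsub>int_ring\<^esub> y = x + (y::'k)"
  by (simp_all add: int_ring_def K_ring_def R_def)

lemma R_0 [simp]: "0 \<in> R" and R_1 [simp]: "1 \<in> R"
  and R_add [simp]: "x \<in> R \<Longrightarrow> y \<in> R \<Longrightarrow> x + y \<in> R" and R_mult [simp]: "x \<in> R \<Longrightarrow> y \<in> R \<Longrightarrow> x * y \<in> R"
  using ring.ring_simprules(1,2,5,6)[OF ring] by (auto simp: int_ring_simps)
lemma R_of_int [simp]: "of_int n \<in> R"
  by (simp add: R_def int_imp_algebraic_int)
lemma R_of_nat [simp]: "of_nat n \<in> R"
  using R_of_int[of "int n"] by simp
lemma R_minus [simp]: "x \<in> R \<Longrightarrow> - x \<in> R"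
  using R_mult[of "of_int (-1)" x] R_of_int[of "-1"] by simp
lemma R_diff [simp]: "x \<in> R \<Longrightarrow> y \<in> R \<Longrightarrow> x - y \<in> R"
  using R_add[of x "-y"] by simp
lemma R_power [simp]: "x \<in> R \<Longrightarrow> x ^ n \<in> R"
  by (induction n) auto
lemma R_sum: "(\<And>s. s \<in> S \<Longrightarrow> f s \<in> R) \<Longrightarrow> sum f S \<in> R"
  by (induction S rule: infinite_finite_induct) auto

lemma root_in_R:
  assumes "x ^ j - x ^ i \<in> R" "i < j" shows "x \<in> R"
proof -
  define p :: "'k poly" where "p = monom 1 j - monom 1 i"
  have c: "coeff p n = (if n = j then 1 else 0) - (if n = i then 1 else 0)" for n by (simp add: p_def)
  have "degree p \<le> j" unfolding p_def using assms(2) by (intro degree_diff_le) (auto simp: degree_monom_eq)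
  moreover have "coeff p j \<noteq> 0" using assms(2) by (simp add: c)
  ultimately have d: "degree p = j" by (simp add: le_degree order_antisym)
  show ?thesis unfolding R_def
  proof (rule CollectI, rule algebraic_int_root)
    show "algebraic_int (x ^ j - x ^ i)" using assms by (simp add: R_def)
    show "poly p x = x ^ j - x ^ i" by (simp add: p_def poly_monom)
    show "\<forall>i. coeff p i \<in> \<int>" by (simp add: c)
    show "lead_coeff p = 1" using assms(2) by (simp add: d c)
    show "0 < degree p" using assms(2) by (simp add: d)
  qed
qed

lemma power_root_in_R: "x ^ n \<in> R \<Longrightarrow> n > 0 \<Longrightarrow> x \<in> R"
  using root_in_R[of x n 0] by auto

definition idl :: "'k set \<Rightarrow> bool" where
  "idl I \<longleftrightarrow> I \<subseteq> R \<and> 0 \<in> I \<and> (\<forall>x\<in>I. \<forall>y\<in>I. x + y \<in> I) \<and> (\<forall>r\<in>R. \<forall>x\<in>I. r * x \<in> I)"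

lemma idlD: "idl I \<Longrightarrow> x \<in> I \<Longrightarrow> x \<in> R" "idl I \<Longrightarrow> 0 \<in> I" "idl I \<Longrightarrow> x \<in> I \<Longrightarrow> y \<in> I \<Longrightarrow> x + y \<in> I"
  "idl I \<Longrightarrow> r \<in> R \<Longrightarrow> x \<in> I \<Longrightarrow> r * x \<in> I"
  by (auto simp: idl_def)
lemma idl_minus: "idl I \<Longrightarrow> x \<in> I \<Longrightarrow> - x \<in> I"
  using idlD(4)[of I "-1" x] R_minus[OF R_1] by simp
lemma idl_diff: "idl I \<Longrightarrow> x \<in> I \<Longrightarrow> y \<in> I \<Longrightarrow> x - y \<in> I"
  using idlD(3)[of I x "-y"] by (simp add: idl_minus)
lemma idl_right: "idl I \<Longrightarrow> r \<in> R \<Longrightarrow> x \<in> I \<Longrightarrow> x * r \<in> I"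
  using idlD(4)[of I r x] by (simp add: mult.commute)
lemma idl_R: "idl R" by (auto simp: idl_def)
lemma idl_one: "idl I \<Longrightarrow> 1 \<in> I \<Longrightarrow> I = R"
  using idlD(1) idlD(4)[of I _ 1] by fastforce

lemma smult_iff: "y \<in> smult_set x I \<longleftrightarrow> (\<exists>z\<in>I. y = x * z)"
  by (auto simp: smult_set_def)

lemma idl_smult: assumes I: "idl I" and x: "x \<in> R" shows "idl (smult_set x I)"
  unfolding idl_def
proof (intro conjI ballI)
  show "smult_set x I \<subseteq> R" using idlD(1)[OF I] x by (auto simp: smult_iff)
  show "0 \<in> smult_set x I" using idlD(2)[OF I] by (auto simp: smult_iff intro!: bexI[of _ 0])
  show "y + z \<in> smult_set x I" if "y \<in> smult_set x I" "z \<in> smult_set x I" for y z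
    using that idlD(3)[OF I] unfolding smult_iff by (metis distrib_left)
  show "r * y \<in> smult_set x I" if "r \<in> R" "y \<in> smult_set x I" for r y
    using that idlD(4)[OF I] unfolding smult_iff by (metis mult.left_commute)
qed

lemma ideal_iff: "ideal I (int_ring :: 'k ring) \<longleftrightarrow> idl I"
proof
  assume "ideal I (int_ring :: 'k ring)"
  then interpret I: ideal I "int_ring :: 'k ring" .
  have sub: "I \<subseteq> R" using I.a_subset unfolding int_ring_simps .
  have "0 \<in> I" using I.additive_subgroup_axioms additive_subgroup.zero_closed unfolding int_ring_simps(4)[symmetric] by blast
  moreover have "x + y \<in> I" if "x \<in> I" "y \<in> I" for x y
    using additive_subgroup.a_closed[OF I.additive_subgroup_axioms that] unfolding int_ring_simps .
  moreover have "r * x \<in> I" if "r \<in> R" "x \<in> I" for r x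
    using I.I_l_closed[OF that(2), of r] that(1) unfolding int_ring_simps .
  ultimately show "idl I" using sub unfolding idl_def by blast
next
  assume I: "idl I"
  show "ideal I (int_ring :: 'k ring)"
  proof (rule idealI[OF ring])
    interpret Rr: ring "int_ring :: 'k ring" by (rule ring)
    show "subgroup I (add_monoid (int_ring :: 'k ring))"
    proof (rule Rr.add.subgroupI)
      show "I \<subseteq> carrier int_ring" "I \<noteq> {}" using I by (auto simp: idl_def int_ring_simps)
      fix a b assume a: "a \<in> I" and b: "b \<in> I"
      have aR: "a \<in> R" "- a \<in> R" using idlD(1)[OF I] a by auto
      have "\<ominus>\<^bsub>int_ring\<^esub> a = - a"
        by (rule Rr.minus_equality) (simp_all add: int_ring_simps aR)
      then show "\<ominus>\<^bsub>int_ring\<^esub> a \<in> I" using idl_minus[OF I a] by simp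
      show "a \<oplus>\<^bsub>int_ring\<^esub> b \<in> I" using I a b by (simp add: int_ring_simps idlD)
    qed
  qed (use I in \<open>auto simp: int_ring_simps idlD idl_right\<close>)
qed

subsection \<open>Finiteness of quotients\<close>

text \<open>
  Finiteness of \<open>R/J\<close>, in terms of representatives.
\<close>

definition finquot :: "'k set \<Rightarrow> bool" where
  "finquot J \<longleftrightarrow> (\<exists>F. finite F \<and> F \<subseteq> R \<and> (\<forall>r\<in>R. \<exists>f\<in>F. r - f \<in> J))"

lemma finquot_mono: "finquot J \<Longrightarrow> J \<subseteq> J' \<Longrightarrow> finquot J'"
  unfolding finquot_def by (meson subsetD)

text \<open>
  Linear independence over \<open>\<int>/l\<close> of the images in \<open>R/lR\<close>.
\<close>

definition indep_mod :: "nat \<Rightarrow> 'k set \<Rightarrow> bool" where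
  "indep_mod l S \<longleftrightarrow> finite S \<and> S \<subseteq> R \<and>
     (\<forall>c. (\<Sum>s\<in>S. of_int (c s) * s) \<in> smult_set (of_nat l) R \<longrightarrow> (\<forall>s\<in>S. int l dvd c s))"

lemma integral_relation:
  "\<exists>d. \<forall>S. finite S \<and> card S > d \<longrightarrow> (\<exists>c::'k \<Rightarrow> int. (\<exists>v\<in>S. c v \<noteq> 0) \<and> (\<Sum>v\<in>S. of_int (c v) * v) = 0)"
proof -
  obtain B where "finite_dimensional_vector_space (\<lambda>(q::rat) (x::'k). of_rat q * x) B"
    using field by (auto simp: number_field_def)
  then interpret F: finite_dimensional_vector_space "\<lambda>(q::rat) (x::'k). of_rat q * x" B .
  have "\<exists>c::'k \<Rightarrow> int. (\<exists>v\<in>S. c v \<noteq> 0) \<and> (\<Sum>v\<in>S. of_int (c v) * v) = 0" if finS: "finite S" and big: "card S > card B" for S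
  proof -
    have "F.dependent S"
      using F.independent_span_bound[OF F.finite_Basis, of S] F.span_Basis big by auto
    then obtain u where u: "\<exists>v\<in>S. u v \<noteq> 0" "(\<Sum>v\<in>S. of_rat (u v) * v) = 0"
      using F.dependent_finite[OF finS] by auto
    define D where "D = (\<Prod>v\<in>S. snd (quotient_of (u v)))"
    have Dpos: "D > 0" unfolding D_def by (intro prod_pos) (simp add: quotient_of_denom_pos')
    have int: "of_int D * u v \<in> \<int>" if "v \<in> S" for v
    proof -
      have "D = snd (quotient_of (u v)) * (\<Prod>v\<in>S - {v}. snd (quotient_of (u v)))"
        unfolding D_def using finS that by (rule prod.remove)
      moreover have "u v = of_int (fst (quotient_of (u v))) / of_int (snd (quotient_of (u v)))"
        by (simp add: quotient_of_div)
      moreover have "snd (quotient_of (u v)) \<noteq> 0" using quotient_of_denom_pos'[of "u v"] by simp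
      ultimately have "of_int D * u v = of_int (fst (quotient_of (u v)) * (\<Prod>v\<in>S - {v}. snd (quotient_of (u v))))"
        by (simp add: field_simps)
      then show ?thesis by (metis Ints_of_int)
    qed
    define c0 where "c0 = (\<lambda>v. \<lfloor>of_int D * u v\<rfloor>)"
    have c0: "of_int (c0 v) = of_int D * u v" if "v \<in> S" for v
      using int[OF that] by (auto simp: c0_def elim!: Ints_cases)
    have c0': "(of_int (c0 v) :: 'k) = of_int D * of_rat (u v)" if "v \<in> S" for v
      using arg_cong[OF c0[OF that], of "of_rat :: rat \<Rightarrow> 'k"] by (simp add: of_rat_mult)
    have "(\<Sum>v\<in>S. of_int (c0 v) * v) = of_int D * (\<Sum>v\<in>S. of_rat (u v) * v)"
      unfolding sum_distrib_left by (intro sum.cong refl) (simp add: c0' mult.assoc)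
    moreover have "\<exists>v\<in>S. c0 v \<noteq> 0"
    proof -
      obtain v where "v \<in> S" "u v \<noteq> 0" using u(1) by auto
      then have "of_int (c0 v) \<noteq> (0::rat)" using c0 Dpos by simp
      then show ?thesis using \<open>v \<in> S\<close> by auto
    qed
    ultimately show ?thesis using u(2) by (intro exI[of _ c0]) simp
  qed
  then show ?thesis by blast
qed

text \<open>
  Over \<open>\<rat>\<close> a family of more than \<open>[K : \<rat>]\<close> integers is dependent, and a shortest integral
  relation is not divisible by \<open>l\<close>; so \<open>R/lR\<close> has bounded rank.
\<close>

lemma indep_mod_card_bounded:
  assumes l: "l > 1"
  shows "\<exists>d. \<forall>S. indep_mod l S \<longrightarrow> card S \<le> d"
proof -
  obtain d where d: "\<forall>S. finite S \<and> card S > d \<longrightarrow> (\<exists>c::'k \<Rightarrow> int. (\<exists>v\<in>S. c v \<noteq> 0) \<and> (\<Sum>v\<in>S. of_int (c v) * v) = 0)"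
    using integral_relation by blast
  have "card S \<le> d" if S: "indep_mod l S" for S
  proof (rule ccontr)
    assume big: "\<not> card S \<le> d"
    have finS: "finite S" using S by (simp add: indep_mod_def)
    define Rel where "Rel = {c. (\<exists>v\<in>S. c v \<noteq> 0) \<and> (\<Sum>v\<in>S. of_int (c v) * v) = 0}"
    have "\<exists>c. c \<in> Rel" unfolding Rel_def using d finS big by simp
    then obtain c0 where "c0 \<in> Rel" by blast
    define size where "size = (\<lambda>c::'k \<Rightarrow> int. nat (\<Sum>v\<in>S. \<bar>c v\<bar>))"
    obtain c where c: "c \<in> Rel" and cmin: "\<And>c'. c' \<in> Rel \<Longrightarrow> size c \<le> size c'"
      using arg_min_nat_lemma[of "\<lambda>c. c \<in> Rel" c0 size] \<open>c0 \<in> Rel\<close> by blast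
    have "int l dvd c s" if "s \<in> S" for s
    proof -
      have "(\<Sum>v\<in>S. of_int (c v) * v) = of_nat l * 0" using c by (simp add: Rel_def)
      then have "(\<Sum>v\<in>S. of_int (c v) * v) \<in> smult_set (of_nat l) R" unfolding smult_iff using R_0 by blast
      then show ?thesis using S that by (auto simp: indep_mod_def)
    qed
    then have cdiv: "c s = int l * (c s div int l)" if "s \<in> S" for s using that by simp
    define c' where "c' = (\<lambda>s. c s div int l)"
    have cc: "c s = int l * c' s" if "s \<in> S" for s using cdiv[OF that] by (simp add: c'_def)
    have "(\<Sum>v\<in>S. of_int (c v) * v) = of_nat l * (\<Sum>v\<in>S. of_int (c' v) * v)"
      unfolding sum_distrib_left by (intro sum.cong refl) (simp add: cc)
    then have "(\<Sum>v\<in>S. of_int (c' v) * v) = 0" using c l by (simp add: Rel_def)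
    moreover obtain s where s: "s \<in> S" "c s \<noteq> 0" using c by (auto simp: Rel_def)
    moreover have s': "c' s \<noteq> 0" using s cc by force
    ultimately have "c' \<in> Rel" by (auto simp: Rel_def)
    then have "size c \<le> size c'" by (rule cmin)
    have le: "\<bar>c' v\<bar> \<le> \<bar>c v\<bar>" if "v \<in> S" for v
      using cc[OF that] l by (simp add: abs_mult mult_le_cancel_right1)
    have lt: "\<bar>c' s\<bar> < \<bar>c s\<bar>"
      using cc[OF s(1)] l s' by (simp add: abs_mult)
    have "(\<Sum>v\<in>S. \<bar>c' v\<bar>) < (\<Sum>v\<in>S. \<bar>c v\<bar>)"
      by (rule sum_strict_mono_ex1[OF finS]) (use le lt s in auto)
    moreover have "(\<Sum>v\<in>S. \<bar>c' v\<bar>) \<ge> 0" by (rule sum_nonneg) simp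
    ultimately have "0 < (\<Sum>v\<in>S. \<bar>c v\<bar>)" "(\<Sum>v\<in>S. \<bar>c' v\<bar>) < (\<Sum>v\<in>S. \<bar>c v\<bar>)" by linarith+
    then have "size c' < size c" by (simp add: size_def)
    then show False using \<open>size c \<le> size c'\<close> by simp
  qed
  then show ?thesis by blast
qed

text \<open>
  A maximal independent set modulo \<open>l\<close> spans \<open>R/lR\<close> over the field with \<open>l\<close> elements.
\<close>

lemma finquot_prime:
  assumes l: "prime (l::nat)" shows "finquot (smult_set (of_nat l) R)"
proof -
  let ?J = "smult_set (of_nat l :: 'k) R"
  have J: "idl ?J" by (rule idl_smult[OF idl_R R_of_nat])
  have l1: "l > 1" by (rule prime_gt_1_nat[OF l])
  obtain d where d: "\<And>S. indep_mod l S \<Longrightarrow> card S \<le> d" using indep_mod_card_bounded[OF l1] by blast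
  have "indep_mod l {}" by (simp add: indep_mod_def)
  then obtain S where S: "indep_mod l S" and Smax: "\<And>S'. indep_mod l S' \<Longrightarrow> card S' \<le> card S"
    using ex_has_greatest_nat[of "indep_mod l" "{}" card "Suc d"] d le_imp_less_Suc by blast
  have finS: "finite S" "S \<subseteq> R" using S by (auto simp: indep_mod_def)
  define F where "F = (\<lambda>c. \<Sum>s\<in>S. of_int (c s) * s) ` (S \<rightarrow>\<^sub>E {0..<int l})"
  have "finite F" unfolding F_def using finS by (intro finite_imageI finite_PiE) auto
  moreover have "F \<subseteq> R" using finS by (auto simp: F_def intro!: R_sum)
  moreover have "\<exists>f\<in>F. r - f \<in> ?J" if r: "r \<in> R" for r
  proof -
    \<comment> \<open>Any integral combination may be reduced modulo \<open>l\<close>.\<close>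
    have red: "\<exists>f\<in>F. r - f \<in> ?J" if rc: "r - (\<Sum>s\<in>S. of_int (c s) * s) \<in> ?J" for c
    proof -
      define c' where "c' = (\<lambda>s\<in>S. c s mod int l)"
      have "(\<Sum>s\<in>S. of_int (c s) * s) - (\<Sum>s\<in>S. of_int (c' s) * s) = of_nat l * (\<Sum>s\<in>S. of_int (c s div int l) * s)"
        unfolding sum_distrib_left sum_subtractf[symmetric]
      proof (intro sum.cong refl)
        fix s assume s: "s \<in> S"
        have "of_int (c s) - of_int (c' s) = (of_nat l * of_int (c s div int l) :: 'k)"
        proof -
          have "c s - c' s = int l * (c s div int l)" using s by (simp add: c'_def minus_mod_eq_mult_div)
          from arg_cong[OF this, of "of_int :: int \<Rightarrow> 'k"] show ?thesis by simp
        qed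
        then show "of_int (c s) * s - of_int (c' s) * s = of_nat l * (of_int (c s div int l) * s)"
          by (metis left_diff_distrib mult.assoc)
      qed
      moreover have "(\<Sum>s\<in>S. of_int (c s div int l) * s) \<in> R" using finS by (intro R_sum) auto
      ultimately have "(\<Sum>s\<in>S. of_int (c s) * s) - (\<Sum>s\<in>S. of_int (c' s) * s) \<in> ?J" unfolding smult_iff by blast
      from idlD(3)[OF J rc this] have "r - (\<Sum>s\<in>S. of_int (c' s) * s) \<in> ?J" by simp
      moreover have "(\<Sum>s\<in>S. of_int (c' s) * s) \<in> F" unfolding F_def
        using l1 by (intro imageI) (auto simp: c'_def)
      ultimately show ?thesis by blast
    qed
    show ?thesis
    proof (cases "r \<in> S")
      case True
      have "(\<Sum>s\<in>S. of_int (if s = r then 1 else 0) * s) = (\<Sum>s\<in>S. if s = r then r else 0)" by (intro sum.cong) auto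
      also have "\<dots> = r" using True finS by (simp add: sum.delta)
      finally show ?thesis using red[of "\<lambda>s. if s = r then 1 else 0"] idlD(2)[OF J] by simp
    next
      case False
      then have "\<not> indep_mod l (insert r S)" using Smax[of "insert r S"] finS by auto
      then obtain c s0 where c: "(\<Sum>s\<in>insert r S. of_int (c s) * s) \<in> ?J" and s0: "s0 \<in> insert r S" "\<not> int l dvd c s0"
        using finS r by (auto simp: indep_mod_def)
      have c: "of_int (c r) * r + (\<Sum>s\<in>S. of_int (c s) * s) \<in> ?J" using c False finS by simp
      have "\<not> int l dvd c r"
      proof
        assume "int l dvd c r"
        then obtain q where "c r = int l * q" by auto
        then have "of_int (c r) * r = of_nat l * (of_int q * r)" by (simp add: mult.assoc)
        moreover have "of_int q * r \<in> R" using r by simp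
        ultimately have cr: "of_int (c r) * r \<in> ?J" unfolding smult_iff by blast
        have "(\<Sum>s\<in>S. of_int (c s) * s) \<in> ?J" using idl_diff[OF J c cr] by simp
        then show False using S s0 \<open>int l dvd c r\<close> by (auto simp: indep_mod_def)
      qed
      then have "coprime (int l) (c r)" using l by (simp add: prime_imp_coprime)
      then obtain e k where ek: "e * c r + k * int l = 1"
        by (metis bezout_int coprime_iff_gcd_eq_1 gcd.commute)
      have "of_int e * (of_int (c r) * r + (\<Sum>s\<in>S. of_int (c s) * s)) \<in> ?J" by (rule idlD(4)[OF J R_of_int c])
      moreover have "of_nat l * (of_int k * r) \<in> ?J" unfolding smult_iff using r by (metis R_mult R_of_int)
      ultimately have "of_int e * (of_int (c r) * r + (\<Sum>s\<in>S. of_int (c s) * s)) + of_nat l * (of_int k * r) \<in> ?J"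
        by (rule idlD(3)[OF J])
      moreover have "of_int e * (of_int (c r) * r + (\<Sum>s\<in>S. of_int (c s) * s)) + of_nat l * (of_int k * r)
         = r - (\<Sum>s\<in>S. of_int (- (e * c s)) * s)"
      proof -
        have "(of_int e * of_int (c r) + of_int k * of_nat l) * r = 1 * r"
          using arg_cong[OF ek, of "of_int :: int \<Rightarrow> 'k"] by simp
        moreover have "(\<Sum>s\<in>S. of_int (- (e * c s)) * s) = - (of_int e * (\<Sum>s\<in>S. of_int (c s) * s))"
          by (simp add: sum_distrib_left sum_negf mult.assoc)
        ultimately show ?thesis by (simp add: algebra_simps)
      qed
      ultimately show ?thesis using red[of "\<lambda>s. - (e * c s)"] by simp
    qed
  qed
  ultimately show ?thesis by (auto simp: finquot_def)
qed

lemma finquot_nat: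
  assumes "n > 0" shows "finquot (smult_set (of_nat n) R)"
  using assms
proof (induction n rule: less_induct)
  case (less n)
  show ?case
  proof (cases "n = 1")
    case True
    then show ?thesis unfolding finquot_def smult_set_def by (intro exI[of _ "{0}"]) auto
  next
    case False
    then obtain l where l: "prime l" "l dvd n" using prime_factor_nat by blast
    then obtain m where m: "n = l * m" by auto
    have "m < n" "m > 0" using less.prems m l prime_gt_1_nat[OF l(1)] by auto
    then obtain F where F: "finite F" "F \<subseteq> R" "\<forall>r\<in>R. \<exists>f\<in>F. r - f \<in> smult_set (of_nat m) R"
      using less.IH[of m] unfolding finquot_def by blast
    obtain F' where F': "finite F'" "F' \<subseteq> R" "\<forall>r\<in>R. \<exists>f\<in>F'. r - f \<in> smult_set (of_nat l) R"
      using finquot_prime[OF l(1)] unfolding finquot_def by blast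
    let ?G = "(\<lambda>(f', f). f' + of_nat l * f) ` (F' \<times> F)"
    have "\<exists>g\<in>?G. r - g \<in> smult_set (of_nat n) R" if r: "r \<in> R" for r
    proof -
      obtain f' q where f': "f' \<in> F'" "q \<in> R" "r - f' = of_nat l * q" using F'(3) r unfolding smult_iff by blast
      obtain f q' where f: "f \<in> F" "q' \<in> R" "q - f = of_nat m * q'" using F(3) f'(2) unfolding smult_iff by blast
      have "r - (f' + of_nat l * f) = of_nat l * (q - f)" using f'(3) by (simp add: algebra_simps)
      also have "\<dots> = of_nat n * q'" using f(3) m by (simp add: mult.assoc)
      finally have "r - (f' + of_nat l * f) \<in> smult_set (of_nat n) R" unfolding smult_iff using f(2) by blast
      then show ?thesis using f(1) f'(1) by force
    qed
    moreover have "finite ?G" using F F' by auto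
    moreover have "?G \<subseteq> R" using F(2) F'(2) by (auto simp: subset_iff)
    ultimately show ?thesis unfolding finquot_def by blast
  qed
qed

text \<open>If \<open>a\<^sub>0 + \<dots> + a\<^sub>n x\<^sup>n = 0\<close> with integers \<open>a\<^sub>i\<close>, then \<open>a\<^sub>n x\<close> is integral.\<close>

lemma has_denominator: "\<exists>b\<in>R. b \<noteq> 0 \<and> b * x \<in> R"
proof -
  obtain d where d: "\<forall>S. finite S \<and> card S > d \<longrightarrow> (\<exists>c::'k \<Rightarrow> int. (\<exists>v\<in>S. c v \<noteq> 0) \<and> (\<Sum>v\<in>S. of_int (c v) * v) = 0)"
    using integral_relation by blast
  show ?thesis
  proof (cases "inj_on (\<lambda>i. x ^ i) {..d}")
    case False
    then obtain i j where "i < j" "x ^ i = x ^ j" unfolding inj_on_def by (metis linorder_neqE_nat)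
    then have "x \<in> R" using root_in_R[of x j i] by simp
    then show ?thesis by (intro bexI[of _ 1]) auto
  next
    case True
    let ?S = "(\<lambda>i. x ^ i) ` {..d}"
    have "card ?S > d" using card_image[OF True] by simp
    then obtain c :: "'k \<Rightarrow> int" where c: "\<exists>v\<in>?S. c v \<noteq> 0" "(\<Sum>v\<in>?S. of_int (c v) * v) = 0"
      using d[rule_format, of ?S] by auto
    define a where "a = (\<lambda>i. c (x ^ i))"
    have a: "(\<Sum>i\<le>d. of_int (a i) * x ^ i) = 0" using c(2) sum.reindex[OF True, of "\<lambda>v. of_int (c v) * v"] by (simp add: a_def)
    define n where "n = (GREATEST i. i \<le> d \<and> a i \<noteq> 0)"
    have ex: "\<exists>i. i \<le> d \<and> a i \<noteq> 0" using c(1) by (auto simp: a_def)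
    have n: "n \<le> d \<and> a n \<noteq> 0" unfolding n_def by (rule GreatestI_ex_nat[OF ex, of d]) simp
    have ngr: "a i = 0" if "i \<le> d" "i > n" for i
      using Greatest_le_nat[of "\<lambda>i. i \<le> d \<and> a i \<noteq> 0" i d] that unfolding n_def by auto
    have an: "(\<Sum>i\<le>n. of_int (a i) * x ^ i) = 0"
    proof -
      have "(\<Sum>i\<le>n. of_int (a i) * x ^ i) = (\<Sum>i\<le>d. of_int (a i) * x ^ i)"
        by (rule sum.mono_neutral_left) (use n ngr in auto)
      then show ?thesis using a by simp
    qed
    define y where "y = of_int (a n) * x"
    have "y \<in> R"
    proof (cases "n = 0")
      case True
      then show ?thesis using an n by simp
    next
      case False
      define P :: "'k poly" where "P = monom 1 n + (\<Sum>i<n. monom (of_int (a i * a n ^ (n - 1 - i))) i)"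
      have cP: "coeff P k = (if k = n then 1 else 0) + (if k < n then of_int (a k * a n ^ (n - 1 - k)) else 0)" for k
        by (simp add: P_def coeff_sum sum.delta)
      have "degree P = n"
      proof (rule order_antisym)
        show "degree P \<le> n" by (rule degree_le) (auto simp: cP)
        show "n \<le> degree P" by (rule le_degree) (simp add: cP)
      qed
      have "poly P y = y ^ n + (\<Sum>i<n. of_int (a i * a n ^ (n - 1 - i)) * y ^ i)"
        by (simp add: P_def poly_monom poly_sum)
      also have "\<dots> = of_int (a n) ^ (n - 1) * (of_int (a n) * x ^ n) + (\<Sum>i<n. of_int (a n) ^ (n - 1) * (of_int (a i) * x ^ i))"
      proof (intro arg_cong2[of _ _ _ _ "(+)"] sum.cong refl)
        have "of_int (a n) ^ n = (of_int (a n) ^ (n - 1) * of_int (a n) :: 'k)" using False by (simp flip: power_Suc2)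
        then show "y ^ n = of_int (a n) ^ (n - 1) * (of_int (a n) * x ^ n)"
          by (simp add: y_def power_mult_distrib mult.assoc)
        fix i assume i: "i \<in> {..<n}"
        have "of_int (a n) ^ (n - 1) = (of_int (a n) ^ (n - 1 - i) * of_int (a n) ^ i :: 'k)" using i by (simp flip: power_add)
        then show "of_int (a i * a n ^ (n - 1 - i)) * y ^ i = of_int (a n) ^ (n - 1) * (of_int (a i) * x ^ i)"
          by (simp add: y_def power_mult_distrib mult_ac)
      qed
      also have "\<dots> = of_int (a n) ^ (n - 1) * (\<Sum>i\<le>n. of_int (a i) * x ^ i)"
        by (simp add: sum_distrib_left distrib_left lessThan_Suc_atMost[symmetric] add.commute)
      finally have "poly P y = 0" using an by simp
      moreover have "lead_coeff P = 1" using \<open>degree P = n\<close> by (simp add: cP)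
      moreover have "\<forall>i. coeff P i \<in> \<int>" by (simp add: cP)
      ultimately show ?thesis unfolding R_def by (auto intro: algebraic_int.intros)
    qed
    then show ?thesis using n by (intro bexI[of _ "of_int (a n)"]) (auto simp: y_def)
  qed
qed

lemma poly_int_in_R: "x \<in> R \<Longrightarrow> poly (map_poly of_int p) x \<in> R"
  by (induction p) (auto simp: map_poly_pCons)

lemma nat_in_ideal:
  assumes I: "idl I" "I \<noteq> {0}"
  obtains n where "n > 0" "of_nat n \<in> I"
proof -
  obtain a where a: "a \<in> I" "a \<noteq> 0" using I idlD(2)[OF I(1)] by blast
  have aR: "a \<in> R" using idlD(1)[OF I(1) a(1)] .
  obtain p0 where p0: "poly (map_poly of_int p0) a = 0" "lead_coeff p0 = 1"
    using aR unfolding R_def algebraic_int_altdef_ipoly by auto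
  have "\<exists>n>0. of_nat n \<in> I" if "poly (map_poly of_int p) a = 0" "p \<noteq> 0" for p
    using that
  proof (induction p)
    case 0 then show ?case by simp
  next
    case (pCons c p)
    have eq: "of_int c + a * poly (map_poly of_int p) a = 0" using pCons.prems by (simp add: map_poly_pCons)
    show ?case
    proof (cases "c = 0")
      case True
      then have "poly (map_poly of_int p) a = 0" "p \<noteq> 0" using eq a pCons by auto
      then show ?thesis using pCons.IH by blast
    next
      case False
      have "a * poly (map_poly of_int p) a \<in> I" by (rule idl_right[OF I(1) poly_int_in_R[OF aR] a(1)])
      moreover have "a * poly (map_poly of_int p) a = - of_int c" using eq by (simp add: eq_neg_iff_add_eq_0 add.commute)
      ultimately have "- of_int c \<in> I" "of_int c \<in> I" using idl_minus[OF I(1), of "- of_int c"] by auto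
      moreover have "of_nat (nat \<bar>c\<bar>) = (of_int c :: 'k) \<or> of_nat (nat \<bar>c\<bar>) = (- of_int c :: 'k)"
        by (cases "c \<ge> 0") (auto simp: abs_if)
      ultimately have "of_nat (nat \<bar>c\<bar>) \<in> I" by metis
      then show ?thesis using False by (intro exI[of _ "nat \<bar>c\<bar>"]) simp
    qed
  qed
  then obtain n where "n > 0" "of_nat n \<in> I" using p0 by (metis leading_coeff_0_iff zero_neq_one)
  then show thesis by (rule that)
qed

theorem finquot_ideal: assumes I: "idl I" "I \<noteq> {0}" shows "finquot I"
proof -
  obtain n where n: "n > 0" "of_nat n \<in> I" using nat_in_ideal[OF assms] .
  have "smult_set (of_nat n) R \<subseteq> I" using n idl_right[OF I(1)] by (auto simp: smult_iff)
  then show ?thesis using finquot_mono finquot_nat[OF n(1)] by blast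
qed

lemma R_nontrivial: "R \<noteq> {0}"
  using R_1 by (metis singletonD zero_neq_one)

lemma smult_nonzero: "x \<noteq> 0 \<Longrightarrow> I \<noteq> {0} \<Longrightarrow> idl I \<Longrightarrow> smult_set x I \<noteq> {0}"
  by (metis idlD(2) insertI1 mult_eq_0_iff singletonD smult_iff subsetI subset_antisym singletonI)

text \<open>Two of infinitely many elements of \<open>R\<close> agree modulo a nonzero ideal.\<close>

lemma pigeonhole_mod:
  assumes I: "idl I" "I \<noteq> {0}" and g: "\<And>n::nat. g n \<in> R"
  obtains i j where "i < j" "g j - g i \<in> I"
proof -
  obtain F where F: "finite F" "\<And>r. r \<in> R \<Longrightarrow> \<exists>f\<in>F. r - f \<in> I" using finquot_ideal[OF I] unfolding finquot_def by blast
  have "\<forall>n. \<exists>f. f \<in> F \<and> g n - f \<in> I" using F(2)[OF g] by blast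
  from choice[OF this] obtain f where f: "\<And>n. f n \<in> F" "\<And>n. g n - f n \<in> I" by blast
  have "\<not> inj f" using F(1) f(1) by (metis finite_subset image_subset_iff infinite_UNIV_nat finite_imageD)
  then obtain i j where "i < j" "f i = f j" by (metis injI linorder_neqE_nat)
  then have "g j - g i \<in> I" using idl_diff[OF I(1) f(2)[of j] f(2)[of i]] by simp
  then show thesis using \<open>i < j\<close> that by blast
qed

text \<open>\<open>R\<close> is completely integrally closed.\<close>

lemma almost_integral:
  assumes a: "a \<in> R" "a \<noteq> 0" and x: "\<And>n. x ^ n * a \<in> R" shows "x \<in> R"
proof -
  have I: "idl (smult_set a R)" "smult_set a R \<noteq> {0}"
    using a idl_smult[OF idl_R a(1)] smult_nonzero[OF a(2) _ idl_R] R_nontrivial by auto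
  obtain i j where ij: "i < j" "x ^ j * a - x ^ i * a \<in> smult_set a R"
    by (rule pigeonhole_mod[OF I, of "\<lambda>n. x ^ n * a", OF x])
  then obtain r where r: "r \<in> R" "x ^ j * a - x ^ i * a = a * r" by (auto simp: smult_iff)
  then have "a * (x ^ j - x ^ i) = a * r" by (simp add: algebra_simps)
  then have "x ^ j - x ^ i \<in> R" using a(2) r(1) by simp
  then show ?thesis using root_in_R ij(1) by blast
qed

text \<open>
  An ideal containing \<open>c\<close> is determined by the representatives of \<open>R/c\<close> that it contains.
\<close>

lemma maximal_in_family:
  assumes c: "idl c" "c \<noteq> {0}" and fam: "\<And>I. I \<in> A \<Longrightarrow> idl I \<and> c \<subseteq> I" and ne: "I0 \<in> A"
  obtains M where "M \<in> A" "\<And>J. J \<in> A \<Longrightarrow> M \<subseteq> J \<Longrightarrow> J = M"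
proof -
  obtain F where F: "finite F" "F \<subseteq> R" "\<forall>r\<in>R. \<exists>f\<in>F. r - f \<in> c" using finquot_ideal[OF c] unfolding finquot_def by blast
  have "\<exists>M. M \<in> A \<and> (\<forall>J. J \<in> A \<longrightarrow> card (J \<inter> F) \<le> card (M \<inter> F))"
    by (rule ex_has_greatest_nat[of "\<lambda>I. I \<in> A" I0 _ "Suc (card F)"])
      (use ne F(1) in \<open>auto intro!: le_imp_less_Suc card_mono\<close>)
  then obtain M where M: "M \<in> A" and Mmax: "\<And>J. J \<in> A \<Longrightarrow> card (J \<inter> F) \<le> card (M \<inter> F)" by blast
  have "J = M" if J: "J \<in> A" "M \<subseteq> J" for J
  proof (rule ccontr)
    assume "J \<noteq> M"
    then obtain x where x: "x \<in> J" "x \<notin> M" using J by auto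
    have Ji: "idl J" "c \<subseteq> J" and Mi: "idl M" "c \<subseteq> M" using fam J M by auto
    obtain f where f: "f \<in> F" "x - f \<in> c" using F(3) idlD(1)[OF Ji(1) x(1)] by blast
    have "f \<in> J" using idl_diff[OF Ji(1) x(1), of "x - f"] f Ji by auto
    moreover have "f \<notin> M" using idlD(3)[OF Mi(1), of "x - f" f] f Mi x by auto
    ultimately have "M \<inter> F \<subset> J \<inter> F" using f J by blast
    then have "card (M \<inter> F) < card (J \<inter> F)" using F(1) by (intro psubset_card_mono) auto
    then show False using Mmax[OF J(1)] by simp
  qed
  then show thesis using M that by blast
qed

subsection \<open>Primes and their inverses\<close>

definition prm :: "'k set \<Rightarrow> bool" where
  "prm p \<longleftrightarrow> idl p \<and> p \<noteq> {0} \<and> 1 \<notin> p \<and> (\<forall>x\<in>R. \<forall>y\<in>R. x * y \<in> p \<longrightarrow> x \<in> p \<or> y \<in> p)"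

lemma prmD: "prm p \<Longrightarrow> idl p" "prm p \<Longrightarrow> p \<noteq> {0}" "prm p \<Longrightarrow> 1 \<notin> p"
  "prm p \<Longrightarrow> x \<in> R \<Longrightarrow> y \<in> R \<Longrightarrow> x * y \<in> p \<Longrightarrow> x \<in> p \<or> y \<in> p"
  by (auto simp: prm_def)

lemma prm_power: "prm p \<Longrightarrow> x \<in> R \<Longrightarrow> x \<notin> p \<Longrightarrow> x ^ n \<notin> p"
  by (induction n) (auto simp: prmD(3) dest: prmD(4)[of p x "x ^ _"])

lemma prm_prod:
  assumes p: "prm p" and "finite A" and "\<And>a. a \<in> A \<Longrightarrow> s a \<in> R - p" shows "prod s A \<in> R - p"
  using assms(2,3)
proof (induction A rule: finite_induct)
  case empty then show ?case using prmD(3)[OF p] by simp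
next
  case (insert a A)
  then have "s a \<in> R - p" "prod s A \<in> R - p" by auto
  then show ?case using insert(1,2) prmD(4)[OF p, of "s a" "prod s A"] by auto
qed

lemma nonzero_prime_iff: "nonzero_prime p \<longleftrightarrow> prm p"
proof
  assume "nonzero_prime p"
  then have p: "primeideal p int_ring" "p \<noteq> {0}" by (auto simp: nonzero_prime_def)
  interpret primeideal p "int_ring :: 'k ring" by (rule p)
  have i: "idl p" using ideal_axioms ideal_iff by blast
  have "1 \<notin> p" using idl_one[OF i] I_notcarr by (auto simp: int_ring_simps)
  then show "prm p" using i p(2) I_prime by (auto simp: prm_def int_ring_simps)
next
  assume p: "prm p"
  have "primeideal p int_ring"
  proof (rule primeidealI)
    show "ideal p (int_ring :: 'k ring)" using prmD(1)[OF p] ideal_iff by blast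
    show "cring (int_ring :: 'k ring)"
      by (rule cring.intro[OF ring]) (unfold_locales, auto simp: int_ring_simps mult_ac)
    show "carrier (int_ring :: 'k ring) \<noteq> p" using prmD(3)[OF p] R_1 by (auto simp: int_ring_simps)
  qed (use prmD(4)[OF p] in \<open>auto simp: int_ring_simps\<close>)
  then show "nonzero_prime p" using prmD(2)[OF p] by (simp add: nonzero_prime_def)
qed

text \<open>
  Let \<open>Z\<close> be the part of \<open>aR\<close> visible at \<open>p\<close>, for \<open>0 \<noteq> a \<in> p\<close>. Modulo \<open>Z\<close> every element of \<open>p\<close> is
  nilpotent, so a maximal annihilator \<open>(Z : b)\<close> contains \<open>p\<close>. Clearing the finitely many
  denominators by \<open>s \<notin> p\<close>, the element \<open>sb/a\<close> lies in \<open>p\<inverse>\<close> but not in \<open>R\<close>.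
\<close>

lemma prime_inverse:
  assumes p: "prm p"
  obtains h where "h \<notin> R" "\<And>x. x \<in> p \<Longrightarrow> h * x \<in> R"
proof -
  note pi = prmD(1)[OF p]
  obtain a where a: "a \<in> p" "a \<noteq> 0" using prmD(2)[OF p] idlD(2)[OF pi] by blast
  have aR: "a \<in> R" using idlD(1)[OF pi a(1)] .
  let ?A = "smult_set a R"
  have A: "idl ?A" "?A \<noteq> {0}" using idl_smult[OF idl_R aR] smult_nonzero[OF a(2) R_nontrivial idl_R] by auto
  have Ap: "?A \<subseteq> p" using idl_right[OF pi _ a(1)] by (auto simp: smult_iff)
  define Z where "Z = {r \<in> R. \<exists>s\<in>R - p. s * r \<in> ?A}"
  have mulp: "s * s' \<in> R - p" if "s \<in> R - p" "s' \<in> R - p" for s s' using prmD(4)[OF p] that by auto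
  have AZ: "?A \<subseteq> Z" unfolding Z_def using idlD(1)[OF A(1)] prmD(3)[OF p] by (auto intro!: bexI[of _ 1])
  have Z: "idl Z" unfolding idl_def
  proof (intro conjI ballI)
    show "Z \<subseteq> R" "0 \<in> Z" using AZ idlD(2)[OF A(1)] by (auto simp: Z_def)
    fix x y assume x: "x \<in> Z" and y: "y \<in> Z"
    obtain s s' where s: "s \<in> R - p" "s * x \<in> ?A" "s' \<in> R - p" "s' * y \<in> ?A" using x y by (auto simp: Z_def)
    have "s' * (s * x) + s * (s' * y) \<in> ?A"
      by (intro idlD(3)[OF A(1)] idlD(4)[OF A(1) _ s(2)] idlD(4)[OF A(1) _ s(4)]) (use s in auto)
    then have "(s * s') * (x + y) \<in> ?A" by (simp add: algebra_simps)
    then show "x + y \<in> Z" using x y mulp[OF s(1,3)] by (auto simp: Z_def)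
  next
    fix r x assume r: "r \<in> R" and x: "x \<in> Z"
    obtain s where s: "s \<in> R - p" "s * x \<in> ?A" using x by (auto simp: Z_def)
    have "s * (r * x) \<in> ?A" using idlD(4)[OF A(1) r s(2)] by (simp add: mult.left_commute)
    then show "r * x \<in> Z" using s r x by (auto simp: Z_def)
  qed
  have Zsat: "x \<in> Z" if x: "x \<in> R" and s: "s \<in> R - p" and sx: "s * x \<in> Z" for x s
  proof -
    obtain s' where "s' \<in> R - p" "s' * (s * x) \<in> ?A" using sx by (auto simp: Z_def)
    then have "s' * s \<in> R - p" "(s' * s) * x \<in> ?A" using mulp[of s' s] s by (auto simp: mult.assoc)
    then show ?thesis using x unfolding Z_def by blast
  qed
  have Z1: "1 \<notin> Z" using Ap by (auto simp: Z_def)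
  define ann where "ann = (\<lambda>b. {r \<in> R. r * b \<in> Z})"
  have annI: "idl (ann b) \<and> ?A \<subseteq> ann b" if "b \<in> R" for b
  proof
    show "idl (ann b)" unfolding idl_def ann_def
      using idlD[OF Z] by (auto simp: distrib_right mult.assoc)
    show "?A \<subseteq> ann b" using AZ idl_right[OF Z that] idlD(1)[OF A(1)] by (auto simp: ann_def)
  qed
  have fam: "\<And>I. I \<in> ann ` (R - Z) \<Longrightarrow> idl I \<and> ?A \<subseteq> I" using annI by auto
  have 1: "1 \<in> R - Z" using Z1 by simp
  obtain M where M: "M \<in> ann ` (R - Z)" and Mmax: "\<And>J. J \<in> ann ` (R - Z) \<Longrightarrow> M \<subseteq> J \<Longrightarrow> J = M"
    using maximal_in_family[OF A fam imageI[OF 1]] by blast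
  obtain b where b: "b \<in> R" "b \<notin> Z" "M = ann b" using M by auto
  have nil: "\<exists>i. x ^ i \<in> Z" if x: "x \<in> p" for x
  proof -
    have xR: "x \<in> R" using idlD(1)[OF pi x] .
    obtain i j where ij: "i < j" "x ^ j - x ^ i \<in> ?A" using pigeonhole_mod[OF A, of "\<lambda>n. x ^ n"] R_power[OF xR] by blast
    have "x ^ j = x ^ i * x ^ (j - i)" using ij(1) by (simp flip: power_add)
    then have eq: "(x ^ (j - i) - 1) * x ^ i = x ^ j - x ^ i" by (simp add: algebra_simps)
    have "x ^ (j - i) \<in> p" using ij(1) idlD(4)[OF pi _ x, of "x ^ (j - i - 1)"] xR
      by (metis R_power Suc_diff_Suc diff_Suc_1 power_Suc2 zero_less_diff gr0_implies_Suc)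
    then have "x ^ (j - i) - 1 \<notin> p" using idl_diff[OF pi, of "x ^ (j - i)" "x ^ (j - i) - 1"] prmD(3)[OF p] by auto
    then show ?thesis using Zsat[of "x ^ i" "x ^ (j - i) - 1"] AZ ij(2) eq xR by auto
  qed
  have pM: "x \<in> M" if x: "x \<in> p" for x
  proof -
    have xR: "x \<in> R" using idlD(1)[OF pi x] .
    obtain i0 where "x ^ i0 \<in> Z" using nil[OF x] by blast
    then have ex: "x ^ i0 * b \<in> Z" using idl_right[OF Z b(1)] by blast
    define i where "i = (LEAST i. x ^ i * b \<in> Z)"
    have i: "x ^ i * b \<in> Z" unfolding i_def by (rule LeastI[of "\<lambda>i. x ^ i * b \<in> Z", OF ex])
    have "i \<noteq> 0" using i b by (metis mult_1 power_0)
    then obtain k where k: "i = Suc k" by (cases i) auto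
    have nk: "x ^ k * b \<notin> Z" using not_less_Least[of k "\<lambda>i. x ^ i * b \<in> Z"] k unfolding i_def by simp
    have "ann b \<subseteq> ann (x ^ k * b)"
    proof
      fix r assume "r \<in> ann b"
      then have "r \<in> R" "x ^ k * (r * b) \<in> Z" using idlD(4)[OF Z, of "x ^ k" "r * b"] xR by (auto simp: ann_def)
      then show "r \<in> ann (x ^ k * b)" by (simp add: ann_def mult.left_commute)
    qed
    then have "ann (x ^ k * b) = M" using nk xR b by (intro Mmax) auto
    moreover have "x \<in> ann (x ^ k * b)" using i k xR by (simp add: ann_def mult.assoc)
    ultimately show ?thesis by simp
  qed
  \<comment> \<open>A single \<open>s \<notin> p\<close> with \<open>sZ \<subseteq> aR\<close>.\<close>
  obtain F where F: "finite F" "F \<subseteq> R" "\<forall>r\<in>R. \<exists>f\<in>F. r - f \<in> ?A" using finquot_ideal[OF A] unfolding finquot_def by blast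
  have "\<forall>f\<in>F \<inter> Z. \<exists>s\<in>R - p. s * f \<in> ?A" by (auto simp: Z_def)
  then obtain s where s: "\<And>f. f \<in> F \<inter> Z \<Longrightarrow> s f \<in> R - p" "\<And>f. f \<in> F \<inter> Z \<Longrightarrow> s f * f \<in> ?A" by metis
  define S where "S = prod s (F \<inter> Z)"
  have S: "S \<in> R - p" unfolding S_def using F(1) s(1) by (intro prm_prod[OF p]) auto
  have SZ: "S * z \<in> ?A" if z: "z \<in> Z" for z
  proof -
    obtain f where f: "f \<in> F" "z - f \<in> ?A" using F(3) idlD(1)[OF Z z] by blast
    have fZ: "f \<in> F \<inter> Z" using f AZ idl_diff[OF Z z, of "z - f"] by auto
    have "S = s f * prod s (F \<inter> Z - {f})" unfolding S_def using F(1) fZ by (intro prod.remove) auto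
    moreover have "prod s (F \<inter> Z - {f}) \<in> R" using prm_prod[OF p, of "F \<inter> Z - {f}" s] F(1) s(1) by auto
    ultimately have "S * f \<in> ?A" using idlD(4)[OF A(1), of "prod s (F \<inter> Z - {f})" "s f * f"] s(2)[OF fZ] by (simp add: mult_ac)
    moreover have "S * (z - f) \<in> ?A" using idlD(4)[OF A(1)] S f(2) by auto
    ultimately have "S * (z - f) + S * f \<in> ?A" by (intro idlD(3)[OF A(1)])
    then show ?thesis by (simp add: algebra_simps)
  qed
  define h where "h = S * b / a"
  have "h * x \<in> R" if "x \<in> p" for x
  proof -
    have "x * b \<in> Z" using pM[OF that] by (simp add: b(3) ann_def)
    then obtain r where "r \<in> R" "S * (x * b) = a * r" using SZ unfolding smult_iff by blast
    moreover have "h * x = S * (x * b) / a" by (simp add: h_def)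
    ultimately show ?thesis using a(2) by simp
  qed
  moreover have "h \<notin> R"
  proof
    assume "h \<in> R"
    then have "S * b \<in> ?A" unfolding smult_iff h_def using a(2) by (intro bexI[of _ "S * b / a"]) auto
    then show False using b S by (auto simp: Z_def)
  qed
  ultimately show thesis using that by blast
qed

text \<open>Multiplying by \<open>h\<close> as often as possible makes an ideal prime to \<open>p\<close>.\<close>

lemma strip_prime:
  assumes p: "prm p" and h: "h \<notin> R" "\<And>x. x \<in> p \<Longrightarrow> h * x \<in> R" and c: "idl c" "c \<noteq> {0}"
  obtains n x where "\<And>x. x \<in> c \<Longrightarrow> h ^ n * x \<in> R" "x \<in> c" "h ^ n * x \<notin> p"
proof -
  have "\<exists>n. (\<forall>x\<in>c. h ^ n * x \<in> R) \<and> (\<exists>x\<in>c. h ^ n * x \<notin> p)"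
  proof (rule ccontr)
    assume no: "\<not> ?thesis"
    have all: "\<forall>x\<in>c. h ^ n * x \<in> R" for n
    proof (induction n)
      case 0 then show ?case using idlD(1)[OF c(1)] by simp
    next
      case (Suc n)
      then have "\<forall>x\<in>c. h ^ n * x \<in> p" using no by blast
      then show ?case using h(2) by (simp add: mult.assoc)
    qed
    obtain a where "a \<in> c" "a \<noteq> 0" using c idlD(2)[OF c(1)] by blast
    then have "h \<in> R" by (intro almost_integral[of a h]) (use all idlD(1)[OF c(1)] in blast)+
    then show False using h(1) by simp
  qed
  then show thesis using that by blast
qed

text \<open>
  Every nonzero ideal \<open>c\<close> is the intersection of the principal fractional ideals containing it.
  For \<open>u \<notin> c\<close> replace \<open>u\<close> by a multiple with maximal, hence prime, annihilator in \<open>R/c\<close>; then a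
  power of the element inverting this prime separates \<open>u\<close> from \<open>c\<close>.
\<close>

theorem ideal_separation:
  assumes c: "idl c" "c \<noteq> {0}" and u: "u \<in> R" "u \<notin> c"
  obtains y where "\<And>x. x \<in> c \<Longrightarrow> y * x \<in> R" "y * u \<notin> R"
proof -
  define ann where "ann = (\<lambda>v. {r \<in> R. r * v \<in> c})"
  define U where "U = {v. v \<notin> c \<and> (\<exists>r\<in>R. v = r * u)}"
  have UR: "v \<in> R" if "v \<in> U" for v using that u by (auto simp: U_def)
  have annI: "idl (ann v) \<and> c \<subseteq> ann v" if "v \<in> R" for v
  proof
    show "idl (ann v)" unfolding idl_def ann_def using idlD[OF c(1)] by (auto simp: distrib_right mult.assoc)
    show "c \<subseteq> ann v" using idl_right[OF c(1) that] idlD(1)[OF c(1)] by (auto simp: ann_def)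
  qed
  have uU: "u \<in> U" using u by (auto simp: U_def intro!: bexI[of _ 1])
  have fam: "\<And>I. I \<in> ann ` U \<Longrightarrow> idl I \<and> c \<subseteq> I" using annI UR by auto
  obtain M where M: "M \<in> ann ` U" and Mmax: "\<And>J. J \<in> ann ` U \<Longrightarrow> M \<subseteq> J \<Longrightarrow> J = M"
    using maximal_in_family[OF c fam imageI[OF uU]] by blast
  obtain v where v: "v \<in> U" "M = ann v" using M by auto
  obtain r where r: "r \<in> R" "v = r * u" "v \<notin> c" using v by (auto simp: U_def)
  have vR: "v \<in> R" using UR v by blast
  have "prm M" unfolding prm_def
  proof (intro conjI ballI impI)
    show "idl M" using annI vR v by blast
    show "M \<noteq> {0}" using annI[OF vR] v c idlD(2)[OF c(1)] by blast
    show "1 \<notin> M" using v r by (simp add: ann_def)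
    fix x y assume x: "x \<in> R" and y: "y \<in> R" and xy: "x * y \<in> M"
    show "x \<in> M \<or> y \<in> M"
    proof (cases "x \<in> M")
      case False
      then have "x * v \<notin> c" using x v by (simp add: ann_def)
      moreover have "x * v = (x * r) * u" using r by (simp add: mult.assoc)
      ultimately have xvU: "x * v \<in> U" using x r by (auto simp: U_def)
      have "M \<subseteq> ann (x * v)"
      proof
        fix z assume "z \<in> M"
        then have "z \<in> R" "x * (z * v) \<in> c" using v idlD(4)[OF c(1) x] by (auto simp: ann_def)
        then show "z \<in> ann (x * v)" by (simp add: ann_def mult.left_commute)
      qed
      then have "ann (x * v) = M" using xvU by (intro Mmax) auto
      moreover have "y \<in> ann (x * v)" using xy y v by (simp add: ann_def mult_ac)
      ultimately show ?thesis by simp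
    qed simp
  qed
  obtain h where h: "h \<notin> R" "\<And>x. x \<in> M \<Longrightarrow> h * x \<in> R" using prime_inverse[OF \<open>prm M\<close>] by blast
  obtain n x where n: "\<And>x. x \<in> c \<Longrightarrow> h ^ n * x \<in> R" "x \<in> c" "h ^ n * x \<notin> M"
    using strip_prime[OF \<open>prm M\<close> h c] by blast
  have "h ^ n * u \<notin> R"
  proof
    assume "h ^ n * u \<in> R"
    then have "r * (h ^ n * u) \<in> R" using r by simp
    then have "x * (r * (h ^ n * u)) \<in> c" using idl_right[OF c(1) _ n(2)] by blast
    then have "(h ^ n * x) * v \<in> c" using r by (simp add: mult_ac)
    then have "h ^ n * x \<in> M" using n(1)[OF n(2)] v by (simp add: ann_def)
    then show False using n(3) by simp
  qed
  then show thesis using that n(1) by blast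
qed

text \<open>
  If \<open>c + m\<close> were proper, it would be contained in a maximal ideal, which is prime.
\<close>

lemma comaximal_if_coprime:
  assumes c: "idl c" "c \<noteq> {0}" and m: "idl m" "m \<noteq> {0}"
    and cop: "\<And>p. prm p \<Longrightarrow> m \<subseteq> p \<Longrightarrow> \<not> c \<subseteq> p"
  obtains d where "d \<in> c" "d \<noteq> 0" "1 - d \<in> m"
proof -
  define J where "J = {x + y |x y. x \<in> c \<and> y \<in> m}"
  have cJ: "c \<subseteq> J" "m \<subseteq> J"
  proof -
    show "c \<subseteq> J" unfolding J_def using idlD(2)[OF m(1)] by force
    show "m \<subseteq> J" unfolding J_def using idlD(2)[OF c(1)] by force
  qed
  have "1 \<in> J"
  proof (rule ccontr)
    assume J1: "1 \<notin> J"
    have J: "idl J" unfolding idl_def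
    proof (intro conjI ballI)
      show "J \<subseteq> R" using idlD(1)[OF c(1)] idlD(1)[OF m(1)] by (auto simp: J_def)
      show "0 \<in> J" using cJ idlD(2)[OF c(1)] by auto
      fix x y assume "x \<in> J" "y \<in> J"
      then obtain a b a' b' where "x = a + b" "y = a' + b'" "a \<in> c" "b \<in> m" "a' \<in> c" "b' \<in> m" by (auto simp: J_def)
      then have "x + y = (a + a') + (b + b')" "a + a' \<in> c" "b + b' \<in> m" using idlD(3)[OF c(1)] idlD(3)[OF m(1)] by auto
      then show "x + y \<in> J" unfolding J_def by blast
    next
      fix r x assume "r \<in> R" "x \<in> J"
      then obtain a b where "x = a + b" "a \<in> c" "b \<in> m" by (auto simp: J_def)
      then have "r * x = r * a + r * b" "r * a \<in> c" "r * b \<in> m" using idlD(4)[OF c(1)] idlD(4)[OF m(1)] \<open>r \<in> R\<close> by (auto simp: distrib_left)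
      then show "r * x \<in> J" unfolding J_def by blast
    qed
    let ?A = "{I. idl I \<and> J \<subseteq> I \<and> 1 \<notin> I}"
    obtain M where M: "M \<in> ?A" and Mmax: "\<And>I. I \<in> ?A \<Longrightarrow> M \<subseteq> I \<Longrightarrow> I = M"
      using maximal_in_family[OF c, of ?A J] J J1 cJ by auto
    have Mi: "idl M" using M by simp
    have "prm M" unfolding prm_def
    proof (intro conjI ballI impI)
      show "M \<noteq> {0}" using M cJ c idlD(2)[OF c(1)] by blast
      fix x y assume x: "x \<in> R" and y: "y \<in> R" and xy: "x * y \<in> M"
      show "x \<in> M \<or> y \<in> M"
      proof (cases "x \<in> M")
        case False
        let ?I = "{a + x * r |a r. a \<in> M \<and> r \<in> R}"
        have I: "idl ?I" unfolding idl_def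
        proof (intro conjI ballI)
          show "?I \<subseteq> R" using idlD(1)[OF Mi] x by auto
          show "0 \<in> ?I" using idlD(2)[OF Mi] by (auto intro!: exI[of _ 0])
          fix s t assume "s \<in> ?I" "t \<in> ?I"
          then obtain a r a' r' where "s = a + x * r" "t = a' + x * r'" "a \<in> M" "r \<in> R" "a' \<in> M" "r' \<in> R" by auto
          then have "s + t = (a + a') + x * (r + r')" "a + a' \<in> M" "r + r' \<in> R" using idlD(3)[OF Mi] by (auto simp: algebra_simps)
          then show "s + t \<in> ?I" by blast
        next
          fix q s assume "q \<in> R" "s \<in> ?I"
          then obtain a r where "s = a + x * r" "a \<in> M" "r \<in> R" by auto
          then have "q * s = q * a + x * (q * r)" "q * a \<in> M" "q * r \<in> R" using idlD(4)[OF Mi] \<open>q \<in> R\<close> by (auto simp: distrib_left mult.left_commute)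
          then show "q * s \<in> ?I" by blast
        qed
        have MI: "M \<subseteq> ?I" by (force intro: R_0)
        have "x = 0 + x * 1" by simp
        then have "x \<in> ?I" using idlD(2)[OF Mi] R_1 by blast
        then have "?I \<noteq> M" using False by blast
        then have "1 \<in> ?I" using Mmax[of ?I] I MI M by blast
        then obtain a r where "1 = a + x * r" "a \<in> M" "r \<in> R" by auto
        then have "y = a * y + (x * y) * r" by (metis distrib_right mult.assoc mult.commute mult_1)
        moreover have "a * y \<in> M" "(x * y) * r \<in> M" using idl_right[OF Mi] y xy \<open>a \<in> M\<close> \<open>r \<in> R\<close> by auto
        ultimately have "y \<in> M" using idlD(3)[OF Mi] by metis
        then show ?thesis by simp
      qed simp
    qed (use M in auto)
    moreover have "m \<subseteq> M" "c \<subseteq> M" using M cJ by auto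
    ultimately show False using cop by blast
  qed
  then obtain d y where dy: "1 = d + y" "d \<in> c" "y \<in> m" by (auto simp: J_def)
  then have yd: "1 - d = y" by (metis add_diff_cancel_left')
  show thesis
  proof (cases "d = 0")
    case False then show thesis using that[of d] dy yd by simp
  next
    case True
    then have "1 \<in> m" using dy by simp
    then have "m = R" by (rule idl_one[OF m(1)])
    moreover obtain e where "e \<in> c" "e \<noteq> 0" using c idlD(2)[OF c(1)] by blast
    ultimately show thesis using that[of e] idlD(1)[OF c(1)] by simp
  qed
qed

text \<open>Nonzero primes are maximal, in the form \<open>1 \<in> p + hp\<close>.\<close>

lemma prime_partition:
  assumes p: "prm p" and h: "h \<notin> R" "\<And>x. x \<in> p \<Longrightarrow> h * x \<in> R"
  obtains p1 p2 where "p1 \<in> p" "p2 \<in> p" "1 = p1 + h * p2"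
proof -
  note pi = prmD(1)[OF p]
  have "\<exists>q\<in>p. h * q \<notin> p"
  proof (rule ccontr)
    assume "\<not> ?thesis"
    then have step: "h * q \<in> p" if "q \<in> p" for q using that by blast
    obtain a where a: "a \<in> p" "a \<noteq> 0" using prmD(2)[OF p] idlD(2)[OF pi] by blast
    have "h ^ n * a \<in> p" for n by (induction n) (auto simp: a step mult.assoc)
    then have "h \<in> R" by (intro almost_integral[of a h]) (use idlD(1)[OF pi] a in blast)+
    then show False using h(1) by simp
  qed
  then obtain q where q: "q \<in> p" "h * q \<notin> p" by blast
  define w where "w = h * q"
  have w: "w \<in> R" "w \<notin> p" using q h(2) by (auto simp: w_def)
  obtain i j where ij: "i < j" "w ^ j - w ^ i \<in> p" using pigeonhole_mod[OF pi prmD(2)[OF p], of "\<lambda>n. w ^ n"] R_power[OF w(1)] by blast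
  define k where "k = j - i - 1"
  have jk: "w ^ j = w ^ i * (w * w ^ k)" using ij(1) by (simp add: k_def flip: power_add power_Suc)
  have "w ^ i * (w * w ^ k - 1) \<in> p" using ij(2) unfolding jk by (simp add: algebra_simps)
  moreover have "w ^ i \<notin> p" using prm_power[OF p w] .
  ultimately have "w * w ^ k - 1 \<in> p" using prmD(4)[OF p, of "w ^ i" "w * w ^ k - 1"] w by auto
  then have 1: "1 - w * w ^ k \<in> p" using idl_minus[OF pi, of "w * w ^ k - 1"] by simp
  have 2: "q * w ^ k \<in> p" using idl_right[OF pi _ q(1)] w by simp
  have 3: "1 = (1 - w * w ^ k) + h * (q * w ^ k)" by (simp add: w_def mult.assoc)
  show thesis by (rule that[OF 1 2 3])
qed

end

section \<open>Valuations\<close>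

context number_ring
begin

lemma smult_smult: "smult_set x (smult_set y I) = smult_set (x * y) I"
  by (auto simp: smult_set_def image_image mult.assoc)
lemma smult_1 [simp]: "smult_set 1 I = (I :: 'k set)"
  by (auto simp: smult_set_def)
lemma smult_self: "x \<in> smult_set x R"
  unfolding smult_iff by (rule bexI[of _ 1]) auto

lemma power_down:
  assumes x: "x \<in> R" and h: "h ^ n * x \<in> R" and k: "k \<le> n" shows "h ^ k * x \<in> R"
proof (cases "n = 0")
  case True then show ?thesis using x k by simp
next
  case False
  have "(h ^ k * x) ^ n = (h ^ n * x) ^ k * x ^ (n - k)"
  proof -
    have "x ^ n = x ^ k * x ^ (n - k)" using k by (simp flip: power_add)
    then show ?thesis by (simp add: power_mult_distrib mult.commute[of n k] mult_ac flip: power_mult)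
  qed
  then have "(h ^ k * x) ^ n \<in> R" using x h by simp
  then show ?thesis using power_root_in_R False by blast
qed

text \<open>
  The single element \<open>h\<close> of \<open>p\<inverse>\<close> detects all powers of \<open>p\<close>, so exponents can be computed with elements.
\<close>

lemma prime_power_iff:
  assumes p: "prm p" and h: "h \<notin> R" "\<And>x. x \<in> p \<Longrightarrow> h * x \<in> R"
  shows "p [^]\<^bsub>fractional_ideals\<^esub> (n::nat) = {x \<in> R. h ^ n * x \<in> R}"
proof (induction n)
  case 0
  then show ?case by (auto simp: nat_pow_def fractional_ideals_def int_ring_simps)
next
  case (Suc n)
  note pi = prmD(1)[OF p]
  obtain p1 p2 where pp: "p1 \<in> p" "p2 \<in> p" "1 = p1 + h * p2" using prime_partition[OF p h] by blast
  have pow: "p [^]\<^bsub>fractional_ideals\<^esub> Suc n = ideal_prod K_ring {x \<in> R. h ^ n * x \<in> R} p"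
    using Suc by (simp add: nat_pow_def fractional_ideals_def)
  show ?case unfolding pow
  proof (intro equalityI subsetI)
    fix x assume "x \<in> ideal_prod K_ring {x \<in> R. h ^ n * x \<in> R} p"
    then show "x \<in> {x \<in> R. h ^ Suc n * x \<in> R}"
    proof (induction rule: ideal_prod.induct)
      case (prod i j)
      have eq: "h ^ Suc n * (i * j) = (h ^ n * i) * (h * j)" by (simp add: mult_ac)
      have "h ^ Suc n * (i * j) \<in> R" unfolding eq using prod h(2)[of j] by simp
      moreover have "i * j \<in> R" using prod idlD(1)[OF pi] by simp
      ultimately show ?case by (simp add: K_ring_def del: power_Suc)
    next
      case (sum x y)
      then show ?case by (auto simp: K_ring_def distrib_left simp del: power_Suc)
    qed
  next
    fix x assume x: "x \<in> {x \<in> R. h ^ Suc n * x \<in> R}"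
    have hx: "h * x \<in> R" using power_down[of x h "Suc n" 1] x by simp
    have 1: "x \<in> {x \<in> R. h ^ n * x \<in> R}" using power_down[of x h "Suc n" n] x by simp
    have 2: "h * x \<in> {x \<in> R. h ^ n * x \<in> R}" using x hx by (simp add: mult_ac power_Suc2)
    have "x * p1 + (h * x) * p2 = x * (p1 + h * p2)" by (simp add: algebra_simps)
    then have eq: "x = x * p1 + (h * x) * p2" using pp(3) by simp
    have "x * p1 + (h * x) * p2 \<in> ideal_prod K_ring {x \<in> R. h ^ n * x \<in> R} p"
      using ideal_prod.sum[OF ideal_prod.prod[OF 1 pp(1), of K_ring] ideal_prod.prod[OF 2 pp(2), of K_ring]]
      by (simp add: K_ring_def)
    then show "x \<in> ideal_prod K_ring {x \<in> R. h ^ n * x \<in> R} p" using eq by simp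
  qed
qed

text \<open>
  The ideal \<open>I\<close> has exponent \<open>n\<close> at \<open>p\<close>, where \<open>h\<close> is an element of \<open>p\<inverse>\<close> outside \<open>R\<close>.
\<close>

definition stripped :: "'k set \<Rightarrow> 'k \<Rightarrow> 'k set \<Rightarrow> nat \<Rightarrow> bool" where
  "stripped p h I n \<longleftrightarrow> (\<forall>x\<in>I. h ^ n * x \<in> R) \<and> (\<exists>x\<in>I. h ^ n * x \<notin> p)"

lemma prime_exponent_eq:
  assumes p: "prm p" and h: "h \<notin> R" "\<And>x. x \<in> p \<Longrightarrow> h * x \<in> R" and I: "I \<subseteq> R" and s: "stripped p h I n"
  shows "prime_exponent p I = n"
proof -
  have pw: "p [^]\<^bsub>fractional_ideals\<^esub> (k::nat) = {x \<in> R. h ^ k * x \<in> R}" for k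
    by (rule prime_power_iff[OF p h])
  show ?thesis unfolding prime_exponent_def
  proof (rule Greatest_equality)
  show "I \<subseteq> p [^]\<^bsub>fractional_ideals\<^esub> n" using s I by (auto simp: stripped_def pw)
  fix m assume "I \<subseteq> p [^]\<^bsub>fractional_ideals\<^esub> (m::nat)"
  then have m: "I \<subseteq> {x \<in> R. h ^ m * x \<in> R}" unfolding pw .
  show "m \<le> n"
  proof (rule ccontr)
    assume "\<not> m \<le> n"
    obtain x where x: "x \<in> I" "h ^ n * x \<notin> p" "h ^ n * x \<in> R" using s by (auto simp: stripped_def)
    have "h ^ Suc n * x \<in> R" by (rule power_down[of x h m]) (use x m \<open>\<not> m \<le> n\<close> in auto)
    then have hw: "h * (h ^ n * x) \<in> R" by (simp add: mult.assoc)
    obtain p1 p2 where pp: "p1 \<in> p" "p2 \<in> p" "1 = p1 + h * p2" using prime_partition[OF p h] by blast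
    have "p1 * (h ^ n * x) + p2 * (h * (h ^ n * x)) = (p1 + h * p2) * (h ^ n * x)" by (simp add: algebra_simps)
    then have eq: "h ^ n * x = p1 * (h ^ n * x) + p2 * (h * (h ^ n * x))" using pp(3) by simp
    have "p1 * (h ^ n * x) + p2 * (h * (h ^ n * x)) \<in> p"
      by (rule idlD(3)[OF prmD(1)[OF p] idl_right[OF prmD(1)[OF p] x(3) pp(1)] idl_right[OF prmD(1)[OF p] hw pp(2)]])
    then show False using x(2) eq by simp
  qed
qed
qed

lemma stripped_ex:
  assumes p: "prm p" and h: "h \<notin> R" "\<And>x. x \<in> p \<Longrightarrow> h * x \<in> R" and c: "idl c" "c \<noteq> {0}"
  shows "stripped p h c (prime_exponent p c)"
proof -
  obtain n x where "\<And>x. x \<in> c \<Longrightarrow> h ^ n * x \<in> R" "x \<in> c" "h ^ n * x \<notin> p"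
    using strip_prime[OF p h c] by blast
  then have s: "stripped p h c n" by (auto simp: stripped_def)
  then show ?thesis using prime_exponent_eq[OF p h _ s] idlD(1)[OF c(1)] by auto
qed

lemma principal_idl: "x \<in> R \<Longrightarrow> x \<noteq> 0 \<Longrightarrow> idl (smult_set x R) \<and> smult_set x R \<noteq> {0}"
  using idl_smult[OF idl_R] smult_nonzero[OF _ R_nontrivial idl_R] by blast

lemma stripped_principal:
  assumes p: "prm p" and h: "h \<notin> R" "\<And>x. x \<in> p \<Longrightarrow> h * x \<in> R" and d: "d \<in> R" "d \<noteq> 0"
  shows "h ^ prime_exponent p (smult_set d R) * d \<in> R" "h ^ prime_exponent p (smult_set d R) * d \<notin> p"
proof -
  let ?n = "prime_exponent p (smult_set d R)"
  have s: "stripped p h (smult_set d R) ?n" using stripped_ex[OF p h] principal_idl[OF d] by blast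
  then show "h ^ ?n * d \<in> R" using smult_self by (auto simp: stripped_def)
  obtain r where "r \<in> R" "h ^ ?n * (d * r) \<notin> p" using s by (auto simp: stripped_def smult_iff)
  then show "h ^ ?n * d \<notin> p" using idl_right[OF prmD(1)[OF p], of r "h ^ ?n * d"] by (auto simp: mult.assoc)
qed

lemma prime_exponent_smult:
  assumes p: "prm p" and c: "idl c" "c \<noteq> {0}" and d: "d \<in> R" "d \<noteq> 0"
  shows "prime_exponent p (smult_set d c) = prime_exponent p c + prime_exponent p (smult_set d R)"
proof -
  obtain h where h: "h \<notin> R" "\<And>x. x \<in> p \<Longrightarrow> h * x \<in> R" using prime_inverse[OF p] by blast
  let ?n = "prime_exponent p c" and ?m = "prime_exponent p (smult_set d R)"
  have s: "stripped p h c ?n" by (rule stripped_ex[OF p h c])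
  note sd = stripped_principal[OF p h d]
  have eq: "h ^ (?n + ?m) * (d * x) = (h ^ ?n * x) * (h ^ ?m * d)" for x by (simp add: power_add mult_ac)
  have "stripped p h (smult_set d c) (?n + ?m)"
    unfolding stripped_def
  proof (intro conjI ballI)
    fix y assume "y \<in> smult_set d c"
    then obtain x where "x \<in> c" "y = d * x" by (auto simp: smult_iff)
    then show "h ^ (?n + ?m) * y \<in> R" using s sd(1) by (auto simp: eq stripped_def)
  next
    obtain x where x: "x \<in> c" "h ^ ?n * x \<notin> p" "h ^ ?n * x \<in> R" using s by (auto simp: stripped_def)
    have "h ^ (?n + ?m) * (d * x) \<notin> p" unfolding eq using prmD(4)[OF p x(3) sd(1)] x(2) sd(2) by blast
    then show "\<exists>y\<in>smult_set d c. h ^ (?n + ?m) * y \<notin> p" using x(1) by (intro bexI[of _ "d * x"]) (auto simp: smult_iff)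
  qed
  then show ?thesis using prime_exponent_eq[OF p h] idlD(1)[OF idl_smult[OF c(1) d(1)]] by blast
qed

lemma prime_exponent_R: "prm p \<Longrightarrow> prime_exponent p R = 0"
  using prime_exponent_smult[of p R 1] idl_R R_nontrivial by simp

lemma prime_exponent_0_iff:
  assumes p: "prm p" and c: "idl c" "c \<noteq> {0}" shows "prime_exponent p c = 0 \<longleftrightarrow> \<not> c \<subseteq> p"
proof -
  obtain h where h: "h \<notin> R" "\<And>x. x \<in> p \<Longrightarrow> h * x \<in> R" using prime_inverse[OF p] by blast
  show ?thesis
  proof
    assume "prime_exponent p c = 0"
    then have "stripped p h c 0" using stripped_ex[OF p h c] by simp
    then show "\<not> c \<subseteq> p" by (auto simp: stripped_def)
  next
    assume "\<not> c \<subseteq> p"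
    then have "stripped p h c 0" using idlD(1)[OF c(1)] by (auto simp: stripped_def)
    then show "prime_exponent p c = 0" using prime_exponent_eq[OF p h] idlD(1)[OF c(1)] by blast
  qed
qed

lemma fractional_ideal_iff: "fractional_ideal (I :: 'k set) \<longleftrightarrow> I \<noteq> {0} \<and> (\<exists>d\<in>R. d \<noteq> 0 \<and> idl (smult_set d I))"
  by (simp add: fractional_ideal_def ideal_iff int_ring_simps)

lemma fractional_idealD:
  assumes "fractional_ideal (I :: 'k set)"
  shows "0 \<in> I" "x \<in> I \<Longrightarrow> y \<in> I \<Longrightarrow> x + y \<in> I" "r \<in> R \<Longrightarrow> x \<in> I \<Longrightarrow> r * x \<in> I"
proof -
  obtain d where d: "d \<noteq> 0" "idl (smult_set d I)" using assms by (auto simp: fractional_ideal_iff)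
  have iff: "d * x \<in> smult_set d I \<longleftrightarrow> x \<in> I" for x using d(1) by (auto simp: smult_iff)
  show "0 \<in> I" using idlD(2)[OF d(2)] iff[of 0] by simp
  show "x + y \<in> I" if "x \<in> I" "y \<in> I"
    using idlD(3)[OF d(2), of "d * x" "d * y"] that iff by (metis distrib_left)
  show "r * x \<in> I" if "r \<in> R" "x \<in> I"
    using idlD(4)[OF d(2), of r "d * x"] that iff by (metis mult.left_commute)
qed

lemma fractional_ideal_integral: assumes "fractional_ideal I" "I \<subseteq> R" shows "idl I"
  using fractional_idealD[OF assms(1)] assms(2) unfolding idl_def by blast

lemma fractional_ideal_nonzero: "fractional_ideal (I :: 'k set) \<Longrightarrow> I \<noteq> {0}"
  by (simp add: fractional_ideal_iff)

lemma smult_nonzero': "x \<noteq> 0 \<Longrightarrow> I \<noteq> {0} \<Longrightarrow> 0 \<in> I \<Longrightarrow> smult_set x I \<noteq> {0}" for I :: "'k set"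
  by (metis insertI1 mult_eq_0_iff singletonD smult_iff subsetI subset_antisym singletonI)

lemma fractional_ideal_smult:
  assumes I: "fractional_ideal (I :: 'k set)" and x: "x \<noteq> 0" shows "fractional_ideal (smult_set x I)"
proof -
  obtain d where d: "d \<in> R" "d \<noteq> 0" "idl (smult_set d I)" using I by (auto simp: fractional_ideal_iff)
  obtain b where b: "b \<in> R" "b \<noteq> 0" "b * x \<in> R" using has_denominator[of x] by blast
  have "smult_set (d * b) (smult_set x I) = smult_set (b * x) (smult_set d I)"
    by (simp add: smult_smult mult_ac)
  then have "idl (smult_set (d * b) (smult_set x I))" using idl_smult[OF d(3) b(3)] by simp
  moreover have "smult_set x I \<noteq> {0}" using smult_nonzero'[OF x fractional_ideal_nonzero[OF I] fractional_idealD(1)[OF I]] .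
  ultimately show ?thesis using d b unfolding fractional_ideal_iff by (metis R_mult mult_eq_0_iff)
qed

lemma fractional_ideal_R: "fractional_ideal R"
  unfolding fractional_ideal_iff using R_nontrivial idl_R by (auto intro!: bexI[of _ 1])

lemma smult_idl_if_sub:
  assumes I: "fractional_ideal (I :: 'k set)" and "d \<noteq> 0" "smult_set d I \<subseteq> R"
  shows "idl (smult_set d I)" "smult_set d I \<noteq> {0}"
  using fractional_ideal_integral[OF fractional_ideal_smult[OF I assms(2)] assms(3)]
    fractional_ideal_nonzero[OF fractional_ideal_smult[OF I assms(2)]] by auto

lemma ideal_valuation_eq:
  assumes p: "prm p" and I: "fractional_ideal I" and d: "d \<in> R" "d \<noteq> 0" "smult_set d I \<subseteq> R"
  shows "ideal_valuation p I = int (prime_exponent p (smult_set d I)) - int (prime_exponent p (smult_set d R))"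
  unfolding ideal_valuation_def int_ring_simps
proof (rule the_equality)
  show "\<exists>d'\<in>R. d' \<noteq> 0 \<and> smult_set d' I \<subseteq> R \<and> int (prime_exponent p (smult_set d I)) - int (prime_exponent p (smult_set d R)) =
    int (prime_exponent p (smult_set d' I)) - int (prime_exponent p (smult_set d' R))"
    using d by blast
  fix v assume "\<exists>d'\<in>R. d' \<noteq> 0 \<and> smult_set d' I \<subseteq> R \<and> v =
    int (prime_exponent p (smult_set d' I)) - int (prime_exponent p (smult_set d' R))"
  then obtain d' where d': "d' \<in> R" "d' \<noteq> 0" "smult_set d' I \<subseteq> R"
    and v: "v = int (prime_exponent p (smult_set d' I)) - int (prime_exponent p (smult_set d' R))" by blast
  note i = smult_idl_if_sub[OF I d(2,3)] and i' = smult_idl_if_sub[OF I d'(2,3)]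
  have "smult_set d' (smult_set d I) = smult_set d (smult_set d' I)" by (simp add: smult_smult mult.commute)
  then have "prime_exponent p (smult_set d I) + prime_exponent p (smult_set d' R) =
    prime_exponent p (smult_set d' I) + prime_exponent p (smult_set d R)"
    using prime_exponent_smult[OF p i d'(1,2)] prime_exponent_smult[OF p i' d(1,2)] by simp
  then show "v = int (prime_exponent p (smult_set d I)) - int (prime_exponent p (smult_set d R))" using v by linarith
qed

lemma ideal_valuation_integral:
  assumes p: "prm p" and c: "idl c" "c \<noteq> {0}" shows "ideal_valuation p c = int (prime_exponent p c)"
proof -
  have "fractional_ideal c" unfolding fractional_ideal_iff using c by (auto intro!: bexI[of _ 1])
  then show ?thesis using ideal_valuation_eq[OF p, of c 1] idlD(1)[OF c(1)] by (auto simp: prime_exponent_R[OF p])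
qed

lemma ideal_valuation_smult:
  assumes p: "prm p" and I: "fractional_ideal I" and x: "x \<noteq> 0"
  shows "ideal_valuation p (smult_set x I) = valuation p x + ideal_valuation p I"
proof -
  obtain b where b: "b \<in> R" "b \<noteq> 0" "b * x \<in> R" using has_denominator[of x] by blast
  obtain d where d: "d \<in> R" "d \<noteq> 0" "idl (smult_set d I)" using I by (auto simp: fractional_ideal_iff)
  have bx: "b * x \<noteq> 0" using b x by simp
  have dI: "smult_set d I \<subseteq> R" "smult_set d I \<noteq> {0}" using idlD(1)[OF d(3)] smult_idl_if_sub(2)[OF I d(2)] by auto
  have e: "smult_set (b * d) (smult_set x I) = smult_set (b * x) (smult_set d I)" by (simp add: smult_smult mult_ac)
  have "ideal_valuation p (smult_set x I) = int (prime_exponent p (smult_set (b * x) (smult_set d I))) - int (prime_exponent p (smult_set (b * d) R))"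
    unfolding e[symmetric] by (rule ideal_valuation_eq[OF p fractional_ideal_smult[OF I x]])
      (use b d idlD(1)[OF idl_smult[OF d(3) b(3)]] e in auto)
  also have "prime_exponent p (smult_set (b * x) (smult_set d I)) = prime_exponent p (smult_set d I) + prime_exponent p (smult_set (b * x) R)"
    by (rule prime_exponent_smult[OF p d(3) dI(2) b(3) bx])
  also have "prime_exponent p (smult_set (b * d) R) = prime_exponent p (smult_set d R) + prime_exponent p (smult_set b R)"
    using prime_exponent_smult[OF p conjunct1[OF principal_idl[OF d(1,2)]] conjunct2[OF principal_idl[OF d(1,2)]] b(1,2)]
    by (simp add: smult_smult)
  also have "int (prime_exponent p (smult_set d I) + prime_exponent p (smult_set (b * x) R)) - int (prime_exponent p (smult_set d R) + prime_exponent p (smult_set b R))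
    = (int (prime_exponent p (smult_set (b * x) R)) - int (prime_exponent p (smult_set b R))) + (int (prime_exponent p (smult_set d I)) - int (prime_exponent p (smult_set d R)))"
    by simp
  also have "int (prime_exponent p (smult_set d I)) - int (prime_exponent p (smult_set d R)) = ideal_valuation p I"
    using ideal_valuation_eq[OF p I d(1,2) dI(1)] by simp
  also have "int (prime_exponent p (smult_set (b * x) R)) - int (prime_exponent p (smult_set b R)) = valuation p x"
  proof -
    have "smult_set b (smult_set x R) = smult_set (b * x) R" by (simp add: smult_smult)
    moreover have "smult_set (b * x) R \<subseteq> R" using idlD(1)[OF idl_smult[OF idl_R b(3)]] by blast
    ultimately show ?thesis
      using ideal_valuation_eq[OF p fractional_ideal_smult[OF fractional_ideal_R x] b(1,2)]
      by (simp add: valuation_def int_ring_simps)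
  qed
  finally show ?thesis .
qed

lemma valuation_mult: "prm p \<Longrightarrow> x \<noteq> 0 \<Longrightarrow> y \<noteq> 0 \<Longrightarrow> valuation p (x * y) = valuation p x + valuation p y"
  using ideal_valuation_smult[of p "smult_set y R" x] fractional_ideal_smult[OF fractional_ideal_R, of y]
  by (simp add: valuation_def int_ring_simps smult_smult)

lemma valuation_1: "prm p \<Longrightarrow> valuation p 1 = 0"
  using valuation_mult[of p 1 1] by simp

lemma valuation_inverse: "prm p \<Longrightarrow> x \<noteq> 0 \<Longrightarrow> valuation p (inverse x) = - valuation p x"
  using valuation_mult[of p x "inverse x"] valuation_1[of p] by simp

lemma valuation_int: "prm p \<Longrightarrow> x \<in> R \<Longrightarrow> x \<noteq> 0 \<Longrightarrow> valuation p x = int (prime_exponent p (smult_set x R))"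
  using ideal_valuation_integral[of p "smult_set x R"] principal_idl[of x]
  by (simp add: valuation_def int_ring_simps)

lemma valuation_0_iff: assumes "prm p" "x \<in> R" "x \<noteq> 0" shows "valuation p x = 0 \<longleftrightarrow> x \<notin> p"
proof -
  have "smult_set x R \<subseteq> p \<longleftrightarrow> x \<in> p" using smult_self idl_right[OF prmD(1)[OF assms(1)]] by (auto simp: smult_iff)
  then show ?thesis using assms prime_exponent_0_iff[of p "smult_set x R"] principal_idl[of x] by (simp add: valuation_int)
qed

subsection \<open>Real embeddings\<close>

lemma embedding_facts:
  assumes w: "real_embedding w"
  shows "w 0 = 0" "w (- x) = - w x" "w (x - y) = w x - w y" "w (of_nat n) = of_nat n" "w (of_int k) = of_int k"
    "w (x ^ n) = w x ^ n" "x \<noteq> 0 \<Longrightarrow> w x \<noteq> 0"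
proof -
  have add: "w (x + y) = w x + w y" and mult: "w (x * y) = w x * w y" and one: "w 1 = 1" for x y
    using w by (auto simp: real_embedding_def)
  show z: "w 0 = 0" using add[of 0 0] by simp
  show m: "w (- x) = - w x" for x using add[of x "- x"] z by simp
  show "w (x - y) = w x - w y" using add[of x "- y"] m by simp
  show n: "w (of_nat n) = of_nat n" for n by (induction n) (auto simp: z add one)
  show "w (of_int k) = of_int k" by (cases k rule: int_cases2) (auto simp: n m)
  show "w (x ^ n) = w x ^ n" by (induction n) (auto simp: one mult)
  show "w x \<noteq> 0" if "x \<noteq> 0" using mult[of x "inverse x"] one that by auto
qed

text \<open>The images of an algebraic integer are roots of one polynomial, hence bounded.\<close>

lemma embeddings_bounded:
  assumes x: "x \<in> R" shows "\<exists>B. \<forall>w. real_embedding w \<longrightarrow> \<bar>w x\<bar> \<le> B"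
proof -
  obtain q where q: "poly (map_poly of_int q) x = 0" "lead_coeff q = 1"
    using x unfolding R_def algebraic_int_altdef_ipoly by auto
  let ?Z = "{y::real. poly (map_poly of_int q) y = 0}"
  have "map_poly of_int q \<noteq> (0 :: real poly)" 
  proof
    assume "map_poly of_int q = (0 :: real poly)"
    then have "coeff (map_poly of_int q :: real poly) (degree q) = 0" by simp
    then show False using q(2) by (simp add: coeff_map_poly)
  qed
  then have fin: "finite ?Z" by (rule poly_roots_finite)
  have "w x \<in> ?Z" if w: "real_embedding w" for w
  proof -
    have "w (poly (map_poly of_int r) x) = poly (map_poly of_int r) (w x)" for r
      using w embedding_facts[OF w] by (induction r) (auto simp: map_poly_pCons real_embedding_def)
    from this[of q] show ?thesis using q(1) embedding_facts(1)[OF w] by simp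
  qed
  then have "\<bar>w x\<bar> \<le> Max (abs ` ?Z)" if "real_embedding w" for w using that fin by (intro Max_ge) auto
  then show ?thesis by blast
qed

lemma positive_shift:
  assumes e: "e \<in> R" and g: "g \<in> R" "g \<noteq> 0" "\<And>w. real_embedding w \<Longrightarrow> w g \<ge> 1"
  obtains k :: nat where "e + of_nat k * g \<noteq> 0" "\<And>w. real_embedding w \<Longrightarrow> w (e + of_nat k * g) \<ge> 1"
proof -
  obtain B where B: "\<And>w. real_embedding w \<Longrightarrow> \<bar>w e\<bar> \<le> B" using embeddings_bounded[OF e] by blast
  obtain k0 :: nat where k0: "real k0 \<ge> B + 1" using real_arch_simple by blast
  have pos: "w (e + of_nat k * g) \<ge> 1" if "k \<ge> k0" and w: "real_embedding w" for k w
  proof -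
    have "w (e + of_nat k * g) = w e + real k * w g"
      using w embedding_facts(4)[OF w] by (simp add: real_embedding_def)
    moreover have "real k * w g \<ge> real k * 1" using g(3)[OF w] by (intro mult_left_mono) auto
    ultimately show ?thesis using B[OF w] k0 that(1) by linarith
  qed
  show thesis
  proof (cases "e + of_nat k0 * g = 0")
    case False then show ?thesis using that[of k0] pos by simp
  next
    case True
    have "e + of_nat (Suc k0) * g = (e + of_nat k0 * g) + g" by (simp add: algebra_simps)
    then have "e + of_nat (Suc k0) * g \<noteq> 0" using True g(2) by simp
    then show ?thesis using that[of "Suc k0"] pos[of "Suc k0"] by simp
  qed
qed

text \<open>Multipliers of an ideal are units.\<close>

lemma ideal_stabilizer:
  assumes c: "idl c" "c \<noteq> {0}" and v: "smult_set v c = c" "v \<noteq> 0"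
  shows "v \<in> R" "inverse v \<in> R"
proof -
  obtain a where a: "a \<in> c" "a \<noteq> 0" using c idlD(2)[OF c(1)] by blast
  have step: "v * x \<in> c" "inverse v * x \<in> c" if "x \<in> c" for x
  proof -
    show "v * x \<in> c" using that v(1) smult_iff by blast
    have "x \<in> smult_set v c" using that v(1) by simp
    then obtain z where "z \<in> c" "x = v * z" unfolding smult_iff by blast
    then show "inverse v * x \<in> c" using v(2) by (simp flip: mult.assoc)
  qed
  have "v ^ n * a \<in> c" "inverse v ^ n * a \<in> c" for n by (induction n) (auto simp: a step mult.assoc)
  then show "v \<in> R" "inverse v \<in> R" using a idlD(1)[OF c(1)] by (blast intro: almost_integral)+
qed

lemma not_in_all_powers:
  assumes c: "idl c" "c \<noteq> {0}" and b: "b > 1"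
  shows "\<exists>k. \<not> c \<subseteq> smult_set (of_nat b ^ k) R"
proof (rule ccontr)
  assume "\<not> ?thesis"
  then have all: "c \<subseteq> smult_set (of_nat b ^ k) R" for k by blast
  obtain a where a: "a \<in> c" "a \<noteq> 0" using c idlD(2)[OF c(1)] by blast
  have b0: "(of_nat b :: 'k) \<noteq> 0" using b by simp
  have "inverse (of_nat b) ^ k * a \<in> R" for k
  proof -
    obtain r where "r \<in> R" "a = of_nat b ^ k * r" using subsetD[OF all[of k] a(1)] unfolding smult_iff by blast
    then show ?thesis using b0 by (simp add: power_inverse flip: mult.assoc)
  qed
  then have "inverse (of_nat b) \<in> R" using a idlD(1)[OF c(1)] by (blast intro: almost_integral)
  then have "inverse (of_nat b :: 'k) \<in> \<int>" unfolding R_def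
    by (intro rational_algebraic_int_is_int) (auto intro: Rats_inverse)
  then obtain z where z: "inverse (of_nat b :: 'k) = of_int z" by (auto elim: Ints_cases)
  then have "(of_int (int b * z) :: 'k) = of_int 1" using b0 by (metis of_int_1 of_int_mult of_int_of_nat_eq right_inverse)
  then have "int b * z = 1" by (simp only: of_int_eq_iff)
  then show False using b by (metis int_one_le_iff_zero_less nat_int of_nat_1 of_nat_less_iff pos_zmult_eq_1_iff zero_less_one order_less_trans less_irrefl)
qed

end

section \<open>Ray classes\<close>

locale ray_setup = number_ring R for R :: "'k::field_char_0 set" +
  fixes \<mm> :: "'k modulus" and \<Gamma> :: "((('k \<Rightarrow> real) \<Rightarrow> real) \<times> 'k set) set"
  assumes modulus: "is_modulus \<mm>" and \<Gamma>: "subgroup \<Gamma> (residue_units \<mm>)"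
begin

abbreviation "m \<equiv> m_fin \<mm>"
abbreviation "Cop \<equiv> coprime_elems \<mm>"
abbreviation "\<G> \<equiv> residue_units \<mm>"
abbreviation "RR \<equiv> R_ray \<mm> \<Gamma>"
abbreviation "KR \<equiv> K_ray \<mm> \<Gamma>"
abbreviation "ires \<equiv> int_residue \<mm>"

lemma m: "idl m" "m \<noteq> {0}"
  using modulus by (auto simp: is_modulus_def ideal_iff)

lemma fin_primes_iff: "p \<in> fin_primes \<mm> \<longleftrightarrow> prm p \<and> m \<subseteq> p"
  by (auto simp: fin_primes_def nonzero_prime_iff)

lemma Cop_iff: "x \<in> Cop \<longleftrightarrow> x \<noteq> 0 \<and> (\<forall>p. prm p \<and> m \<subseteq> p \<longrightarrow> valuation p x = 0)"
  by (auto simp: coprime_elems_def fin_primes_iff)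

lemma Cop_int: "x \<in> R \<Longrightarrow> x \<in> Cop \<longleftrightarrow> x \<noteq> 0 \<and> (\<forall>p. prm p \<and> m \<subseteq> p \<longrightarrow> x \<notin> p)"
  by (auto simp: Cop_iff valuation_0_iff)

lemma Cop_mult: "x \<in> Cop \<Longrightarrow> y \<in> Cop \<Longrightarrow> x * y \<in> Cop"
  by (auto simp: Cop_iff valuation_mult)
lemma Cop_inverse: "x \<in> Cop \<Longrightarrow> inverse x \<in> Cop"
  by (auto simp: Cop_iff valuation_inverse)
lemma Cop_1: "1 \<in> Cop"
  by (auto simp: Cop_iff valuation_1)

lemma Cop_if_one_mod: "x \<in> R \<Longrightarrow> x \<noteq> 0 \<Longrightarrow> 1 - x \<in> m \<Longrightarrow> x \<in> Cop"
proof -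
  assume x: "x \<in> R" "x \<noteq> 0" "1 - x \<in> m"
  have "x \<notin> p" if "prm p" "m \<subseteq> p" for p
    using idlD(3)[OF prmD(1)[OF that(1)], of x "1 - x"] prmD(3)[OF that(1)] that x by auto
  then show ?thesis using x by (auto simp: Cop_int)
qed

lemma ideal_coprime_iff: "idl c \<Longrightarrow> c \<noteq> {0} \<Longrightarrow> (\<forall>p\<in>fin_primes \<mm>. ideal_valuation p c = 0) \<longleftrightarrow> (\<forall>p. prm p \<and> m \<subseteq> p \<longrightarrow> \<not> c \<subseteq> p)"
  by (auto simp: fin_primes_iff ideal_valuation_integral prime_exponent_0_iff)

lemma comaximal:
  assumes "idl c" "c \<noteq> {0}" "\<And>p. prm p \<Longrightarrow> m \<subseteq> p \<Longrightarrow> \<not> c \<subseteq> p"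
  obtains d where "d \<in> c" "d \<noteq> 0" "1 - d \<in> m"
  using comaximal_if_coprime[OF assms(1,2) m assms(3)] by blast

text \<open>Every element coprime to the modulus has a denominator congruent to \<open>1\<close>.\<close>

lemma Cop_denominator:
  assumes x: "x \<in> Cop"
  obtains b where "b \<in> R" "b \<noteq> 0" "1 - b \<in> m" "b * x \<in> R"
proof -
  have x0: "x \<noteq> 0" using x by (simp add: Cop_iff)
  define D where "D = {r \<in> R. r * x \<in> R}"
  have D: "idl D" unfolding idl_def D_def by (auto simp: distrib_right mult.assoc)
  obtain b where b: "b \<in> R" "b \<noteq> 0" "b * x \<in> R" using has_denominator[of x] by blast
  have D0: "D \<noteq> {0}" using b by (auto simp: D_def)
  have "\<not> D \<subseteq> p" if p: "prm p" "m \<subseteq> p" for p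
  proof -
    obtain h where h: "h \<notin> R" "\<And>y. y \<in> p \<Longrightarrow> h * y \<in> R" using prime_inverse[OF p(1)] by blast
    have bx: "b * x \<noteq> 0" using b x0 by simp
    have "valuation p (b * x) = valuation p b" using valuation_mult[OF p(1) b(2) x0] x p by (simp add: Cop_iff)
    then have e: "prime_exponent p (smult_set (b * x) R) = prime_exponent p (smult_set b R)"
      using valuation_int[OF p(1)] b bx by simp
    define n where "n = prime_exponent p (smult_set b R)"
    have 1: "h ^ n * b \<in> R" "h ^ n * b \<notin> p" using stripped_principal[OF p(1) h b(1,2)] by (auto simp: n_def)
    have 2: "h ^ n * (b * x) \<in> R" using stripped_principal(1)[OF p(1) h b(3) bx] by (simp add: n_def e)
    have "h ^ n * b \<in> D" using 1 2 by (simp add: D_def mult.assoc)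
    then show ?thesis using 1 by blast
  qed
  then obtain d where "d \<in> D" "d \<noteq> 0" "1 - d \<in> m" using comaximal[OF D D0] by blast
  then show thesis using that[of d] by (auto simp: D_def)
qed

subsection \<open>The residue map\<close>

lemma coset_eq: "a \<in> R \<Longrightarrow> b \<in> R \<Longrightarrow> a - b \<in> m \<Longrightarrow> m +>\<^bsub>int_ring\<^esub> a = m +>\<^bsub>int_ring\<^esub> b"
proof -
  have sub: "m +>\<^bsub>int_ring\<^esub> a \<subseteq> m +>\<^bsub>int_ring\<^esub> b" if "a - b \<in> m" for a b
  proof
    fix x assume "x \<in> m +>\<^bsub>int_ring\<^esub> a"
    then obtain h where h: "h \<in> m" "x = h + a" by (auto simp: a_r_coset_def' int_ring_simps)
    then have "x = (h + (a - b)) + b" "h + (a - b) \<in> m" using idlD(3)[OF m(1)] that by auto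
    then show "x \<in> m +>\<^bsub>int_ring\<^esub> b" unfolding a_r_coset_def' int_ring_simps by blast
  qed
  assume "a \<in> R" "b \<in> R" "a - b \<in> m"
  moreover have "b - a \<in> m" using idl_minus[OF m(1) \<open>a - b \<in> m\<close>] by simp
  ultimately show ?thesis using sub[of a b] sub[of b a] by blast
qed

lemma sign_group: "group sign_group"
  by (rule groupI) (auto simp: sign_group_def)

lemma m_ideal: "ideal m (int_ring :: 'k ring)"
  using m(1) ideal_iff by blast

lemma quot_mult: "a \<in> R \<Longrightarrow> b \<in> R \<Longrightarrow>
  (m +>\<^bsub>int_ring\<^esub> a) \<otimes>\<^bsub>int_ring Quot m\<^esub> (m +>\<^bsub>int_ring\<^esub> b) = m +>\<^bsub>int_ring\<^esub> (a * b)"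
  using ideal.rcoset_mult_add[OF m_ideal, of a b] by (simp add: FactRing_def int_ring_simps)

lemma quot_carrier: "x \<in> carrier (int_ring Quot m) \<longleftrightarrow> (\<exists>a\<in>R. x = m +>\<^bsub>int_ring\<^esub> a)"
  by (auto simp: FactRing_def A_RCOSETS_def' int_ring_simps)

lemma quot_one: "\<one>\<^bsub>int_ring Quot m\<^esub> = m +>\<^bsub>int_ring\<^esub> 1"
  by (simp add: FactRing_def int_ring_simps)

lemma comm_group_G: "comm_group \<G>"
proof (rule group.group_comm_groupI)
  have mon: "monoid (int_ring Quot m)"
    using ring.is_monoid[OF ideal.quotient_is_ring[OF m_ideal]] .
  show "group \<G>" unfolding residue_units_def
    by (intro DirProd_group product_group sign_group monoid.units_group[OF mon])
  fix x y assume x: "x \<in> carrier \<G>" and y: "y \<in> carrier \<G>"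
  obtain f X where X: "x = (f, X)" "f \<in> carrier (product_group (inf_places \<mm>) (\<lambda>_. sign_group))" "X \<in> Units (int_ring Quot m)"
    using x by (auto simp: residue_units_def DirProd_def units_of_def)
  obtain g Y where Y: "y = (g, Y)" "g \<in> carrier (product_group (inf_places \<mm>) (\<lambda>_. sign_group))" "Y \<in> Units (int_ring Quot m)"
    using y by (auto simp: residue_units_def DirProd_def units_of_def)
  obtain a b where a: "a \<in> R" "X = m +>\<^bsub>int_ring\<^esub> a" and b: "b \<in> R" "Y = m +>\<^bsub>int_ring\<^esub> b"
    using X(3) Y(3) quot_carrier by (auto simp: Units_def)
  have "X \<otimes>\<^bsub>int_ring Quot m\<^esub> Y = Y \<otimes>\<^bsub>int_ring Quot m\<^esub> X"
    using a b quot_mult[OF a(1) b(1)] quot_mult[OF b(1) a(1)] by (simp add: mult.commute)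
  moreover have "f \<otimes>\<^bsub>product_group (inf_places \<mm>) (\<lambda>_. sign_group)\<^esub> g = g \<otimes>\<^bsub>product_group (inf_places \<mm>) (\<lambda>_. sign_group)\<^esub> f"
    by (simp add: sign_group_def mult.commute)
  ultimately show "x \<otimes>\<^bsub>\<G>\<^esub> y = y \<otimes>\<^bsub>\<G>\<^esub> x"
    unfolding X(1) Y(1) by (simp add: residue_units_def DirProd_def units_of_def)
qed

sublocale G: comm_group \<G> by (rule comm_group_G)

lemma inf_place: "w \<in> inf_places \<mm> \<Longrightarrow> real_embedding w"
  by (simp add: inf_places_def)

lemma ires_carrier: assumes a: "a \<in> R" "a \<in> Cop" shows "ires a \<in> carrier \<G>"
proof -
  have a0: "a \<noteq> 0" using a by (simp add: Cop_iff)
  have sgn: "sgn (w a) \<in> {1, -1}" if "w \<in> inf_places \<mm>" for w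
    using embedding_facts(7)[OF inf_place[OF that] a0] by (simp add: sgn_if)
  have "\<not> smult_set a R \<subseteq> p" if "prm p" "m \<subseteq> p" for p
    using a that smult_self[of a] by (auto simp: Cop_int)
  then obtain d where d: "d \<in> smult_set a R" "1 - d \<in> m"
    using comaximal[of "smult_set a R"] principal_idl[OF a(1) a0] by blast
  then obtain b where b: "b \<in> R" "d = a * b" by (auto simp: smult_iff)
  have ab: "m +>\<^bsub>int_ring\<^esub> (a * b) = m +>\<^bsub>int_ring\<^esub> 1"
    using coset_eq[of 1 "a * b"] a b d by simp
  have "m +>\<^bsub>int_ring\<^esub> a \<in> Units (int_ring Quot m)"
    unfolding Units_def mem_Collect_eq
  proof (intro conjI bexI)
    show "m +>\<^bsub>int_ring\<^esub> a \<in> carrier (int_ring Quot m)" "m +>\<^bsub>int_ring\<^esub> b \<in> carrier (int_ring Quot m)"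
      using a b quot_carrier by blast+
    show "(m +>\<^bsub>int_ring\<^esub> b) \<otimes>\<^bsub>int_ring Quot m\<^esub> (m +>\<^bsub>int_ring\<^esub> a) = \<one>\<^bsub>int_ring Quot m\<^esub>"
      "(m +>\<^bsub>int_ring\<^esub> a) \<otimes>\<^bsub>int_ring Quot m\<^esub> (m +>\<^bsub>int_ring\<^esub> b) = \<one>\<^bsub>int_ring Quot m\<^esub>"
      using a b ab by (simp_all add: quot_mult quot_one mult.commute)
  qed
  then show ?thesis using sgn
    by (auto simp: int_residue_def residue_units_def DirProd_def units_of_def sign_group_def)
qed

lemma ires_mult: "a \<in> R \<Longrightarrow> b \<in> R \<Longrightarrow> ires (a * b) = ires a \<otimes>\<^bsub>\<G>\<^esub> ires b"
  by (auto simp: int_residue_def residue_units_def DirProd_def units_of_def quot_mult sign_group_def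
      inf_places_def real_embedding_def sgn_mult fun_eq_iff)

lemma ires_one_if:
  assumes "a \<in> R" "1 - a \<in> m" "\<And>w. w \<in> inf_places \<mm> \<Longrightarrow> w a > 0"
  shows "ires a = \<one>\<^bsub>\<G>\<^esub>"
  using assms coset_eq[of 1 a]
  by (auto simp: int_residue_def residue_units_def DirProd_def units_of_def quot_one sign_group_def fun_eq_iff)

lemma ires_1: "ires 1 = \<one>\<^bsub>\<G>\<^esub>"
  by (rule ires_one_if) (auto simp: idlD(2)[OF m(1)] inf_places_def real_embedding_def)

text \<open>Such elements have trivial residue, so they lie in the ray semigroup of any subgroup.\<close>

lemma RR_if_one:
  assumes "a \<in> R" "a \<noteq> 0" "1 - a \<in> m" "\<And>w. w \<in> inf_places \<mm> \<Longrightarrow> w a > 0" shows "a \<in> RR"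
proof -
  have "ires a = \<one>\<^bsub>\<G>\<^esub>" by (rule ires_one_if) (use assms in auto)
  then show ?thesis using assms(1-3) Cop_if_one_mod subgroup.one_closed[OF \<Gamma>]
    by (simp add: R_ray_def int_ring_simps)
qed

lemma residue_quotient:
  assumes a: "a \<in> R" "a \<in> Cop" and b: "b \<in> R" "b \<in> Cop"
  shows "residue \<mm> (a / b) = ires a \<otimes>\<^bsub>\<G>\<^esub> inv\<^bsub>\<G>\<^esub> ires b"
  unfolding residue_def int_ring_simps
proof (rule the_equality)
  show "\<exists>a'\<in>R \<inter> Cop. \<exists>b'\<in>R \<inter> Cop. a / b = a' / b' \<and> ires a \<otimes>\<^bsub>\<G>\<^esub> inv\<^bsub>\<G>\<^esub> ires b = ires a' \<otimes>\<^bsub>\<G>\<^esub> inv\<^bsub>\<G>\<^esub> ires b'"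
    using a b by blast
  fix g assume "\<exists>a'\<in>R \<inter> Cop. \<exists>b'\<in>R \<inter> Cop. a / b = a' / b' \<and> g = ires a' \<otimes>\<^bsub>\<G>\<^esub> inv\<^bsub>\<G>\<^esub> ires b'"
  then obtain a' b' where a': "a' \<in> R" "a' \<in> Cop" and b': "b' \<in> R" "b' \<in> Cop" and eq: "a / b = a' / b'"
    and g: "g = ires a' \<otimes>\<^bsub>\<G>\<^esub> inv\<^bsub>\<G>\<^esub> ires b'" by blast
  have "b \<noteq> 0" "b' \<noteq> 0" using b b' by (auto simp: Cop_iff)
  then have "a * b' = a' * b" using eq by (simp add: field_simps)
  then have rel: "ires a \<otimes>\<^bsub>\<G>\<^esub> ires b' = ires a' \<otimes>\<^bsub>\<G>\<^esub> ires b"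
    using ires_mult[of a b'] ires_mult[of a' b] a(1) b(1) a'(1) b'(1) by simp
  note c = ires_carrier[OF a] ires_carrier[OF b] ires_carrier[OF a'] ires_carrier[OF b']
  have "ires a \<otimes>\<^bsub>\<G>\<^esub> inv\<^bsub>\<G>\<^esub> ires b = (ires a \<otimes>\<^bsub>\<G>\<^esub> ires b') \<otimes>\<^bsub>\<G>\<^esub> (inv\<^bsub>\<G>\<^esub> ires b \<otimes>\<^bsub>\<G>\<^esub> inv\<^bsub>\<G>\<^esub> ires b')"
    using c by (simp add: G.m_ac G.r_inv)
  also have "\<dots> = ires a' \<otimes>\<^bsub>\<G>\<^esub> inv\<^bsub>\<G>\<^esub> ires b'"
    unfolding rel using c by (simp add: G.m_assoc) (simp add: G.m_ac G.m_assoc[symmetric] G.r_inv)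
  finally show "g = ires a \<otimes>\<^bsub>\<G>\<^esub> inv\<^bsub>\<G>\<^esub> ires b" using g by simp
qed

lemma residue_int: "a \<in> R \<Longrightarrow> a \<in> Cop \<Longrightarrow> residue \<mm> a = ires a"
  using residue_quotient[of a 1] Cop_1 ires_carrier[of a] by (simp add: ires_1)

lemma Cop_quotient:
  assumes "x \<in> Cop" obtains a b where "a \<in> R" "a \<in> Cop" "b \<in> R" "b \<in> Cop" "x = a / b"
proof -
  obtain b where b: "b \<in> R" "b \<noteq> 0" "1 - b \<in> m" "b * x \<in> R" using Cop_denominator[OF assms] .
  have bC: "b \<in> Cop" by (rule Cop_if_one_mod[OF b(1-3)])
  then have "b * x \<in> Cop" using assms by (rule Cop_mult)
  then show thesis using that[of "b * x" b] b bC by simp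
qed

lemma residue_carrier_mult:
  assumes x: "x \<in> Cop" and y: "y \<in> Cop"
  shows "residue \<mm> (x * y) = residue \<mm> x \<otimes>\<^bsub>\<G>\<^esub> residue \<mm> y" "residue \<mm> x \<in> carrier \<G>"
proof -
  obtain a b where ab: "a \<in> R" "a \<in> Cop" "b \<in> R" "b \<in> Cop" "x = a / b" using Cop_quotient[OF x] .
  obtain a' b' where ab': "a' \<in> R" "a' \<in> Cop" "b' \<in> R" "b' \<in> Cop" "y = a' / b'" using Cop_quotient[OF y] .
  note c = ires_carrier[OF ab(1,2)] ires_carrier[OF ab(3,4)] ires_carrier[OF ab'(1,2)] ires_carrier[OF ab'(3,4)]
  have "x * y = (a * a') / (b * b')" using ab ab' by simp
  then have "residue \<mm> (x * y) = ires (a * a') \<otimes>\<^bsub>\<G>\<^esub> inv\<^bsub>\<G>\<^esub> ires (b * b')"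
    using residue_quotient[of "a * a'" "b * b'"] ab ab' Cop_mult by simp
  also have "\<dots> = (ires a \<otimes>\<^bsub>\<G>\<^esub> inv\<^bsub>\<G>\<^esub> ires b) \<otimes>\<^bsub>\<G>\<^esub> (ires a' \<otimes>\<^bsub>\<G>\<^esub> inv\<^bsub>\<G>\<^esub> ires b')"
    using ab ab' c by (simp add: ires_mult G.inv_mult G.m_ac)
  finally show "residue \<mm> (x * y) = residue \<mm> x \<otimes>\<^bsub>\<G>\<^esub> residue \<mm> y"
    using residue_quotient[OF ab(1-4)] residue_quotient[OF ab'(1-4)] ab(5) ab'(5) by simp
  show "residue \<mm> x \<in> carrier \<G>" using residue_quotient[OF ab(1-4)] ab(5) c by simp
qed

lemma KR_mult: "x \<in> KR \<Longrightarrow> y \<in> KR \<Longrightarrow> x * y \<in> KR"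
  using subgroup.m_closed[OF \<Gamma>] by (auto simp: K_ray_def Cop_mult residue_carrier_mult)

lemma KR_inverse: assumes x: "x \<in> KR" shows "inverse x \<in> KR"
proof -
  have xC: "x \<in> Cop" "inverse x \<in> Cop" "residue \<mm> x \<in> \<Gamma>" using x Cop_inverse by (auto simp: K_ray_def)
  have "x \<noteq> 0" using xC by (simp add: Cop_iff)
  then have "residue \<mm> (inverse x) \<otimes>\<^bsub>\<G>\<^esub> residue \<mm> x = \<one>\<^bsub>\<G>\<^esub>"
    using residue_carrier_mult(1)[OF xC(2,1)] residue_int[OF R_1 Cop_1] by (simp add: ires_1)
  then have "residue \<mm> (inverse x) = inv\<^bsub>\<G>\<^esub> residue \<mm> x"
    using residue_carrier_mult(2)[OF xC(2,1)] residue_carrier_mult(2)[OF xC(1,2)] by (simp add: G.inv_equality)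
  then show ?thesis using xC subgroup.m_inv_closed[OF \<Gamma>] by (simp add: K_ray_def)
qed

lemma RR_iff: "x \<in> RR \<longleftrightarrow> x \<in> R \<and> x \<in> KR"
  by (auto simp: R_ray_def K_ray_def int_ring_simps residue_int)

lemma KR_nonzero: "x \<in> KR \<Longrightarrow> x \<noteq> 0"
  by (simp add: K_ray_def Cop_iff)

lemma RR_mult: "x \<in> RR \<Longrightarrow> y \<in> RR \<Longrightarrow> x * y \<in> RR"
  by (simp add: RR_iff KR_mult)

lemma RR_1: "1 \<in> RR"
  by (rule RR_if_one) (auto simp: idlD(2)[OF m(1)] inf_places_def real_embedding_def)

lemma RR_units_iff: "x \<in> R_ray_units \<mm> \<Gamma> \<longleftrightarrow> x \<in> KR \<and> x \<in> R \<and> inverse x \<in> R"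
proof -
  have "x \<in> Units (int_ring :: 'k ring) \<longleftrightarrow> inverse x \<in> R" if x: "x \<in> R" "x \<noteq> 0"
  proof
    assume "x \<in> Units (int_ring :: 'k ring)"
    then obtain y where "y \<in> R" "x * y = 1" by (auto simp: Units_def int_ring_simps)
    then show "inverse x \<in> R" by (metis inverse_unique)
  next
    assume "inverse x \<in> R"
    then show "x \<in> Units (int_ring :: 'k ring)" using x by (auto simp: Units_def int_ring_simps intro!: bexI[of _ "inverse x"])
  qed
  then show ?thesis using KR_nonzero[of x] by (auto simp: R_ray_units_def RR_iff)
qed

lemma KR_quotient:
  assumes g: "g \<in> KR" obtains a b where "a \<in> RR" "b \<in> RR" "g = a / b"
proof -
  have "g \<in> Cop" using g by (simp add: K_ray_def)
  then obtain b where b: "b \<in> R" "b \<noteq> 0" "1 - b \<in> m" "b * g \<in> R" using Cop_denominator by blast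
  \<comment> \<open>Squares are positive at every real place.\<close>
  have bb: "b * b \<in> RR"
  proof (rule RR_if_one)
    have "1 - b * b = (1 - b) * (1 + b)" by (simp add: algebra_simps)
    then show "1 - b * b \<in> m" using idl_right[OF m(1) _ b(3), of "1 + b"] b by simp
    show "w (b * b) > 0" if "w \<in> inf_places \<mm>" for w
    proof -
      have "w (b * b) = w b * w b" using inf_place[OF that] by (simp add: real_embedding_def)
      then show ?thesis using embedding_facts(7)[OF inf_place[OF that] b(2)] by (auto simp: zero_less_mult_iff linorder_neq_iff)
    qed
  qed (use b in auto)
  have "b * b * g \<in> R" unfolding mult.assoc by (rule R_mult[OF b(1,4)])
  moreover have "b * b * g \<in> KR" using KR_mult g bb by (simp add: RR_iff)
  ultimately have "b * b * g \<in> RR" by (simp add: RR_iff)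
  then show thesis using that[of "b * b * g" "b * b"] bb b(2) by simp
qed

text \<open>
  The separating element \<open>y\<close> for \<open>c\<close> and \<open>u\<close> may be changed by elements of \<open>R\<close>. A denominator
  \<open>d \<in> c\<close> with \<open>d \<equiv> 1\<close> exists as \<open>c\<close> is coprime to the modulus, and adding suitable integers makes
  numerator and denominator congruent to \<open>1\<close> and positive.
\<close>

theorem ray_separation:
  assumes c: "idl c" "c \<noteq> {0}" "\<And>p. prm p \<Longrightarrow> m \<subseteq> p \<Longrightarrow> \<not> c \<subseteq> p" and u: "u \<in> R" "u \<notin> c"
  obtains e d where "e \<in> RR" "d \<in> RR" "\<And>x. x \<in> c \<Longrightarrow> e * x \<in> smult_set d R" "e * u \<notin> smult_set d R"
proof -
  obtain y where y: "\<And>x. x \<in> c \<Longrightarrow> y * x \<in> R" "y * u \<notin> R" using ideal_separation[OF c(1,2) u] by blast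
  obtain d0 where d0: "d0 \<in> c" "d0 \<noteq> 0" "1 - d0 \<in> m" using comaximal[OF c] by blast
  obtain n1 where n1: "n1 > 0" "of_nat n1 \<in> c" using nat_in_ideal[OF c(1,2)] .
  obtain n2 where n2: "n2 > 0" "of_nat n2 \<in> m" using nat_in_ideal[OF m] .
  define N where "N = n1 * n2"
  have N: "N > 0" "of_nat N \<in> c" "of_nat N \<in> m"
    using n1 n2 idl_right[OF c(1) R_of_nat n1(2)] idlD(4)[OF m(1) R_of_nat n2(2)] by (auto simp: N_def)
  have N1: "w (of_nat N) \<ge> 1" if "real_embedding w" for w using embedding_facts(4)[OF that] N(1) by simp
  obtain k :: nat where k: "d0 + of_nat k * of_nat N \<noteq> 0" "\<And>w. real_embedding w \<Longrightarrow> w (d0 + of_nat k * of_nat N) \<ge> 1"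
  proof (rule positive_shift[of d0 "of_nat N"])
    show "d0 \<in> R" "of_nat N \<in> R" "of_nat N \<noteq> (0::'k)" using idlD(1)[OF c(1) d0(1)] N(1) by auto
    show "w (of_nat N) \<ge> 1" if "real_embedding w" for w using N1[OF that] .
  qed blast
  define d where "d = d0 + of_nat k * of_nat N"
  have dc: "d \<in> c" unfolding d_def by (intro idlD(3)[OF c(1)] idlD(4)[OF c(1)] d0 N R_of_nat)
  have dR: "d \<in> R" using idlD(1)[OF c(1) dc] .
  have deq: "1 - d = (1 - d0) - of_nat k * of_nat N" by (simp add: d_def)
  have dm: "1 - d \<in> m" unfolding deq by (rule idl_diff[OF m(1) d0(3) idlD(4)[OF m(1) R_of_nat N(3)]])
  have dw: "w d \<ge> 1" if "real_embedding w" for w using k(2)[OF that] by (simp add: d_def)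
  have d0': "d \<noteq> 0" using k(1) by (simp add: d_def)
  have dRR: "d \<in> RR" using dR d0' dm dw inf_place by (intro RR_if_one) (auto intro: less_le_trans[OF zero_less_one])
  define n where "n = y * d"
  have nR: "n \<in> R" using y(1)[OF dc] by (simp add: n_def)
  define e0 where "e0 = n + d * (1 - n)"
  have e0R: "e0 \<in> R" using nR dR by (simp add: e0_def)
  have Nd: "of_nat N * d \<in> R" "of_nat N * d \<noteq> 0" using dR d0' N(1) by auto
  have Ndw: "w (of_nat N * d) \<ge> 1" if "real_embedding w" for w
  proof -
    have "w (of_nat N * d) = w (of_nat N) * w d" using that by (simp add: real_embedding_def)
    then show ?thesis using mult_mono[OF N1[OF that] dw[OF that]] N1[OF that] by simp
  qed
  obtain j :: nat where j: "e0 + of_nat j * (of_nat N * d) \<noteq> 0" "\<And>w. real_embedding w \<Longrightarrow> w (e0 + of_nat j * (of_nat N * d)) \<ge> 1"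
  proof (rule positive_shift[OF e0R Nd])
    show "w (of_nat N * d) \<ge> 1" if "real_embedding w" for w using Ndw[OF that] .
  qed blast
  define e where "e = e0 + of_nat j * (of_nat N * d)"
  define r where "r = (1 - n) + of_nat j * of_nat N"
  have rR: "r \<in> R" using nR by (simp add: r_def)
  have er: "e = d * (y + r)" by (simp add: e_def e0_def r_def n_def algebra_simps)
  have eR: "e \<in> R" using e0R Nd by (simp add: e_def)
  have "1 - e = (1 - d) * (1 - n) - (of_nat j * d) * of_nat N" by (simp add: e_def e0_def algebra_simps)
  then have em: "1 - e \<in> m"
    using idl_diff[OF m(1) idl_right[OF m(1) _ dm, of "1 - n"] idlD(4)[OF m(1) _ N(3), of "of_nat j * d"]] nR dR by simp
  have eRR: "e \<in> RR" using eR j em inf_place by (intro RR_if_one) (auto simp: e_def intro: less_le_trans[OF zero_less_one])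
  have 1: "e * x \<in> smult_set d R" if "x \<in> c" for x
    unfolding smult_iff
  proof (rule bexI)
    show "e * x = d * (y * x + r * x)" by (simp add: er algebra_simps)
    show "y * x + r * x \<in> R" using y(1)[OF that] rR idlD(1)[OF c(1) that] by simp
  qed
  have 2: "e * u \<notin> smult_set d R"
  proof
    assume "e * u \<in> smult_set d R"
    then obtain z where z: "z \<in> R" "e * u = d * z" by (auto simp: smult_iff)
    then have "d * (y * u + r * u) = d * z" by (simp add: er algebra_simps)
    then have "y * u = z - r * u" using d0' by (simp add: eq_diff_eq)
    then show False using y(2) z(1) rR u(1) by simp
  qed
  show thesis using that[OF eRR dRR 1 2] .
qed

subsection \<open>Ideals in a ray class\<close>

lemma ideal_prod_principal:
  assumes I: "fractional_ideal I" shows "ideal_prod K_ring (smult_set x R) I = smult_set x I"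
proof (intro equalityI subsetI)
  fix y assume "y \<in> ideal_prod K_ring (smult_set x R) I"
  then show "y \<in> smult_set x I"
  proof (induction rule: ideal_prod.induct)
    case (prod i j)
    then obtain r where "r \<in> R" "i = x * r" by (auto simp: smult_iff)
    then show ?case using prod fractional_idealD(3)[OF I, of r j] by (auto simp: smult_iff K_ring_def mult.assoc)
  next
    case (sum s t)
    then obtain a b where "a \<in> I" "s = x * a" "b \<in> I" "t = x * b" by (auto simp: smult_iff)
    then have "s + t = x * (a + b)" "a + b \<in> I" using fractional_idealD(2)[OF I] by (auto simp: distrib_left)
    then show ?case unfolding smult_iff by (auto simp: K_ring_def)
  qed
next
  fix y assume "y \<in> smult_set x I"
  then obtain a where "a \<in> I" "y = x * a" by (auto simp: smult_iff)
  then show "y \<in> ideal_prod K_ring (smult_set x R) I"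
    using ideal_prod.prod[OF smult_self[of x], of a I K_ring] by (simp add: K_ring_def)
qed

lemma ray_class_cases:
  assumes "\<kk> \<in> ray_classes \<mm> \<Gamma>"
  obtains I0 where "fractional_ideal I0" "\<And>p. prm p \<Longrightarrow> m \<subseteq> p \<Longrightarrow> ideal_valuation p I0 = 0"
    "\<kk> = {smult_set x I0 |x. x \<in> KR}"
proof -
  obtain I0 where I0: "I0 \<in> carrier (coprime_ideals \<mm>)" "\<kk> = principal_ray \<mm> \<Gamma> #>\<^bsub>coprime_ideals \<mm>\<^esub> I0"
    using assms by (auto simp: ray_classes_def carrier_FactGroup)
  have f: "fractional_ideal I0" using I0 by (simp add: coprime_ideals_def)
  have "\<kk> = {smult_set x I0 |x. x \<in> KR}"
    unfolding I0(2) r_coset_def principal_ray_def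
    by (auto simp: coprime_ideals_def fractional_ideals_def int_ring_simps ideal_prod_principal[OF f])
  moreover have "ideal_valuation p I0 = 0" if "prm p" "m \<subseteq> p" for p
    using I0(1) that by (auto simp: coprime_ideals_def fin_primes_iff)
  ultimately show thesis using that f by blast
qed

lemma ray_class_smult: "\<kk> \<in> ray_classes \<mm> \<Gamma> \<Longrightarrow> I \<in> \<kk> \<Longrightarrow> x \<in> KR \<Longrightarrow> smult_set x I \<in> \<kk>"
  by (auto elim!: ray_class_cases simp: smult_smult) (metis KR_mult)

lemma ray_class_coprime:
  assumes k: "\<kk> \<in> ray_classes \<mm> \<Gamma>" and I: "I \<in> \<kk>" shows "I \<in> carrier (coprime_ideals \<mm>)" "fractional_ideal I"
proof -
  obtain I0 where I0: "fractional_ideal I0" "\<And>p. prm p \<Longrightarrow> m \<subseteq> p \<Longrightarrow> ideal_valuation p I0 = 0"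
    "\<kk> = {smult_set x I0 |x. x \<in> KR}" using ray_class_cases[OF k] by blast
  obtain x where x: "x \<in> KR" "I = smult_set x I0" using I I0(3) by blast
  show f: "fractional_ideal I" using fractional_ideal_smult[OF I0(1) KR_nonzero[OF x(1)]] x by simp
  have "ideal_valuation p I = 0" if p: "prm p" "m \<subseteq> p" for p
    using ideal_valuation_smult[OF p(1) I0(1) KR_nonzero[OF x(1)]] I0(2)[OF p] x p by (simp add: K_ray_def Cop_iff)
  then show "I \<in> carrier (coprime_ideals \<mm>)" using f by (simp add: coprime_ideals_def fin_primes_iff)
qed

lemma ray_class_integral:
  assumes k: "\<kk> \<in> ray_classes \<mm> \<Gamma>" and I: "I \<in> \<kk>" "I \<subseteq> R"
  shows "idl I" "I \<noteq> {0}" "\<And>p. prm p \<Longrightarrow> m \<subseteq> p \<Longrightarrow> \<not> I \<subseteq> p"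
proof -
  note f = ray_class_coprime[OF k I(1)]
  show i: "idl I" "I \<noteq> {0}" using fractional_ideal_integral[OF f(2) I(2)] fractional_ideal_nonzero[OF f(2)] by auto
  have "\<forall>p\<in>fin_primes \<mm>. ideal_valuation p I = 0" using f(1) by (simp add: coprime_ideals_def)
  then show "\<not> I \<subseteq> p" if "prm p" "m \<subseteq> p" for p using ideal_coprime_iff[OF i] that by blast
qed

text \<open>A positive integer in the ideal of the modulus, increased by \<open>1\<close>.\<close>

lemma ray_natural: obtains b :: nat where "b > 1" "of_nat b \<in> RR"
proof -
  obtain n where n: "n > 0" "of_nat n \<in> m" using nat_in_ideal[OF m] .
  have "of_nat (Suc n) \<in> RR"
  proof (rule RR_if_one)
    show "1 - of_nat (Suc n) \<in> m" using idl_minus[OF m(1) n(2)] by simp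
    show "w (of_nat (Suc n)) > 0" if "w \<in> inf_places \<mm>" for w using embedding_facts(4)[OF inf_place[OF that], of "Suc n"] by (simp del: of_nat_Suc)
  qed (auto simp del: of_nat_Suc)
  then show thesis using that[of "Suc n"] n by simp
qed

end

section \<open>The commutant of the representation of a class\<close>

locale class_setup = ray_setup R \<mm> \<Gamma> + hilbert H
  for R :: "'k::field_char_0 set" and \<mm> \<Gamma> and H :: "'h::ab_group_add hilbert" +
  fixes \<aa> :: "'k set set \<Rightarrow> 'k set" and t :: "'k set \<Rightarrow> 'k" and rep :: "'k set \<Rightarrow> 'k set" and \<kk> :: "'k set set"
    and \<pi>\<^sub>0 :: "(nat \<Rightarrow> 'k \<times> 'k \<Rightarrow> complex) set \<Rightarrow> 'h \<Rightarrow> 'h"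
    and \<theta> :: "(('k \<times> 'k \<Rightarrow> complex) \<Rightarrow> ('k \<times> 'k \<Rightarrow> complex)) \<Rightarrow> ('k set \<times> 'k \<Rightarrow> 'h) \<Rightarrow> ('k set \<times> 'k \<Rightarrow> 'h)"
  assumes ideals: "ideal_choice \<mm> \<Gamma> \<aa> t" and reps: "representative_choice \<mm> rep" and kk: "\<kk> \<in> ray_classes \<mm> \<Gamma>"
    and \<pi>\<^sub>0: "representation (full_cstar (class_group \<mm> \<Gamma> \<aa> \<kk>)) H \<pi>\<^sub>0"
    and \<theta>: "class_representation \<mm> \<Gamma> \<aa> t rep \<kk> H \<pi>\<^sub>0 \<theta>"
begin

abbreviation "Sg \<equiv> ray_semigroup \<mm> \<Gamma>"
abbreviation "Gp \<equiv> class_group \<mm> \<Gamma> \<aa> \<kk>"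
abbreviation "RU \<equiv> R_ray_units \<mm> \<Gamma>"
abbreviation "ak \<equiv> \<aa> \<kk>"

sublocale square_summable H "class_index rep \<kk>" ..

abbreviation "X \<equiv> class_index rep \<kk>"

lemma ak: "ak \<in> \<kk>" "ak \<subseteq> R" and t: "I \<in> \<kk> \<Longrightarrow> t I \<in> KR" "I \<in> \<kk> \<Longrightarrow> smult_set (t I) I = ak"
proof -
  have "\<aa> \<kk> \<in> \<kk> \<and> \<aa> \<kk> \<subseteq> R \<and> (R \<in> \<kk> \<longrightarrow> \<aa> \<kk> = R) \<and> (\<forall>I\<in>\<kk>. t I \<in> KR \<and> smult_set (t I) I = \<aa> \<kk>)"
    by (rule ideals[unfolded ideal_choice_def int_ring_simps, THEN conjunct1, THEN bspec, OF kk])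
  then show "ak \<in> \<kk>" "ak \<subseteq> R" "I \<in> \<kk> \<Longrightarrow> t I \<in> KR" "I \<in> \<kk> \<Longrightarrow> smult_set (t I) I = ak" by simp_all
qed

lemma ak_idl: "idl ak" "ak \<noteq> {0}"
  using ray_class_integral[OF kk ak] by auto

lemma t_mult: "I \<in> \<kk> \<Longrightarrow> x \<in> I \<Longrightarrow> t I * x \<in> ak"
  using t(2)[of I] by (auto simp: smult_set_def)

lemma rep_facts:
  assumes "I \<in> \<kk>" "I \<subseteq> R"
  shows "rep I \<subseteq> R" "0 \<in> rep I" "\<And>x. x \<in> R \<Longrightarrow> \<exists>!y. y \<in> rep I \<and> x - y \<in> I"
proof -
  have f: "rep I \<subseteq> R \<and> 0 \<in> rep I \<and> (\<forall>x\<in>R. \<exists>!y. y \<in> rep I \<and> x - y \<in> I)"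
    by (rule reps[unfolded representative_choice_def int_ring_simps, THEN bspec, THEN mp,
      OF ray_class_coprime(1)[OF kk assms(1)] assms(2)])
  then show "rep I \<subseteq> R" "0 \<in> rep I" by simp_all
  show "\<exists>!y. y \<in> rep I \<and> x - y \<in> I" if "x \<in> R" for x
    by (rule bspec[OF conjunct2[OF conjunct2[OF f]] that])
qed

lemma bar_facts:
  assumes "I \<in> \<kk>" "I \<subseteq> R" "x \<in> R"
  shows "bar rep I x \<in> rep I" "x - bar rep I x \<in> I" "bar rep I x \<in> R"
  using theI'[OF rep_facts(3)[OF assms]] rep_facts(1)[OF assms(1,2)] unfolding bar_def by auto

lemma bar_eqI:
  assumes "I \<in> \<kk>" "I \<subseteq> R" "x \<in> R" "y \<in> rep I" "x - y \<in> I" shows "bar rep I x = y"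
  using rep_facts(3)[OF assms(1-3)] bar_facts[OF assms(1-3)] assms(4,5) by blast

lemma X_iff: "(I, x) \<in> X \<longleftrightarrow> I \<in> \<kk> \<and> I \<subseteq> R \<and> x \<in> rep I"
  by (simp add: class_index_def int_ring_simps)

lemma X_facts:
  assumes "(I, x) \<in> X" shows "I \<in> \<kk>" "I \<subseteq> R" "x \<in> rep I" "x \<in> R" "idl I" "I \<noteq> {0}"
  using assms rep_facts(1) ray_class_integral[OF kk] by (auto simp: X_iff)

lemma X_nonempty: "X \<noteq> {}"
  using X_iff[of ak 0] ak rep_facts(2)[OF ak] by blast

lemma smult_class: "b \<in> RR \<Longrightarrow> I \<in> \<kk> \<Longrightarrow> I \<subseteq> R \<Longrightarrow> smult_set b I \<in> \<kk> \<and> smult_set b I \<subseteq> R"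
  using ray_class_smult[OF kk, of I b] by (auto simp: RR_iff smult_iff intro!: R_mult)

subsection \<open>The group of the class\<close>

lemma RU_facts: "u \<in> RU \<Longrightarrow> u \<in> R" "u \<in> RU \<Longrightarrow> u \<in> RR" "u \<in> RU \<Longrightarrow> u \<noteq> 0" "u \<in> RU \<Longrightarrow> inverse u \<in> RU"
  "u \<in> RU \<Longrightarrow> v \<in> RU \<Longrightarrow> u * v \<in> RU" "1 \<in> RU"
  using KR_inverse KR_nonzero RR_1 KR_mult by (auto simp: RR_units_iff RR_iff)

lemma Gp_simps: "carrier Gp = ak \<times> RU" "\<one>\<^bsub>Gp\<^esub> = (0, 1)" "(a, b) \<otimes>\<^bsub>Gp\<^esub> (c, d) = (a + b * c, b * d)"
  by (simp_all add: class_group_def affine_monoid_def)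

lemma group_Gp: "group Gp"
proof (rule groupI)
  fix x assume "x \<in> carrier Gp"
  then obtain a u where x: "x = (a, u)" "a \<in> ak" "u \<in> RU" by (auto simp: Gp_simps)
  have "(- (inverse u * a), inverse u) \<in> carrier Gp"
    using idl_minus[OF ak_idl(1) idlD(4)[OF ak_idl(1) RU_facts(1)[OF RU_facts(4)[OF x(3)]] x(2)]] RU_facts(4)[OF x(3)]
    by (simp add: Gp_simps)
  moreover have "(- (inverse u * a), inverse u) \<otimes>\<^bsub>Gp\<^esub> x = \<one>\<^bsub>Gp\<^esub>"
    using RU_facts(3)[OF x(3)] by (simp add: x(1) Gp_simps)
  ultimately show "\<exists>y\<in>carrier Gp. y \<otimes>\<^bsub>Gp\<^esub> x = \<one>\<^bsub>Gp\<^esub>" by blast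
qed (auto simp: Gp_simps RU_facts idlD(2)[OF ak_idl(1)] intro!: idlD(3)[OF ak_idl(1)] idlD(4)[OF ak_idl(1)] simp: algebra_simps)

sublocale Gr: group_cstar_rep Gp H \<pi>\<^sub>0
  by (intro group_cstar_rep.intro group_cstar.intro group_cstar_rep_axioms.intro group_Gp hilbert_axioms \<pi>\<^sub>0)

abbreviation "\<sigma> g \<equiv> \<pi>\<^sub>0 (canonical_unitary Gp g)"

definition unitary :: "('h \<Rightarrow> 'h) \<Rightarrow> bool" where
  "unitary W \<longleftrightarrow> W \<in> Bd \<and> (\<forall>x\<in>V. \<forall>y\<in>V. ip (W x) (W y) = ip x y) \<and> (\<forall>y\<in>V. \<exists>x\<in>V. W x = y)"

lemma unitary_\<sigma>: "g \<in> carrier Gp \<Longrightarrow> unitary (\<sigma> g)"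
  unfolding unitary_def
  using Gr.\<sigma>_bd Gr.\<sigma>_isometry Gr.\<sigma>_inv(2) group.inv_closed[OF group_Gp] by (metis bd_V')

lemma unitary_comp: "unitary S \<Longrightarrow> unitary T \<Longrightarrow> unitary (S \<circ> T)"
  unfolding unitary_def by (auto, metis bd_V')

lemma unitary_orthogonal: assumes W: "unitary W" and k: "k \<in> V" "\<And>\<xi>. \<xi> \<in> V \<Longrightarrow> ip k (W \<xi>) = 0" shows "k = 0"
proof -
  obtain x where "x \<in> V" "W x = k" using W k(1) by (auto simp: unitary_def)
  then show ?thesis using k ip_eq_0 by metis
qed

lemma unitary_inj0: assumes W: "unitary W" and x: "x \<in> V" "W x = 0" shows "x = 0"
proof -
  have "ip (W x) (W x) = ip x x" using W x(1) unfolding unitary_def by blast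
  then show ?thesis using x ip_eq_0[OF x(1)] by simp
qed

subsection \<open>The isometries of the representation\<close>

text \<open>
  The operators \<open>U\<^sup>x\<close> and \<open>S\<^sub>b\<close> send \<open>\<delta>\<^sub>s \<otimes> \<xi>\<close> to \<open>\<delta>\<^bsub>\<phi> s\<^esub> \<otimes> W s \<xi>\<close> for the following \<open>\<phi>\<close> and \<open>W\<close>.
\<close>

definition \<phi>U :: "'k \<Rightarrow> 'k set \<times> 'k \<Rightarrow> 'k set \<times> 'k" where
  "\<phi>U x = (\<lambda>(c, y). (c, bar rep c (x + y)))"
definition WU :: "'k \<Rightarrow> 'k set \<times> 'k \<Rightarrow> 'h \<Rightarrow> 'h" where
  "WU x = (\<lambda>(c, y). \<sigma> (t c * (x + y - bar rep c (x + y)), 1))"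
definition \<phi>S :: "'k \<Rightarrow> 'k set \<times> 'k \<Rightarrow> 'k set \<times> 'k" where
  "\<phi>S b = (\<lambda>(c, y). (smult_set b c, bar rep (smult_set b c) (b * y)))"
definition WS :: "'k \<Rightarrow> 'k set \<times> 'k \<Rightarrow> 'h \<Rightarrow> 'h" where
  "WS b = (\<lambda>(c, y). \<sigma> (t (smult_set b c) * (b * y - bar rep (smult_set b c) (b * y)), b * inverse (t c) * t (smult_set b c)))"

lemma U_data:
  assumes x: "x \<in> R"
  shows "inj_on (\<phi>U x) X" "\<phi>U x ` X \<subseteq> X" "\<And>c y. (c, y) \<in> X \<Longrightarrow> (t c * (x + y - bar rep c (x + y)), 1) \<in> carrier Gp"
proof -
  show "inj_on (\<phi>U x) X"
  proof (rule inj_onI, clarsimp simp: \<phi>U_def)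
    fix c y y' assume s: "(c, y) \<in> X" "(c, y') \<in> X" and e: "bar rep c (x + y) = bar rep c (x + y')"
    note f = X_facts[OF s(1)] and f' = X_facts[OF s(2)]
    have "x + y - bar rep c (x + y) \<in> c" "x + y' - bar rep c (x + y') \<in> c" using bar_facts(2)[OF f(1,2)] x f(4) f'(4) by simp_all
    then have "(x + y - bar rep c (x + y)) - (x + y' - bar rep c (x + y')) \<in> c" by (rule idl_diff[OF f(5)])
    then have "y - y' \<in> c" using e by simp
    then have "bar rep c y = y'" by (rule bar_eqI[OF f(1,2,4) f'(3)])
    moreover have "bar rep c y = y" by (rule bar_eqI[OF f(1,2,4,3)]) (simp add: idlD(2)[OF f(5)])
    ultimately show "y = y'" by simp
  qed
  show "\<phi>U x ` X \<subseteq> X"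
  proof (clarsimp simp: \<phi>U_def)
    fix c y assume "(c, y) \<in> X"
    note f = X_facts[OF this]
    show "(c, bar rep c (x + y)) \<in> X" using bar_facts(1)[OF f(1,2), of "x + y"] x f by (simp add: X_iff)
  qed
  show "(t c * (x + y - bar rep c (x + y)), 1) \<in> carrier Gp" if "(c, y) \<in> X" for c y
    using t_mult[OF X_facts(1)[OF that]] bar_facts(2)[OF X_facts(1,2)[OF that], of "x + y"] x X_facts(4)[OF that] RU_facts(6)
    by (simp add: Gp_simps)
qed

lemma S_data:
  assumes b: "b \<in> RR"
  shows "inj_on (\<phi>S b) X" "\<phi>S b ` X \<subseteq> X"
    "\<And>c y. (c, y) \<in> X \<Longrightarrow> (t (smult_set b c) * (b * y - bar rep (smult_set b c) (b * y)), b * inverse (t c) * t (smult_set b c)) \<in> carrier Gp"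
proof -
  have bR: "b \<in> R" "b \<in> KR" "b \<noteq> 0" using b KR_nonzero by (auto simp: RR_iff)
  have cl: "smult_set b c \<in> \<kk>" "smult_set b c \<subseteq> R" "b * y \<in> R" if "(c, y) \<in> X" for c y
    using smult_class[OF b] X_facts[OF that] bR by auto
  have inj_smult: "c = c'" if "smult_set b c = smult_set b c'" for c c'
  proof -
    have "smult_set (inverse b) (smult_set b c) = smult_set (inverse b) (smult_set b c')" using that by simp
    then show ?thesis using bR by (simp add: smult_smult)
  qed
  show "inj_on (\<phi>S b) X"
  proof (rule inj_onI)
    fix p q assume pq: "p \<in> X" "q \<in> X" "\<phi>S b p = \<phi>S b q"
    obtain c y c' y' where cy: "p = (c, y)" "q = (c', y')" by (cases p, cases q) auto
    have s: "(c, y) \<in> X" "(c', y') \<in> X" and ec: "smult_set b c = smult_set b c'"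
      and e: "bar rep (smult_set b c) (b * y) = bar rep (smult_set b c') (b * y')"
      using pq unfolding cy \<phi>S_def prod.case prod.inject by blast+
    have c: "c' = c" using inj_smult[OF ec] by simp
    note f = X_facts[OF s(1)] and f' = X_facts[OF s(2), unfolded c] and l = cl[OF s(1)] and l' = cl[OF s(2), unfolded c]
    have "(b * y - bar rep (smult_set b c) (b * y)) - (b * y' - bar rep (smult_set b c) (b * y')) \<in> smult_set b c"
      by (intro idl_diff[OF idl_smult[OF f(5) bR(1)]] bar_facts(2) l l')
    then have "b * (y - y') \<in> smult_set b c" using e c by (simp add: algebra_simps)
    then have "y - y' \<in> c" using bR(3) by (auto simp: smult_iff)
    then have "bar rep c y = y'" by (rule bar_eqI[OF f(1,2,4) f'(3)])
    moreover have "bar rep c y = y" by (rule bar_eqI[OF f(1,2,4,3)]) (simp add: idlD(2)[OF f(5)])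
    ultimately show "p = q" using c cy by simp
  qed
  show "\<phi>S b ` X \<subseteq> X"
  proof (rule image_subsetI)
    fix p assume p: "p \<in> X"
    obtain c y where cy: "p = (c, y)" by (cases p)
    note s = p[unfolded cy]
    show "\<phi>S b p \<in> X" unfolding cy using cl[OF s] bar_facts(1)[OF cl[OF s]] unfolding \<phi>S_def prod.case X_iff by blast
  qed
  show "(t (smult_set b c) * (b * y - bar rep (smult_set b c) (b * y)), b * inverse (t c) * t (smult_set b c)) \<in> carrier Gp"
    if s: "(c, y) \<in> X" for c y
  proof -
    note f = X_facts[OF s] and l = cl[OF s]
    define v where "v = b * inverse (t c) * t (smult_set b c)"
    have tc: "t c \<in> KR" "t (smult_set b c) \<in> KR" using t(1) f l by auto
    have vK: "v \<in> KR" unfolding v_def by (intro KR_mult KR_inverse bR tc)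
    have vt: "v * t c = t (smult_set b c) * b" using KR_nonzero[OF tc(1)] by (simp add: v_def field_simps)
    have "smult_set v ak = smult_set v (smult_set (t c) c)" using t(2)[OF f(1)] by simp
    also have "\<dots> = smult_set (t (smult_set b c)) (smult_set b c)"
      by (simp only: smult_smult vt)
    also have "\<dots> = ak" using t(2)[OF l(1)] .
    finally have "v \<in> R" "inverse v \<in> R" using ideal_stabilizer[OF ak_idl] KR_nonzero[OF vK] by blast+
    then have "v \<in> RU" using vK by (simp add: RR_units_iff)
    moreover have "t (smult_set b c) * (b * y - bar rep (smult_set b c) (b * y)) \<in> ak"
      by (intro t_mult bar_facts(2) l)
    ultimately show ?thesis by (simp add: Gp_simps v_def)
  qed
qed

lemma unitary_WU: "x \<in> R \<Longrightarrow> s \<in> X \<Longrightarrow> unitary (WU x s)"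
  using U_data(3) by (cases s) (auto simp: WU_def intro!: unitary_\<sigma>)
lemma unitary_WS: "b \<in> RR \<Longrightarrow> s \<in> X \<Longrightarrow> unitary (WS b s)"
  using S_data(3) by (cases s) (auto simp: WS_def intro!: unitary_\<sigma>)

definition P :: "'k \<Rightarrow> 'k \<Rightarrow> ('k set \<times> 'k \<Rightarrow> 'h) \<Rightarrow> 'k set \<times> 'k \<Rightarrow> 'h" where
  "P x b = \<theta> (left_regular Sg (x, b))"
definition \<phi> :: "'k \<Rightarrow> 'k \<Rightarrow> 'k set \<times> 'k \<Rightarrow> 'k set \<times> 'k" where
  "\<phi> x b s = \<phi>U x (\<phi>S b s)"
definition W :: "'k \<Rightarrow> 'k \<Rightarrow> 'k set \<times> 'k \<Rightarrow> 'h \<Rightarrow> 'h" where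
  "W x b s = WU x (\<phi>S b s) \<circ> WS b s"

context
  fixes x b assumes x: "x \<in> R" and b: "b \<in> RR"
begin

lemma P_eq: "P x b = basis_op X H (\<phi>U x) (WU x) \<circ> basis_op X H (\<phi>S b) (WS b)"
  using \<theta> x b unfolding class_representation_def Let_def int_ring_simps P_def U_op_def S_op_def \<phi>U_def WU_def \<phi>S_def WS_def
  by blast

lemma \<phi>_X: "s \<in> X \<Longrightarrow> \<phi> x b s \<in> X"
  using U_data(2)[OF x] S_data(2)[OF b] by (auto simp: \<phi>_def)

lemma \<phi>S_X: "s \<in> X \<Longrightarrow> \<phi>S b s \<in> X"
  using S_data(2)[OF b] by auto

lemma unitary_W: "s \<in> X \<Longrightarrow> unitary (W x b s)"
  unfolding W_def by (intro unitary_comp unitary_WU unitary_WS x b \<phi>S_X)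

lemma P_isometry: "P x b \<in> bounded_ops L"
  "f \<in> hcarrier L \<Longrightarrow> g \<in> hcarrier L \<Longrightarrow> hinner L (P x b f) (P x b g) = hinner L f g"
proof -
  have u: "WU x s \<in> Bd" "\<And>y z. y \<in> V \<Longrightarrow> z \<in> V \<Longrightarrow> ip (WU x s y) (WU x s z) = ip y z" if "s \<in> X" for s
    using unitary_WU[OF x that] by (auto simp: unitary_def)
  have v: "WS b s \<in> Bd" "\<And>y z. y \<in> V \<Longrightarrow> z \<in> V \<Longrightarrow> ip (WS b s y) (WS b s z) = ip y z" if "s \<in> X" for s
    using unitary_WS[OF b that] by (auto simp: unitary_def)
  have 1: "basis_op X H (\<phi>U x) (WU x) \<in> bounded_ops L" by (rule basis_op_isometry(1)[OF U_data(1,2)[OF x] u])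
  have 2: "basis_op X H (\<phi>S b) (WS b) \<in> bounded_ops L" by (rule basis_op_isometry(1)[OF S_data(1,2)[OF b] v])
  show "P x b \<in> bounded_ops L" unfolding P_eq by (rule L.bd_comp[OF 1 2])
  have "hinner L (P x b f) (P x b g) = hinner L (basis_op X H (\<phi>S b) (WS b) f) (basis_op X H (\<phi>S b) (WS b) g)"
    unfolding P_eq comp_apply by (rule basis_op_isometry(2)[OF U_data(1,2)[OF x] u L.bd_V'[OF 2] L.bd_V'[OF 2]])
  also have "\<dots> = hinner L f g" if "f \<in> hcarrier L" "g \<in> hcarrier L"
    by (rule basis_op_isometry(2)[OF S_data(1,2)[OF b] v that])
  finally show "hinner L (P x b f) (P x b g) = hinner L f g" if "f \<in> hcarrier L" "g \<in> hcarrier L"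
    using that by blast
qed

lemma P_apply: "f \<in> hcarrier L \<Longrightarrow> s \<in> X \<Longrightarrow> P x b f (\<phi> x b s) = W x b s (f s)"
proof -
  assume f: "f \<in> hcarrier L" and s: "s \<in> X"
  have v: "WS b s \<in> Bd" "\<And>y z. y \<in> V \<Longrightarrow> z \<in> V \<Longrightarrow> ip (WS b s y) (WS b s z) = ip y z" if "s \<in> X" for s
    using unitary_WS[OF b that] by (auto simp: unitary_def)
  have "basis_op X H (\<phi>S b) (WS b) f \<in> hcarrier L"
    by (rule L.bd_V'[OF basis_op_isometry(1)[OF S_data(1,2)[OF b] v]])
  then show ?thesis unfolding P_eq \<phi>_def W_def comp_apply
    using basis_op_apply[OF _ U_data(1)[OF x] \<phi>S_X[OF s]] basis_op_apply[OF f S_data(1)[OF b] s] by simp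
qed

lemma P_off: "r \<notin> \<phi> x b ` X \<Longrightarrow> f \<in> hcarrier L \<Longrightarrow> P x b f r = 0"
proof -
  assume r: "r \<notin> \<phi> x b ` X" and f: "f \<in> hcarrier L"
  have v: "WS b s \<in> Bd" "\<And>y z. y \<in> V \<Longrightarrow> z \<in> V \<Longrightarrow> ip (WS b s y) (WS b s z) = ip y z" if "s \<in> X" for s
    using unitary_WS[OF b that] by (auto simp: unitary_def)
  let ?g = "basis_op X H (\<phi>S b) (WS b) f"
  have g: "?g \<in> hcarrier L"
    by (rule L.bd_V'[OF basis_op_isometry(1)[OF S_data(1,2)[OF b] v]])
  show ?thesis
  proof (cases "r \<in> \<phi>U x ` X")
    case False then show ?thesis by (simp add: P_eq basis_op_apply_off)
  next
    case True
    then obtain s' where s': "s' \<in> X" "r = \<phi>U x s'" by auto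
    have "s' \<notin> \<phi>S b ` X" using r s' by (auto simp: \<phi>_def)
    then have "?g s' = 0" by (rule basis_op_apply_off)
    then show ?thesis unfolding P_eq comp_apply s'(2) basis_op_apply[OF g U_data(1)[OF x] s'(1)]
      using unitary_WU[OF x s'(1)] by (simp add: unitary_def bd_0)
  qed
qed

lemma \<phi>_inj: "inj_on (\<phi> x b) X"
  using comp_inj_on[OF S_data(1)[OF b] inj_on_subset[OF U_data(1)[OF x] S_data(2)[OF b]]] by (simp add: \<phi>_def[abs_def] o_def)

lemma P_basis_vec: assumes s: "s \<in> X" and \<xi>: "\<xi> \<in> V"
  shows "P x b (basis_vec s \<xi>) = basis_vec (\<phi> x b s) (W x b s \<xi>)"
proof
  fix r
  show "P x b (basis_vec s \<xi>) r = basis_vec (\<phi> x b s) (W x b s \<xi>) r"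
  proof (cases "r \<in> \<phi> x b ` X")
    case True
    then obtain s' where s': "s' \<in> X" "r = \<phi> x b s'" by auto
    have "W x b s' \<in> Bd" using unitary_W[OF s'(1)] by (simp add: unitary_def)
    then show ?thesis using P_apply[OF basis_vec_L[OF s \<xi>] s'(1)] s' inj_onD[OF \<phi>_inj _ s'(1) s]
      by (auto simp: basis_vec_def bd_0)
  next
    case False
    then show ?thesis using P_off[OF False basis_vec_L[OF s \<xi>]] s by (auto simp: basis_vec_def)
  qed
qed

text \<open>An operator commuting with \<open>P\<close> and \<open>P\<^sup>*\<close> preserves the range of \<open>P\<close> and its complement.\<close>

context
  fixes T assumes T: "T \<in> bounded_ops L" "T \<circ> P x b = P x b \<circ> T" "T \<circ> adjoint_op L (P x b) = adjoint_op L (P x b) \<circ> T"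
begin

lemma range_preserved:
  assumes f: "f \<in> hcarrier L" "\<And>r. r \<notin> \<phi> x b ` X \<Longrightarrow> f r = 0" and r: "r \<notin> \<phi> x b ` X" shows "T f r = 0"
proof -
  let ?P = "P x b" and ?Q = "adjoint_op L (P x b)"
  have B: "?P \<in> bounded_ops L" "?Q \<in> bounded_ops L" using P_isometry(1) by simp_all
  have QP: "?Q (?P g) = g" if "g \<in> hcarrier L" for g
    using L.isometry_adj[OF P_isometry(1) P_isometry(2)] that by (metis L.id_op_apply comp_apply)
  define k where "k = f - ?P (?Q f)"
  have k: "k \<in> hcarrier L" using f B by (simp add: k_def)
  have Qk: "?Q k = 0" using f B QP[of "?Q f"] by (simp add: k_def L.bd_diff zero_fun_def)
  have "k = 0"
  proof (rule L_eq_if_basis[OF k])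
    fix r assume "r \<in> X"
    show "k r = 0 r"
    proof (cases "r \<in> \<phi> x b ` X")
      case True
      then obtain s where s: "s \<in> X" "r = \<phi> x b s" by auto
      have "k r = 0"
      proof (rule unitary_orthogonal[OF unitary_W[OF s(1)] L_V[OF k]])
        fix \<xi> assume \<xi>: "\<xi> \<in> V"
        have w: "W x b s \<xi> \<in> V" using unitary_W[OF s(1)] by (simp add: unitary_def)
        have "ip (k r) (W x b s \<xi>) = hinner L k (?P (basis_vec s \<xi>))"
          using ip_basis_vec_right[OF \<phi>_X[OF s(1)] w k] s P_basis_vec[OF s(1) \<xi>] by simp
        also have "\<dots> = hinner L (?Q k) (basis_vec s \<xi>)" using L.adj_ip'[OF B(1) k] s \<xi> by simp
        finally show "ip (k r) (W x b s \<xi>) = 0" using Qk s \<xi> by simp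
      qed
      then show ?thesis by simp
    next
      case False
      then show ?thesis using f(2)[OF False] P_off[OF False, of "?Q f"] B by (simp add: k_def op_apply)
    qed
  qed simp
  then have "f = ?P (?Q f)" by (simp add: k_def)
  then have "T f = ?P (T (?Q f))" using T(2) by (metis comp_apply)
  then show ?thesis using P_off[OF r, of "T (?Q f)"] T(1) by simp
qed

lemma complement_preserved:
  assumes f: "f \<in> hcarrier L" "\<And>s. s \<in> X \<Longrightarrow> f (\<phi> x b s) = 0" and s: "s \<in> X" shows "T f (\<phi> x b s) = 0"
proof -
  let ?P = "P x b" and ?Q = "adjoint_op L (P x b)"
  have B: "?P \<in> bounded_ops L" "?Q \<in> bounded_ops L" using P_isometry(1) by simp_all
  have key: "ip \<xi> (?Q g s) = ip (W x b s \<xi>) (g (\<phi> x b s))" if "g \<in> hcarrier L" "\<xi> \<in> V" "s \<in> X" for g \<xi> s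
  proof -
    have w: "W x b s \<xi> \<in> V" using unitary_W[OF that(3)] by (simp add: unitary_def)
    have "ip \<xi> (?Q g s) = hinner L (basis_vec s \<xi>) (?Q g)" using ip_basis_vec_left[OF that(3,2)] that B by simp
    also have "\<dots> = hinner L (?P (basis_vec s \<xi>)) g" using L.adj_ip[OF B(1)] that by simp
    also have "\<dots> = ip (W x b s \<xi>) (g (\<phi> x b s))"
      using ip_basis_vec_left[OF \<phi>_X[OF that(3)] w that(1)] P_basis_vec[OF that(3,2)] by simp
    finally show ?thesis .
  qed
  have Qf: "?Q f = 0"
  proof (rule L_eq_if_basis)
    fix s assume s: "s \<in> X"
    have v: "?Q f s \<in> V" using L_V B by simp
    have "ip (?Q f s) (?Q f s) = 0" using key[OF f(1) v s] f(2)[OF s] unitary_W[OF s] by (simp add: unitary_def)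
    then show "?Q f s = 0 s" using ip_eq_0[OF v] by simp
  qed (use B in auto)
  have "?Q (T f) = T (?Q f)" using T(3) by (metis comp_apply)
  then have QT: "?Q (T f) = 0" using Qf L.bd_0[OF T(1)] by simp
  have Tf: "T f \<in> hcarrier L" using T by simp
  show ?thesis
  proof (rule unitary_orthogonal[OF unitary_W[OF s] L_V[OF Tf]])
    fix \<xi> assume \<xi>: "\<xi> \<in> V"
    have w: "W x b s \<xi> \<in> V" using unitary_W[OF s] by (simp add: unitary_def)
    have "ip (W x b s \<xi>) (T f (\<phi> x b s)) = 0" using key[OF Tf \<xi> s] QT \<xi> by simp
    then show "ip (T f (\<phi> x b s)) (W x b s \<xi>) = 0" using ip_commute[OF w L_V[OF Tf]] by simp
  qed
qed

lemma entry_transport: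
  assumes s: "s \<in> X" and \<xi>: "\<xi> \<in> V"
  shows "entry T (\<phi> x b s) (\<phi> x b s) (W x b s \<xi>) = W x b s (entry T s s \<xi>)"
proof -
  have "T (P x b (basis_vec s \<xi>)) (\<phi> x b s) = P x b (T (basis_vec s \<xi>)) (\<phi> x b s)" using T(2) by (metis comp_apply)
  then show ?thesis using P_basis_vec[OF s \<xi>] P_apply[OF _ s, of "T (basis_vec s \<xi>)"] T(1) by (simp add: entry_app)
qed

end

end

subsection \<open>Separation of the basis\<close>

text \<open>
  The image of \<open>(c, y)\<close> is the ideal \<open>dc\<close> with a representative of \<open>x + dy\<close>; conversely \<open>d\<inverse>I\<close> is again an
  integral ideal of the class.
\<close>

lemma \<phi>_range_iff:
  assumes x: "x \<in> R" and d: "d \<in> RR" and s: "(I, z) \<in> X"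
  shows "(I, z) \<in> \<phi> x d ` X \<longleftrightarrow> I \<subseteq> smult_set d R \<and> z - x \<in> smult_set d R"
proof -
  have dR: "d \<in> R" "d \<in> KR" "d \<noteq> 0" using d KR_nonzero by (auto simp: RR_iff)
  note f = X_facts[OF s]
  have J: "idl (smult_set d R)" using idl_smult[OF idl_R dR(1)] .
  show ?thesis
  proof
    assume "(I, z) \<in> \<phi> x d ` X"
    then obtain c y where cy: "(c, y) \<in> X" "(I, z) = \<phi> x d (c, y)" by auto
    define y' where "y' = bar rep I (d * y)"
    have I: "I = smult_set d c" and z: "z = bar rep I (x + y')" using cy(2) by (auto simp: \<phi>_def \<phi>U_def \<phi>S_def y'_def)
    note g = X_facts[OF cy(1)]
    have sub: "I \<subseteq> smult_set d R" using g(2) unfolding I smult_set_def by blast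
    have y'R: "y' \<in> R" "d * y - y' \<in> I" using bar_facts[OF f(1,2), of "d * y"] dR g(4) by (auto simp: y'_def)
    have "x + y' - z \<in> I" using bar_facts(2)[OF f(1,2), of "x + y'"] x y'R by (simp add: z)
    then have "d * y - ((d * y - y') + (x + y' - z)) \<in> smult_set d R"
      using sub y'R g(4) idl_diff[OF J] idlD(3)[OF J] by (metis smult_iff subsetD)
    then show "I \<subseteq> smult_set d R \<and> z - x \<in> smult_set d R" using sub by (simp add: algebra_simps)
  next
    assume a: "I \<subseteq> smult_set d R \<and> z - x \<in> smult_set d R"
    then obtain r where r: "r \<in> R" "z - x = d * r" by (auto simp: smult_iff)
    define c where "c = smult_set (inverse d) I"
    have cI: "smult_set d c = I" using dR by (simp add: c_def smult_smult)
    have ck: "c \<in> \<kk>" unfolding c_def by (rule ray_class_smult[OF kk f(1) KR_inverse[OF dR(2)]])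
    have cR: "c \<subseteq> R"
    proof
      fix w assume "w \<in> c"
      then obtain v where "v \<in> I" "w = inverse d * v" by (auto simp: c_def smult_iff)
      moreover from this obtain q where "q \<in> R" "v = d * q" using a smult_iff[of v d R] by blast
      ultimately show "w \<in> R" using dR by (simp flip: mult.assoc)
    qed
    define y where "y = bar rep c r"
    have y: "y \<in> rep c" "r - y \<in> c" "y \<in> R" using bar_facts[OF ck cR r(1)] by (auto simp: y_def)
    have cy: "(c, y) \<in> X" using ck cR y by (simp add: X_iff)
    define y' where "y' = bar rep I (d * y)"
    have y'R: "y' \<in> R" "d * y - y' \<in> I" using bar_facts[OF f(1,2), of "d * y"] dR y by (auto simp: y'_def)
    have "d * (r - y) \<in> I" using y(2) cI by (metis smult_iff)
    then have "(d * y - y') + d * (r - y) \<in> I" using idlD(3)[OF f(5) y'R(2)] by blast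
    then have "- ((d * y - y') + d * (r - y)) \<in> I" by (rule idl_minus[OF f(5)])
    moreover have "- ((d * y - y') + d * (r - y)) = x + y' - z" using r(2) by (simp add: algebra_simps)
    ultimately have "x + y' - z \<in> I" by (simp only:)
    then have "bar rep I (x + y') = z" using x y'R f by (intro bar_eqI) auto
    then have "\<phi> x d (c, y) = (I, z)" by (simp add: \<phi>_def \<phi>U_def \<phi>S_def cI y'_def)
    then show "(I, z) \<in> \<phi> x d ` X" using cy by (metis imageI)
  qed
qed

lemma \<phi>0:
  assumes e: "e \<in> RR" and s: "(c, y) \<in> X"
  shows "\<phi> 0 e (c, y) = (smult_set e c, bar rep (smult_set e c) (e * y))"
    "(smult_set e c, bar rep (smult_set e c) (e * y)) \<in> X" "e * y - bar rep (smult_set e c) (e * y) \<in> smult_set e c"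
proof -
  note f = X_facts[OF s]
  have eR: "e \<in> R" using e by (simp add: RR_iff)
  have l: "smult_set e c \<in> \<kk>" "smult_set e c \<subseteq> R" "e * y \<in> R" using smult_class[OF e f(1,2)] eR f(4) by auto
  note bf = bar_facts[OF l]
  show 2: "(smult_set e c, bar rep (smult_set e c) (e * y)) \<in> X" using l bf by (simp add: X_iff)
  show "e * y - bar rep (smult_set e c) (e * y) \<in> smult_set e c" by (rule bf(2))
  have "bar rep (smult_set e c) (bar rep (smult_set e c) (e * y)) = bar rep (smult_set e c) (e * y)"
    by (rule bar_eqI[OF l(1,2) bf(3,1)]) (simp add: idlD(2)[OF X_facts(5)[OF 2]])
  then show "\<phi> 0 e (c, y) = (smult_set e c, bar rep (smult_set e c) (e * y))" by (simp add: \<phi>_def \<phi>U_def \<phi>S_def)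
qed

text \<open>
  The preimages under \<open>\<phi>(0,e)\<close> of the ranges of the \<open>\<phi>(x,d)\<close> separate the points of \<open>X\<close>.
\<close>

lemma separation:
  assumes s: "s \<in> X" "s' \<in> X" "s \<noteq> s'"
  shows "\<exists>e\<in>RR. \<exists>d\<in>RR. \<exists>x\<in>R. (\<phi> 0 e s \<in> \<phi> x d ` X) \<noteq> (\<phi> 0 e s' \<in> \<phi> x d ` X)"
proof -
  obtain c y c' y' where sc: "s = (c, y)" "s' = (c', y')" by (cases s, cases s')
  have crit: "\<phi> 0 e (c, y) \<in> \<phi> x d ` X \<longleftrightarrow> (\<forall>v\<in>c. e * v \<in> smult_set d R) \<and> e * y - x \<in> smult_set d R"
    if e: "e \<in> RR" and d: "d \<in> RR" and x: "x \<in> R" and s: "(c, y) \<in> X" for e d x c y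
  proof -
    let ?z = "bar rep (smult_set e c) (e * y)"
    have J: "idl (smult_set d R)" using idl_smult[OF idl_R] d by (simp add: RR_iff)
    note p = \<phi>0[OF e s]
    have "smult_set e c \<subseteq> smult_set d R \<longleftrightarrow> (\<forall>v\<in>c. e * v \<in> smult_set d R)" by (auto simp: smult_set_def)
    moreover have "?z - x \<in> smult_set d R \<longleftrightarrow> e * y - x \<in> smult_set d R" if sub: "smult_set e c \<subseteq> smult_set d R"
    proof -
      have k: "e * y - ?z \<in> smult_set d R" using p(3) sub by blast
      show ?thesis using idlD(3)[OF J _ k, of "?z - x"] idl_diff[OF J _ k, of "e * y - x"] by (auto simp: algebra_simps)
    qed
    ultimately show ?thesis unfolding p(1) using \<phi>_range_iff[OF x d p(2)] by auto
  qed
  have half: "\<exists>e\<in>RR. \<exists>d\<in>RR. \<exists>x\<in>R. (\<phi> 0 e (c, y) \<in> \<phi> x d ` X) \<noteq> (\<phi> 0 e (c', y') \<in> \<phi> x d ` X)"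
    if s: "(c, y) \<in> X" "(c', y') \<in> X" and u: "u \<in> R" "u \<notin> c" and uc: "u \<in> c' \<or> u = y' - y" for c y c' y' u
  proof -
    note f = X_facts[OF s(1)]
    obtain e d where ed: "e \<in> RR" "d \<in> RR" "\<And>v. v \<in> c \<Longrightarrow> e * v \<in> smult_set d R" "e * u \<notin> smult_set d R"
      using ray_separation[OF f(5,6) ray_class_integral(3)[OF kk f(1,2)] u] by blast
    have eR: "e \<in> R" "d \<in> R" using ed by (auto simp: RR_iff)
    have x: "e * y \<in> R" using eR f(4) by simp
    have "e * y - e * y \<in> smult_set d R" using idlD(2)[OF idl_smult[OF idl_R eR(2)]] by simp
    then have "\<phi> 0 e (c, y) \<in> \<phi> (e * y) d ` X" using crit[OF ed(1,2) x s(1)] ed(3) by blast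
    moreover have "\<phi> 0 e (c', y') \<notin> \<phi> (e * y) d ` X"
      using crit[OF ed(1,2) x s(2)] ed(4) uc by (auto simp: right_diff_distrib)
    ultimately show ?thesis using ed(1,2) x by blast
  qed
  have sX: "(c, y) \<in> X" "(c', y') \<in> X" using s sc by auto
  note f = X_facts[OF sX(1)] and f' = X_facts[OF sX(2)]
  show ?thesis
  proof (cases "c = c'")
    case True
    have "y' - y \<notin> c"
    proof
      assume "y' - y \<in> c"
      then have "bar rep c y' = y" by (rule bar_eqI[OF f(1,2) f'(4) f(3)])
      moreover have "bar rep c y' = y'" using True f' by (intro bar_eqI) (auto simp: idlD(2)[OF f(5)])
      ultimately show False using True s(3) sc by simp
    qed
    then show ?thesis using half[OF sX, of "y' - y"] f(4) f'(4) sc by simp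
  next
    case False
    then consider u where "u \<in> c'" "u \<notin> c" | u where "u \<in> c" "u \<notin> c'" by blast
    then show ?thesis
    proof cases
      case 1 then show ?thesis using half[OF sX, of u] idlD(1)[OF f'(5)] sc by blast
    next
      case 2 then show ?thesis using half[OF sX(2,1), of u] idlD(1)[OF f(5)] sc by blast
    qed
  qed
qed

subsection \<open>The commutant\<close>

definition commuting :: "(('k set \<times> 'k \<Rightarrow> 'h) \<Rightarrow> 'k set \<times> 'k \<Rightarrow> 'h) \<Rightarrow> bool" where
  "commuting T \<longleftrightarrow> T \<in> bounded_ops L \<and> (\<forall>x\<in>R. \<forall>b\<in>RR. T \<circ> P x b = P x b \<circ> T \<and> T \<circ> adjoint_op L (P x b) = adjoint_op L (P x b) \<circ> T)"

lemma commutingD: assumes "commuting T" "x \<in> R" "b \<in> RR"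
  shows "T \<in> bounded_ops L" "T \<circ> P x b = P x b \<circ> T" "T \<circ> adjoint_op L (P x b) = adjoint_op L (P x b) \<circ> T"
  using assms by (auto simp: commuting_def)

text \<open>
  \<open>P 0 e\<close> moves \<open>s\<close> and \<open>s'\<close> to points of which only one belongs to the range of \<open>\<phi> x d\<close>, and \<open>T\<close> preserves
  both the range of \<open>P x d\<close> and its complement.
\<close>

lemma commuting_diagonal:
  assumes T: "commuting T" and s: "s \<in> X" "s' \<in> X" "s \<noteq> s'" and \<xi>: "\<xi> \<in> V"
  shows "T (basis_vec s \<xi>) s' = 0"
proof -
  obtain e d x where ed: "e \<in> RR" "d \<in> RR" "x \<in> R" and sep: "(\<phi> 0 e s \<in> \<phi> x d ` X) \<noteq> (\<phi> 0 e s' \<in> \<phi> x d ` X)"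
    using separation[OF s] by blast
  note De = commutingD[OF T R_0 ed(1)] and Dd = commutingD[OF T ed(3,2)]
  let ?f = "P 0 e (basis_vec s \<xi>)"
  have b: "basis_vec s \<xi> \<in> hcarrier L" using s \<xi> by simp
  have fL: "?f \<in> hcarrier L" using P_isometry(1)[OF R_0 ed(1)] by simp
  have fv: "?f r = 0" if "r \<noteq> \<phi> 0 e s" for r
    using P_basis_vec[OF R_0 ed(1) s(1) \<xi>] that by (simp add: basis_vec_def)
  have "T ?f (\<phi> 0 e s') = 0"
  proof (cases "\<phi> 0 e s \<in> \<phi> x d ` X")
    case True
    then have n: "\<phi> 0 e s' \<notin> \<phi> x d ` X" using sep by simp
    show ?thesis by (rule range_preserved[OF ed(3,2) Dd fL _ n]) (use fv True in metis)
  next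
    case False
    then obtain r where r: "r \<in> X" "\<phi> 0 e s' = \<phi> x d r" using sep by auto
    show ?thesis unfolding r(2)
      by (rule complement_preserved[OF ed(3,2) Dd fL _ r(1)]) (use fv False in \<open>metis imageI\<close>)
  qed
  moreover have "T ?f = P 0 e (T (basis_vec s \<xi>))" using De(2) by (metis comp_apply)
  ultimately have "W 0 e s' (T (basis_vec s \<xi>) s') = 0"
    using P_apply[OF R_0 ed(1) L.bd_V'[OF De(1)] s(2)] by simp
  then show ?thesis using unitary_inj0[OF unitary_W[OF R_0 ed(1) s(2)]] L_V[OF L.bd_V'[OF De(1)]] by blast
qed

lemma smult_unit: assumes u: "u \<in> RU" and c: "idl c" shows "smult_set u c = c"
proof
  show "smult_set u c \<subseteq> c" using idlD(4)[OF c RU_facts(1)[OF u]] by (auto simp: smult_iff)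
  show "c \<subseteq> smult_set u c"
  proof
    fix z assume "z \<in> c"
    then have "inverse u * z \<in> c" "z = u * (inverse u * z)" using idlD(4)[OF c RU_facts(1)[OF RU_facts(4)[OF u]]] RU_facts(3)[OF u] by (auto simp flip: mult.assoc)
    then show "z \<in> smult_set u c" unfolding smult_iff by blast
  qed
qed

text \<open>
  The elements of the semigroup fixing a point of \<open>X\<close> act there through \<open>\<sigma>\<close>; the translations by
  \<open>c\<close> and the units, corrected by a translation, generate all of the group.
\<close>

lemma entry_commutes:
  assumes T: "commuting T" and s: "s \<in> X" and g: "g \<in> carrier Gp" and \<xi>: "\<xi> \<in> V"
  shows "entry T s s (\<sigma> g \<xi>) = \<sigma> g (entry T s s \<xi>)"
proof -
  obtain c y where sc: "s = (c, y)" by (cases s)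
  have cy: "(c, y) \<in> X" using s sc by simp
  note f = X_facts[OF cy]
  obtain n u where g': "g = (n, u)" "n \<in> ak" "u \<in> RU" using g by (auto simp: Gp_simps)
  have tc: "t c \<noteq> 0" using KR_nonzero[OF t(1)[OF f(1)]] .
  have bary: "bar rep c y = y" by (rule bar_eqI[OF f(1,2,4,3)]) (simp add: idlD(2)[OF f(5)])
  have TB: "T \<in> bounded_ops L" using T by (simp add: commuting_def)
  have one: "entry T s s (\<sigma> (n, 1) \<xi>) = \<sigma> (n, 1) (entry T s s \<xi>)" if \<xi>: "\<xi> \<in> V" for \<xi>
  proof -
    obtain x where x: "x \<in> c" "n = t c * x" using t(2)[OF f(1)] g'(2) by (metis smult_iff)
    have xR: "x \<in> R" using idlD(1)[OF f(5) x(1)] .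
    have b1: "bar rep c (x + y) = y" using x f xR by (intro bar_eqI) auto
    have ph: "\<phi> x 1 s = s" by (simp add: sc \<phi>_def \<phi>U_def \<phi>S_def bary b1)
    have "WS 1 s = id_op H" using Gr.\<sigma>_one tc by (simp add: sc WS_def bary Gp_simps)
    moreover have "\<phi>S 1 s = s" by (simp add: sc \<phi>S_def bary)
    moreover have "WU x s = \<sigma> (n, 1)" using x by (simp add: sc WU_def b1)
    moreover have "\<sigma> (n, 1) \<in> Bd" using g'(2) RU_facts(6) by (intro Gr.\<sigma>_bd) (simp add: Gp_simps)
    ultimately have "W x 1 s = \<sigma> (n, 1)" by (simp add: W_def)
    then show ?thesis using entry_transport[OF xR RR_1 commutingD[OF T xR RR_1] s \<xi>] ph by simp
  qed
  have two: "entry T s s (\<sigma> (0, u) \<xi>) = \<sigma> (0, u) (entry T s s \<xi>)"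
  proof -
    have u: "u \<in> RR" "u \<in> R" using RU_facts g'(3) by auto
    have uc: "smult_set u c = c" by (rule smult_unit[OF g'(3) f(5)])
    define z where "z = bar rep c (u * y)"
    have z: "z \<in> rep c" "u * y - z \<in> c" "z \<in> R" using bar_facts[OF f(1,2), of "u * y"] u f(4) by (auto simp: z_def)
    \<comment> \<open>Chosen such that \<open>x + uy = y\<close>, so that \<open>(x, u)\<close> fixes the point \<open>(c, y)\<close>.\<close>
    define x where "x = y - u * y"
    have xR: "x \<in> R" using u f(4) by (simp add: x_def)
    have zc: "x + z - y \<in> c" using idl_minus[OF f(5) z(2)] by (simp add: x_def)
    have b1: "bar rep c (x + z) = y" using xR z(3) f zc by (intro bar_eqI) auto
    have ph: "\<phi> x u s = s" by (simp add: sc \<phi>_def \<phi>U_def \<phi>S_def uc b1 flip: z_def)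
    have 1: "(t c * (x + z - y), 1) \<in> carrier Gp" "(t c * (u * y - z), u) \<in> carrier Gp"
      using t_mult[OF f(1)] zc z(2) g'(3) RU_facts(6) by (auto simp: Gp_simps)
    have ut: "u * inverse (t c) * t c = u" using tc by (simp add: mult.assoc)
    have "W x u s = \<sigma> (t c * (x + z - y), 1) \<circ> \<sigma> (t c * (u * y - z), u)"
      unfolding W_def sc \<phi>S_def WS_def WU_def prod.case uc b1 z_def[symmetric] ut ..
    also have "\<dots> = \<sigma> ((t c * (x + z - y), 1) \<otimes>\<^bsub>Gp\<^esub> (t c * (u * y - z), u))" by (rule Gr.\<sigma>_mult[OF 1, symmetric])
    also have "\<dots> = \<sigma> (0, u)" by (simp add: Gp_simps x_def algebra_simps)
    finally show ?thesis using entry_transport[OF xR u(1) commutingD[OF T xR u(1)] s \<xi>] ph by simp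
  qed
  have gs: "\<sigma> g = \<sigma> (n, 1) \<circ> \<sigma> (0, u)"
    using Gr.\<sigma>_mult[of "(n, 1)" "(0, u)"] g' RU_facts(6) idlD(2)[OF ak_idl(1)] by (simp add: Gp_simps)
  have "\<sigma> (0, u) \<xi> \<in> V" using g'(3) idlD(2)[OF ak_idl(1)] by (intro bd_V' Gr.\<sigma>_bd) (simp add: Gp_simps)
  then show ?thesis using one two by (simp add: gs)
qed

lemma W_commutes:
  assumes x: "x \<in> R" and b: "b \<in> RR" and s: "s \<in> X" and T0: "T0 \<in> Bd" and comm: "\<And>g \<xi>. g \<in> carrier Gp \<Longrightarrow> \<xi> \<in> V \<Longrightarrow> T0 (\<sigma> g \<xi>) = \<sigma> g (T0 \<xi>)"
    and \<xi>: "\<xi> \<in> V"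
  shows "T0 (W x b s \<xi>) = W x b s (T0 \<xi>)"
proof -
  obtain c y where sc: "s = (c, y)" by (cases s)
  obtain g where g: "g \<in> carrier Gp" "WS b s = \<sigma> g" using S_data(3)[OF b] s sc by (auto simp: WS_def)
  obtain c' y' where sc': "\<phi>S b s = (c', y')" by (cases "\<phi>S b s")
  obtain g' where g': "g' \<in> carrier Gp" "WU x (\<phi>S b s) = \<sigma> g'" using U_data(3)[OF x] \<phi>S_X[OF x b s] sc' by (auto simp: WU_def)
  have "\<sigma> g \<xi> \<in> V" using g(1) by simp
  then show ?thesis using comm g g' \<xi> by (simp add: W_def)
qed

text \<open>
  Entries are carried along by \<open>\<phi> x b\<close>, where the unitaries cancel. For ideals \<open>c\<close> and \<open>c'\<close> of the class,
  \<open>ac = bc'\<close> for some \<open>a\<close> and \<open>b\<close> in the ray semigroup, so any two points have a common image.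
\<close>

lemma entry_constant:
  assumes T: "commuting T" and s: "s \<in> X" "s' \<in> X" shows "entry T s s = entry T s' s'"
proof -
  have TB: "T \<in> bounded_ops L" using T by (simp add: commuting_def)
  have step: "entry T (\<phi> x b s) (\<phi> x b s) = entry T s s" if x: "x \<in> R" and b: "b \<in> RR" and s: "s \<in> X" for x b s
  proof (rule bd_eqI)
    show "entry T (\<phi> x b s) (\<phi> x b s) \<in> Bd" "entry T s s \<in> Bd" using TB s \<phi>_X[OF x b s] by auto
    fix \<eta> assume "\<eta> \<in> V"
    then obtain \<xi> where \<xi>: "\<xi> \<in> V" "W x b s \<xi> = \<eta>" using unitary_W[OF x b s] by (auto simp: unitary_def)
    have "entry T (\<phi> x b s) (\<phi> x b s) \<eta> = W x b s (entry T s s \<xi>)"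
      using entry_transport[OF x b commutingD[OF T x b] s \<xi>(1)] \<xi>(2) by simp
    also have "\<dots> = entry T s s \<eta>"
      using W_commutes[OF x b s _ entry_commutes[OF T s] \<xi>(1)] TB s \<xi>(2) by simp
    finally show "entry T (\<phi> x b s) (\<phi> x b s) \<eta> = entry T s s \<eta>" .
  qed
  obtain c y c' y' where sc: "s = (c, y)" "s' = (c', y')" by (cases s, cases s')
  have sX: "(c, y) \<in> X" "(c', y') \<in> X" using s sc by auto
  note f = X_facts[OF sX(1)] and f' = X_facts[OF sX(2)]
  have tK: "t c \<in> KR" "t c' \<in> KR" using t(1) f f' by auto
  obtain a b where ab: "a \<in> RR" "b \<in> RR" "t c * inverse (t c') = a / b"
    using KR_quotient[OF KR_mult[OF tK(1) KR_inverse[OF tK(2)]]] .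
  have b0: "b \<noteq> 0" using ab KR_nonzero by (auto simp: RR_iff)
  have "smult_set b c' = smult_set b (smult_set (inverse (t c')) (smult_set (t c') c'))"
    using KR_nonzero[OF tK(2)] by (simp add: smult_smult)
  also have "\<dots> = smult_set b (smult_set (inverse (t c')) (smult_set (t c) c))" using t(2)[OF f(1)] t(2)[OF f'(1)] by simp
  also have "\<dots> = smult_set (b * (t c * inverse (t c'))) c" by (simp add: smult_smult mult_ac)
  also have "\<dots> = smult_set a c" using ab(3) b0 by simp
  finally have same: "smult_set b c' = smult_set a c" .
  define z where "z = bar rep (smult_set a c) (a * y)"
  define z' where "z' = bar rep (smult_set a c) (b * y')"
  note p = \<phi>0[OF ab(1) sX(1), folded z_def] and p' = \<phi>0[OF ab(2) sX(2), unfolded same, folded z'_def]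
  note zf = X_facts[OF p(2)] and zf' = X_facts[OF p'(2)]
  have xR: "z - z' \<in> R" using zf(4) zf'(4) by simp
  have "bar rep (smult_set a c) (z - z' + z') = z" using zf by (intro bar_eqI) (auto simp: idlD(2))
  then have "\<phi> (z - z') b (c', y') = (smult_set a c, z)" by (simp add: \<phi>_def \<phi>U_def \<phi>S_def same flip: z'_def)
  then have "\<phi> (z - z') b s' = \<phi> 0 a s" using p(1) sc by simp
  then show ?thesis using step[OF R_0 ab(1) s(1)] step[OF xR ab(2) s(2)] by simp
qed

abbreviation "N' \<equiv> commutant H (\<pi>\<^sub>0 ` acarrier (full_cstar Gp))"

lemma commuting_iff: "commuting T \<longleftrightarrow> T \<in> amp ` N'"
proof
  assume T: "commuting T"
  have TB: "T \<in> bounded_ops L" using T by (simp add: commuting_def)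
  obtain s where s: "s \<in> X" using X_nonempty by auto
  have eB: "entry T s s \<in> Bd" using TB s by simp
  have "T = amp (entry T s s)"
  proof (rule eq_if_entries[OF TB amp_bd[OF eB]])
    fix r q assume r: "r \<in> X" and q: "q \<in> X"
    show "entry T r q = entry (amp (entry T s s)) r q"
    proof (cases "r = q")
      case True then show ?thesis using entry_constant[OF T r s] eB r by (simp add: entry_amp)
    next
      case False
      have "entry T r q = (\<lambda>x. 0)"
        by (rule bd_eqI) (use TB r q commuting_diagonal[OF T q r] False in \<open>auto simp: entry_app\<close>)
      then show ?thesis using False eB r q by (simp add: entry_amp)
    qed
  qed
  moreover have "entry T s s \<in> N'" unfolding Gr.commutant_rep
  proof (intro CollectI conjI ballI eB)
    fix g assume g: "g \<in> carrier Gp"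
    show "entry T s s \<circ> \<sigma> g = \<sigma> g \<circ> entry T s s"
      by (rule bd_eqI) (use eB g entry_commutes[OF T s g] in auto)
  qed
  ultimately show "T \<in> amp ` N'" by blast
next
  assume "T \<in> amp ` N'"
  then obtain T0 where T0: "T0 \<in> N'" "T = amp T0" by auto
  have sub: "\<pi>\<^sub>0 ` acarrier (full_cstar Gp) \<subseteq> Bd" using rep_bd[OF \<pi>\<^sub>0] by auto
  have star: "adj a \<in> \<pi>\<^sub>0 ` acarrier (full_cstar Gp)" if "a \<in> \<pi>\<^sub>0 ` acarrier (full_cstar Gp)" for a
    using that Gr.astar_closed by (auto simp flip: rep_star[OF \<pi>\<^sub>0])
  have aT0: "adj T0 \<in> N'" by (rule commutant_adj[OF sub star T0(1)])
  have comm: "amp S \<circ> P x b = P x b \<circ> amp S" if S: "S \<in> N'" and x: "x \<in> R" and b: "b \<in> RR" for S x b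
  proof (rule bd_eq_if_basis)
    have SB: "S \<in> Bd" using S by (simp add: commutant_def)
    have PB: "P x b \<in> bounded_ops L" by (rule P_isometry(1)[OF x b])
    show "amp S \<circ> P x b \<in> bounded_ops L" "P x b \<circ> amp S \<in> bounded_ops L" using SB PB by simp_all
    fix s \<xi> assume s: "s \<in> X" and \<xi>: "\<xi> \<in> V"
    have "S (\<sigma> g \<eta>) = \<sigma> g (S \<eta>)" if "g \<in> carrier Gp" for g \<eta>
      using S that unfolding Gr.commutant_rep by (metis (mono_tags, lifting) comp_apply mem_Collect_eq)
    then have "S (W x b s \<xi>) = W x b s (S \<xi>)" by (intro W_commutes[OF x b s SB] \<xi>)
    moreover have "W x b s \<xi> \<in> V" using unitary_W[OF x b s] by (simp add: unitary_def)
    ultimately show "(amp S \<circ> P x b) (basis_vec s \<xi>) = (P x b \<circ> amp S) (basis_vec s \<xi>)"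
      using P_basis_vec[OF x b s] amp_basis_vec[OF SB s \<xi>] amp_basis_vec[OF SB \<phi>_X[OF x b s]] SB \<xi> by simp
  qed
  have T0B: "T0 \<in> Bd" using T0 by (simp add: commutant_def)
  have "amp T0 \<circ> adjoint_op L (P x b) = adjoint_op L (P x b) \<circ> amp T0" if x: "x \<in> R" and b: "b \<in> RR" for x b
  proof -
    have PB: "P x b \<in> bounded_ops L" by (rule P_isometry(1)[OF x b])
    have "adjoint_op L (amp (adj T0) \<circ> P x b) = adjoint_op L (P x b \<circ> amp (adj T0))" using comm[OF aT0 x b] by simp
    then show ?thesis using PB T0B by (simp add: L.adj_comp adj_amp)
  qed
  then show "commuting T" using comm[OF T0(1)] T0B T0(2) by (simp add: commuting_def)
qed

abbreviation "A \<equiv> reduced_cstar Sg"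

lemma Sg_simps: "carrier Sg = R \<times> RR" "(a, b) \<otimes>\<^bsub>Sg\<^esub> (c, d) = (a + b * c, b * d)"
  by (simp_all add: ray_semigroup_def affine_monoid_def int_ring_simps)

lemma left_regular_bd: "left_regular Sg ` carrier Sg \<subseteq> bounded_ops (ell2 (carrier Sg) complex_hilbert)"
proof clarify
  fix x b assume p: "(x, b) \<in> carrier Sg"
  interpret C: square_summable complex_hilbert "carrier Sg" by unfold_locales (rule hilbert_space_complex)
  have xb: "x \<in> R" "b \<in> RR" "b \<in> R" "b \<noteq> 0" using p KR_nonzero by (auto simp: Sg_simps RR_iff)
  show "left_regular Sg (x, b) \<in> bounded_ops (ell2 (carrier Sg) complex_hilbert)"
    unfolding left_regular_def
  proof (rule C.basis_op_isometry(1))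
    show "inj_on (\<lambda>q. (x, b) \<otimes>\<^bsub>Sg\<^esub> q) (carrier Sg)"
      by (rule inj_onI) (use xb in \<open>auto simp: Sg_simps\<close>)
    show "(\<lambda>q. (x, b) \<otimes>\<^bsub>Sg\<^esub> q) ` carrier Sg \<subseteq> carrier Sg"
      using xb RR_mult by (auto simp: Sg_simps)
    have "id = id_op complex_hilbert" by (auto simp: id_op_def complex_hilbert_def)
    then show "id \<in> bounded_ops complex_hilbert" using C.bd_id by metis
  qed simp
qed

lemma \<theta>_rep: "representation A L \<theta>"
  using \<theta> by (simp add: class_representation_def)

lemma A_star: "a \<in> acarrier A \<Longrightarrow> astar A a \<in> acarrier A"
proof -
  interpret C: square_summable complex_hilbert "carrier Sg" by unfold_locales (rule hilbert_space_complex)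
  assume "a \<in> acarrier A"
  then show ?thesis
    using C.L.op_cstar_subalgebra_facts(6)[OF C.L.op_cstar_generated_subalgebra[OF left_regular_bd]]
    unfolding reduced_cstar_def by (simp add: op_cstar_generated_def)
qed

text \<open>
  A representation of the reduced C*-algebra is continuous, so the generators decide.
\<close>

theorem commutant_\<theta>: "commutant L (\<theta> ` acarrier A) = amp ` N'"
proof -
  have gen: "left_regular Sg (x, b) \<in> acarrier A" if "x \<in> R" "b \<in> RR" for x b
    using that by (auto simp: reduced_cstar_def op_cstar_generated_def Sg_simps)
  have "commuting T" if T: "T \<in> commutant L (\<theta> ` acarrier A)" for T
    unfolding commuting_def
  proof (intro conjI ballI)
    show "T \<in> bounded_ops L" using T by (simp add: commutant_def)
    fix x b assume xb: "x \<in> R" "b \<in> RR"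
    show "T \<circ> P x b = P x b \<circ> T" using T gen[OF xb] by (auto simp: commutant_def P_def)
    have "\<theta> (astar A (left_regular Sg (x, b))) = adjoint_op L (P x b)" using L.rep_star[OF \<theta>_rep gen[OF xb]] by (simp add: P_def)
    then show "T \<circ> adjoint_op L (P x b) = adjoint_op L (P x b) \<circ> T"
      using T A_star[OF gen[OF xb]] unfolding commutant_def by (metis (mono_tags, lifting) imageI mem_Collect_eq)
  qed
  moreover have "T \<in> commutant L (\<theta> ` acarrier A)" if T: "commuting T" for T
  proof -
    interpret C: square_summable complex_hilbert "carrier Sg" by unfold_locales (rule hilbert_space_complex)
    have TB: "T \<in> bounded_ops L" using T by (simp add: commuting_def)
    let ?G = "left_regular Sg ` carrier Sg" and ?E = "ell2 (carrier Sg) complex_hilbert"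
    have A: "A = op_cstar_generated ?E ?G" by (rule reduced_cstar_def)
    have gens: "\<forall>g\<in>?G. T \<circ> \<theta> g = \<theta> g \<circ> T \<and> T \<circ> adjoint_op L (\<theta> g) = adjoint_op L (\<theta> g) \<circ> T"
    proof clarify
      fix x b assume "(x, b) \<in> carrier Sg"
      then have xb: "x \<in> R" "b \<in> RR" by (auto simp: Sg_simps)
      show "T \<circ> \<theta> (left_regular Sg (x, b)) = \<theta> (left_regular Sg (x, b)) \<circ> T \<and>
          T \<circ> adjoint_op L (\<theta> (left_regular Sg (x, b))) = adjoint_op L (\<theta> (left_regular Sg (x, b))) \<circ> T"
        using commutingD[OF T xb] unfolding P_def by blast
    qed
    have "T \<circ> \<theta> a = \<theta> a \<circ> T" if a: "a \<in> acarrier A" for a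
    proof (rule L.commutes_if_commutes_generators[OF C.L.hilbert_axioms left_regular_bd \<theta>_rep[unfolded A] TB _ a[unfolded A]])
      show "T \<circ> \<theta> g = \<theta> g \<circ> T \<and> T \<circ> adjoint_op L (\<theta> g) = adjoint_op L (\<theta> g) \<circ> T" if "g \<in> ?G" for g
        by (rule bspec[OF gens that])
    qed
    then show ?thesis using TB by (auto simp: commutant_def)
  qed
  ultimately show ?thesis using commuting_iff by blast
qed

subsection \<open>The generated von Neumann algebra\<close>

abbreviation "NN \<equiv> bicommutant H (\<pi>\<^sub>0 ` acarrier (full_cstar Gp))"
abbreviation "MM \<equiv> bicommutant L (\<theta> ` acarrier A)"

lemma \<pi>\<^sub>0_image: "\<pi>\<^sub>0 ` acarrier (full_cstar Gp) \<subseteq> Bd" "a \<in> \<pi>\<^sub>0 ` acarrier (full_cstar Gp) \<Longrightarrow> adj a \<in> \<pi>\<^sub>0 ` acarrier (full_cstar Gp)"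
  using rep_bd[OF \<pi>\<^sub>0] Gr.astar_closed by (auto simp flip: rep_star[OF \<pi>\<^sub>0])

lemma commutant_NN: "commutant H NN = N'"
  by (rule commutant3[OF \<pi>\<^sub>0_image(1)])

lemma von_neumann_NN: "von_neumann_algebra H NN"
  unfolding von_neumann_algebra_def
proof (intro conjI ballI)
  show "NN \<subseteq> Bd" by (rule commutant_sub)
  have "adj T \<in> N'" if "T \<in> N'" for T using commutant_adj[OF \<pi>\<^sub>0_image that] .
  then show "adj T \<in> NN" if "T \<in> NN" for T using commutant_adj[OF commutant_sub _ that] by blast
  show "bicommutant H NN = NN" using commutant_NN by simp
qed

sublocale M: amplified_algebra H X NN
  by unfold_locales (use von_neumann_NN X_nonempty in auto)

lemma MM_eq: "MM = M.M"
  unfolding M.M_def commutant_NN commutant_\<theta> ..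

lemma MM_tensor: "MM = vn_tensor X H (bounded_ops (ell2 X complex_hilbert)) NN"
  unfolding vn_tensor_def commutant_elementary[OF M.Nf(1,4) X_nonempty] commutant_NN commutant_\<theta> ..

text \<open>
  A natural number \<open>b > 1\<close> of the ray semigroup gives a proper isometry, since no ideal is
  divisible by all powers of \<open>b\<close>.
\<close>

lemma infinite_MM: assumes nz: "V \<noteq> {0}" shows "\<not> finite_projection L MM (id_op L)"
proof -
  obtain b :: nat where b: "b > 1" "of_nat b \<in> RR" using ray_natural .
  let ?b = "of_nat b :: 'k" and ?v = "P 0 (of_nat b)"
  have vB: "?v \<in> bounded_ops L" by (rule P_isometry(1)[OF R_0 b(2)])
  have "left_regular Sg (0, ?b) \<in> acarrier A" using b by (auto simp: reduced_cstar_def op_cstar_generated_def Sg_simps)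
  then have "?v \<in> \<theta> ` acarrier A" by (simp add: P_def)
  moreover have "\<theta> ` acarrier A \<subseteq> bounded_ops L" using L.rep_bd[OF \<theta>_rep] by auto
  ultimately have vM: "?v \<in> M.M" using L.bicommutant_ext MM_eq by blast
  have iso: "adjoint_op L ?v \<circ> ?v = id_op L"
    by (rule L.isometry_adj[OF vB P_isometry(2)[OF R_0 b(2)]])
  have "\<exists>s\<in>X. s \<notin> \<phi> 0 ?b ` X"
  proof (rule ccontr)
    assume no: "\<not> ?thesis"
    have "\<forall>I. I \<in> \<kk> \<and> I \<subseteq> R \<longrightarrow> I \<subseteq> smult_set (?b ^ k) R" for k
    proof (induction k)
      case 0 then show ?case by simp
    next
      case (Suc k)
      show ?case
      proof (intro allI impI)
        fix I assume I: "I \<in> \<kk> \<and> I \<subseteq> R"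
        then have "(I, 0) \<in> X" using rep_facts(2) by (simp add: X_iff)
        then have "(I, 0) \<in> \<phi> 0 ?b ` X" using no by blast
        then obtain c y where cy: "(c, y) \<in> X" "(I, 0) = \<phi> 0 ?b (c, y)" by auto
        then have Ic: "I = smult_set ?b c" using \<phi>0(1)[OF b(2) cy(1)] by simp
        have "c \<subseteq> smult_set (?b ^ k) R" using Suc X_facts(1,2)[OF cy(1)] by blast
        then have "smult_set ?b c \<subseteq> smult_set ?b (smult_set (?b ^ k) R)" by (auto simp: smult_set_def)
        then show "I \<subseteq> smult_set (?b ^ Suc k) R" by (simp add: Ic smult_smult)
      qed
    qed
    then show False using not_in_all_powers[OF ak_idl b(1)] ak by blast
  qed
  then obtain s where s: "s \<in> X" "s \<notin> \<phi> 0 ?b ` X" by blast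
  obtain \<xi> where \<xi>: "\<xi> \<in> V" "\<xi> \<noteq> 0" using nz V_0 by blast
  have "?v \<circ> adjoint_op L ?v \<noteq> id_op L"
  proof
    assume "?v \<circ> adjoint_op L ?v = id_op L"
    then have "?v (adjoint_op L ?v (basis_vec s \<xi>)) = basis_vec s \<xi>" using s \<xi> by (metis L.id_op_apply basis_vec_L comp_apply)
    then have "basis_vec s \<xi> s = 0" using P_off[OF R_0 b(2) s(2), of "adjoint_op L ?v (basis_vec s \<xi>)"] vB by simp
    then show False using \<xi> by simp
  qed
  then show ?thesis using M.infinite_M[OF vM iso] MM_eq by simp
qed

lemma irreducible_iff: "irreducible_rep A L \<theta> \<longleftrightarrow> irreducible_rep (full_cstar Gp) H \<pi>\<^sub>0"
proof -
  obtain s where s: "s \<in> X" using X_nonempty by auto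
  have nz: "hcarrier L \<noteq> {0} \<longleftrightarrow> V \<noteq> {0}"
  proof
    assume "hcarrier L \<noteq> {0}"
    then obtain f where f: "f \<in> hcarrier L" "f \<noteq> 0" using L.V_0 by blast
    then obtain r where "f r \<noteq> 0" by (auto simp: fun_eq_iff)
    then show "V \<noteq> {0}" using L_V[OF f(1), of r] by auto
  next
    assume "V \<noteq> {0}"
    then obtain \<xi> where \<xi>: "\<xi> \<in> V" "\<xi> \<noteq> 0" using V_0 by blast
    then show "hcarrier L \<noteq> {0}" using basis_vec_L[OF s \<xi>(1)] by (metis basis_vec_same singletonD zero_fun_def)
  qed
  have zero: "amp (\<lambda>x. 0) = (\<lambda>x. 0)" by (auto simp: amp_def zero_fun_def)
  have proj: "(\<forall>p\<in>amp ` N'. p \<circ> p = p \<and> adjoint_op L p = p \<longrightarrow> p = (\<lambda>x. 0) \<or> p = id_op L) \<longleftrightarrow>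
    (\<forall>p\<in>N'. p \<circ> p = p \<and> adj p = p \<longrightarrow> p = (\<lambda>x. 0) \<or> p = id_op H)"
  proof -
    have "(amp p \<circ> amp p = amp p \<longleftrightarrow> p \<circ> p = p) \<and> (adjoint_op L (amp p) = amp p \<longleftrightarrow> adj p = p) \<and>
      (amp p = (\<lambda>x. 0) \<longleftrightarrow> p = (\<lambda>x. 0)) \<and> (amp p = id_op L \<longleftrightarrow> p = id_op H)" if "p \<in> N'" for p
    proof -
      have pB: "p \<in> Bd" using that commutant_sub by blast
      have pp: "p \<circ> p \<in> Bd" "adj p \<in> Bd" "(\<lambda>x. 0) \<in> Bd" "id_op H \<in> Bd" using pB by simp_all
      have "amp p \<circ> amp p = amp p \<longleftrightarrow> p \<circ> p = p" unfolding amp_comp[OF pB pB] by (metis amp_inj[OF pp(1) pB X_nonempty])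
      moreover have "adjoint_op L (amp p) = amp p \<longleftrightarrow> adj p = p" unfolding adj_amp[OF pB] by (metis amp_inj[OF pp(2) pB X_nonempty])
      moreover have "amp p = (\<lambda>x. 0) \<longleftrightarrow> p = (\<lambda>x. 0)" using amp_inj[OF pB pp(3) X_nonempty] zero by metis
      moreover have "amp p = id_op L \<longleftrightarrow> p = id_op H" using amp_inj[OF pB pp(4) X_nonempty] amp_id by metis
      ultimately show ?thesis by blast
    qed
    then show ?thesis by auto
  qed
  have 1: "irreducible_rep A L \<theta> \<longleftrightarrow> hcarrier L \<noteq> {0} \<and>
      (\<forall>p\<in>commutant L (\<theta> ` acarrier A). p \<circ> p = p \<and> adjoint_op L p = p \<longrightarrow> p = (\<lambda>x. 0) \<or> p = id_op L)"
    by (rule L.irreducible_iff_projections[OF \<theta>_rep A_star])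
  have 2: "irreducible_rep (full_cstar Gp) H \<pi>\<^sub>0 \<longleftrightarrow> V \<noteq> {0} \<and>
      (\<forall>p\<in>N'. p \<circ> p = p \<and> adj p = p \<longrightarrow> p = (\<lambda>x. 0) \<or> p = id_op H)"
    by (rule irreducible_iff_projections[OF \<pi>\<^sub>0 Gr.astar_closed])
  show ?thesis by (simp only: 1 2 commutant_\<theta> nz proj)
qed

end

theorem theorem6p6:
  fixes \<mm> :: "'k::field_char_0 modulus"
    and \<Gamma> :: "((('k \<Rightarrow> real) \<Rightarrow> real) \<times> 'k set) set"
    and \<aa> :: "'k set set \<Rightarrow> 'k set"
    and t :: "'k set \<Rightarrow> 'k"
    and rep :: "'k set \<Rightarrow> 'k set"
    and \<kk> :: "'k set set"
    and H\<^sub>0 :: "'h::ab_group_add hilbert"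
    and \<pi>\<^sub>0 :: "(nat \<Rightarrow> 'k \<times> 'k \<Rightarrow> complex) set \<Rightarrow> 'h \<Rightarrow> 'h"
    and \<theta> :: "(('k \<times> 'k \<Rightarrow> complex) \<Rightarrow> ('k \<times> 'k \<Rightarrow> complex)) \<Rightarrow>
             ('k set \<times> 'k \<Rightarrow> 'h) \<Rightarrow> ('k set \<times> 'k \<Rightarrow> 'h)"
  defines "X \<equiv> class_index rep \<kk>"
    and "A \<equiv> reduced_cstar (ray_semigroup \<mm> \<Gamma>)"
    and "B \<equiv> full_cstar (class_group \<mm> \<Gamma> \<aa> \<kk>)"
  defines "M \<equiv> bicommutant (ell2 X H\<^sub>0) (\<theta> ` acarrier A)"
    and "N \<equiv> bicommutant H\<^sub>0 (\<pi>\<^sub>0 ` acarrier B)"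
  assumes K: "number_field TYPE('k)"
    and modulus: "is_modulus \<mm>"
    and \<Gamma>: "subgroup \<Gamma> (residue_units \<mm>)"
    and ideals: "ideal_choice \<mm> \<Gamma> \<aa> t"
    and reps: "representative_choice \<mm> rep"
    and \<kk>: "\<kk> \<in> ray_classes \<mm> \<Gamma>"
    and H\<^sub>0: "hilbert_space H\<^sub>0"
    and \<pi>\<^sub>0: "representation B H\<^sub>0 \<pi>\<^sub>0"
    and \<theta>: "class_representation \<mm> \<Gamma> \<aa> t rep \<kk> H\<^sub>0 \<pi>\<^sub>0 \<theta>"
  shows "M = vn_tensor X H\<^sub>0 (bounded_ops (ell2 X complex_hilbert)) N \<and>
    (type_I_factor H\<^sub>0 N \<longrightarrow> type_I_infinite_factor (ell2 X H\<^sub>0) M) \<and>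
    (type_II_1_factor H\<^sub>0 N \<longrightarrow> type_II_infinite_factor (ell2 X H\<^sub>0) M) \<and>
    (irreducible_rep A (ell2 X H\<^sub>0) \<theta> \<longleftrightarrow> irreducible_rep B H\<^sub>0 \<pi>\<^sub>0)"
proof -
  have "ideal (m_fin \<mm>) int_ring" using modulus by (simp add: is_modulus_def)
  then have ring: "ring (int_ring :: 'k ring)" by (rule ideal.axioms(2))
  interpret class_setup "{x. algebraic_int x}" \<mm> \<Gamma> H\<^sub>0 \<aa> t rep \<kk> \<pi>\<^sub>0 \<theta>
    by (intro class_setup.intro ray_setup.intro number_ring.intro hilbert.intro ray_setup_axioms.intro
      class_setup_axioms.intro refl K ring modulus \<Gamma> H\<^sub>0 ideals reps \<kk> \<pi>\<^sub>0[unfolded B_def] \<theta>)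
  have inf: "\<not> finite_projection (ell2 X H\<^sub>0) M (id_op (ell2 X H\<^sub>0))" if "factor H\<^sub>0 N"
    unfolding X_def M_def A_def by (rule infinite_MM) (use that in \<open>simp add: factor_def\<close>)
  have "M = vn_tensor X H\<^sub>0 (bounded_ops (ell2 X complex_hilbert)) N"
    using MM_tensor by (simp add: X_def M_def A_def N_def B_def)
  moreover have "type_I_infinite_factor (ell2 X H\<^sub>0) M" if "type_I_factor H\<^sub>0 N"
    using M.amplification_type_I that inf[OF conjunct1[OF that[unfolded type_I_factor_def]]]
    unfolding X_def M_def A_def N_def B_def MM_eq by blast
  moreover have "type_II_infinite_factor (ell2 X H\<^sub>0) M" if II: "type_II_1_factor H\<^sub>0 N"
  proof -
    have "factor H\<^sub>0 N" using II by (simp add: type_II_1_factor_def type_II_factor_def)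
    from inf[OF this] II show ?thesis
      using M.amplification_type_II unfolding X_def M_def A_def N_def B_def MM_eq by blast
  qed
  moreover have "irreducible_rep A (ell2 X H\<^sub>0) \<theta> \<longleftrightarrow> irreducible_rep B H\<^sub>0 \<pi>\<^sub>0"
    unfolding A_def X_def B_def by (rule irreducible_iff)
  ultimately show ?thesis by blast
qed


end
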